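(* Let $\mathbb K$ be a local field, $\Gamma$ a finitely generated word-hyperbolic group and $\rho:\Gamma\to\mathrm{PGL}_d(\mathbb K)$ a $(1,1,r)$-hyperconvex representation. Then $$\mathrm{Hff}\big(\xi^1(\partial\Gamma)\big)\le\mathrm{Hff}\big(\mathbb P(\mathbb K^r)\big).$$
   Context: $\mathbb K$ is a commutative local field with absolute value $|\cdot|$: the usual modulus if $\mathbb K=\mathbb R,\mathbb C$; if non-Archimedean with valuation ring $\mathcal O$ and uniformizer $\omega$, $|\omega|=1/q$, $q=\#(\mathcal O/\omega\mathcal O)$. $\mathbb K^d$ carries a good norm (inner/Hermitian product norm if Archimedean; $\|\sum a_ie_i\|=\max|a_i|$ otherwise), exterior powers carry the induced norms. Every $g\in\mathrm{GL}_d(\mathbb K)$ has a Cartan decomposition $g=k_ga_gl_g$, $k_g,l_g$ in the maximal compact group preserving the norm ($\mathrm{GL}_d(\mathcal O)$ in the non-Archimedean case), $a_g$ diagonal in an orthonormal basis $(e_i)$ with entries of absolute values $\sigma_1(g)\ge\dots\ge\sigma_d(g)$ (the singular values); ratios $\sigma_i/\sigma_j$ are well defined on $\mathrm{PGL}_d(\mathbb K)$. $U_p(g)=k_g\langle e_1,\dots,e_p\rangle$ for a chosen decomposition. $|\gamma|$ is word length for a fixed finite symmetric generating set; $\partial\Gamma$ is the Gromov boundary. $\rho$ is $\{\mathsf a_p\}$-Anosov if there are $c,\mu>0$ with $\frac{\sigma_{p+1}}{\sigma_p}(\rho(\gamma))\le ce^{-\mu|\gamma|}$ for all $\gamma$.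 Then $\xi^k(x)=\lim_nU_k(\rho(\gamma_n))$ ($k\in\{p,d-p\}$, $(\gamma_n)$ any geodesic ray converging to $x$) defines continuous equivariant maps $\xi^k:\partial\Gamma\to\mathcal G_k(\mathbb K^d)$ into Grassmannians with $\xi^p(x)\oplus\xi^{d-p}(y)=\mathbb K^d$ for $x\ne y$. For $2\le r\le d-1$, $\rho$ is $(1,1,r)$-hyperconvex if it is $\{\mathsf a_1\}$- and $\{\mathsf a_r\}$-Anosov and $(\xi^1(x)\oplus\xi^1(y))\cap\xi^{d-r}(z)=\{0\}$ for all pairwise distinct $x,y,z\in\partial\Gamma$. $\mathrm{Hff}$ is Hausdorff dimension for the metric $d([v],[w])=\|v\wedge w\|/(\|v\|\|w\|)$ on projective spaces. *)

theory Defs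
  imports
    "HOL-Library.Extended_Nonnegative_Real"
    "HOL-Algebra.Coset"
    "HOL-Algebra.Generated_Groups"
    "Jordan_Normal_Form.VS_Connect"
begin

section \<open>Local fields\<close>

definition valuation_ring :: "('k::field \<Rightarrow> real) \<Rightarrow> 'k set" where
  "valuation_ring av = {x. av x \<le> 1}"

definition uniformizer :: "('k::field \<Rightarrow> real) \<Rightarrow> 'k \<Rightarrow> bool" where
  "uniformizer av \<omega> \<longleftrightarrow> \<omega> \<noteq> 0 \<and> {x. av x < 1} = (*) \<omega> ` valuation_ring av"

definition residue_field :: "('k::field \<Rightarrow> real) \<Rightarrow> 'k \<Rightarrow> 'k set set" where
  "residue_field av \<omega> = valuation_ring av //
     {(x, y). x \<in> valuation_ring av \<and> y \<in> valuation_ring av \<and> x - y \<in> (*) \<omega> ` valuation_ring av}"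

definition ultrametric :: "('k::field \<Rightarrow> real) \<Rightarrow> bool" where
  "ultrametric av \<longleftrightarrow> (\<forall>x y. av (x + y) \<le> max (av x) (av y))"

definition nonarchimedean_local :: "('k::field \<Rightarrow> real) \<Rightarrow> bool" where
  "nonarchimedean_local av \<longleftrightarrow>
     (\<forall>x. 0 \<le> av x) \<and> (\<forall>x. av x = 0 \<longleftrightarrow> x = 0) \<and> (\<forall>x y. av (x * y) = av x * av y) \<and>
     ultrametric av \<and>
     (\<forall>X::nat \<Rightarrow> 'k. (\<forall>e>0. \<exists>N. \<forall>m\<ge>N. \<forall>n\<ge>N. av (X m - X n) < e) \<longrightarrow>
        (\<exists>L. (\<lambda>n. av (X n - L)) \<longlonglongrightarrow> 0)) \<and>
     (\<exists>\<omega>. uniformizer av \<omega> \<and> finite (residue_field av \<omega>) \<and>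
        av \<omega> = 1 / real (card (residue_field av \<omega>)))"

definition field_iso :: "('k::field \<Rightarrow> 'l::field) \<Rightarrow> bool" where
  "field_iso \<phi> \<longleftrightarrow> bij \<phi> \<and> (\<forall>x y. \<phi> (x + y) = \<phi> x + \<phi> y) \<and> (\<forall>x y. \<phi> (x * y) = \<phi> x * \<phi> y)"

definition archimedean_local :: "('k::field \<Rightarrow> real) \<Rightarrow> bool" where
  "archimedean_local av \<longleftrightarrow>
     (\<exists>\<phi>::'k \<Rightarrow> real. field_iso \<phi> \<and> (\<forall>x. av x = \<bar>\<phi> x\<bar>)) \<or>
     (\<exists>\<phi>::'k \<Rightarrow> complex. field_iso \<phi> \<and> (\<forall>x. av x = cmod (\<phi> x)))"

definition local_field :: "('k::field \<Rightarrow> real) \<Rightarrow> bool" where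
  "local_field av \<longleftrightarrow> archimedean_local av \<or> nonarchimedean_local av"


section \<open>Good norms, Grassmannians, projective metric\<close>

text \<open>The norm, in terms of its coordinates \<open>x\<close> (indexed by \<open>I\<close>) in an orthonormal basis.\<close>

definition onb_norm :: "('k::field \<Rightarrow> real) \<Rightarrow> 'i set \<Rightarrow> ('i \<Rightarrow> 'k) \<Rightarrow> real" where
  "onb_norm av I x =
     (if ultrametric av then Max (insert 0 ((\<lambda>i. av (x i)) ` I)) else sqrt (\<Sum>i\<in>I. (av (x i))\<^sup>2))"

text \<open>A good norm on \<open>K^d\<close> is given by an invertible matrix \<open>E\<close> whose columns \<open>e\<^sub>0, \<dots>, e\<^sub>d\<^sub>-\<^sub>1\<close>
  are declared to be an orthonormal basis; every inner (Hermitian) product norm arises in this way.\<close>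

definition coords :: "'k::field mat \<Rightarrow> 'k vec \<Rightarrow> 'k vec" where
  "coords E v = (THE c. c \<in> carrier_vec (dim_col E) \<and> E *\<^sub>v c = v)"

definition good_norm :: "('k::field \<Rightarrow> real) \<Rightarrow> 'k mat \<Rightarrow> 'k vec \<Rightarrow> real" where
  "good_norm av E v = onb_norm av {..<dim_col E} (\<lambda>i. coords E v $ i)"

text \<open>The norm of \<open>v \<and> w\<close> for the induced norm on the exterior square, where the
  \<open>e\<^sub>i \<and> e\<^sub>j\<close> with \<open>i < j\<close> form an orthonormal basis.\<close>

definition wedge_norm :: "('k::field \<Rightarrow> real) \<Rightarrow> 'k mat \<Rightarrow> 'k vec \<Rightarrow> 'k vec \<Rightarrow> real" where
  "wedge_norm av E v w = onb_norm av {(i, j). i < j \<and> j < dim_col E}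
     (\<lambda>(i, j). coords E v $ i * coords E w $ j - coords E v $ j * coords E w $ i)"

definition grassmannian :: "nat \<Rightarrow> nat \<Rightarrow> 'k::field vec set set" where
  "grassmannian k d = {V. VectorSpace.subspace class_ring V (module_vec TYPE('k) d) \<and>
     vectorspace.dim class_ring (module_vec TYPE('k) d \<lparr>carrier := V\<rparr>) = k}"

abbreviation projective_space :: "nat \<Rightarrow> 'k::field vec set set" where
  "projective_space d \<equiv> grassmannian 1 d"

text \<open>The distance \<open>\<parallel>v \<and> w\<parallel> / (\<parallel>v\<parallel> \<parallel>w\<parallel>)\<close> does not depend on the chosen spanning vectors.\<close>

definition proj_dist :: "('k::field \<Rightarrow> real) \<Rightarrow> 'k mat \<Rightarrow> 'k vec set \<Rightarrow> 'k vec set \<Rightarrow> real" where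
  "proj_dist av E L M =
     (let v = (SOME v. v \<in> L \<and> v \<noteq> 0\<^sub>v (dim_row E));
          w = (SOME w. w \<in> M \<and> w \<noteq> 0\<^sub>v (dim_row E))
      in wedge_norm av E v w / (good_norm av E v * good_norm av E w))"

text \<open>Convergence in a Grassmannian: the gap (the Hausdorff distance of unit balls) tends to 0.\<close>

definition grass_tendsto ::
    "('k::field \<Rightarrow> real) \<Rightarrow> 'k mat \<Rightarrow> (nat \<Rightarrow> 'k vec set) \<Rightarrow> 'k vec set \<Rightarrow> bool" where
  "grass_tendsto av E W V \<longleftrightarrow> (\<forall>\<epsilon>>0. \<forall>\<^sub>F n in sequentially.
     (\<forall>w\<in>W n. \<exists>v\<in>V. good_norm av E (w - v) \<le> \<epsilon> * good_norm av E w) \<and>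
     (\<forall>v\<in>V. \<exists>w\<in>W n. good_norm av E (w - v) \<le> \<epsilon> * good_norm av E v))"


section \<open>The group \<open>PGL\<^sub>d\<close> and Cartan decompositions\<close>

definition GL :: "nat \<Rightarrow> 'k::field mat monoid" where
  "GL d = units_of (ring_mat TYPE('k) d ())"

definition scalars :: "nat \<Rightarrow> 'k::field mat set" where
  "scalars d = {c \<cdot>\<^sub>m 1\<^sub>m d | c. c \<noteq> 0}"

text \<open>Elements of \<open>PGL d\<close> are cosets, i.e. sets of matrices that differ by a nonzero scalar.\<close>

definition PGL :: "nat \<Rightarrow> 'k::field mat set monoid" where
  "PGL d = GL d Mod scalars d"

definition isometries :: "('k::field \<Rightarrow> real) \<Rightarrow> 'k mat \<Rightarrow> 'k mat set" where
  "isometries av E = {g \<in> carrier (GL (dim_row E)).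
     \<forall>v\<in>carrier_vec (dim_row E). good_norm av E (g *\<^sub>v v) = good_norm av E v}"

text \<open>\<open>g = k a l\<close>, where \<open>a e\<^sub>i = \<alpha>\<^sub>i e\<^sub>i\<close> (indices starting at 0).\<close>

definition cartan :: "('k::field \<Rightarrow> real) \<Rightarrow> 'k mat \<Rightarrow> 'k mat \<Rightarrow> 'k mat \<Rightarrow> (nat \<Rightarrow> 'k) \<Rightarrow> 'k mat \<Rightarrow> bool" where
  "cartan av E g k \<alpha> l \<longleftrightarrow>
     k \<in> isometries av E \<and> l \<in> isometries av E \<and>
     (\<forall>i j. i \<le> j \<and> j < dim_row E \<longrightarrow> av (\<alpha> j) \<le> av (\<alpha> i)) \<and>
     (\<exists>a \<in> carrier (GL (dim_row E)). a * E = E * mat_diag (dim_row E) \<alpha> \<and> g = k * a * l)"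

text \<open>Indices of singular values start at 1.\<close>

definition singular_value :: "('k::field \<Rightarrow> real) \<Rightarrow> 'k mat \<Rightarrow> nat \<Rightarrow> 'k mat \<Rightarrow> real" where
  "singular_value av E i g = (THE s. \<exists>k \<alpha> l. cartan av E g k \<alpha> l \<and> s = av (\<alpha> (i - 1)))"

text \<open>For \<open>C\<close> in \<open>PGL d\<close>, one Cartan decomposition of one lift of \<open>C\<close> is chosen
  once and for all, and \<open>cartan_space av E p C\<close> is the span of \<open>k e\<^sub>0, \<dots>, k e\<^sub>p\<^sub>-\<^sub>1\<close>.\<close>

definition cartan_K :: "('k::field \<Rightarrow> real) \<Rightarrow> 'k mat \<Rightarrow> 'k mat set \<Rightarrow> 'k mat" where
  "cartan_K av E C = (SOME k. \<exists>g\<in>C. \<exists>\<alpha> l. cartan av E g k \<alpha> l)"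

definition cartan_space :: "('k::field \<Rightarrow> real) \<Rightarrow> 'k mat \<Rightarrow> nat \<Rightarrow> 'k mat set \<Rightarrow> 'k vec set" where
  "cartan_space av E p C = (*\<^sub>v) (cartan_K av E C) `
     LinearCombinations.module.span class_ring (module_vec TYPE('k) (dim_row E)) (col E ` {..<p})"


section \<open>Word metric, hyperbolicity, Gromov boundary\<close>

definition sym_generating :: "('g, 'm) monoid_scheme \<Rightarrow> 'g set \<Rightarrow> bool" where
  "sym_generating G S \<longleftrightarrow>
     finite S \<and> S \<subseteq> carrier G \<and> (\<forall>s\<in>S. inv\<^bsub>G\<^esub> s \<in> S) \<and> generate G S = carrier G"

definition word_length :: "('g, 'm) monoid_scheme \<Rightarrow> 'g set \<Rightarrow> 'g \<Rightarrow> nat" where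
  "word_length G S g =
     (LEAST n. \<exists>ws. length ws = n \<and> set ws \<subseteq> S \<and> foldr (mult G) ws \<one>\<^bsub>G\<^esub> = g)"

definition word_dist :: "('g, 'm) monoid_scheme \<Rightarrow> 'g set \<Rightarrow> 'g \<Rightarrow> 'g \<Rightarrow> nat" where
  "word_dist G S g h = word_length G S (inv\<^bsub>G\<^esub> g \<otimes>\<^bsub>G\<^esub> h)"

definition gromov_product :: "('g, 'm) monoid_scheme \<Rightarrow> 'g set \<Rightarrow> 'g \<Rightarrow> 'g \<Rightarrow> 'g \<Rightarrow> real" where
  "gromov_product G S w x y =
     (real (word_dist G S w x) + real (word_dist G S w y) - real (word_dist G S x y)) / 2"

text \<open>Gromov's four-point condition on the vertices of the Cayley graph.\<close>

definition word_hyperbolic :: "('g, 'm) monoid_scheme \<Rightarrow> 'g set \<Rightarrow> bool" where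
  "word_hyperbolic G S \<longleftrightarrow>
     (\<exists>\<delta>. \<forall>w\<in>carrier G. \<forall>x\<in>carrier G. \<forall>y\<in>carrier G. \<forall>z\<in>carrier G.
        min (gromov_product G S w x y) (gromov_product G S w y z) - \<delta> \<le> gromov_product G S w x z)"

definition geodesic_rays :: "('g, 'm) monoid_scheme \<Rightarrow> 'g set \<Rightarrow> (nat \<Rightarrow> 'g) set" where
  "geodesic_rays G S = {\<gamma>. (\<forall>n. \<gamma> n \<in> carrier G) \<and>
     (\<forall>m n. m \<le> n \<longrightarrow> word_dist G S (\<gamma> m) (\<gamma> n) = n - m)}"

text \<open>A boundary point is the set of all geodesic rays (with arbitrary starting vertex) that
  converge to it; two rays are equivalent if they stay at bounded distance.\<close>

definition gromov_boundary :: "('g, 'm) monoid_scheme \<Rightarrow> 'g set \<Rightarrow> (nat \<Rightarrow> 'g) set set" where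
  "gromov_boundary G S = geodesic_rays G S //
     {(\<gamma>, \<eta>). \<gamma> \<in> geodesic_rays G S \<and> \<eta> \<in> geodesic_rays G S \<and>
        (\<exists>K. \<forall>n. word_dist G S (\<gamma> n) (\<eta> n) \<le> K)}"


section \<open>Anosov and hyperconvex representations\<close>

definition anosov ::
    "('k::field \<Rightarrow> real) \<Rightarrow> 'k mat \<Rightarrow> ('g, 'm) monoid_scheme \<Rightarrow> 'g set \<Rightarrow> ('g \<Rightarrow> 'k mat set) \<Rightarrow> nat \<Rightarrow> bool"
  where
  "anosov av E G S \<rho> p \<longleftrightarrow> (\<exists>c>0. \<exists>\<mu>>0. \<forall>\<gamma>\<in>carrier G. \<forall>g\<in>\<rho> \<gamma>.
     singular_value av E (p + 1) g / singular_value av E p g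
       \<le> c * exp (- \<mu> * real (word_length G S \<gamma>)))"

definition limit_map ::
    "('k::field \<Rightarrow> real) \<Rightarrow> 'k mat \<Rightarrow> ('g \<Rightarrow> 'k mat set) \<Rightarrow> nat \<Rightarrow> (nat \<Rightarrow> 'g) set \<Rightarrow> 'k vec set"
  where
  "limit_map av E \<rho> k x = (THE V. V \<in> grassmannian k (dim_row E) \<and>
     (\<forall>\<gamma>\<in>x. grass_tendsto av E (\<lambda>n. cartan_space av E k (\<rho> (\<gamma> n))) V))"

definition hyperconvex ::
    "('k::field \<Rightarrow> real) \<Rightarrow> 'k mat \<Rightarrow> ('g, 'm) monoid_scheme \<Rightarrow> 'g set \<Rightarrow> ('g \<Rightarrow> 'k mat set) \<Rightarrow> nat \<Rightarrow> bool"
  where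
  "hyperconvex av E G S \<rho> r \<longleftrightarrow>
     anosov av E G S \<rho> 1 \<and> anosov av E G S \<rho> r \<and>
     (\<forall>x\<in>gromov_boundary G S. \<forall>y\<in>gromov_boundary G S. \<forall>z\<in>gromov_boundary G S.
        x \<noteq> y \<and> y \<noteq> z \<and> x \<noteq> z \<longrightarrow>
        {u + v | u v. u \<in> limit_map av E \<rho> 1 x \<and> v \<in> limit_map av E \<rho> 1 y}
          \<inter> limit_map av E \<rho> (dim_row E - r) z = {0\<^sub>v (dim_row E)})"


section \<open>Hausdorff dimension\<close>

definition diam :: "('a \<Rightarrow> 'a \<Rightarrow> real) \<Rightarrow> 'a set \<Rightarrow> ennreal" where
  "diam dst C = (SUP x\<in>C. SUP y\<in>C. ennreal (dst x y))"

definition hausdorff_measure :: "('a \<Rightarrow> 'a \<Rightarrow> real) \<Rightarrow> real \<Rightarrow> 'a set \<Rightarrow> ennreal" where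
  "hausdorff_measure dst s A = (SUP \<delta>\<in>{0<..}.
     INF C\<in>{C :: nat \<Rightarrow> 'a set. (\<Union>i. C i) = A \<and> (\<forall>i. diam dst (C i) \<le> ennreal \<delta>)}.
       (\<Sum>i. ennreal (enn2real (diam dst (C i)) powr s)))"

text \<open>Only exponents \<open>s > 0\<close> are used, since \<open>0 powr 0 = 0\<close>; this does not change the infimum.\<close>

definition hausdorff_dim :: "('a \<Rightarrow> 'a \<Rightarrow> real) \<Rightarrow> 'a set \<Rightarrow> ennreal" where
  "hausdorff_dim dst A = (INF s\<in>{s. 0 < s \<and> hausdorff_measure dst s A = 0}. ennreal s)"

end

theory Submission
  imports "HOL-Analysis.L2_Norm" "HOL-Analysis.Topology_Euclidean_Space" "HOL-Analysis.Caratheodory"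
    "HOL-Library.Diagonal_Subsequence" Defs
begin

text \<open>
  Fix a boundary point \<open>z\<close> and project \<open>K\<^sup>d\<close> to \<open>K\<^sup>r\<close> along \<open>\<xi>\<^sup>d\<^sup>-\<^sup>r(z)\<close>. If \<open>x \<noteq> y\<close> stay away from \<open>z\<close>, then the plane
  \<open>\<xi>\<^sup>1(x) \<oplus> \<xi>\<^sup>1(y)\<close> is uniformly transverse to \<open>\<xi>\<^sup>d\<^sup>-\<^sup>r(z)\<close>, even when \<open>x\<close> and \<open>y\<close> approach each other: translating a
  quasi-centre \<open>g\<close> of the triangle \<open>x, y, z\<close> to the identity, hyperconvexity and compactness give a definite angle, and going
  back by \<open>g\<close> pushes the plane towards \<open>\<xi>\<^sup>r(x)\<close>, which is transverse to \<open>\<xi>\<^sup>d\<^sup>-\<^sup>r(z)\<close>. A projection that is bounded below on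
  every such plane contracts the distance of projective spaces by at most a constant factor. Hence \<open>\<xi>\<^sup>1(\<partial>\<Gamma>)\<close> without the
  point \<open>\<xi>\<^sup>1(z)\<close> is a countable union of sets with Lipschitz parametrisations by subsets of \<open>P(K\<^sup>r)\<close>.
\<close>

section \<open>Local fields\<close>

text \<open>\<open>anosov\<close> is only a gap between singular values. Convergence of
  \<open>U p\<close> along rays, equivariance, continuity and the transversality of \<xi>^p(x) and
  \<xi>^(d-p)(y) are all derived from that gap. Transversality is the obstacle. A common vector
  along a bi-infinite quasi-geodesic would make \<open>F\<close>, the normalised logarithm of the
  product of the first p singular values, fall short of additivity by an amount proportional to the
  length at each concatenation. Repeated doubling would then push \<open>F\<close> below every
  bound, while it is bounded below. Pointwise transversality becomes uniform by compactness. Rays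
  from the identity have pointwise convergent subsequences, a bound on Gromov products survives such
  limits, and \<open>U p\<close> converges along rays at an exponential rate that is the same for
  all rays from the identity. The pieces of the limit set are cut out by such a bound, on Gromov
  products with a ray towards z, so that pairs x, y in one piece may be arbitrarily close to each
  other while all constants stay fixed. The basis \<open>E\<close> of a good norm enters only at the
  end; until then all is done in standard coordinates.\<close>

locale local_abs =
  fixes av :: "'k::field \<Rightarrow> real"
  assumes av_nonneg [simp]: "0 \<le> av x"
    and av_eq_0 [simp]: "av x = 0 \<longleftrightarrow> x = 0"
    and av_mult: "av (x * y) = av x * av y"
    and av_triangle: "av (x + y) \<le> av x + av y"
    \<comment> \<open>Local compactness in sequential form. Completeness of the field enters the
      later arguments only through it.\<close>
    and av_compact: "(\<And>n. av (X n) \<le> B) \<Longrightarrow>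
      \<exists>L s. strict_mono (s :: nat \<Rightarrow> nat) \<and> (\<lambda>n. av (X (s n) - L)) \<longlonglongrightarrow> 0"
    \<comment> \<open>The Archimedean fields are treated at once, as subfields of the complex
      numbers that contain the reals and are stable under conjugation. This suffices for Hermitian
      forms and for normalising vectors.\<close>
    and av_cases: "ultrametric av \<or> (\<exists>\<phi> :: 'k \<Rightarrow> complex.
      \<phi> 1 = 1 \<and> (\<forall>x y. \<phi> (x + y) = \<phi> x + \<phi> y) \<and> (\<forall>x y. \<phi> (x * y) = \<phi> x * \<phi> y) \<and>
      (\<forall>x. av x = cmod (\<phi> x)) \<and> (\<forall>x. \<exists>y. \<phi> y = cnj (\<phi> x)) \<and> (\<forall>t. \<exists>y. \<phi> y = complex_of_real t))"

lemma field_iso_additive: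
  assumes "field_iso \<phi>"
  shows "\<phi> 0 = 0" "\<phi> 1 = 1" "\<phi> (- x) = - \<phi> x" "\<phi> (x - y) = \<phi> x - \<phi> y"
proof -
  have add: "\<phi> (x + y) = \<phi> x + \<phi> y" and mult: "\<phi> (x * y) = \<phi> x * \<phi> y" for x y
    using assms by (auto simp: field_iso_def)
  have inj: "\<phi> x = \<phi> y \<Longrightarrow> x = y" for x y
    using assms by (auto simp: field_iso_def bij_def inj_def)
  show 0: "\<phi> 0 = 0" using add[of 0 0] by (metis add_cancel_right_right add_0)
  have "\<phi> 1 \<noteq> 0" using inj[of 1 0] 0 by auto
  then show "\<phi> 1 = 1" using mult[of 1 1] by simp
  show m: "\<phi> (- x) = - \<phi> x" for x using add[of x "- x"] 0 by (simp add: eq_neg_iff_add_eq_0 add.commute)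
  show "\<phi> (x - y) = \<phi> x - \<phi> y" using add[of x "- y"] m[of y] by simp
qed

lemma local_abs_real:
  fixes \<phi> :: "'k::field \<Rightarrow> real"
  assumes iso: "field_iso \<phi>" and av: "\<And>x. av x = \<bar>\<phi> x\<bar>"
  shows "local_abs av"
proof
  have add: "\<phi> (x + y) = \<phi> x + \<phi> y" and mult: "\<phi> (x * y) = \<phi> x * \<phi> y" for x y
    using iso by (auto simp: field_iso_def)
  have inj: "\<phi> x = \<phi> y \<Longrightarrow> x = y" for x y
    using iso by (auto simp: field_iso_def bij_def inj_def)
  have surj: "\<exists>y. \<phi> y = t" for t using iso by (metis field_iso_def bij_pointE)
  note h = field_iso_additive[OF iso]
  show "0 \<le> av x" for x by (simp add: av)
  show "av x = 0 \<longleftrightarrow> x = 0" for x using inj[of x 0] h by (auto simp: av)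
  show "av (x * y) = av x * av y" for x y by (simp add: av mult abs_mult)
  show "av (x + y) \<le> av x + av y" for x y by (simp add: av add abs_triangle_ineq)
  show "\<exists>L s. strict_mono (s :: nat \<Rightarrow> nat) \<and> (\<lambda>n. av (X (s n) - L)) \<longlonglongrightarrow> 0"
    if "\<And>n. av (X n) \<le> B" for X :: "nat \<Rightarrow> 'k" and B
  proof -
    have "bounded (range (\<lambda>n. \<phi> (X n)))"
      using that by (auto simp: bounded_iff av)
    then obtain l s where s: "strict_mono (s :: nat \<Rightarrow> nat)" "((\<lambda>n. \<phi> (X n)) \<circ> s) \<longlonglongrightarrow> l"
      using bounded_imp_convergent_subsequence by blast
    obtain L where L: "\<phi> L = l" using surj by blast
    have "(\<lambda>n. \<phi> (X (s n)) - l) \<longlonglongrightarrow> 0" using s(2) LIM_zero by (fastforce simp: o_def)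
    then have "(\<lambda>n. av (X (s n) - L)) \<longlonglongrightarrow> 0"
      using L h tendsto_rabs_zero by (fastforce simp: av)
    then show ?thesis using s(1) by blast
  qed
  show "ultrametric av \<or> (\<exists>\<phi> :: 'k \<Rightarrow> complex.
      \<phi> 1 = 1 \<and> (\<forall>x y. \<phi> (x + y) = \<phi> x + \<phi> y) \<and> (\<forall>x y. \<phi> (x * y) = \<phi> x * \<phi> y) \<and>
      (\<forall>x. av x = cmod (\<phi> x)) \<and> (\<forall>x. \<exists>y. \<phi> y = cnj (\<phi> x)) \<and> (\<forall>t. \<exists>y. \<phi> y = complex_of_real t))"
    by (rule disjI2, rule exI[of _ "\<lambda>x. complex_of_real (\<phi> x)"]) (use h add mult surj in \<open>auto simp: av\<close>)
qed

lemma local_abs_complex: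
  fixes \<phi> :: "'k::field \<Rightarrow> complex"
  assumes iso: "field_iso \<phi>" and av: "\<And>x. av x = cmod (\<phi> x)"
  shows "local_abs av"
proof
  have add: "\<phi> (x + y) = \<phi> x + \<phi> y" and mult: "\<phi> (x * y) = \<phi> x * \<phi> y" for x y
    using iso by (auto simp: field_iso_def)
  have inj: "\<phi> x = \<phi> y \<Longrightarrow> x = y" for x y
    using iso by (auto simp: field_iso_def bij_def inj_def)
  have surj: "\<exists>y. \<phi> y = t" for t using iso by (metis field_iso_def bij_pointE)
  note h = field_iso_additive[OF iso]
  show "0 \<le> av x" for x by (simp add: av)
  show "av x = 0 \<longleftrightarrow> x = 0" for x using inj[of x 0] h by (auto simp: av)
  show "av (x * y) = av x * av y" for x y by (simp add: av mult norm_mult)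
  show "av (x + y) \<le> av x + av y" for x y by (simp add: av add norm_triangle_ineq)
  show "\<exists>L s. strict_mono (s :: nat \<Rightarrow> nat) \<and> (\<lambda>n. av (X (s n) - L)) \<longlonglongrightarrow> 0"
    if "\<And>n. av (X n) \<le> B" for X :: "nat \<Rightarrow> 'k" and B
  proof -
    have "bounded (range (\<lambda>n. \<phi> (X n)))"
      using that by (auto simp: bounded_iff av)
    then obtain l s where s: "strict_mono (s :: nat \<Rightarrow> nat)" "((\<lambda>n. \<phi> (X n)) \<circ> s) \<longlonglongrightarrow> l"
      using bounded_imp_convergent_subsequence by blast
    obtain L where L: "\<phi> L = l" using surj by blast
    have "(\<lambda>n. \<phi> (X (s n)) - l) \<longlonglongrightarrow> 0" using s(2) LIM_zero by (fastforce simp: o_def)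
    then have "(\<lambda>n. av (X (s n) - L)) \<longlonglongrightarrow> 0"
      using L h tendsto_norm_zero by (fastforce simp: av)
    then show ?thesis using s(1) by blast
  qed
  show "ultrametric av \<or> (\<exists>\<phi> :: 'k \<Rightarrow> complex.
      \<phi> 1 = 1 \<and> (\<forall>x y. \<phi> (x + y) = \<phi> x + \<phi> y) \<and> (\<forall>x y. \<phi> (x * y) = \<phi> x * \<phi> y) \<and>
      (\<forall>x. av x = cmod (\<phi> x)) \<and> (\<forall>x. \<exists>y. \<phi> y = cnj (\<phi> x)) \<and> (\<forall>t. \<exists>y. \<phi> y = complex_of_real t))"
    by (rule disjI2, rule exI[of _ \<phi>]) (use h add mult surj in \<open>auto simp: av\<close>)
qed

text \<open>Since there are finitely many residue classes, infinitely many terms lie in one of them.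
  Their differences to a fixed term \<open>X n0\<close> are divisible by \<omega>, and the quotients
  again form a sequence in the valuation ring. Each round of the induction gains one factor
  \<open>av \<omega>\<close>.\<close>

lemma nonarchimedean_cauchy_subseq:
  fixes av :: "'k::field \<Rightarrow> real"
  assumes na: "nonarchimedean_local av" and u: "uniformizer av \<omega>"
    and fin: "finite (residue_field av \<omega>)" and X: "\<And>n. av (X n) \<le> 1"
  shows "\<exists>s. strict_mono (s :: nat \<Rightarrow> nat) \<and> (\<forall>m n. av (X (s m) - X (s n)) \<le> av \<omega> ^ k)"
  using X
proof (induction k arbitrary: X)
  case 0
  have um: "av (x + y) \<le> max (av x) (av y)" and nn: "0 \<le> av x" and m: "av (x * y) = av x * av y"
    for x y using na by (auto simp: nonarchimedean_local_def ultrametric_def)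
  have "av 1 * av 1 = av 1" using m[of 1 1] by simp
  moreover have "av 1 \<noteq> 0" using na unfolding nonarchimedean_local_def by (metis zero_neq_one)
  ultimately have 1: "av 1 = 1" by simp
  have "av (-1) * av (-1) = 1" using m[of "-1" "-1"] 1 by simp
  then have m1: "av (-1) = 1" using nn[of "-1"] by (metis abs_of_nonneg abs_square_eq_1 power2_eq_square)
  have neg: "av (- x) = av x" for x using m[of "-1" x] m1 by simp
  have "av (X m - X n) \<le> 1" for m n using um[of "X m" "- X n"] 0[of m] 0[of n] neg[of "X n"] by auto
  then show ?case using strict_mono_id by (metis id_def power_0)
next
  case (Suc k)
  have nn: "0 \<le> av x" and m: "av (x * y) = av x * av y" for x y
    using na by (auto simp: nonarchimedean_local_def)
  let ?R = "{(x, y). x \<in> valuation_ring av \<and> y \<in> valuation_ring av \<and> x - y \<in> (*) \<omega> ` valuation_ring av}"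
  define c where "c n = ?R `` {X n}" for n
  have "c n \<in> residue_field av \<omega>" for n
    unfolding c_def residue_field_def using Suc.prems by (intro quotientI) (auto simp: valuation_ring_def)
  then have "finite (range c)" using fin by (meson finite_subset image_subset_iff)
  then obtain n0 where n0: "infinite {n \<in> UNIV. c n = c n0}"
    using pigeonhole_infinite[of UNIV c] by auto
  define s1 where "s1 = enumerate {n. c n = c n0}"
  have s1: "strict_mono s1" unfolding s1_def using n0 by (simp add: strict_mono_enumerate)
  have cs1: "c (s1 n) = c n0" for n
    unfolding s1_def using enumerate_in_set[of "{n. c n = c n0}" n] n0 by auto
  have 0: "0 \<in> valuation_ring av" 
  proof -
    have "av 0 = 0" using na by (simp add: nonarchimedean_local_def)
    then show ?thesis by (simp add: valuation_ring_def)
  qed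
  have "X n0 \<in> c n0" using Suc.prems[of n0] 0 by (auto simp: c_def valuation_ring_def image_iff)
  then have "X n0 \<in> c (s1 n)" for n using cs1 by simp
  then have "\<exists>y. y \<in> valuation_ring av \<and> X (s1 n) - X n0 = \<omega> * y" for n
    by (auto simp: c_def)
  then obtain Y where Y: "\<And>n. Y n \<in> valuation_ring av" "\<And>n. X (s1 n) - X n0 = \<omega> * Y n" by metis
  obtain s2 where s2: "strict_mono (s2 :: nat \<Rightarrow> nat)" "\<And>m n. av (Y (s2 m) - Y (s2 n)) \<le> av \<omega> ^ k"
    using Suc.IH[of Y] Y(1) by (auto simp: valuation_ring_def)
  have "av (X (s1 (s2 m)) - X (s1 (s2 n))) \<le> av \<omega> ^ Suc k" for m n
  proof -
    have "X (s1 (s2 m)) - X (s1 (s2 n)) = \<omega> * (Y (s2 m) - Y (s2 n))"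
      using Y(2)[of "s2 m"] Y(2)[of "s2 n"] by (simp add: algebra_simps)
    then show ?thesis using s2(2)[of m n] nn[of \<omega>] by (simp add: m mult_left_mono)
  qed
  moreover have "strict_mono (s1 \<circ> s2)" using s1 s2(1) by (simp add: strict_mono_o)
  ultimately show ?case by (metis comp_apply)
qed

text \<open>Compactness of balls: a diagonal sequence through the subsequences of the preceding
  lemma is Cauchy, because \<open>av \<omega> < 1\<close>, and completeness supplies the
  limit.\<close>

lemma local_abs_nonarchimedean:
  fixes av :: "'k::field \<Rightarrow> real"
  assumes na: "nonarchimedean_local av"
  shows "local_abs av"
proof
  obtain \<omega> where u: "uniformizer av \<omega>" and fin: "finite (residue_field av \<omega>)"
    using na by (auto simp: nonarchimedean_local_def)
  have um: "av (x + y) \<le> max (av x) (av y)" and nn: "0 \<le> av x" and m: "av (x * y) = av x * av y"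
    and z: "av x = 0 \<longleftrightarrow> x = 0"
    for x y using na by (auto simp: nonarchimedean_local_def ultrametric_def)
  show "0 \<le> av x" "av (x * y) = av x * av y" "av x = 0 \<longleftrightarrow> x = 0" for x y by (fact nn m z)+
  show "av (x + y) \<le> av x + av y" for x y using um[of x y] nn[of x] nn[of y] by auto
  show "ultrametric av \<or> (\<exists>\<phi> :: 'k \<Rightarrow> complex.
      \<phi> 1 = 1 \<and> (\<forall>x y. \<phi> (x + y) = \<phi> x + \<phi> y) \<and> (\<forall>x y. \<phi> (x * y) = \<phi> x * \<phi> y) \<and>
      (\<forall>x. av x = cmod (\<phi> x)) \<and> (\<forall>x. \<exists>y. \<phi> y = cnj (\<phi> x)) \<and> (\<forall>t. \<exists>y. \<phi> y = complex_of_real t))"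
    using na by (auto simp: nonarchimedean_local_def)
  have w0: "\<omega> \<noteq> 0" using u by (simp add: uniformizer_def)
  have one: "av 1 = 1" using m[of 1 1] z[of 1] by simp
  have "\<omega> \<in> (*) \<omega> ` valuation_ring av" by (rule image_eqI[of _ _ 1]) (auto simp: one valuation_ring_def)
  then have w1: "av \<omega> < 1" using u by (auto simp: uniformizer_def)
  have wp: "av \<omega> > 0" using nn[of \<omega>] z[of \<omega>] w0 by linarith
  have pw: "av (x ^ n) = av x ^ n" for x n by (induction n) (auto simp: one m)
  show "\<exists>L s. strict_mono (s :: nat \<Rightarrow> nat) \<and> (\<lambda>n. av (X (s n) - L)) \<longlonglongrightarrow> 0"
    if XB: "\<And>n. av (X n) \<le> B" for X :: "nat \<Rightarrow> 'k" and B
  proof -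
    have B: "0 \<le> B" using XB[of 0] nn[of "X 0"] by linarith
    obtain N where N: "av \<omega> ^ N < inverse (B + 1)"
      using real_arch_pow_inv[of "inverse (B + 1)" "av \<omega>"] B w1 by auto
    \<comment> \<open>Scaling by a power of \<omega> moves a bounded sequence into the valuation
      ring; the factor is divided out again in \<open>diagX\<close>.\<close>
    define Z where "Z n = \<omega> ^ N * X n" for n
    have Z1: "av (Z n) \<le> 1" for n
    proof -
      have "av (Z n) \<le> inverse (B + 1) * (B + 1)"
        unfolding Z_def m pw using N XB[of n] nn[of "X n"] B by (intro mult_mono) auto
      then show ?thesis using B by simp
    qed
    interpret subseqs "\<lambda>k s. \<forall>m n. av (Z (s m) - Z (s n)) \<le> av \<omega> ^ k"
    proof
      fix k and s :: "nat \<Rightarrow> nat"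
      show "\<exists>r'. strict_mono (r' :: nat \<Rightarrow> nat) \<and> (\<forall>m n. av (Z ((s \<circ> r') m) - Z ((s \<circ> r') n)) \<le> av \<omega> ^ k)"
        using nonarchimedean_cauchy_subseq[OF na u fin, of "\<lambda>n. Z (s n)" k] Z1 by simp
    qed
    have diag: "av (Z (diagseq m) - Z (diagseq n)) \<le> av \<omega> ^ k" if mn: "k < m" "k < n" for k m n
    proof -
      have "\<forall>m n. av (Z ((diagseq \<circ> (+) (Suc k)) m) - Z ((diagseq \<circ> (+) (Suc k)) n)) \<le> av \<omega> ^ k"
        by (rule diagseq_holds) auto
      from this[rule_format, of "m - Suc k" "n - Suc k"] mn show ?thesis by simp
    qed
    have diagX: "av (X (diagseq m) - X (diagseq n)) \<le> av \<omega> ^ k / av \<omega> ^ N" if mn: "k < m" "k < n" for k m n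
    proof -
      have "Z (diagseq m) - Z (diagseq n) = \<omega> ^ N * (X (diagseq m) - X (diagseq n))"
        by (simp add: Z_def algebra_simps)
      then have "av (Z (diagseq m) - Z (diagseq n)) = av \<omega> ^ N * av (X (diagseq m) - X (diagseq n))"
        by (simp add: m pw)
      then show ?thesis using diag[OF mn] wp by (simp add: field_simps)
    qed
    have "\<exists>M. \<forall>m\<ge>M. \<forall>n\<ge>M. av (X (diagseq m) - X (diagseq n)) < e" if e: "e > 0" for e
    proof -
      obtain k where k: "av \<omega> ^ k < e * av \<omega> ^ N"
        using real_arch_pow_inv[of "e * av \<omega> ^ N" "av \<omega>"] e w1 wp by auto
      have "av (X (diagseq m) - X (diagseq n)) < e" if "m \<ge> Suc k" "n \<ge> Suc k" for m n
      proof -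
        have "av \<omega> ^ k / av \<omega> ^ N < e" using k wp by (simp add: field_simps)
        then show ?thesis using diagX[of k m n] that by simp
      qed
      then show ?thesis by blast
    qed
    note cauchy = this
    have "(\<forall>e>0. \<exists>N. \<forall>m\<ge>N. \<forall>n\<ge>N. av (Y m - Y n) < e) \<longrightarrow> (\<exists>L. (\<lambda>n. av (Y n - L)) \<longlonglongrightarrow> 0)"
      for Y :: "nat \<Rightarrow> 'k" using na by (auto simp: nonarchimedean_local_def)
    from this[of "\<lambda>n. X (diagseq n)"] cauchy
    have "\<exists>L. (\<lambda>n. av (X (diagseq n) - L)) \<longlonglongrightarrow> 0" by simp
    then show ?thesis using subseq_diagseq by blast
  qed
qed

lemma local_field_local_abs: "local_field av \<Longrightarrow> local_abs av"
  unfolding local_field_def archimedean_local_def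
  using local_abs_real local_abs_complex local_abs_nonarchimedean by metis

section \<open>Good norms\<close>

context local_abs
begin

lemma av_1 [simp]: "av 1 = 1"
  using av_mult[of 1 1] av_eq_0[of 1] by simp

lemma av_0 [simp]: "av 0 = 0" by simp

lemma av_minus [simp]: "av (- x) = av x"
proof -
  have "av (-1) * av (-1) = 1" using av_mult[of "-1" "-1"] by simp
  then have "av (-1) = 1" using av_nonneg[of "-1"] by (metis abs_of_nonneg abs_square_eq_1 power2_eq_square)
  then show ?thesis using av_mult[of "-1" x] by simp
qed

lemma av_minus_commute: "av (x - y) = av (y - x)"
  using av_minus[of "x - y"] by simp

lemma av_power: "av (x ^ n) = av x ^ n" by (induction n) (auto simp: av_mult)

lemma av_prod: "av (prod f A) = (\<Prod>a\<in>A. av (f a))"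
  by (induction A rule: infinite_finite_induct) (auto simp: av_mult)

lemma av_inverse: "av (inverse x) = inverse (av x)"
proof (cases "x = 0")
  case False
  then have "av x * av (inverse x) = 1" using av_mult[of x "inverse x"] by simp
  then show ?thesis by (metis inverse_unique)
qed simp

lemma av_divide: "av (x / y) = av x / av y"
  by (simp add: divide_inverse av_mult av_inverse)

lemma av_pos: "x \<noteq> 0 \<Longrightarrow> 0 < av x"
  using av_nonneg[of x] av_eq_0[of x] by linarith

lemma av_sum: "av (sum f A) \<le> (\<Sum>a\<in>A. av (f a))"
proof (induction A rule: infinite_finite_induct)
  case (insert x F)
  then show ?case using av_triangle[of "f x" "sum f F"] by simp
qed auto

lemma av_triangle2: "av (x - y) \<le> av x + av y"
  using av_triangle[of x "- y"] by simp

lemma av_sign: "av (of_int (sign p)) = 1"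
  by (cases p rule: sign_cases) auto

lemma ultra: "ultrametric av \<Longrightarrow> av (x + y) \<le> max (av x) (av y)"
  by (auto simp: ultrametric_def)

lemma onb_norm_nonneg [simp]: "finite I \<Longrightarrow> 0 \<le> onb_norm av I x"
  by (auto simp: onb_norm_def sum_nonneg)

lemma onb_norm_entry: "finite I \<Longrightarrow> i \<in> I \<Longrightarrow> av (x i) \<le> onb_norm av I x"
proof (cases "ultrametric av")
  case False
  assume "finite I" "i \<in> I"
  then have "(av (x i))\<^sup>2 \<le> (\<Sum>i\<in>I. (av (x i))\<^sup>2)" by (intro member_le_sum) auto
  then show ?thesis using False by (simp add: onb_norm_def real_le_rsqrt)
qed (auto simp: onb_norm_def)

text \<open>The factor \<open>card I\<close> is crude, but it serves the maximum norm and the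
  Euclidean norm alike. Estimates through entries only have to be right up to constants, while exact
  constants are reserved for isometries.\<close>

lemma onb_norm_le:
  assumes "finite I" "0 \<le> B" "\<And>i. i \<in> I \<Longrightarrow> av (x i) \<le> B"
  shows "onb_norm av I x \<le> real (card I) * B"
proof (cases "I = {}")
  case True then show ?thesis by (auto simp: onb_norm_def)
next
  case False
  then have c: "1 \<le> real (card I)" using assms(1) by (metis One_nat_def Suc_leI card_gt_0_iff of_nat_1 of_nat_mono)
  show ?thesis
  proof (cases "ultrametric av")
    case True
    have "B \<le> real (card I) * B" using c assms(2) by (metis mult_1 mult_right_mono)
    then show ?thesis using True assms by (auto simp: onb_norm_def intro: order_trans)
  next
    case ar: False
    have "(\<Sum>i\<in>I. (av (x i))\<^sup>2) \<le> (\<Sum>i\<in>I. B\<^sup>2)" using assms by (intro sum_mono power_mono) auto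
    also have "\<dots> = real (card I) * B\<^sup>2" by simp
    also have "\<dots> \<le> (real (card I))\<^sup>2 * B\<^sup>2"
      using c by (intro mult_right_mono) (auto simp: power2_eq_square)
    also have "\<dots> = (real (card I) * B)\<^sup>2" by (simp add: power_mult_distrib)
    finally show ?thesis using ar assms(2) by (simp add: onb_norm_def real_le_lsqrt)
  qed
qed

lemma onb_norm_eq_0: "finite I \<Longrightarrow> onb_norm av I x = 0 \<longleftrightarrow> (\<forall>i\<in>I. x i = 0)"
proof
  assume I: "finite I" and "onb_norm av I x = 0"
  then have "i \<in> I \<Longrightarrow> av (x i) \<le> 0" for i using onb_norm_entry[of I i x] by simp
  then show "\<forall>i\<in>I. x i = 0" using av_nonneg av_eq_0 by (metis order_antisym)
next
  assume "finite I" "\<forall>i\<in>I. x i = 0"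
  then show "onb_norm av I x = 0" using onb_norm_le[of I 0 x] onb_norm_nonneg[of I x]
    by (metis av_eq_0 mult_zero_right order_antisym order_refl)
qed

lemma onb_norm_smult: "finite I \<Longrightarrow> onb_norm av I (\<lambda>i. c * x i) = av c * onb_norm av I x"
proof (cases "ultrametric av")
  case True
  assume I: "finite I"
  have "insert 0 ((\<lambda>i. av (c * x i)) ` I) = (*) (av c) ` insert 0 ((\<lambda>i. av (x i)) ` I)"
    by (auto simp: av_mult image_iff)
  moreover have "Max ((*) (av c) ` insert 0 ((\<lambda>i. av (x i)) ` I)) = av c * Max (insert 0 ((\<lambda>i. av (x i)) ` I))"
    by (rule mono_Max_commute[symmetric]) (use I in \<open>auto simp: mono_def mult_left_mono\<close>)
  ultimately show ?thesis using True by (simp add: onb_norm_def)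
qed (simp add: onb_norm_def av_mult power_mult_distrib sum_distrib_left[symmetric] real_sqrt_mult)

lemma onb_norm_triangle: "finite I \<Longrightarrow> onb_norm av I (\<lambda>i. x i + y i) \<le> onb_norm av I x + onb_norm av I y"
proof (cases "ultrametric av")
  case True
  assume I: "finite I"
  have "av (x i + y i) \<le> onb_norm av I x + onb_norm av I y" if "i \<in> I" for i
    using av_triangle[of "x i" "y i"] onb_norm_entry[OF I that, of x] onb_norm_entry[OF I that, of y] by linarith
  moreover have "0 \<le> onb_norm av I x + onb_norm av I y" using I by simp
  ultimately have "Max (insert 0 ((\<lambda>i. av (x i + y i)) ` I)) \<le> onb_norm av I x + onb_norm av I y" using I by auto
  then show ?thesis using True by (simp add: onb_norm_def)
next
  case False
  have "L2_set (\<lambda>i. av (x i + y i)) I \<le> L2_set (\<lambda>i. av (x i) + av (y i)) I"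
    by (rule L2_set_mono) (auto simp: av_triangle)
  also have "\<dots> \<le> L2_set (\<lambda>i. av (x i)) I + L2_set (\<lambda>i. av (y i)) I" by (rule L2_set_triangle_ineq)
  finally show ?thesis using False by (simp add: onb_norm_def L2_set_def)
qed

lemma onb_norm_cong: "(\<And>i. i \<in> I \<Longrightarrow> av (x i) = av (y i)) \<Longrightarrow> onb_norm av I x = onb_norm av I y"
  by (simp add: onb_norm_def cong: image_cong sum.cong)

lemma family_convergent_subseq:
  assumes "finite I" "\<And>n i. i \<in> I \<Longrightarrow> av (X n i) \<le> B"
  shows "\<exists>L s. strict_mono (s :: nat \<Rightarrow> nat) \<and> (\<forall>i\<in>I. (\<lambda>n. av (X (s n) i - L i)) \<longlonglongrightarrow> 0)"
  using assms
proof (induction I rule: finite_induct)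
  case empty
  then show ?case using strict_mono_id by blast
next
  case (insert j I)
  obtain L s where s: "strict_mono (s :: nat \<Rightarrow> nat)" and L: "\<And>i. i \<in> I \<Longrightarrow> (\<lambda>n. av (X (s n) i - L i)) \<longlonglongrightarrow> 0"
    using insert by blast
  obtain l t where t: "strict_mono (t :: nat \<Rightarrow> nat)" and l: "(\<lambda>n. av (X (s (t n)) j - l)) \<longlonglongrightarrow> 0"
    using av_compact[of "\<lambda>n. X (s n) j" B] insert.prems by auto
  have "(\<lambda>n. av (X ((s \<circ> t) n) i - (L(j := l)) i)) \<longlonglongrightarrow> 0" if "i \<in> insert j I" for i
    using that l LIMSEQ_subseq_LIMSEQ[OF L t, of i] insert.hyps(2) by (auto simp: o_def)
  moreover have "strict_mono (s \<circ> t)" using s t by (rule strict_mono_o)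
  ultimately show ?case by blast
qed

end

section \<open>The good norm of the standard basis\<close>

lemma tendsto_0_le:
  fixes f g :: "nat \<Rightarrow> real"
  assumes "\<And>n. 0 \<le> f n" "\<And>n. f n \<le> g n" "g \<longlonglongrightarrow> 0"
  shows "f \<longlonglongrightarrow> 0"
  using tendsto_sandwich[OF _ _ tendsto_const assms(3), of f] assms(1,2) by simp

context local_abs
begin

text \<open>The good norm whose orthonormal basis is the standard one. Any other good norm turns
  into it after the change of coordinates \<open>minv E\<close>.\<close>

definition nv :: "'k vec \<Rightarrow> real" where
  "nv v = onb_norm av {..<dim_vec v} (\<lambda>i. v $ i)"

lemma nv_nonneg [simp]: "0 \<le> nv v" by (simp add: nv_def)

lemma nv_entry: "i < dim_vec v \<Longrightarrow> av (v $ i) \<le> nv v"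
  unfolding nv_def by (rule onb_norm_entry) auto

lemma nv_le: "0 \<le> B \<Longrightarrow> (\<And>i. i < dim_vec v \<Longrightarrow> av (v $ i) \<le> B) \<Longrightarrow> nv v \<le> real (dim_vec v) * B"
  unfolding nv_def using onb_norm_le[of "{..<dim_vec v}" B "\<lambda>i. v $ i"] by simp

lemma nv_eq_0: "v \<in> carrier_vec n \<Longrightarrow> nv v = 0 \<longleftrightarrow> v = 0\<^sub>v n"
  unfolding nv_def by (auto simp: onb_norm_eq_0)

lemma nv_pos: "v \<in> carrier_vec n \<Longrightarrow> v \<noteq> 0\<^sub>v n \<Longrightarrow> 0 < nv v"
  using nv_eq_0[of v n] nv_nonneg[of v] by linarith

lemma nv_zero [simp]: "nv (0\<^sub>v n) = 0" using nv_eq_0[of "0\<^sub>v n" n] by simp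

lemma nv_smult [simp]: "nv (c \<cdot>\<^sub>v v) = av c * nv v"
proof -
  have "nv (c \<cdot>\<^sub>v v) = onb_norm av {..<dim_vec v} (\<lambda>i. c * v $ i)"
    unfolding nv_def index_smult_vec by (rule onb_norm_cong) simp
  then show ?thesis using onb_norm_smult[of "{..<dim_vec v}" c "\<lambda>i. v $ i"] by (simp add: nv_def)
qed

lemma nv_triangle: "v \<in> carrier_vec n \<Longrightarrow> w \<in> carrier_vec n \<Longrightarrow> nv (v + w) \<le> nv v + nv w"
proof -
  assume vw: "v \<in> carrier_vec n" "w \<in> carrier_vec n"
  then have d: "dim_vec (v + w) = n" by simp
  have "nv (v + w) = onb_norm av {..<n} (\<lambda>i. v $ i + w $ i)"
    unfolding nv_def d by (rule onb_norm_cong) (use vw in auto)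
  also have "\<dots> \<le> nv v + nv w" using onb_norm_triangle[of "{..<n}" "\<lambda>i. v $ i" "\<lambda>i. w $ i"] vw by (simp add: nv_def)
  finally show ?thesis .
qed

lemma nv_minus [simp]: "nv (- v) = nv v"
proof -
  have "- v = (-1) \<cdot>\<^sub>v v" by (intro eq_vecI) auto
  then show ?thesis by simp
qed

lemma nv_triangle_minus: "v \<in> carrier_vec n \<Longrightarrow> w \<in> carrier_vec n \<Longrightarrow> nv (v - w) \<le> nv v + nv w"
  using nv_triangle[of v n "- w"] by (simp add: minus_add_uminus_vec)

lemma nv_minus_commute: "v \<in> carrier_vec n \<Longrightarrow> w \<in> carrier_vec n \<Longrightarrow> nv (v - w) = nv (w - v)"
proof -
  assume "v \<in> carrier_vec n" "w \<in> carrier_vec n"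
  then have "v - w = - (w - v)" by (intro eq_vecI) auto
  then show ?thesis by simp
qed

lemma nv_dist_triangle:
  assumes "u \<in> carrier_vec n" "v \<in> carrier_vec n" "w \<in> carrier_vec n"
  shows "nv (u - w) \<le> nv (u - v) + nv (v - w)"
proof -
  have "u - w = (u - v) + (v - w)" using assms by (intro eq_vecI) auto
  then show ?thesis using nv_triangle[of "u - v" n "v - w"] assms by simp
qed

lemma nv_le_dist:
  assumes "u \<in> carrier_vec n" "v \<in> carrier_vec n"
  shows "nv u \<le> nv v + nv (u - v)"
proof -
  have "u = v + (u - v)" using assms by (intro eq_vecI) auto
  then show ?thesis using nv_triangle[of v n "u - v"] assms by simp
qed

lemma nv_unit: "i < n \<Longrightarrow> nv (unit_vec n i) = 1"
proof (cases "ultrametric av")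
  case True
  assume i: "i < n"
  have "insert 0 ((\<lambda>j. av (unit_vec n i $ j)) ` {..<n}) = {0, 1}"
  proof (intro equalityI subsetI)
    fix x assume "x \<in> {0, 1 :: real}"
    then show "x \<in> insert 0 ((\<lambda>j. av (unit_vec n i $ j)) ` {..<n})"
      using i by (auto intro!: image_eqI[of _ _ i])
  qed (use i in auto)
  then show ?thesis using True by (simp add: nv_def onb_norm_def)
next
  case False
  assume i: "i < n"
  have "(\<Sum>j\<in>{..<n}. (av (unit_vec n i $ j))\<^sup>2) = (\<Sum>j\<in>{..<n}. if j = i then 1 else 0)"
    using i by (intro sum.cong) auto
  then show ?thesis using False i by (simp add: nv_def onb_norm_def)
qed

text \<open>In the ultrametric case the maximum is attained by an entry; in the Archimedean case
  every real number comes from a scalar. Hence each nonzero vector can be scaled to norm exactly 1,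
  which transitivity of the isometries on unit vectors requires.\<close>

lemma nv_value:
  assumes "v \<in> carrier_vec n"
  shows "\<exists>c. av c = nv v"
proof (cases "ultrametric av")
  case True
  have "Max (insert 0 ((\<lambda>i. av (v $ i)) ` {..<dim_vec v})) \<in> insert 0 ((\<lambda>i. av (v $ i)) ` {..<dim_vec v})"
    by (rule Max_in) auto
  then have "nv v \<in> insert 0 ((\<lambda>i. av (v $ i)) ` {..<dim_vec v})" using True unfolding nv_def onb_norm_def by simp
  then have "nv v = 0 \<or> (\<exists>i. nv v = av (v $ i))" by auto
  then show ?thesis using av_0 by metis
next
  case False
  then obtain \<phi> :: "'k \<Rightarrow> complex" where \<phi>: "\<And>x. av x = cmod (\<phi> x)" "\<And>t. \<exists>y. \<phi> y = complex_of_real t"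
    using av_cases by blast
  obtain c where "\<phi> c = complex_of_real (nv v)" using \<phi>(2) by blast
  then show ?thesis using \<phi>(1) by (metis abs_of_nonneg norm_of_real nv_nonneg)
qed

lemma nv_normalise:
  assumes "v \<in> carrier_vec n" "v \<noteq> 0\<^sub>v n"
  shows "\<exists>c. c \<noteq> 0 \<and> nv (c \<cdot>\<^sub>v v) = 1"
proof -
  obtain c where c: "av c = nv v" using nv_value[OF assms(1)] by blast
  then have "c \<noteq> 0" using nv_pos[OF assms] by auto
  then show ?thesis using c nv_pos[OF assms] by (intro exI[of _ "inverse c"]) (simp add: av_inverse)
qed

lemma vec_convergent_subseq:
  assumes "\<And>n. X n \<in> carrier_vec d" "\<And>n. nv (X n) \<le> B"
  shows "\<exists>L s. strict_mono (s :: nat \<Rightarrow> nat) \<and> L \<in> carrier_vec d \<and> (\<lambda>n. nv (X (s n) - L)) \<longlonglongrightarrow> 0"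
proof -
  have "av (X n $ i) \<le> B" if "i \<in> {..<d}" for n i
    using nv_entry[of i "X n"] assms(1)[of n] assms(2)[of n] that by auto
  then obtain L s where s: "strict_mono (s :: nat \<Rightarrow> nat)" 
    and L: "\<And>i. i < d \<Longrightarrow> (\<lambda>n. av (X (s n) $ i - L i)) \<longlonglongrightarrow> 0"
    using family_convergent_subseq[of "{..<d}" "\<lambda>n i. X n $ i" B] unfolding lessThan_iff[symmetric] by blast
  let ?L = "Matrix.vec d L"
  have le: "nv (X (s n) - ?L) \<le> real d * (\<Sum>i<d. av (X (s n) $ i - L i))" for n
  proof -
    have "av (X (s n) $ i - L i) \<le> (\<Sum>i<d. av (X (s n) $ i - L i))" if "i < d" for i
      using member_le_sum[of i "{..<d}" "\<lambda>i. av (X (s n) $ i - L i)"] that by auto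
    then have "nv (X (s n) - ?L) \<le> real (dim_vec (X (s n) - ?L)) * (\<Sum>i<d. av (X (s n) $ i - L i))"
      using assms(1)[of "s n"] by (intro nv_le) (auto simp: sum_nonneg)
    then show ?thesis by simp
  qed
  have "(\<lambda>n. real d * (\<Sum>i<d. av (X (s n) $ i - L i))) \<longlonglongrightarrow> real d * (\<Sum>i<d. 0)"
    by (intro tendsto_mult_left tendsto_sum L) auto
  then have "(\<lambda>n. nv (X (s n) - ?L)) \<longlonglongrightarrow> 0"
    by (intro tendsto_0_le[OF _ le]) simp_all
  then show ?thesis using s by (metis vec_carrier)
qed

lemma mult_mat_vec_bounded_entries:
  assumes A: "A \<in> carrier_mat m n" and v: "v \<in> carrier_vec n"
    and B: "\<And>i j. i < m \<Longrightarrow> j < n \<Longrightarrow> av (A $$ (i, j)) \<le> B" "0 \<le> B"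
  shows "nv (A *\<^sub>v v) \<le> real m * (real n * B) * nv v"
proof -
  have "av ((A *\<^sub>v v) $ i) \<le> real n * B * nv v" if i: "i < m" for i
  proof -
    have "av ((A *\<^sub>v v) $ i) \<le> (\<Sum>j<n. av (A $$ (i, j) * v $ j))"
      using av_sum[of "\<lambda>j. A $$ (i, j) * v $ j" "{..<n}"] i A v
      by (auto simp: scalar_prod_def atLeast0LessThan)
    also have "\<dots> \<le> (\<Sum>j<n. B * nv v)"
      unfolding av_mult using i B v by (intro sum_mono mult_mono) (auto intro: nv_entry)
    finally show ?thesis by simp
  qed
  then show ?thesis using nv_le[of "real n * B * nv v" "A *\<^sub>v v"] A B by (simp add: mult_ac)
qed

lemma mult_mat_vec_bounded:
  assumes A: "A \<in> carrier_mat m n"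
  shows "\<exists>B>0. \<forall>v\<in>carrier_vec n. nv (A *\<^sub>v v) \<le> B * nv v"
proof -
  define B where "B = (\<Sum>(i, j)\<in>{..<m} \<times> {..<n}. av (A $$ (i, j)))"
  have "av (A $$ (i, j)) \<le> B" if "i < m" "j < n" for i j
    unfolding B_def using member_le_sum[of "(i, j)" "{..<m} \<times> {..<n}" "\<lambda>(i, j). av (A $$ (i, j))"] that by auto
  moreover have "0 \<le> B" unfolding B_def by (auto intro!: sum_nonneg)
  ultimately have *: "nv (A *\<^sub>v v) \<le> real m * (real n * B) * nv v" if "v \<in> carrier_vec n" for v
    using mult_mat_vec_bounded_entries[OF A that] by blast
  have "nv (A *\<^sub>v v) \<le> (real m * (real n * B) + 1) * nv v" if "v \<in> carrier_vec n" for v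
    using *[OF that] nv_nonneg[of v] unfolding distrib_right by linarith
  moreover have "real m * (real n * B) + 1 > 0" using \<open>0 \<le> B\<close> by (simp add: add_nonneg_pos)
  ultimately show ?thesis by blast
qed

end

section \<open>Isometries and Cartan decompositions\<close>

text \<open>The adjugate formula makes the inverse a total function that is available over any
  field, without choosing a witness of invertibility.\<close>

definition minv :: "'k::field mat \<Rightarrow> 'k mat" where
  "minv A = inverse (det A) \<cdot>\<^sub>m adj_mat A"

lemma minv:
  assumes "(A :: 'k::field mat) \<in> carrier_mat n n" "det A \<noteq> 0"
  shows "minv A \<in> carrier_mat n n" "minv A * A = 1\<^sub>m n" "A * minv A = 1\<^sub>m n" "det (minv A) \<noteq> 0"
proof -
  note a = adj_mat[OF assms(1)]
  show c: "minv A \<in> carrier_mat n n" using a(1) by (simp add: minv_def)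
  show "minv A * A = 1\<^sub>m n" 
    using a assms mult_smult_assoc_mat[OF a(1) assms(1), of "inverse (det A)"]
    by (auto simp: minv_def intro!: eq_matI)
  show AA: "A * minv A = 1\<^sub>m n" 
    using a assms mult_smult_distrib[OF assms(1) a(1), of "inverse (det A)"]
    by (auto simp: minv_def intro!: eq_matI)
  show "det (minv A) \<noteq> 0" using det_mult[OF assms(1) c] AA by auto
qed

lemma minv_mult_vec:
  assumes "(A :: 'k::field mat) \<in> carrier_mat n n" "det A \<noteq> 0" "v \<in> carrier_vec n"
  shows "minv A *\<^sub>v (A *\<^sub>v v) = v" "A *\<^sub>v (minv A *\<^sub>v v) = v"
  using minv[OF assms(1,2)] assms by (simp_all flip: assoc_mult_mat_vec[of _ n n _ n])

lemma mult_mat_vec_unit: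
  assumes "(A :: 'k::field mat) \<in> carrier_mat m n" "i < n"
  shows "A *\<^sub>v unit_vec n i = col A i"
  using assms by (intro eq_vecI) auto

lemma mat_eqI_vec:
  assumes A: "(A :: 'k::field mat) \<in> carrier_mat m n" and B: "B \<in> carrier_mat m n"
    and eq: "\<And>v. v \<in> carrier_vec n \<Longrightarrow> A *\<^sub>v v = B *\<^sub>v v"
  shows "A = B"
proof (rule eq_matI)
  fix i j assume "i < dim_row B" "j < dim_col B"
  then have ij: "i < m" "j < n" using B by auto
  have "col A j = col B j" using eq[of "unit_vec n j"] mult_mat_vec_unit[OF A ij(2)] mult_mat_vec_unit[OF B ij(2)] by simp
  then have "col A j $ i = col B j $ i" by simp
  then show "A $$ (i, j) = B $$ (i, j)" using ij A B by simp
qed (use A B in auto)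

lemma sum_lessThan_plus: "sum f {..<m + n :: nat} = sum f {..<m} + (\<Sum>i<n. f (m + i) :: 'a::comm_monoid_add)"
  by (induction n) (simp_all add: add.assoc)

context local_abs
begin

section \<open>The maximal compact group and its transitivity on unit vectors\<close>

definition isom :: "nat \<Rightarrow> 'k mat set" where
  "isom n = {k \<in> carrier_mat n n. \<forall>v\<in>carrier_vec n. nv (k *\<^sub>v v) = nv v}"

lemma isom_carrier: "k \<in> isom n \<Longrightarrow> k \<in> carrier_mat n n" by (simp add: isom_def)

lemma isom_nv: "k \<in> isom n \<Longrightarrow> v \<in> carrier_vec n \<Longrightarrow> nv (k *\<^sub>v v) = nv v" by (simp add: isom_def)

lemma isom_det: "k \<in> isom n \<Longrightarrow> det k \<noteq> 0"
proof
  assume k: "k \<in> isom n" and "det k = 0"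
  then obtain v where v: "v \<in> carrier_vec n" "v \<noteq> 0\<^sub>v n" "k *\<^sub>v v = 0\<^sub>v n"
    using det_0_iff_vec_prod_zero[OF isom_carrier[OF k]] by auto
  then have "nv v = 0" using isom_nv[OF k v(1)] by simp
  then show False using v nv_eq_0 by blast
qed

lemma isom_one [simp]: "1\<^sub>m n \<in> isom n" by (simp add: isom_def)

lemma isom_mult: "k \<in> isom n \<Longrightarrow> l \<in> isom n \<Longrightarrow> k * l \<in> isom n"
proof -
  assume k: "k \<in> isom n" and l: "l \<in> isom n"
  have "nv ((k * l) *\<^sub>v v) = nv v" if v: "v \<in> carrier_vec n" for v
  proof -
    have "(k * l) *\<^sub>v v = k *\<^sub>v (l *\<^sub>v v)"
      by (rule assoc_mult_mat_vec[OF isom_carrier[OF k] isom_carrier[OF l] v])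
    then show ?thesis using isom_nv[OF k mult_mat_vec_carrier[OF isom_carrier[OF l] v]] isom_nv[OF l v] by simp
  qed
  then show ?thesis using mult_carrier_mat[OF isom_carrier[OF k] isom_carrier[OF l]] unfolding isom_def by blast
qed

lemma isom_minv: "k \<in> isom n \<Longrightarrow> minv k \<in> isom n"
proof -
  assume k: "k \<in> isom n"
  note m = minv[OF isom_carrier[OF k] isom_det[OF k]]
  have "nv (minv k *\<^sub>v v) = nv v" if v: "v \<in> carrier_vec n" for v
    using isom_nv[OF k, of "minv k *\<^sub>v v"] minv_mult_vec(2)[OF isom_carrier[OF k] isom_det[OF k] v] m(1) v by simp
  then show ?thesis using m(1) by (simp add: isom_def)
qed

lemma isom_entry: "k \<in> isom n \<Longrightarrow> i < n \<Longrightarrow> j < n \<Longrightarrow> av (k $$ (i, j)) \<le> 1"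
proof -
  assume k: "k \<in> isom n" and ij: "i < n" "j < n"
  have "nv (col k j) = 1" using isom_nv[OF k, of "unit_vec n j"] nv_unit[OF ij(2)] mult_mat_vec_unit[OF isom_carrier[OF k] ij(2)] by simp
  then show ?thesis using nv_entry[of i "col k j"] ij isom_carrier[OF k] by auto
qed

lemma isomI_le:
  assumes "A \<in> carrier_mat n n" "B \<in> carrier_mat n n" "B * A = 1\<^sub>m n"
    and "\<And>v. v \<in> carrier_vec n \<Longrightarrow> nv (A *\<^sub>v v) \<le> nv v" "\<And>v. v \<in> carrier_vec n \<Longrightarrow> nv (B *\<^sub>v v) \<le> nv v"
  shows "A \<in> isom n"
proof -
  have "nv v \<le> nv (A *\<^sub>v v)" if v: "v \<in> carrier_vec n" for v
  proof -
    have "B *\<^sub>v (A *\<^sub>v v) = v" using assms(1-3) v by (simp flip: assoc_mult_mat_vec[of _ n n _ n])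
    then show ?thesis using assms(5)[of "A *\<^sub>v v"] assms(1) v by simp
  qed
  then show ?thesis using assms unfolding isom_def by (auto intro: order_antisym)
qed

lemma nv_ultra_le_iff:
  "ultrametric av \<Longrightarrow> 0 \<le> B \<Longrightarrow> nv v \<le> B \<longleftrightarrow> (\<forall>i<dim_vec v. av (v $ i) \<le> B)"
  by (auto simp: nv_def onb_norm_def)

lemma ultra_sum_le:
  assumes "ultrametric av" "0 \<le> B" "\<And>i. i \<in> I \<Longrightarrow> av (f i) \<le> B"
  shows "av (sum f I) \<le> B"
  using assms(3)
proof (induction I rule: infinite_finite_induct)
  case (insert i I)
  have "av (f i + sum f I) \<le> max (av (f i)) (av (sum f I))" by (rule ultra[OF assms(1)])
  also have "\<dots> \<le> B" using insert by simp
  finally show ?case using insert by simp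
qed (use assms in auto)

lemma ultra_integral_le:
  assumes "ultrametric av" "A \<in> carrier_mat m n" "v \<in> carrier_vec n"
    and "\<And>i j. i < m \<Longrightarrow> j < n \<Longrightarrow> av (A $$ (i, j)) \<le> 1"
  shows "nv (A *\<^sub>v v) \<le> nv v"
proof -
  have "av ((A *\<^sub>v v) $ i) \<le> nv v" if i: "i < m" for i
  proof -
    have "av (A $$ (i, j) * v $ j) \<le> nv v" if "j < n" for j
      using assms(4)[OF i that] nv_entry[of j v] assms(3) that
      by (metis av_mult av_nonneg carrier_vecD mult_left_le_one_le order_trans)
    then show ?thesis using i assms(2,3) ultra_sum_le[OF assms(1), of "nv v" "{0..<n}" "\<lambda>j. A $$ (i, j) * v $ j"]
      by (auto simp: scalar_prod_def)
  qed
  then show ?thesis using assms nv_ultra_le_iff by auto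
qed

lemma nv_append:
  "nv (a @\<^sub>v d) = (if ultrametric av then max (nv a) (nv d) else sqrt ((nv a)\<^sup>2 + (nv d)\<^sup>2))"
proof (cases "ultrametric av")
  case True
  have "nv (a @\<^sub>v d) \<le> B \<longleftrightarrow> max (nv a) (nv d) \<le> B" if B: "0 \<le> B" for B
  proof -
    have "(\<forall>i<dim_vec a + dim_vec d. av ((a @\<^sub>v d) $ i) \<le> B) \<longleftrightarrow>
        (\<forall>i<dim_vec a. av (a $ i) \<le> B) \<and> (\<forall>i<dim_vec d. av (d $ i) \<le> B)"
    proof (intro iffI conjI allI impI)
      fix i assume *: "\<forall>i<dim_vec a + dim_vec d. av ((a @\<^sub>v d) $ i) \<le> B" and i: "i < dim_vec d"
      show "av (d $ i) \<le> B" using *[rule_format, of "dim_vec a + i"] i by simp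
    next
      fix i assume *: "\<forall>i<dim_vec a + dim_vec d. av ((a @\<^sub>v d) $ i) \<le> B" and i: "i < dim_vec a"
      show "av (a $ i) \<le> B" using *[rule_format, of i] i by simp
    qed auto
    then show ?thesis using True B by (simp add: nv_ultra_le_iff)
  qed
  from this[of "nv (a @\<^sub>v d)"] this[of "max (nv a) (nv d)"] show ?thesis using True
    by (metis nv_nonneg max.coboundedI1 order_antisym order_refl)
next
  case False
  have "(\<Sum>i<dim_vec a + dim_vec d. (av ((a @\<^sub>v d) $ i))\<^sup>2)
      = (\<Sum>i<dim_vec a. (av (a $ i))\<^sup>2) + (\<Sum>i<dim_vec d. (av (d $ i))\<^sup>2)"
    unfolding sum_lessThan_plus by (intro arg_cong2[of _ _ _ _ "(+)"] sum.cong) auto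
  then show ?thesis using False by (simp add: nv_def onb_norm_def sum_nonneg)
qed

lemma isom_block:
  assumes "P \<in> isom n"
  shows "four_block_mat (1\<^sub>m 1) (0\<^sub>m 1 n) (0\<^sub>m n 1) P \<in> isom (Suc n)"
proof -
  let ?M = "four_block_mat (1\<^sub>m 1) (0\<^sub>m 1 n) (0\<^sub>m n 1) P"
  have P: "P \<in> carrier_mat n n" using assms by (rule isom_carrier)
  have "nv (?M *\<^sub>v v) = nv v" if v: "v \<in> carrier_vec (Suc n)" for v
  proof -
    obtain a d where ad: "a \<in> carrier_vec 1" "d \<in> carrier_vec n" "v = a @\<^sub>v d"
      using v vec_first_last_append[of v 1 n] by (metis plus_1_eq_Suc vec_first_carrier vec_last_carrier)
    have "?M *\<^sub>v v = a @\<^sub>v (P *\<^sub>v d)"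
      unfolding ad(3) using P ad by (subst four_block_mat_mult_vec[of _ 1 1 _ n _ n]) auto
    then show ?thesis using isom_nv[OF assms ad(2)] by (simp add: ad(3) nv_append)
  qed
  moreover have "?M \<in> carrier_mat (Suc n) (Suc n)"
    using four_block_carrier_mat[of "1\<^sub>m 1" 1 1 P n n] P by simp
  ultimately show ?thesis by (simp add: isom_def)
qed

text \<open>A vector of norm 1 has an entry \<open>v $ i\<close> of absolute value 1.
  \<open>Q\<close> is the permutation matrix that swaps 0 and \<open>i\<close>, with its first
  column replaced by \<open>v\<close>. Its entries are integral, so it does not increase norms.
  Conversely \<open>x\<close> is recovered from \<open>Q *\<^sub>v x\<close> without loss: row
  \<open>i\<close> reads \<open>v $ i * x $ 0\<close>, and then row \<open>t j\<close> gives
  \<open>x $ j\<close>.\<close>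

lemma isom_transitive_ultra:
  assumes um: "ultrametric av" and v: "v \<in> carrier_vec n" and n: "0 < n" and nv1: "nv v = 1"
  shows "\<exists>Q\<in>isom n. Q *\<^sub>v unit_vec n 0 = v"
proof -
  have le: "av (v $ i) \<le> 1" if "i < n" for i using nv_entry[of i v] that v nv1 by auto
  have "\<exists>i<n. av (v $ i) = 1"
  proof -
    have "Max (insert 0 ((\<lambda>i. av (v $ i)) ` {..<dim_vec v})) \<in> insert 0 ((\<lambda>i. av (v $ i)) ` {..<dim_vec v})"
      by (rule Max_in) auto
    then show ?thesis using um nv1 v by (auto simp: nv_def onb_norm_def)
  qed
  then obtain i where i: "i < n" "av (v $ i) = 1" by blast
  define t where "t a = (if a = 0 then i else if a = i then 0 else a)" for a
  have tt: "t (t a) = a" "a < n \<Longrightarrow> t a < n" "t a = i \<longleftrightarrow> a = 0" "t a = 0 \<longleftrightarrow> a = i" for a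
    using i n by (auto simp: t_def)
  define Q where "Q = Matrix.mat n n (\<lambda>(a, b). if b = 0 then v $ a else if a = t b then 1 else 0)"
  have Q: "Q \<in> carrier_mat n n" by (simp add: Q_def)
  have Qx: "(Q *\<^sub>v x) $ a = v $ a * x $ 0 + (if a = i then 0 else x $ t a)" if x: "x \<in> carrier_vec n" and a: "a < n" for x a
  proof -
    have "(Q *\<^sub>v x) $ a = (\<Sum>b\<in>{0..<n}. (if b = 0 then v $ a else if a = t b then 1 else 0) * x $ b)"
      using x a by (auto simp: Q_def scalar_prod_def intro!: sum.cong)
    also have "\<dots> = v $ a * x $ 0 + (\<Sum>b\<in>{0..<n} - {0}. (if b = 0 then v $ a else if a = t b then 1 else 0) * x $ b)"
      using n by (subst sum.remove[of _ 0]) auto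
    also have "(\<Sum>b\<in>{0..<n} - {0}. (if b = 0 then v $ a else if a = t b then 1 else 0) * x $ b)
        = (\<Sum>b\<in>{0..<n} - {0}. if b = t a then x $ b else 0)"
      by (rule sum.cong) (use tt(1) in auto)
    also have "\<dots> = (if a = i then 0 else x $ t a)" using tt(2)[OF a] tt(4)[of a] by auto
    finally show ?thesis .
  qed
  have "nv (Q *\<^sub>v x) = nv x" if x: "x \<in> carrier_vec n" for x
  proof (rule order_antisym)
    show "nv (Q *\<^sub>v x) \<le> nv x"
      by (rule ultra_integral_le[OF um Q x]) (use le in \<open>auto simp: Q_def\<close>)
    have x0: "av (x $ 0) \<le> nv (Q *\<^sub>v x)"
      using Qx[OF x i(1)] nv_entry[of i "Q *\<^sub>v x"] i Q by (simp add: av_mult)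
    have "av (x $ j) \<le> nv (Q *\<^sub>v x)" if j: "j < n" for j
    proof (cases "j = 0")
      case False
      have "x $ j = (Q *\<^sub>v x) $ t j + (- (v $ t j * x $ 0))"
        using Qx[OF x tt(2)[OF j]] False tt by auto
      then have "av (x $ j) \<le> max (av ((Q *\<^sub>v x) $ t j)) (av (v $ t j * x $ 0))"
        using ultra[OF um] by (metis av_minus)
      also have "\<dots> \<le> nv (Q *\<^sub>v x)"
        using nv_entry[of "t j" "Q *\<^sub>v x"] tt(2)[OF j] Q le[OF tt(2)[OF j]] x0
        by (auto simp: av_mult intro: order_trans[OF mult_left_le_one_le])
      finally show ?thesis .
    qed (use x0 in simp)
    then show "nv x \<le> nv (Q *\<^sub>v x)" using x by (simp add: nv_ultra_le_iff[OF um])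
  qed
  then have "Q \<in> isom n" using Q by (simp add: isom_def)
  moreover have "Q *\<^sub>v unit_vec n 0 = v"
    unfolding mult_mat_vec_unit[OF Q n] using v n by (intro eq_vecI) (auto simp: Q_def)
  ultimately show ?thesis by blast
qed

text \<open>A Householder reflection \<open>H\<close> in the direction
  \<open>u = v - \<theta> e_0\<close> exchanges \<open>v\<close> and \<open>\<theta> e_0\<close>.
  The unit scalar \<open>c\<close> in the conclusion is the inverse of \<theta>.\<close>

lemma isom_transitive_arch:
  assumes ar: "\<not> ultrametric av" and v: "v \<in> carrier_vec n" and n: "0 < n" and nv1: "nv v = 1"
  shows "\<exists>Q\<in>isom n. \<exists>c. av c = 1 \<and> Q *\<^sub>v unit_vec n 0 = c \<cdot>\<^sub>v v"
proof -
  obtain \<phi> :: "'k \<Rightarrow> complex" where p1: "\<phi> 1 = 1" and padd: "\<And>x y. \<phi> (x + y) = \<phi> x + \<phi> y"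
    and pm: "\<And>x y. \<phi> (x * y) = \<phi> x * \<phi> y" and pav: "\<And>x. av x = cmod (\<phi> x)"
    and pc: "\<forall>x. \<exists>y. \<phi> y = cnj (\<phi> x)" and pr: "\<And>t. \<exists>y. \<phi> y = complex_of_real t"
    using ar av_cases by blast
  obtain cj where cj: "\<And>x. \<phi> (cj x) = cnj (\<phi> x)" using pc by metis
  have p0: "\<phi> 0 = 0" using pav[of 0] by simp
  have pmin: "\<phi> (- x) = - \<phi> x" for x using padd[of x "- x"] p0 by (simp add: eq_neg_iff_add_eq_0 add.commute)
  have pdiff: "\<phi> (x - y) = \<phi> x - \<phi> y" for x y using padd[of x "- y"] pmin[of y] by simp
  have psum: "\<phi> (sum f A) = (\<Sum>a\<in>A. \<phi> (f a))" for f :: "nat \<Rightarrow> 'k" and A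
    by (induction A rule: infinite_finite_induct) (auto simp: p0 padd)
  define ip where "ip x y = (\<Sum>i<n. x $ i * cj (y $ i))" for x y :: "'k vec"
  have pip: "\<phi> (ip x y) = (\<Sum>i<n. \<phi> (x $ i) * cnj (\<phi> (y $ i)))" for x y
    by (simp add: ip_def psum pm cj)
  have ipnv: "\<phi> (ip x x) = complex_of_real ((nv x)\<^sup>2)" if "x \<in> carrier_vec n" for x
  proof -
    have "(nv x)\<^sup>2 = (\<Sum>i<n. (cmod (\<phi> (x $ i)))\<^sup>2)"
      using ar that by (simp add: nv_def onb_norm_def sum_nonneg pav)
    then show ?thesis unfolding pip complex_norm_square[symmetric] by simp
  qed
  have v1: "(\<Sum>i<n. \<phi> (v $ i) * cnj (\<phi> (v $ i))) = 1" using ipnv[OF v] nv1 by (simp add: pip)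
  \<comment> \<open>The phase is opposite to that of \<open>v $ 0\<close>. Thus the product of
    \<open>v\<close> with \<open>u\<close> is \<open>1 + r\<close>, which stays away from 0 even if
    \<open>v\<close> is a multiple of the first basis vector.\<close>
  obtain \<theta> where th: "cmod (\<phi> \<theta>) = 1" and vth: "\<phi> (v $ 0) * cnj (\<phi> \<theta>) = - complex_of_real (cmod (\<phi> (v $ 0)))"
  proof (cases "v $ 0 = 0")
    case True then show ?thesis using that[of 1] p0 p1 by simp
  next
    case False
    obtain t where t: "\<phi> t = complex_of_real (- inverse (cmod (\<phi> (v $ 0))))" using pr by blast
    have nz: "cmod (\<phi> (v $ 0)) \<noteq> 0" using False av_eq_0[of "v $ 0"] pav by simp
    show ?thesis
    proof (rule that[of "t * v $ 0"])
      show "cmod (\<phi> (t * v $ 0)) = 1" using nz by (simp add: pm t norm_mult norm_inverse)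
      have "\<phi> (v $ 0) * cnj (\<phi> (t * v $ 0)) = \<phi> t * (\<phi> (v $ 0) * cnj (\<phi> (v $ 0)))"
        by (simp add: pm t)
      also have "\<dots> = - complex_of_real (cmod (\<phi> (v $ 0)))"
        using nz unfolding complex_norm_square[symmetric] t
        by (simp add: power2_eq_square)
      finally show "\<phi> (v $ 0) * cnj (\<phi> (t * v $ 0)) = - complex_of_real (cmod (\<phi> (v $ 0)))" .
    qed
  qed
  define r where "r = cmod (\<phi> (v $ 0))"
  have r: "r \<ge> 0" by (simp add: r_def)
  define u where "u = v - \<theta> \<cdot>\<^sub>v unit_vec n 0"
  have uc: "u \<in> carrier_vec n" using v by (simp add: u_def)
  have ui: "\<phi> (u $ i) = \<phi> (v $ i) - (if i = 0 then \<phi> \<theta> else 0)" if "i < n" for i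
    using that v n by (auto simp: u_def pdiff p0)
  have zero_sum: "(\<Sum>i<n. g i) = g 0 + (\<Sum>i\<in>{..<n} - {0}. g i)" for g :: "nat \<Rightarrow> complex"
    using n by (subst sum.remove[of _ 0]) auto
  have split_sum: "(\<Sum>i<n. g i * (if i = 0 then b else 0)) = g 0 * b" for g :: "nat \<Rightarrow> complex" and b
    using n by (simp add: zero_sum)
  have ipv: "\<phi> (ip v u) = 1 + complex_of_real r"
  proof -
    have "\<phi> (ip v u) = (\<Sum>i<n. \<phi> (v $ i) * cnj (\<phi> (v $ i)) - \<phi> (v $ i) * (if i = 0 then cnj (\<phi> \<theta>) else 0))"
      unfolding pip by (intro sum.cong) (auto simp: ui algebra_simps)
    also have "\<dots> = 1 - \<phi> (v $ 0) * cnj (\<phi> \<theta>)" by (simp add: sum_subtractf v1 split_sum)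
    finally show ?thesis using vth by (simp add: r_def)
  qed
  have ipu: "\<phi> (ip u u) = 2 * (1 + complex_of_real r)"
  proof -
    have "\<phi> (ip u u) = \<phi> (ip v u) - (\<Sum>i<n. cnj (\<phi> (u $ i)) * (if i = 0 then \<phi> \<theta> else 0))"
      unfolding pip sum_subtractf[symmetric] by (intro sum.cong) (auto simp: ui algebra_simps)
    also have "\<dots> = 1 + complex_of_real r - cnj (\<phi> (v $ 0) * cnj (\<phi> \<theta>)) + \<phi> \<theta> * cnj (\<phi> \<theta>)"
      unfolding split_sum[of "\<lambda>i. cnj (\<phi> (u $ i))"] ipv ui[OF n] by (simp add: algebra_simps)
    also have "\<phi> \<theta> * cnj (\<phi> \<theta>) = 1" using th by (metis complex_norm_square of_real_1 one_power2)
    finally show ?thesis unfolding vth r_def[symmetric] by (simp add: r_def)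
  qed
  \<comment> \<open>This is 2 divided by the Hermitian square of \<open>u\<close>, the coefficient
    that makes \<open>H\<close> a reflection.\<close>
  obtain b where b: "\<phi> b = complex_of_real (inverse (1 + r))" using pr by blast
  define H where "H = Matrix.mat n n (\<lambda>(i, j). (if i = j then 1 else 0) - b * (u $ i * cj (u $ j)))"
  have H: "H \<in> carrier_mat n n" by (simp add: H_def)
  have Hx: "H *\<^sub>v x = x - (b * ip x u) \<cdot>\<^sub>v u" if x: "x \<in> carrier_vec n" for x
  proof (rule eq_vecI)
    fix i assume "i < dim_vec (x - (b * ip x u) \<cdot>\<^sub>v u)"
    then have i: "i < n" using uc by simp
    have "(H *\<^sub>v x) $ i = (\<Sum>j<n. (if j = i then x $ j else 0) - b * u $ i * (x $ j * cj (u $ j)))"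
      using i x by (auto simp: H_def scalar_prod_def atLeast0LessThan algebra_simps intro!: sum.cong)
    also have "\<dots> = x $ i - b * u $ i * ip x u"
      using i by (simp add: sum_subtractf ip_def sum_distrib_left)
    finally show "(H *\<^sub>v x) $ i = (x - (b * ip x u) \<cdot>\<^sub>v u) $ i" using i x uc by simp
  qed (use H uc in simp)
  have cr1: "\<phi> b * (1 + complex_of_real r) = 1"
  proof -
    have "1 + complex_of_real r = complex_of_real (1 + r)" by simp
    then show ?thesis unfolding b using r
      by (metis add_nonneg_eq_0_iff left_inverse of_real_1 of_real_mult zero_le_one zero_neq_one)
  qed
  then have cr: "\<phi> b * (2 * (1 + complex_of_real r)) = 2"
    by (metis mult.left_commute mult.right_neutral)
  have cb: "cnj (\<phi> b) = \<phi> b" by (simp add: b)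
  have nvH: "nv (H *\<^sub>v x) = nv x" if x: "x \<in> carrier_vec n" for x
  proof -
    define s where "s = \<phi> (ip x u)"
    have s': "(\<Sum>i<n. cnj (\<phi> (x $ i)) * \<phi> (u $ i)) = cnj s"
      by (simp add: s_def pip)
    have "\<phi> (ip (H *\<^sub>v x) (H *\<^sub>v x)) = (\<Sum>i<n. (\<phi> (x $ i) - \<phi> b * s * \<phi> (u $ i)) * cnj (\<phi> (x $ i) - \<phi> b * s * \<phi> (u $ i)))"
      unfolding pip Hx[OF x] using x uc by (intro sum.cong) (auto simp: pdiff pm s_def)
    also have "\<dots> = (\<Sum>i<n. \<phi> (x $ i) * cnj (\<phi> (x $ i)) - \<phi> b * cnj s * (\<phi> (x $ i) * cnj (\<phi> (u $ i)))
        - \<phi> b * s * (cnj (\<phi> (x $ i)) * \<phi> (u $ i)) + \<phi> b * \<phi> b * s * cnj s * (\<phi> (u $ i) * cnj (\<phi> (u $ i))))"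
      by (intro sum.cong) (auto simp: algebra_simps cb)
    also have "\<dots> = \<phi> (ip x x) - \<phi> b * cnj s * s - \<phi> b * s * cnj s + \<phi> b * \<phi> b * s * cnj s * \<phi> (ip u u)"
      by (simp only: sum.distrib sum_subtractf sum_distrib_left[symmetric] s' pip[symmetric] s_def[symmetric])
    also have "\<dots> = \<phi> (ip x x) - 2 * (\<phi> b * s * cnj s) + \<phi> b * s * cnj s * (\<phi> b * (2 * (1 + complex_of_real r)))"
      unfolding ipu by (simp add: algebra_simps)
    also have "\<dots> = \<phi> (ip x x)" unfolding cr by simp
    finally have "complex_of_real ((nv (H *\<^sub>v x))\<^sup>2) = complex_of_real ((nv x)\<^sup>2)"
      using ipnv x H by (metis mult_mat_vec_carrier)
    then have "(nv (H *\<^sub>v x))\<^sup>2 = (nv x)\<^sup>2" by (simp only: of_real_eq_iff)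
    then show ?thesis by simp
  qed
  have inj: "\<phi> x = \<phi> y \<Longrightarrow> x = y" for x y
    using pav[of "x - y"] av_eq_0[of "x - y"] by (simp add: pdiff)
  have Hv: "H *\<^sub>v v = \<theta> \<cdot>\<^sub>v unit_vec n 0"
  proof -
    have "\<phi> (b * ip v u) = \<phi> 1" using cr1 by (simp only: pm ipv p1)
    then have "b * ip v u = 1" by (rule inj)
    then have "H *\<^sub>v v = v - u" using Hx[OF v] by simp
    then show ?thesis using v n by (auto simp: u_def)
  qed
  have HH: "H *\<^sub>v (H *\<^sub>v v) = v"
  proof -
    have "\<phi> (b * ip (H *\<^sub>v v) u) = - 1"
    proof -
      have "ip (H *\<^sub>v v) u = \<theta> * cj (u $ 0)" 
        unfolding Hv ip_def using n by (subst sum.remove[of _ 0]) auto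
      then have "\<phi> (ip (H *\<^sub>v v) u) = \<phi> \<theta> * cnj (\<phi> (v $ 0)) - \<phi> \<theta> * cnj (\<phi> \<theta>)"
        using n by (simp add: pm cj ui algebra_simps)
      also have "\<phi> \<theta> * cnj (\<phi> \<theta>) = 1" using th by (metis complex_norm_square of_real_1 one_power2)
      also have "\<phi> \<theta> * cnj (\<phi> (v $ 0)) = cnj (\<phi> (v $ 0) * cnj (\<phi> \<theta>))" by simp
      also have "\<dots> = - complex_of_real r" unfolding vth r_def by simp
      finally have "\<phi> (ip (H *\<^sub>v v) u) = - (1 + complex_of_real r)" by simp
      then show ?thesis using cr1 by (simp only: pm mult_minus_right)
    qed
    then have "\<phi> (b * ip (H *\<^sub>v v) u) = \<phi> (- 1)" by (simp add: pmin p1)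
    then have "b * ip (H *\<^sub>v v) u = - 1" by (rule inj)
    then have "H *\<^sub>v (H *\<^sub>v v) = H *\<^sub>v v - (- 1) \<cdot>\<^sub>v u" using Hx[of "H *\<^sub>v v"] H v by simp
    then show ?thesis unfolding Hv u_def using v n by auto
  qed
  have th0: "\<theta> \<noteq> 0" using th p0 by auto
  have "H *\<^sub>v unit_vec n 0 = inverse \<theta> \<cdot>\<^sub>v v"
  proof -
    have "v = \<theta> \<cdot>\<^sub>v (H *\<^sub>v unit_vec n 0)"
      using HH unfolding Hv using mult_mat_vec[OF H, of "unit_vec n 0" \<theta>] by simp
    then have "inverse \<theta> \<cdot>\<^sub>v v = inverse \<theta> \<cdot>\<^sub>v (\<theta> \<cdot>\<^sub>v (H *\<^sub>v unit_vec n 0))" by simp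
    then show ?thesis using th0 by (simp add: smult_smult_assoc)
  qed
  moreover have "H \<in> isom n" using nvH H by (simp add: isom_def)
  moreover have "av (inverse \<theta>) = 1" using th by (simp add: av_inverse pav[symmetric])
  ultimately show ?thesis by blast
qed

lemma isom_transitive:
  assumes "v \<in> carrier_vec n" "0 < n" "nv v = 1"
  shows "\<exists>Q\<in>isom n. \<exists>c. av c = 1 \<and> Q *\<^sub>v unit_vec n 0 = c \<cdot>\<^sub>v v"
  using isom_transitive_arch[OF _ assms] isom_transitive_ultra[OF _ assms] av_1
  by (cases "ultrametric av") (metis one_smult_vec, blast)

section \<open>Existence of Cartan decompositions\<close>

lemma operator_norm_attained:
  assumes A: "A \<in> carrier_mat m n" and n: "0 < n"
  shows "\<exists>v\<in>carrier_vec n. nv v = 1 \<and> (\<forall>w\<in>carrier_vec n. nv (A *\<^sub>v w) \<le> nv (A *\<^sub>v v) * nv w)"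
proof -
  obtain B where B: "B > 0" "\<And>v. v \<in> carrier_vec n \<Longrightarrow> nv (A *\<^sub>v v) \<le> B * nv v"
    using mult_mat_vec_bounded[OF A] by blast
  define T where "T = {nv (A *\<^sub>v v) | v. v \<in> carrier_vec n \<and> nv v = 1}"
  define s where "s = Sup T"
  have T: "T \<noteq> {}" unfolding T_def using nv_unit[OF n] by (auto intro!: exI[of _ "unit_vec n 0"])
  have bdd: "bdd_above T" unfolding T_def bdd_above_def using B(2) by (intro exI[of _ B]) force
  have up: "nv (A *\<^sub>v v) \<le> s" if "v \<in> carrier_vec n" "nv v = 1" for v
    unfolding s_def by (rule cSup_upper[OF _ bdd]) (use that in \<open>auto simp: T_def\<close>)
  have "\<exists>v. v \<in> carrier_vec n \<and> nv v = 1 \<and> s - inverse (real (Suc k)) < nv (A *\<^sub>v v)" for k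
    using less_cSup_iff[OF T bdd, of "s - inverse (real (Suc k))"] by (auto simp: s_def T_def)
  then obtain X where X: "\<And>k. X k \<in> carrier_vec n" "\<And>k. nv (X k) = 1"
    "\<And>k. s - inverse (real (Suc k)) < nv (A *\<^sub>v X k)" by metis
  obtain L r where r: "strict_mono (r :: nat \<Rightarrow> nat)" and L: "L \<in> carrier_vec n"
    and lim: "(\<lambda>k. nv (X (r k) - L)) \<longlonglongrightarrow> 0"
    using vec_convergent_subseq[of X n 1] X by auto
  have c1: "\<bar>nv (X (r k)) - nv L\<bar> \<le> nv (X (r k) - L)" for k
    using nv_le_dist[OF X(1) L, of "r k"] nv_le_dist[OF L X(1), of "r k"] nv_minus_commute[OF X(1) L, of "r k"] by auto
  have "(\<lambda>k. \<bar>nv (X (r k)) - nv L\<bar>) \<longlonglongrightarrow> 0" by (rule tendsto_0_le[OF _ c1 lim]) simp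
  then have nvL: "nv L = 1" unfolding X(2) by (simp add: LIMSEQ_const_iff)
  have c2: "s - nv (A *\<^sub>v L) \<le> inverse (real (Suc k)) + B * nv (X (r k) - L)" for k
  proof -
    have "nv (A *\<^sub>v X (r k)) \<le> nv (A *\<^sub>v L) + nv (A *\<^sub>v X (r k) - A *\<^sub>v L)"
      by (rule nv_le_dist[of _ m]) (use A X(1) L in auto)
    also have "A *\<^sub>v X (r k) - A *\<^sub>v L = A *\<^sub>v (X (r k) - L)"
      by (rule mult_minus_distrib_mat_vec[symmetric, OF A X(1) L])
    also have "nv \<dots> \<le> B * nv (X (r k) - L)" by (rule B(2)) (use X(1) L in auto)
    finally have "nv (A *\<^sub>v X (r k)) \<le> nv (A *\<^sub>v L) + B * nv (X (r k) - L)" by simp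
    moreover have "inverse (real (Suc (r k))) \<le> inverse (real (Suc k))"
      using seq_suble[OF r, of k] by (intro le_imp_inverse_le) auto
    ultimately show ?thesis using X(3)[of "r k"] by linarith
  qed
  have "(\<lambda>k. inverse (real (Suc k)) + B * nv (X (r k) - L)) \<longlonglongrightarrow> 0 + B * 0"
    by (intro tendsto_intros LIMSEQ_inverse_real_of_nat lim)
  then have "s - nv (A *\<^sub>v L) \<le> 0" using LIMSEQ_le_const[of _ 0 "s - nv (A *\<^sub>v L)"] c2 by simp
  then have sL: "s = nv (A *\<^sub>v L)" using up[OF L nvL] by linarith
  have "nv (A *\<^sub>v w) \<le> s * nv w" if w: "w \<in> carrier_vec n" for w
  proof (cases "w = 0\<^sub>v n")
    case True then show ?thesis using B(2)[of "0\<^sub>v n"] by simp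
  next
    case False
    obtain c where c: "c \<noteq> 0" "nv (c \<cdot>\<^sub>v w) = 1" using nv_normalise[OF w False] by blast
    have "av c * nv (A *\<^sub>v w) \<le> s" using up[of "c \<cdot>\<^sub>v w"] w c mult_mat_vec[OF A w, of c] by simp
    moreover have "av c * nv w = 1" using c by simp
    ultimately show ?thesis using av_pos[OF c(1)] nv_pos[OF w False]
      by (metis mult.assoc mult.commute mult_le_cancel_left_pos mult_1)
  qed
  then show ?thesis using L nvL sL by blast
qed

end

lemma mat_factor:
  assumes "(P :: 'k::field mat) \<in> carrier_mat n n" "Q \<in> carrier_mat n n" "det P \<noteq> 0" "det Q \<noteq> 0"
    and A: "A \<in> carrier_mat n n" and B: "B = minv P * A * Q"
  shows "A = P * B * minv Q"
proof -
  note p = minv[OF assms(1,3)] and q = minv[OF assms(2,4)]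
  have "P * B * minv Q = (P * minv P) * A * (Q * minv Q)"
    unfolding B using p(1) q(1) assms by (simp add: assoc_mult_mat[of _ n n _ n _ n])
  then show ?thesis using p(3) q(3) A by simp
qed

context local_abs
begin

text \<open>A unit vector \<open>v\<close> at which the operator norm is attained, and the direction
  of its image, are moved to the first basis vector by isometries. The resulting matrix
  \<open>B\<close> has first column \<open>a e_0\<close> with \<open>av a\<close> equal to the
  operator norm, and the maximality of \<open>a\<close> makes it possible to clear the first row by
  an isometry \<open>R\<close>.\<close>

lemma cartan_step:
  assumes A: "A \<in> carrier_mat (Suc n) (Suc n)"
  shows "\<exists>P\<in>isom (Suc n). \<exists>Q\<in>isom (Suc n). \<exists>a. \<exists>D\<in>carrier_mat n n.
    A = P * four_block_mat (Matrix.mat 1 1 (\<lambda>_. a)) (0\<^sub>m 1 n) (0\<^sub>m n 1) D * Q \<and>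
    (\<forall>v\<in>carrier_vec n. nv (D *\<^sub>v v) \<le> av a * nv v)"
proof -
  let ?N = "Suc n"
  obtain v where v: "v \<in> carrier_vec ?N" "nv v = 1"
    and max: "\<And>w. w \<in> carrier_vec ?N \<Longrightarrow> nv (A *\<^sub>v w) \<le> nv (A *\<^sub>v v) * nv w"
    using operator_norm_attained[OF A] by blast
  define s where "s = nv (A *\<^sub>v v)"
  show ?thesis
  proof (cases "s = 0")
    case True
    have "A = 0\<^sub>m ?N ?N"
    proof (rule mat_eqI_vec[OF A])
      fix w :: "'k vec" assume w: "w \<in> carrier_vec ?N"
      have "nv (A *\<^sub>v w) = 0" using max[OF w] True nv_nonneg[of "A *\<^sub>v w"] unfolding s_def by (metis mult_zero_left order_antisym)
      then have "A *\<^sub>v w = 0\<^sub>v ?N" using nv_eq_0[of "A *\<^sub>v w" ?N] A w by simp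
      then show "A *\<^sub>v w = 0\<^sub>m ?N ?N *\<^sub>v w" using w by (intro eq_vecI) auto
    qed simp
    also have "\<dots> = 1\<^sub>m ?N * four_block_mat (Matrix.mat 1 1 (\<lambda>_. 0)) (0\<^sub>m 1 n) (0\<^sub>m n 1) (0\<^sub>m n n) * 1\<^sub>m ?N"
    proof -
      have "four_block_mat (Matrix.mat 1 1 (\<lambda>_. 0)) (0\<^sub>m 1 n) (0\<^sub>m n 1) (0\<^sub>m n n) = (0\<^sub>m ?N ?N :: 'k mat)"
        by (rule eq_matI) auto
      then show ?thesis by simp
    qed
    finally have e: "A = 1\<^sub>m ?N * four_block_mat (Matrix.mat 1 1 (\<lambda>_. 0)) (0\<^sub>m 1 n) (0\<^sub>m n 1) (0\<^sub>m n n) * 1\<^sub>m ?N" .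
    have "nv (0\<^sub>m n n *\<^sub>v w) \<le> av 0 * nv w" if "w \<in> carrier_vec n" for w
    proof -
      have "0\<^sub>m n n *\<^sub>v w = 0\<^sub>v n" using that by (intro eq_vecI) auto
      then show ?thesis by simp
    qed
    then show ?thesis using e isom_one zero_carrier_mat by blast
  next
    case False
    then have s0: "s > 0" using nv_nonneg[of "A *\<^sub>v v"] unfolding s_def by linarith
    have Av: "A *\<^sub>v v \<in> carrier_vec ?N" using A v by simp
    have "A *\<^sub>v v \<noteq> 0\<^sub>v ?N" using s0 by (auto simp: s_def)
    then obtain c where c: "c \<noteq> 0" "nv (c \<cdot>\<^sub>v (A *\<^sub>v v)) = 1" using nv_normalise[OF Av] by blast
    obtain Q c1 where Q: "Q \<in> isom ?N" and c1: "av c1 = 1" "Q *\<^sub>v unit_vec ?N 0 = c1 \<cdot>\<^sub>v v"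
      using isom_transitive[OF v(1) _ v(2)] by auto
    obtain P c2 where P: "P \<in> isom ?N" and c2: "av c2 = 1" "P *\<^sub>v unit_vec ?N 0 = c2 \<cdot>\<^sub>v (c \<cdot>\<^sub>v (A *\<^sub>v v))"
      using isom_transitive[of "c \<cdot>\<^sub>v (A *\<^sub>v v)" ?N] Av c(2) by auto
    have c20: "c2 \<noteq> 0" using c2(1) by auto
    note Pc = isom_carrier[OF P] and Qc = isom_carrier[OF Q] and mP = isom_minv[OF P]
    note mPc = isom_carrier[OF mP]
    define B where "B = minv P * A * Q"
    have Bc: "B \<in> carrier_mat ?N ?N" unfolding B_def using mPc A Qc by auto
    have Bx: "B *\<^sub>v x = minv P *\<^sub>v (A *\<^sub>v (Q *\<^sub>v x))" if "x \<in> carrier_vec ?N" for x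
      unfolding B_def using mPc A Qc that by (simp add: assoc_mult_mat_vec[of _ ?N ?N _ ?N])
    have Bn: "nv (B *\<^sub>v x) \<le> s * nv x" if x: "x \<in> carrier_vec ?N" for x
    proof -
      have "nv (B *\<^sub>v x) = nv (A *\<^sub>v (Q *\<^sub>v x))" unfolding Bx[OF x] using isom_nv[OF mP] A Qc x by simp
      also have "\<dots> \<le> s * nv (Q *\<^sub>v x)" unfolding s_def using max Qc x by simp
      finally show ?thesis using isom_nv[OF Q x] by simp
    qed
    define a where "a = c1 * inverse (c2 * c)"
    have Be: "B *\<^sub>v unit_vec ?N 0 = a \<cdot>\<^sub>v unit_vec ?N 0"
    proof -
      have "A *\<^sub>v v = inverse (c2 * c) \<cdot>\<^sub>v (P *\<^sub>v unit_vec ?N 0)"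
      proof -
        have "inverse (c2 * c) * (c2 * c) = 1" using c20 c(1) by (intro left_inverse) simp
        then show ?thesis unfolding c2 by (simp only: smult_smult_assoc one_smult_vec)
      qed
      then have "A *\<^sub>v (c1 \<cdot>\<^sub>v v) = P *\<^sub>v (a \<cdot>\<^sub>v unit_vec ?N 0)"
        using mult_mat_vec[OF A v(1)] mult_mat_vec[OF Pc, of "unit_vec ?N 0"] by (simp add: a_def smult_smult_assoc)
      then show ?thesis using Bx[of "unit_vec ?N 0"] c1(2) minv_mult_vec(1)[OF Pc isom_det[OF P]] by simp
    qed
    have ava: "av a = s"
    proof -
      have "av c * s = 1" using c(2) by (simp add: s_def)
      then have "s = inverse (av c)" by (metis inverse_unique)
      then show ?thesis using c1 c2 by (simp add: a_def av_mult av_inverse)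
    qed
    have a0: "a \<noteq> 0" using ava s0 by auto
    have col0: "B $$ (i, 0) = (if i = 0 then a else 0)" if "i < ?N" for i
    proof -
      have "B $$ (i, 0) = (B *\<^sub>v unit_vec ?N 0) $ i" using mult_mat_vec_unit[OF Bc, of 0] that Bc by simp
      then show ?thesis unfolding Be using that by simp
    qed
    define b where "b = Matrix.mat 1 n (\<lambda>(i, j). B $$ (0, Suc j))"
    define D where "D = Matrix.mat n n (\<lambda>(i, j). B $$ (Suc i, Suc j))"
    let ?a = "Matrix.mat 1 1 (\<lambda>_. a)"
    have Dc: "D \<in> carrier_mat n n" and bc: "b \<in> carrier_mat 1 n" by (auto simp: D_def b_def)
    have Bblock: "B = four_block_mat ?a b (0\<^sub>m n 1) D"
      by (rule eq_matI) (use Bc col0 in \<open>auto simp: b_def D_def\<close>)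
    \<comment> \<open>The column operation that clears the first row. In the ultrametric case its
      entries are integral, because no entry of \<open>B\<close> exceeds the operator norm
      \<open>av a\<close>. In the Archimedean case the row turns out to be zero already, so that
      \<open>R\<close> is the identity.\<close>
    define R where "R = four_block_mat (1\<^sub>m 1) (- inverse a \<cdot>\<^sub>m b) (0\<^sub>m n 1) (1\<^sub>m n)"
    define R' where "R' = four_block_mat (1\<^sub>m 1) (inverse a \<cdot>\<^sub>m b) (0\<^sub>m n 1) (1\<^sub>m n)"
    have Rc: "R \<in> carrier_mat ?N ?N" "R' \<in> carrier_mat ?N ?N"
      using four_block_carrier_mat[of "1\<^sub>m 1 :: 'k mat" 1 1 "1\<^sub>m n" n n] by (auto simp: R_def R'_def)
    have RR: "R' * R = 1\<^sub>m ?N"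
    proof -
      have "R' * R = four_block_mat (1\<^sub>m 1) (- inverse a \<cdot>\<^sub>m b + inverse a \<cdot>\<^sub>m b) (0\<^sub>m n 1) (1\<^sub>m n)"
        unfolding R_def R'_def using bc by (subst mult_four_block_mat[of _ 1 1 _ n _ n _ _ 1 _ n]) auto
      also have "- inverse a \<cdot>\<^sub>m b + inverse a \<cdot>\<^sub>m b = 0\<^sub>m 1 n" using bc by (intro eq_matI) auto
      finally show ?thesis by simp
    qed
    have Rblock: "B * R = four_block_mat ?a (0\<^sub>m 1 n) (0\<^sub>m n 1) D"
    proof -
      have "?a * (- inverse a \<cdot>\<^sub>m b) + b = 0\<^sub>m 1 n"
        by (rule eq_matI) (use bc a0 in \<open>auto simp: scalar_prod_def\<close>)
      then show ?thesis unfolding Bblock R_def using bc Dc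
        by (subst mult_four_block_mat[of _ 1 1 _ n _ n _ _ 1 _ n]) (auto simp: right_mult_zero_mat[of _ n 1])
    qed
    have Ris: "R \<in> isom ?N"
    proof (cases "ultrametric av")
      case True
      have bn: "av (inverse a * b $$ (0, j)) \<le> 1" if j: "j < n" for j
      proof -
        have "av (B $$ (0, Suc j)) \<le> nv (B *\<^sub>v unit_vec ?N (Suc j))"
          using nv_entry[of 0 "col B (Suc j)"] mult_mat_vec_unit[OF Bc, of "Suc j"] Bc j by simp
        also have "\<dots> \<le> s" using Bn[of "unit_vec ?N (Suc j)"] nv_unit[of "Suc j" ?N] j by simp
        finally have "av (B $$ (0, Suc j)) \<le> s" .
        moreover have "av (inverse a * b $$ (0, j)) = inverse s * av (B $$ (0, Suc j))"
          using j by (simp add: av_mult av_inverse ava b_def)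
        moreover have "inverse s * x \<le> 1" if "x \<le> s" for x using that s0 by (simp add: field_simps)
        ultimately show ?thesis by metis
      qed
      have bn': "av (b $$ (0, j) / a) \<le> 1" if "j < n" for j
        using bn[OF that] by (simp add: field_simps)
      show ?thesis
      proof (rule isomI_le[OF Rc RR])
        show "nv (R *\<^sub>v w) \<le> nv w" if "w \<in> carrier_vec ?N" for w
          by (rule ultra_integral_le[OF True Rc(1) that]) (use bn bn' bc in \<open>auto simp: R_def\<close>)
        show "nv (R' *\<^sub>v w) \<le> nv w" if "w \<in> carrier_vec ?N" for w
          by (rule ultra_integral_le[OF True Rc(2) that]) (use bn bn' bc in \<open>auto simp: R'_def\<close>)
      qed
    next
      case False
      then obtain \<phi> :: "'k \<Rightarrow> complex" where padd: "\<And>x y. \<phi> (x + y) = \<phi> x + \<phi> y"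
        and pm: "\<And>x y. \<phi> (x * y) = \<phi> x * \<phi> y" and pav: "\<And>x. av x = cmod (\<phi> x)"
        and pc: "\<forall>x. \<exists>y. \<phi> y = cnj (\<phi> x)"
        using av_cases by blast
      obtain cj where cj: "\<And>x. \<phi> (cj x) = cnj (\<phi> x)" using pc by metis
      have psum: "\<phi> (sum f I) = (\<Sum>i\<in>I. \<phi> (f i))" for f :: "nat \<Rightarrow> 'k" and I
        using pav[of 0] by (induction I rule: infinite_finite_induct) (auto simp: padd)
      \<comment> \<open>Testing \<open>B\<close> on the conjugate of its first row gives first entry
        \<open>S\<close>, the square of the norm of \<open>x\<close>, hence
        \<open>nv x \<le> s\<close>. As the corner entry alone already has absolute value
        \<open>s\<close>, the other entries vanish.\<close>
      define x where "x = Matrix.vec ?N (\<lambda>j. cj (B $$ (0, j)))"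
      have xc: "x \<in> carrier_vec ?N" by (simp add: x_def)
      define S where "S = (\<Sum>j<?N. (av (B $$ (0, j)))\<^sup>2)"
      have S0: "S \<ge> 0" by (simp add: S_def sum_nonneg)
      have nvx: "(nv x)\<^sup>2 = S"
        using False by (simp add: nv_def onb_norm_def x_def S_def sum_nonneg pav cj del: sum.lessThan_Suc)
      have "\<phi> ((B *\<^sub>v x) $ 0) = complex_of_real S"
      proof -
        have "(B *\<^sub>v x) $ 0 = (\<Sum>j<?N. B $$ (0, j) * cj (B $$ (0, j)))"
          using Bc by (auto simp: scalar_prod_def x_def atLeast0LessThan simp del: sum.lessThan_Suc intro!: sum.cong)
        then show ?thesis by (simp add: psum pm cj complex_norm_square[symmetric] S_def pav del: sum.lessThan_Suc)
      qed
      then have "av ((B *\<^sub>v x) $ 0) = S" using S0 by (simp add: pav)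
      then have "S \<le> s * nv x" using nv_entry[of 0 "B *\<^sub>v x"] Bn[OF xc] Bc by simp
      then have le: "nv x * nv x \<le> s * nv x" using nvx by (simp add: power2_eq_square)
      have "nv x \<le> s"
      proof (rule ccontr)
        assume "\<not> nv x \<le> s"
        then have "s * nv x < nv x * nv x" using s0 by (intro mult_strict_right_mono) auto
        then show False using le by simp
      qed
      then have "S \<le> s\<^sup>2" using nvx nv_nonneg[of x] by (metis power_mono)
      moreover have "S = s\<^sup>2 + (\<Sum>j<n. (av (B $$ (0, Suc j)))\<^sup>2)"
        unfolding S_def sum.lessThan_Suc_shift using col0[of 0] ava by simp
      ultimately have "(\<Sum>j<n. (av (B $$ (0, Suc j)))\<^sup>2) \<le> 0" by simp
      then have "(\<Sum>j<n. (av (B $$ (0, Suc j)))\<^sup>2) = 0" by (simp add: order_antisym sum_nonneg)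
      then have "B $$ (0, Suc j) = 0" if "j < n" for j using that by (simp add: sum_nonneg_eq_0_iff)
      then have "b = 0\<^sub>m 1 n" by (intro eq_matI) (auto simp: b_def)
      then have "R = 1\<^sub>m ?N" unfolding R_def by (intro eq_matI) auto
      then show ?thesis by simp
    qed
    have eq: "A = P * (B * R) * minv (Q * R)"
    proof (rule mat_factor[OF Pc _ isom_det[OF P] _ A])
      show "Q * R \<in> carrier_mat ?N ?N" using Qc Rc by simp
      show "det (Q * R) \<noteq> 0" by (rule isom_det[OF isom_mult[OF Q Ris]])
      show "B * R = minv P * A * (Q * R)"
        unfolding B_def using mPc A Qc Rc by (simp add: assoc_mult_mat[of _ ?N ?N _ ?N _ ?N])
    qed
    have "nv (D *\<^sub>v w) \<le> av a * nv w" if w: "w \<in> carrier_vec n" for w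
    proof -
      have 0: "nv (0\<^sub>v 1 @\<^sub>v y) = nv y" for y :: "'k vec" by (simp add: nv_append)
      have "four_block_mat ?a (0\<^sub>m 1 n) (0\<^sub>m n 1) D *\<^sub>v (0\<^sub>v 1 @\<^sub>v w) = 0\<^sub>v 1 @\<^sub>v (D *\<^sub>v w)"
        using Dc w by (subst four_block_mat_mult_vec[of _ 1 1 _ n _ n]) (auto simp: scalar_prod_def)
      then have "nv (D *\<^sub>v w) = nv ((B * R) *\<^sub>v (0\<^sub>v 1 @\<^sub>v w))" by (simp only: Rblock 0)
      moreover have wc: "0\<^sub>v 1 @\<^sub>v w \<in> carrier_vec ?N" using append_carrier_vec[of "0\<^sub>v 1" 1 w n] w by simp
      ultimately have "nv (D *\<^sub>v w) = nv (B *\<^sub>v (R *\<^sub>v (0\<^sub>v 1 @\<^sub>v w)))"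
        using Bc Rc by (simp add: assoc_mult_mat_vec[of _ ?N ?N _ ?N])
      also have "\<dots> \<le> s * nv (R *\<^sub>v (0\<^sub>v 1 @\<^sub>v w))" by (rule Bn) (use Rc wc in simp)
      also have "nv (R *\<^sub>v (0\<^sub>v 1 @\<^sub>v w)) = nv w" using isom_nv[OF Ris wc] by (simp only: 0)
      finally show ?thesis by (simp add: ava)
    qed
    then show ?thesis using eq[unfolded Rblock] P isom_minv[OF isom_mult[OF Q Ris]] Dc by blast
  qed
qed

text \<open>The Cartan decomposition in standard coordinates. It is stated for all square matrices,
  so that the induction on the size can pass to the lower right block as it is.\<close>

definition svd :: "nat \<Rightarrow> 'k mat \<Rightarrow> 'k mat \<Rightarrow> (nat \<Rightarrow> 'k) \<Rightarrow> 'k mat \<Rightarrow> bool" where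
  "svd n A k \<alpha> l \<longleftrightarrow> k \<in> isom n \<and> l \<in> isom n \<and> A = k * mat_diag n \<alpha> * l \<and>
     (\<forall>i j. i \<le> j \<and> j < n \<longrightarrow> av (\<alpha> j) \<le> av (\<alpha> i))"

theorem svd_exists:
  "A \<in> carrier_mat n n \<Longrightarrow> \<exists>k \<alpha> l. svd n A k \<alpha> l"
proof (induction n arbitrary: A)
  case 0
  have "A = 1\<^sub>m 0 * mat_diag 0 (\<lambda>_. 0) * 1\<^sub>m 0" using 0 by (intro eq_matI) auto
  then show ?case unfolding svd_def using isom_one[of 0] by (intro exI[of _ "1\<^sub>m 0"] exI[of _ "\<lambda>_. 0"]) auto
next
  case (Suc n)
  let ?N = "Suc n"
  obtain P Q a D where P: "P \<in> isom ?N" and Q: "Q \<in> isom ?N" and D: "D \<in> carrier_mat n n"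
    and A: "A = P * four_block_mat (Matrix.mat 1 1 (\<lambda>_. a)) (0\<^sub>m 1 n) (0\<^sub>m n 1) D * Q"
    and Dle: "\<And>v. v \<in> carrier_vec n \<Longrightarrow> nv (D *\<^sub>v v) \<le> av a * nv v"
    using cartan_step[OF Suc.prems] by blast
  obtain k \<alpha> l where svd: "svd n D k \<alpha> l" using Suc.IH[OF D] by blast
  then have k: "k \<in> isom n" and l: "l \<in> isom n" and De: "D = k * mat_diag n \<alpha> * l"
    and mono: "\<And>i j. i \<le> j \<Longrightarrow> j < n \<Longrightarrow> av (\<alpha> j) \<le> av (\<alpha> i)" by (auto simp: svd_def)
  note kc = isom_carrier[OF k] and lc = isom_carrier[OF l] and Pc = isom_carrier[OF P] and Qc = isom_carrier[OF Q]
  define \<beta> where "\<beta> = case_nat a \<alpha>"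
  let ?b = "\<lambda>X. four_block_mat (1\<^sub>m 1) (0\<^sub>m 1 n) (0\<^sub>m n 1) X :: 'k mat"
  let ?a = "Matrix.mat 1 1 (\<lambda>_. a)"
  have diag: "four_block_mat ?a (0\<^sub>m 1 n) (0\<^sub>m n 1) (mat_diag n \<alpha>) = mat_diag ?N \<beta>"
    by (rule eq_matI) (auto simp: mat_diag_def \<beta>_def split: nat.split)
  have kb: "?b k \<in> carrier_mat ?N ?N" and lb: "?b l \<in> carrier_mat ?N ?N"
    using isom_carrier[OF isom_block[OF k]] isom_carrier[OF isom_block[OF l]] by auto
  have 1: "four_block_mat ?a (0\<^sub>m 1 n) (0\<^sub>m n 1) (k * mat_diag n \<alpha>) = ?b k * mat_diag ?N \<beta>"
    unfolding diag[symmetric] using kc 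
    by (subst mult_four_block_mat[of _ 1 1 _ n _ n _ _ 1 _ n])
      (auto simp: right_mult_zero_mat[of _ n n] left_mult_zero_mat[OF mat_diag_dim])
  have "four_block_mat ?a (0\<^sub>m 1 n) (0\<^sub>m n 1) D = ?b k * mat_diag ?N \<beta> * ?b l"
    unfolding 1[symmetric] De using kc lc
    by (subst mult_four_block_mat[of _ 1 1 _ n _ n _ _ 1 _ n]) (auto simp: right_mult_zero_mat[of _ n n])
  then have "A = (P * ?b k) * mat_diag ?N \<beta> * (?b l * Q)"
    unfolding A using Pc Qc kb lb mult_carrier_mat[OF mat_diag_dim lb, of \<beta>]
      mult_carrier_mat[OF kb mult_carrier_mat[OF mat_diag_dim lb], of \<beta>]
    by (simp add: assoc_mult_mat[of _ ?N ?N _ ?N _ ?N])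
  \<comment> \<open>The ordering of the singular values: the block \<open>D\<close> has operator
    norm at most \<open>av a\<close>, and \<open>D\<close> stretches the inverse image of the
    \<open>i\<close>-th basis vector under \<open>l\<close> by exactly
    \<open>av (\<alpha> i)\<close>.\<close>
  moreover have "av (\<alpha> i) \<le> av a" if i: "i < n" for i
  proof -
    let ?u = "minv l *\<^sub>v unit_vec n i"
    have u: "?u \<in> carrier_vec n" using isom_carrier[OF isom_minv[OF l]] by simp
    have "D *\<^sub>v ?u = k *\<^sub>v (mat_diag n \<alpha> *\<^sub>v (l *\<^sub>v ?u))"
      unfolding De using kc lc u by (simp add: assoc_mult_mat_vec[of _ n n _ n])
    also have "l *\<^sub>v ?u = unit_vec n i" by (rule minv_mult_vec(2)[OF lc isom_det[OF l]]) simp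
    also have "mat_diag n \<alpha> *\<^sub>v unit_vec n i = \<alpha> i \<cdot>\<^sub>v unit_vec n i"
      using mult_mat_vec_unit[of "mat_diag n \<alpha>" n n i] i by (intro eq_vecI) (auto simp: mat_diag_def)
    finally have "nv (D *\<^sub>v ?u) = av (\<alpha> i)"
      using isom_nv[OF k, of "\<alpha> i \<cdot>\<^sub>v unit_vec n i"] nv_unit[OF i] by simp
    moreover have "nv ?u = 1" using isom_nv[OF isom_minv[OF l], of "unit_vec n i"] nv_unit[OF i] by simp
    ultimately show ?thesis using Dle[OF u] by simp
  qed
  then have "av (\<beta> j) \<le> av (\<beta> i)" if "i \<le> j" "j < ?N" for i j
    using that mono by (auto simp: \<beta>_def split: nat.split)
  ultimately show ?case
    unfolding svd_def using isom_mult[OF P isom_block[OF k]] isom_mult[OF isom_block[OF l] Q] by blast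
qed

end

section \<open>Hyperbolic groups\<close>

text \<open>Compactness of a product of finite sets, by a diagonal argument in which the
  \<open>i\<close>-th subsequence is constant at the coordinate \<open>i\<close>. Applied to
  geodesics in a Cayley graph with finite balls, it yields limit rays.\<close>

lemma pointwise_convergent_subseq:
  fixes X :: "nat \<Rightarrow> nat \<Rightarrow> 'a"
  assumes "\<And>i. finite (range (\<lambda>n. X n i))"
  shows "\<exists>l s. strict_mono (s :: nat \<Rightarrow> nat) \<and> (\<forall>i. \<exists>n0. \<forall>n\<ge>n0. X (s n) i = l i)"
proof -
  interpret subseqs "\<lambda>i s. \<exists>c. \<forall>n. X (s n) i = c"
  proof
    fix i and s :: "nat \<Rightarrow> nat"
    have "finite (range (\<lambda>n. X (s n) i))" by (rule finite_subset[OF _ assms[of i]]) auto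
    then obtain n0 where n0: "infinite {n \<in> UNIV. X (s n) i = X (s n0) i}"
      using pigeonhole_infinite[of UNIV "\<lambda>n. X (s n) i"] by auto
    define r where "r = enumerate {n. X (s n) i = X (s n0) i}"
    have "strict_mono r" unfolding r_def using n0 by (simp add: strict_mono_enumerate)
    moreover have "X (s (r n)) i = X (s n0) i" for n
      unfolding r_def using enumerate_in_set[of "{n. X (s n) i = X (s n0) i}" n] n0 by auto
    ultimately show "\<exists>r'. strict_mono (r' :: nat \<Rightarrow> nat) \<and> (\<exists>c. \<forall>n. X ((s \<circ> r') n) i = c)" by auto
  qed
  have "\<exists>c. \<forall>n. X ((diagseq \<circ> (+) (Suc i)) n) i = c" for i
    by (rule diagseq_holds) auto
  then obtain l where l: "\<And>i n. X (diagseq (Suc i + n)) i = l i" by (simp add: o_def) metis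
  have "X (diagseq n) i = l i" if "n \<ge> Suc i" for i n
    using l[of i "n - Suc i"] that by simp
  then show ?thesis using subseq_diagseq by blast
qed

locale hyp_group = group G for G (structure) +
  fixes S :: "'a set" and \<delta> :: real
  assumes gen: "sym_generating G S"
    and four_point: "\<And>w x y z. w \<in> carrier G \<Longrightarrow> x \<in> carrier G \<Longrightarrow> y \<in> carrier G \<Longrightarrow> z \<in> carrier G \<Longrightarrow>
      min (gromov_product G S w x y) (gromov_product G S w y z) - \<delta> \<le> gromov_product G S w x z"
    and \<delta>: "0 \<le> \<delta>"
begin

abbreviation len where "len \<equiv> word_length G S"
abbreviation d where "d \<equiv> word_dist G S"
abbreviation gp where "gp \<equiv> gromov_product G S"
abbreviation rays where "rays \<equiv> geodesic_rays G S"

abbreviation prod_word :: "'a list \<Rightarrow> 'a" where "prod_word ws \<equiv> foldr (\<otimes>) ws \<one>"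

lemma S_carrier: "S \<subseteq> carrier G" using gen by (simp add: sym_generating_def)

lemma prod_word_closed: "set ws \<subseteq> S \<Longrightarrow> prod_word ws \<in> carrier G"
  using S_carrier by (induction ws) auto

lemma prod_word_append: "set us \<subseteq> S \<Longrightarrow> set ws \<subseteq> S \<Longrightarrow> prod_word (us @ ws) = prod_word us \<otimes> prod_word ws"
proof (induction us)
  case (Cons u us)
  then have "u \<in> carrier G" "prod_word us \<in> carrier G" "prod_word ws \<in> carrier G"
    using S_carrier prod_word_closed by auto
  then show ?case using Cons by (simp add: m_assoc)
qed (simp add: prod_word_closed)

lemma ex_word:
  assumes "g \<in> carrier G"
  shows "\<exists>ws. set ws \<subseteq> S \<and> prod_word ws = g"
proof -
  have "g \<in> generate G S" using assms gen by (simp add: sym_generating_def)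
  then show ?thesis
  proof induction
    case one
    show ?case by (rule exI[of _ "[]"]) simp
  next
    case (incl h)
    then show ?case using S_carrier by (intro exI[of _ "[h]"]) auto
  next
    case (inv h)
    then have "inv h \<in> S" using gen by (simp add: sym_generating_def)
    then show ?case using S_carrier by (intro exI[of _ "[inv h]"]) auto
  next
    case (eng h1 h2)
    then obtain us ws where "set us \<subseteq> S" "prod_word us = h1" "set ws \<subseteq> S" "prod_word ws = h2" by blast
    then show ?case using prod_word_append[of us ws] by (intro exI[of _ "us @ ws"]) auto
  qed
qed

lemma len_word:
  assumes "g \<in> carrier G"
  obtains ws where "length ws = len g" "set ws \<subseteq> S" "prod_word ws = g"
proof -
  have "\<exists>n. \<exists>ws. length ws = n \<and> set ws \<subseteq> S \<and> prod_word ws = g" using ex_word[OF assms] by blast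
  from LeastI_ex[OF this] show ?thesis using that unfolding word_length_def by blast
qed

lemma len_le: "set ws \<subseteq> S \<Longrightarrow> len (prod_word ws) \<le> length ws"
  unfolding word_length_def by (rule Least_le) blast

lemma len_one [simp]: "len \<one> = 0" using len_le[of "[]"] by simp

lemma len_mult: "g \<in> carrier G \<Longrightarrow> h \<in> carrier G \<Longrightarrow> len (g \<otimes> h) \<le> len g + len h"
proof -
  assume g: "g \<in> carrier G" and h: "h \<in> carrier G"
  obtain us where u: "length us = len g" "set us \<subseteq> S" "prod_word us = g" by (rule len_word[OF g])
  obtain ws where w: "length ws = len h" "set ws \<subseteq> S" "prod_word ws = h" by (rule len_word[OF h])
  show ?thesis using len_le[of "us @ ws"] prod_word_append[of us ws] u w by simp
qed

lemma len_inv_le: "g \<in> carrier G \<Longrightarrow> len (inv g) \<le> len g"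
proof -
  assume g: "g \<in> carrier G"
  obtain us where u: "length us = len g" "set us \<subseteq> S" "prod_word us = g" by (rule len_word[OF g])
  have inv: "set ws \<subseteq> S \<Longrightarrow> prod_word (rev (map (\<lambda>s. inv s) ws)) = inv (prod_word ws) \<and> set (rev (map (\<lambda>s. inv s) ws)) \<subseteq> S" for ws
  proof (induction ws)
    case (Cons s ws)
    have s: "s \<in> carrier G" "inv s \<in> S" using Cons.prems S_carrier gen by (auto simp: sym_generating_def)
    have ws: "prod_word ws \<in> carrier G" using Cons.prems by (simp add: prod_word_closed)
    have IH: "prod_word (rev (map (\<lambda>s. inv s) ws)) = inv (prod_word ws)" "set (rev (map (\<lambda>s. inv s) ws)) \<subseteq> S"
      using Cons by auto
    have "prod_word (rev (map (\<lambda>s. inv s) ws) @ [inv s]) = inv (prod_word ws) \<otimes> inv s"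
      using prod_word_append[OF IH(2), of "[inv s]"] IH(1) s by simp
    then show ?case using s ws IH(2) by (simp add: inv_mult_group)
  qed simp
  show ?thesis using len_le[of "rev (map (\<lambda>s. inv s) us)"] inv[OF u(2)] u by simp
qed

lemma len_inv: "g \<in> carrier G \<Longrightarrow> len (inv g) = len g"
  using len_inv_le[of g] len_inv_le[of "inv g"] by (simp add: order_antisym)

lemma finite_ball: "finite {g \<in> carrier G. len g \<le> n}"
proof -
  have "{g \<in> carrier G. len g \<le> n} \<subseteq> prod_word ` {ws. set ws \<subseteq> S \<and> length ws \<le> n}"
  proof
    fix g assume "g \<in> {g \<in> carrier G. len g \<le> n}"
    then have g: "g \<in> carrier G" "len g \<le> n" by auto
    obtain us where u: "length us = len g" "set us \<subseteq> S" "prod_word us = g" by (rule len_word[OF g(1)])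
    then show "g \<in> prod_word ` {ws. set ws \<subseteq> S \<and> length ws \<le> n}" using g by force
  qed
  moreover have "finite S" using gen by (simp add: sym_generating_def)
  from this have "finite {ws. set ws \<subseteq> S \<and> length ws \<le> n}" by (rule finite_lists_length_le)
  ultimately show ?thesis by (meson finite_imageI finite_subset)
qed

lemma d_commute: "x \<in> carrier G \<Longrightarrow> y \<in> carrier G \<Longrightarrow> d x y = d y x"
  using len_inv[of "inv x \<otimes> y"] by (simp add: word_dist_def inv_mult_group)

lemma d_triangle:
  assumes "x \<in> carrier G" "y \<in> carrier G" "z \<in> carrier G"
  shows "d x z \<le> d x y + d y z"
proof -
  have "y \<otimes> (inv y \<otimes> z) = z" using assms by (simp flip: m_assoc)
  then have "inv x \<otimes> z = (inv x \<otimes> y) \<otimes> (inv y \<otimes> z)"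
    using assms by (simp add: m_assoc)
  then show ?thesis using len_mult[of "inv x \<otimes> y" "inv y \<otimes> z"] assms by (simp add: word_dist_def)
qed

lemma d_refl [simp]: "x \<in> carrier G \<Longrightarrow> d x x = 0" by (simp add: word_dist_def)

lemma d_one: "x \<in> carrier G \<Longrightarrow> d \<one> x = len x" by (simp add: word_dist_def)

lemma d_left: "g \<in> carrier G \<Longrightarrow> x \<in> carrier G \<Longrightarrow> y \<in> carrier G \<Longrightarrow> d (g \<otimes> x) (g \<otimes> y) = d x y"
proof -
  assume *: "g \<in> carrier G" "x \<in> carrier G" "y \<in> carrier G"
  have "inv (g \<otimes> x) \<otimes> (g \<otimes> y) = inv x \<otimes> (inv g \<otimes> (g \<otimes> y))" using * by (simp add: inv_mult_group m_assoc)
  also have "inv g \<otimes> (g \<otimes> y) = y" using * by (simp flip: m_assoc)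
  finally show ?thesis by (simp add: word_dist_def)
qed

lemma gp_left: "g \<in> carrier G \<Longrightarrow> w \<in> carrier G \<Longrightarrow> x \<in> carrier G \<Longrightarrow> y \<in> carrier G \<Longrightarrow>
    gp (g \<otimes> w) (g \<otimes> x) (g \<otimes> y) = gp w x y"
  by (simp add: gromov_product_def d_left)

lemma finite_d_ball: "x \<in> carrier G \<Longrightarrow> finite {y \<in> carrier G. d x y \<le> n}"
proof -
  assume x: "x \<in> carrier G"
  have "{y \<in> carrier G. d x y \<le> n} \<subseteq> (\<lambda>g. x \<otimes> g) ` {g \<in> carrier G. len g \<le> n}"
  proof
    fix y assume "y \<in> {y \<in> carrier G. d x y \<le> n}"
    then show "y \<in> (\<lambda>g. x \<otimes> g) ` {g \<in> carrier G. len g \<le> n}"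
      using x by (intro image_eqI[of _ _ "inv x \<otimes> y"]) (auto simp: word_dist_def inv_solve_left simp flip: m_assoc)
  qed
  then show ?thesis using finite_ball finite_surj by blast
qed

text \<open>The prefixes of a shortest word. Each piece is at most as long as its number of letters,
  and any strict inequality would shorten the whole word.\<close>

lemma geodesic_exists:
  assumes x: "x \<in> carrier G" and y: "y \<in> carrier G"
  shows "\<exists>\<sigma>. \<sigma> 0 = x \<and> \<sigma> (d x y) = y \<and> (\<forall>i. \<sigma> i \<in> carrier G) \<and>
    (\<forall>i j. i \<le> j \<and> j \<le> d x y \<longrightarrow> d (\<sigma> i) (\<sigma> j) = j - i)"
proof -
  obtain ws where ws: "length ws = len (inv x \<otimes> y)" "set ws \<subseteq> S" "prod_word ws = inv x \<otimes> y"
    by (rule len_word[of "inv x \<otimes> y"]) (use x y in auto)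
  define \<sigma> where "\<sigma> i = x \<otimes> prod_word (take i ws)" for i
  have pc: "prod_word (take i ws) \<in> carrier G" for i
    using ws(2) by (intro prod_word_closed) (meson order_trans set_take_subset)
  have \<sigma>c: "\<sigma> i \<in> carrier G" for i using pc x by (simp add: \<sigma>_def)
  have n: "d x y = length ws" using ws(1) by (simp add: word_dist_def)
  have 0: "\<sigma> 0 = x" using x by (simp add: \<sigma>_def)
  have 1: "\<sigma> (d x y) = y" using x y by (simp add: \<sigma>_def n ws(3) inv_solve_left flip: m_assoc)
  have le: "d (\<sigma> i) (\<sigma> j) \<le> j - i" if "i \<le> j" for i j
  proof -
    have sub: "set (take (j - i) (drop i ws)) \<subseteq> S" using ws(2) by (meson in_set_dropD in_set_takeD subset_iff)
    have "take j ws = take i ws @ take (j - i) (drop i ws)" using that by (simp add: take_add flip: take_add)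
    then have "prod_word (take j ws) = prod_word (take i ws) \<otimes> prod_word (take (j - i) (drop i ws))"
      using prod_word_append[OF _ sub, of "take i ws"] ws(2) by (metis order_trans set_take_subset)
    then have "d (\<sigma> i) (\<sigma> j) = len (prod_word (take (j - i) (drop i ws)))"
      unfolding \<sigma>_def d_left[OF x pc pc] using pc prod_word_closed[OF sub] by (simp add: word_dist_def flip: m_assoc)
    also have "\<dots> \<le> j - i" using len_le[OF sub] by simp
    finally show ?thesis .
  qed
  have "d (\<sigma> i) (\<sigma> j) = j - i" if ij: "i \<le> j" "j \<le> d x y" for i j
  proof (rule order_antisym[OF le[OF ij(1)]])
    have "d x y \<le> d x (\<sigma> i) + (d (\<sigma> i) (\<sigma> j) + d (\<sigma> j) y)"
      using d_triangle[OF x \<sigma>c[of i] y] d_triangle[OF \<sigma>c[of i] \<sigma>c[of j] y] by linarith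
    then show "j - i \<le> d (\<sigma> i) (\<sigma> j)" using le[of 0 i] le[of j "d x y"] ij 0 1 by simp
  qed
  then show ?thesis using 0 1 \<sigma>c by blast
qed

section \<open>Geodesic rays, their equivalence and Gromov products\<close>

lemma ray_carrier: "\<eta> \<in> rays \<Longrightarrow> \<eta> n \<in> carrier G" by (simp add: geodesic_rays_def)

lemma ray_d: "\<eta> \<in> rays \<Longrightarrow> m \<le> n \<Longrightarrow> d (\<eta> m) (\<eta> n) = n - m" by (simp add: geodesic_rays_def)

lemma ray_d0: "\<eta> \<in> rays \<Longrightarrow> d (\<eta> 0) (\<eta> n) = n" using ray_d[of \<eta> 0 n] by simp

definition req :: "(nat \<Rightarrow> 'a) \<Rightarrow> (nat \<Rightarrow> 'a) \<Rightarrow> bool" where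
  "req \<gamma> \<eta> \<longleftrightarrow> (\<exists>K. \<forall>n. d (\<gamma> n) (\<eta> n) \<le> K)"

lemma req_refl: "\<eta> \<in> rays \<Longrightarrow> req \<eta> \<eta>"
  unfolding req_def by (rule exI[of _ 0]) (simp add: ray_carrier)

lemma req_sym: "\<eta> \<in> rays \<Longrightarrow> \<zeta> \<in> rays \<Longrightarrow> req \<eta> \<zeta> \<Longrightarrow> req \<zeta> \<eta>"
  unfolding req_def by (metis d_commute ray_carrier)

lemma req_trans:
  assumes "\<eta> \<in> rays" "\<zeta> \<in> rays" "\<theta> \<in> rays" "req \<eta> \<zeta>" "req \<zeta> \<theta>"
  shows "req \<eta> \<theta>"
proof -
  obtain K L where "\<And>n. d (\<eta> n) (\<zeta> n) \<le> K" "\<And>n. d (\<zeta> n) (\<theta> n) \<le> L" using assms by (auto simp: req_def)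
  then have "d (\<eta> n) (\<theta> n) \<le> K + L" for n
    using d_triangle[of "\<eta> n" "\<zeta> n" "\<theta> n"] assms(1-3) by (meson add_mono order_trans ray_carrier)
  then show ?thesis by (auto simp: req_def)
qed

lemma ray_left: "g \<in> carrier G \<Longrightarrow> \<eta> \<in> rays \<Longrightarrow> (\<lambda>n. g \<otimes> \<eta> n) \<in> rays"
  by (auto simp: geodesic_rays_def d_left)

lemma req_left: "g \<in> carrier G \<Longrightarrow> \<eta> \<in> rays \<Longrightarrow> \<zeta> \<in> rays \<Longrightarrow> req (\<lambda>n. g \<otimes> \<eta> n) (\<lambda>n. g \<otimes> \<zeta> n) \<longleftrightarrow> req \<eta> \<zeta>"
  by (simp add: req_def d_left ray_carrier)

lemma ray_shift: "\<eta> \<in> rays \<Longrightarrow> (\<lambda>n. \<eta> (m + n)) \<in> rays"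
  by (auto simp: geodesic_rays_def)

lemma req_shift: "\<eta> \<in> rays \<Longrightarrow> req (\<lambda>n. \<eta> (m + n)) \<eta>"
  unfolding req_def by (rule exI[of _ m]) (metis add_diff_cancel_right' d_commute le_add2 order_refl ray_carrier ray_d)

lemma boundary_iff:
  "x \<in> gromov_boundary G S \<longleftrightarrow> (\<exists>\<eta>\<in>rays. x = {\<zeta> \<in> rays. req \<eta> \<zeta>})"
  unfolding gromov_boundary_def quotient_def req_def by (auto simp: Image_def)

lemma gp_le: "w \<in> carrier G \<Longrightarrow> x \<in> carrier G \<Longrightarrow> y \<in> carrier G \<Longrightarrow> gp w x y \<le> d w x"
  "w \<in> carrier G \<Longrightarrow> x \<in> carrier G \<Longrightarrow> y \<in> carrier G \<Longrightarrow> gp w x y \<le> d w y"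
  using d_triangle[of w x y] d_triangle[of w y x] d_commute[of x y] by (auto simp: gromov_product_def)

lemma gp_commute: "x \<in> carrier G \<Longrightarrow> y \<in> carrier G \<Longrightarrow> gp w x y = gp w y x"
  by (simp add: gromov_product_def d_commute)

lemma gp_nonneg: "w \<in> carrier G \<Longrightarrow> x \<in> carrier G \<Longrightarrow> y \<in> carrier G \<Longrightarrow> 0 \<le> gp w x y"
  using d_triangle[of x w y] d_commute[of x w] by (auto simp: gromov_product_def)

lemma gp_ray: "\<eta> \<in> rays \<Longrightarrow> gp (\<eta> 0) (\<eta> i) (\<eta> j) = min i j"
  using ray_d[of \<eta> i j] ray_d[of \<eta> j i] d_commute[of "\<eta> i" "\<eta> j"]
  by (cases "i \<le> j") (auto simp: gromov_product_def ray_d0 ray_carrier)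

lemma gp_base:
  assumes "w \<in> carrier G" "p \<in> carrier G" "x \<in> carrier G" "y \<in> carrier G"
  shows "gp p x y - d w p \<le> gp w x y"
proof -
  have "real (d p x) \<le> d w p + real (d w x)" "real (d p y) \<le> d w p + real (d w y)"
    using d_triangle[of p w x] d_triangle[of p w y] d_commute[of w p] assms by auto
  then show ?thesis unfolding gromov_product_def by (simp add: field_simps)
qed

lemma gp_mono:
  assumes "\<alpha> \<in> rays" "y \<in> carrier G" "i \<le> i'"
  shows "gp (\<alpha> 0) (\<alpha> i) y \<le> gp (\<alpha> 0) (\<alpha> i') y"
  using d_triangle[of "\<alpha> i'" "\<alpha> i" y] ray_d[OF assms(1,3)] d_commute[of "\<alpha> i" "\<alpha> i'"] ray_carrier[OF assms(1)] assms
  by (auto simp: gromov_product_def ray_d0)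

text \<open>The four-point condition is used twice along the chain \<open>\<eta> n\<close>,
  \<open>\<eta> i\<close>, \<open>\<zeta> j\<close>, \<open>\<zeta> n\<close>. The outer products
  are about \<open>n\<close> because they are taken along a ray, the middle one is large by choice.
  So the product of \<open>\<eta> n\<close> and \<open>\<zeta> n\<close> is \<open>n\<close> up to a
  constant, which bounds their distance.\<close>

lemma req_of_gp_unbounded:
  assumes \<eta>: "\<eta> \<in> rays" and \<zeta>: "\<zeta> \<in> rays" and w: "w \<in> carrier G"
    and unb: "\<And>N :: real. \<exists>i j. gp w (\<eta> i) (\<zeta> j) \<ge> N"
  shows "req \<eta> \<zeta>"
proof -
  define D where "D = real (d w (\<eta> 0))"
  define D' where "D' = real (d w (\<zeta> 0))"
  note c = ray_carrier[OF \<eta>] ray_carrier[OF \<zeta>]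
  have b: "real (d w (\<eta> n)) \<le> D + n" "real (d w (\<zeta> n)) \<le> D' + n" for n
    using d_triangle[OF w c(1)[of 0] c(1)[of n]] d_triangle[OF w c(2)[of 0] c(2)[of n]] ray_d0[OF \<eta>] ray_d0[OF \<zeta>]
    by (auto simp: D_def D'_def)
  have "real (d (\<eta> n) (\<zeta> n)) \<le> 3 * D + 3 * D' + 4 * \<delta>" for n
  proof -
    obtain i j where ij: "gp w (\<eta> i) (\<zeta> j) \<ge> n + D + D'" using unb by blast
    have D0: "D \<ge> 0" "D' \<ge> 0" by (auto simp: D_def D'_def)
    have "n \<le> i" "n \<le> j" using ij gp_le[OF w c(1)[of i] c(2)[of j]] b(1)[of i] b(2)[of j] D0 by auto
    then have g1: "gp w (\<eta> n) (\<eta> i) \<ge> n - D" and g3: "gp w (\<zeta> j) (\<zeta> n) \<ge> n - D'"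
      using gp_base[OF w c(1) c(1) c(1), of 0 n i] gp_base[OF w c(2) c(2) c(2), of 0 j n] gp_ray[OF \<eta>] gp_ray[OF \<zeta>]
      by (auto simp: D_def D'_def)
    have "min (gp w (\<eta> n) (\<eta> i)) (gp w (\<eta> i) (\<zeta> j)) - \<delta> \<le> gp w (\<eta> n) (\<zeta> j)" by (rule four_point) (simp_all add: c w)
    moreover have "min (gp w (\<eta> n) (\<zeta> j)) (gp w (\<zeta> j) (\<zeta> n)) - \<delta> \<le> gp w (\<eta> n) (\<zeta> n)" by (rule four_point) (simp_all add: c w)
    ultimately have "gp w (\<eta> n) (\<zeta> n) \<ge> n - D - D' - 2 * \<delta>" using g1 g3 ij D0 \<delta> by linarith
    then show ?thesis using b[of n] by (simp add: gromov_product_def)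
  qed
  then have "d (\<eta> n) (\<zeta> n) \<le> nat \<lceil>3 * D + 3 * D' + 4 * \<delta>\<rceil>" for n
    using real_nat_ceiling_ge[of "3 * D + 3 * D' + 4 * \<delta>"] by (meson of_nat_le_iff order_trans)
  then show ?thesis unfolding req_def by blast
qed

lemma gp_unbounded_of_req:
  assumes \<eta>: "\<eta> \<in> rays" and \<zeta>: "\<zeta> \<in> rays" and w: "w \<in> carrier G" and r: "req \<eta> \<zeta>"
  shows "\<exists>n0. \<forall>i\<ge>n0. \<forall>j\<ge>n0. gp w (\<eta> i) (\<zeta> j) \<ge> N"
proof -
  obtain K where K: "\<And>n. d (\<eta> n) (\<zeta> n) \<le> K" using r by (auto simp: req_def)
  define D where "D = real (d w (\<eta> 0))"
  note c = ray_carrier[OF \<eta>] ray_carrier[OF \<zeta>]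
  have "gp w (\<eta> i) (\<zeta> j) \<ge> N" if ij: "i \<ge> nat \<lceil>N + D + K\<rceil>" "j \<ge> nat \<lceil>N + D + K\<rceil>" for i j
  proof -
    define n where "n = min i j"
    have "real n \<ge> N + D + K" using ij by (auto simp: n_def min_def)
    moreover have "d w (\<eta> i) + D \<ge> i"
      using d_triangle[OF c(1)[of 0] w c(1)[of i]] ray_d0[OF \<eta>] d_commute[OF w c(1)[of 0]] by (auto simp: D_def)
    moreover have "d w (\<zeta> j) + D + K \<ge> j"
    proof -
      have "d (\<zeta> 0) (\<zeta> j) \<le> d (\<zeta> 0) (\<eta> 0) + (d (\<eta> 0) w + d w (\<zeta> j))"
        using d_triangle[OF c(2)[of 0] c(1)[of 0] c(2)[of j]] d_triangle[OF c(1)[of 0] w c(2)[of j]] by linarith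
      then show ?thesis using ray_d0[OF \<zeta>] K[of 0] d_commute[OF w c(1)[of 0]] d_commute[OF c(2)[of 0] c(1)[of 0]]
        by (auto simp: D_def)
    qed
    moreover have "d (\<eta> i) (\<zeta> j) \<le> (i - n) + K + (j - n)"
    proof -
      have "d (\<eta> i) (\<zeta> j) \<le> d (\<eta> i) (\<eta> n) + (d (\<eta> n) (\<zeta> n) + d (\<zeta> n) (\<zeta> j))"
        using d_triangle[OF c(1)[of i] c(1)[of n] c(2)[of j]] d_triangle[OF c(1)[of n] c(2)[of n] c(2)[of j]] by linarith
      moreover have "d (\<eta> i) (\<eta> n) = i - n" using ray_d[OF \<eta>, of n i] d_commute[OF c(1) c(1)] by (simp add: n_def)
      moreover have "d (\<zeta> n) (\<zeta> j) = j - n" using ray_d[OF \<zeta>, of n j] by (simp add: n_def)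
      ultimately show ?thesis using K[of n] by linarith
    qed
    moreover have "n \<le> i" "n \<le> j" by (auto simp: n_def)
    ultimately show ?thesis by (simp add: gromov_product_def of_nat_diff)
  qed
  then show ?thesis by blast
qed

text \<open>Geodesic segments from \<open>h\<close> to the points \<open>\<zeta> j\<close>
  subconverge to a ray. Its points lie on geodesics from \<open>h\<close> to points far out on
  \<zeta>, so the Gromov products of the two rays are unbounded.\<close>

lemma ray_from:
  assumes \<zeta>: "\<zeta> \<in> rays" and h: "h \<in> carrier G"
  shows "\<exists>\<zeta>'\<in>rays. \<zeta>' 0 = h \<and> req \<zeta>' \<zeta>"
proof -
  note c = ray_carrier[OF \<zeta>]
  have "\<forall>j. \<exists>\<sigma>. \<sigma> 0 = h \<and> \<sigma> (d h (\<zeta> j)) = \<zeta> j \<and> (\<forall>i. \<sigma> i \<in> carrier G) \<and>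
    (\<forall>i i'. i \<le> i' \<and> i' \<le> d h (\<zeta> j) \<longrightarrow> d (\<sigma> i) (\<sigma> i') = i' - i)"
    using geodesic_exists[OF h c] by blast
  then obtain \<sigma> where \<sigma>: "\<And>j. \<sigma> j 0 = h" "\<And>j. \<sigma> j (d h (\<zeta> j)) = \<zeta> j" "\<And>j i. \<sigma> j i \<in> carrier G"
    "\<And>j i i'. i \<le> i' \<Longrightarrow> i' \<le> d h (\<zeta> j) \<Longrightarrow> d (\<sigma> j i) (\<sigma> j i') = i' - i" by metis
  \<comment> \<open>Each segment is frozen at its endpoint, which makes it a function on all
    naturals with values in finite balls.\<close>
  define X where "X j i = \<sigma> j (min i (d h (\<zeta> j)))" for j i
  have "finite (range (\<lambda>j. X j i))" for i
  proof (rule finite_subset[OF _ finite_d_ball[OF h, of i]])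
    show "range (\<lambda>j. X j i) \<subseteq> {y \<in> carrier G. d h y \<le> i}"
      using \<sigma>(3) \<sigma>(4)[of 0 "min i (d h (\<zeta> j))" j for j] \<sigma>(1) by (auto simp: X_def)
  qed
  then obtain l s where s: "strict_mono (s :: nat \<Rightarrow> nat)" and l: "\<And>i. \<exists>n0. \<forall>n\<ge>n0. X (s n) i = l i"
    using pointwise_convergent_subseq by blast
  have good: "\<exists>j\<ge>J. X j m = l m \<and> X j n = l n \<and> m \<le> d h (\<zeta> j) \<and> n \<le> d h (\<zeta> j)" for m n J
  proof -
    obtain n1 n2 where n1: "\<And>i. i \<ge> n1 \<Longrightarrow> X (s i) m = l m" and n2: "\<And>i. i \<ge> n2 \<Longrightarrow> X (s i) n = l n" using l by meson
    define i where "i = n1 + n2 + m + n + d h (\<zeta> 0) + J"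
    have "s i \<ge> i" by (rule seq_suble[OF s])
    moreover have "s i \<le> d h (\<zeta> 0) + d h (\<zeta> (s i))"
      using d_triangle[OF c[of 0] h c[of "s i"]] ray_d0[OF \<zeta>] d_commute[OF c[of 0] h] by simp
    ultimately show ?thesis using n1[of i] n2[of i] by (intro exI[of _ "s i"]) (auto simp: i_def)
  qed
  have lr: "l \<in> rays" unfolding geodesic_rays_def
  proof (intro CollectI conjI allI impI)
    fix n show "l n \<in> carrier G" using good[of 0 n n] \<sigma>(3) by (metis X_def)
  next
    fix m n :: nat assume mn: "m \<le> n"
    obtain j where "X j m = l m" "X j n = l n" "m \<le> d h (\<zeta> j)" "n \<le> d h (\<zeta> j)" using good by blast
    then show "d (l m) (l n) = n - m" using \<sigma>(4)[OF mn, of j] by (simp add: X_def min_def split: if_splits)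
  qed
  have l0: "l 0 = h" using good[of 0 0 0] \<sigma>(1) by (auto simp: X_def)
  have "req l \<zeta>"
  proof (rule req_of_gp_unbounded[OF lr \<zeta> h])
    fix N :: real
    define n where "n = nat \<lceil>N\<rceil>"
    obtain j where j: "X j n = l n" "n \<le> d h (\<zeta> j)" using good by blast
    have "l n = \<sigma> j n" using j by (simp add: X_def min_def split: if_splits)
    then have "d h (l n) = n" "d (l n) (\<zeta> j) = d h (\<zeta> j) - n"
      using \<sigma>(4)[of 0 n j] \<sigma>(4)[of n "d h (\<zeta> j)" j] \<sigma>(1,2) j(2) by auto
    then have "gp h (l n) (\<zeta> j) = n" using j(2) by (simp add: gromov_product_def)
    then show "\<exists>i j. gp h (l i) (\<zeta> j) \<ge> N" by (rule_tac exI[of _ n], rule_tac exI[of _ j]) (use real_nat_ceiling_ge[of N] in \<open>simp add: n_def\<close>)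
  qed
  then show ?thesis using lr l0 by blast
qed

text \<open>Quantitative inequivalence: seen from its start, \<alpha> parts from \<beta> within the
  distance \<open>C\<close>. In contrast to inequivalence itself, this condition is preserved by
  pointwise limits of rays with a common starting point, which the compactness arguments
  exploit.\<close>

definition sep :: "real \<Rightarrow> (nat \<Rightarrow> 'a) \<Rightarrow> (nat \<Rightarrow> 'a) \<Rightarrow> bool" where
  "sep C \<alpha> \<beta> \<longleftrightarrow> (\<forall>i j. gp (\<alpha> 0) (\<alpha> i) (\<beta> j) \<le> C)"

lemma sep_not_req: "\<alpha> \<in> rays \<Longrightarrow> \<beta> \<in> rays \<Longrightarrow> sep C \<alpha> \<beta> \<Longrightarrow> \<not> req \<alpha> \<beta>"
proof
  assume a: "\<alpha> \<in> rays" and "\<beta> \<in> rays" and s: "sep C \<alpha> \<beta>" and "req \<alpha> \<beta>"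
  then obtain n0 where "\<And>i j. i \<ge> n0 \<Longrightarrow> j \<ge> n0 \<Longrightarrow> gp (\<alpha> 0) (\<alpha> i) (\<beta> j) \<ge> C + 1"
    using gp_unbounded_of_req[of \<alpha> \<beta> "\<alpha> 0" "C + 1"] ray_carrier[OF a] by blast
  from this[of n0 n0] s show False unfolding sep_def by (smt (verit) order_refl)
qed

lemma sep_of_not_req:
  assumes "\<alpha> \<in> rays" "\<beta> \<in> rays" "\<not> req \<alpha> \<beta>"
  shows "\<exists>n::nat. sep n \<alpha> \<beta>"
proof -
  have "\<not> (\<forall>N :: real. \<exists>i j. gp (\<alpha> 0) (\<alpha> i) (\<beta> j) \<ge> N)"
    using req_of_gp_unbounded[OF assms(1,2) ray_carrier[OF assms(1)], of 0] assms(3) by blast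
  then obtain N :: real where N: "\<And>i j. gp (\<alpha> 0) (\<alpha> i) (\<beta> j) < N" using not_le by blast
  obtain n :: nat where n: "N \<le> n" using real_arch_simple by blast
  have "gp (\<alpha> 0) (\<alpha> i) (\<beta> j) \<le> n" for i j using N[of i j] n by linarith
  then show ?thesis unfolding sep_def by blast
qed

text \<open>Far out, the products of \<alpha> with \<alpha>' and of \<beta> with \<beta>' exceed
  \<open>C + 2 * \<delta>\<close>. Two applications of the four-point condition therefore carry the
  bound over at the price of \<delta> each. Products along rays from the base point increase, so the
  bound far out holds everywhere.\<close>

lemma sep_transfer:
  assumes \<alpha>: "\<alpha> \<in> rays" and \<beta>: "\<beta> \<in> rays" and ab: "\<alpha> 0 = \<beta> 0" and \<alpha>': "\<alpha>' \<in> rays" and \<beta>': "\<beta>' \<in> rays"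
    and r: "req \<alpha> \<alpha>'" "req \<beta> \<beta>'" and C: "\<And>i j. i \<ge> n0 \<Longrightarrow> j \<ge> n0 \<Longrightarrow> gp (\<alpha> 0) (\<alpha>' i) (\<beta>' j) \<le> C"
  shows "sep (C + 2 * \<delta>) \<alpha> \<beta>"
  unfolding sep_def
proof (intro allI)
  fix i j
  let ?w = "\<alpha> 0"
  note c = ray_carrier[OF \<alpha>] ray_carrier[OF \<beta>] ray_carrier[OF \<alpha>'] ray_carrier[OF \<beta>']
  obtain n1 where n1: "\<And>i j. i \<ge> n1 \<Longrightarrow> j \<ge> n1 \<Longrightarrow> gp ?w (\<alpha> i) (\<alpha>' j) \<ge> C + 2 * \<delta> + 1"
    using gp_unbounded_of_req[OF \<alpha> \<alpha>' c(1) r(1)] by blast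
  obtain n2 where n2: "\<And>i j. i \<ge> n2 \<Longrightarrow> j \<ge> n2 \<Longrightarrow> gp ?w (\<beta> i) (\<beta>' j) \<ge> C + 2 * \<delta> + 1"
    using gp_unbounded_of_req[OF \<beta> \<beta>' c(1) r(2)] by blast
  define n where "n = n0 + n1 + n2 + i + j"
  have "gp ?w (\<alpha>' n) (\<alpha> n) \<ge> C + 2 * \<delta> + 1" using n1[of n n] gp_commute[OF c(1) c(3)] by (simp add: n_def)
  moreover have "gp ?w (\<beta> n) (\<beta>' n) \<ge> C + 2 * \<delta> + 1" using n2[of n n] by (simp add: n_def)
  moreover have "gp ?w (\<alpha>' n) (\<beta>' n) \<le> C" using C[of n n] by (simp add: n_def)
  moreover have "min (gp ?w (\<alpha>' n) (\<alpha> n)) (gp ?w (\<alpha> n) (\<beta> n)) - \<delta> \<le> gp ?w (\<alpha>' n) (\<beta> n)" by (rule four_point) (simp_all add: c)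
  moreover have "min (gp ?w (\<alpha>' n) (\<beta> n)) (gp ?w (\<beta> n) (\<beta>' n)) - \<delta> \<le> gp ?w (\<alpha>' n) (\<beta>' n)" by (rule four_point) (simp_all add: c)
  ultimately have "gp ?w (\<alpha> n) (\<beta> n) \<le> C + 2 * \<delta>" using \<delta> by linarith
  moreover have "gp ?w (\<alpha> i) (\<beta> j) \<le> gp ?w (\<alpha> n) (\<beta> j)" by (rule gp_mono[OF \<alpha> c(2)]) (simp add: n_def)
  moreover have "gp ?w (\<alpha> n) (\<beta> j) \<le> gp ?w (\<alpha> n) (\<beta> n)"
    using gp_mono[OF \<beta> c(1), of j n n] gp_commute[OF c(1) c(2)] ab by (simp add: n_def)
  ultimately show "gp ?w (\<alpha> i) (\<beta> j) \<le> C + 2 * \<delta>" by linarith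
qed

text \<open>Quasi-centre of an ideal triangle: \<open>\<eta>\<close> and \<open>\<eta>'\<close> fellow-travel up to the time \<open>m\<close>, the
  integral part of their Gromov product.\<close>

lemma centre:
  assumes \<eta>: "\<eta> \<in> rays" and \<eta>': "\<eta>' \<in> rays" and \<zeta>: "\<zeta> \<in> rays"
    and base: "\<eta>' 0 = \<eta> 0" "\<zeta> 0 = \<eta> 0" and k: "sep k \<eta> \<zeta>" "sep k \<eta>' \<zeta>" and nr: "\<not> req \<eta> \<eta>'"
  shows "\<exists>m. \<exists>\<alpha>\<in>rays. \<exists>\<beta>\<in>rays. \<exists>\<theta>\<in>rays. \<alpha> 0 = \<one> \<and> \<beta> 0 = \<one> \<and> \<theta> 0 = \<one> \<and>
    req (\<lambda>n. \<eta> m \<otimes> \<alpha> n) \<eta> \<and> req (\<lambda>n. \<eta> m \<otimes> \<beta> n) \<eta>' \<and> req (\<lambda>n. \<eta> m \<otimes> \<theta> n) \<zeta> \<and>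
    sep (k + 4 * \<delta> + 1) \<alpha> \<beta> \<and> sep (k + 4 * \<delta> + 1) \<alpha> \<theta> \<and> sep (k + 4 * \<delta> + 1) \<beta> \<theta>"
proof -
  let ?h = "\<eta> 0"
  note c = ray_carrier[OF \<eta>] ray_carrier[OF \<eta>'] ray_carrier[OF \<zeta>]
  obtain N where N: "sep (real N) \<eta> \<eta>'" using sep_of_not_req[OF \<eta> \<eta>' nr] by blast
  have k0: "0 \<le> k" using k(1) gp_nonneg[OF c(1) c(1) c(3), of 0 0 0] unfolding sep_def by (meson order_trans)
  \<comment> \<open>Inequivalence bounds the products by \<open>N\<close>, so the maximum exists. It
    follows that all products of the two rays are at most \<open>m + 1\<close>.\<close>
  define m where "m = Max {m. m \<le> N \<and> (\<exists>i j. real m \<le> gp ?h (\<eta> i) (\<eta>' j))}"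
  have fin: "finite {m. m \<le> N \<and> (\<exists>i j. real m \<le> gp ?h (\<eta> i) (\<eta>' j))}" by simp
  have "0 \<in> {m. m \<le> N \<and> (\<exists>i j. real m \<le> gp ?h (\<eta> i) (\<eta>' j))}" using gp_nonneg[OF c(1) c(1) c(2)] by auto
  then have "m \<in> {m. m \<le> N \<and> (\<exists>i j. real m \<le> gp ?h (\<eta> i) (\<eta>' j))}" unfolding m_def using Max_in[OF fin] by blast
  then obtain i0 j0 where m0: "real m \<le> gp ?h (\<eta> i0) (\<eta>' j0)" by blast
  have up: "gp ?h (\<eta> i) (\<eta>' j) \<le> m + 1" for i j
  proof (rule ccontr)
    assume a: "\<not> gp ?h (\<eta> i) (\<eta>' j) \<le> m + 1"
    moreover have "gp ?h (\<eta> i) (\<eta>' j) \<le> N" using N by (simp add: sep_def)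
    ultimately have "real (Suc m) \<le> gp ?h (\<eta> i) (\<eta>' j)" "Suc m \<le> N" by auto
    then have "Suc m \<in> {m. m \<le> N \<and> (\<exists>i j. real m \<le> gp ?h (\<eta> i) (\<eta>' j))}" by blast
    then have "Suc m \<le> m" unfolding m_def by (rule Max_ge[OF fin])
    then show False by simp
  qed
  define g where "g = \<eta> m"
  have gc: "g \<in> carrier G" using c by (simp add: g_def)
  have lo: "gp ?h g (\<eta>' j) \<ge> m - 2 * \<delta>" if "j \<ge> m" for j
  proof -
    have "m \<le> i0" using m0 gp_le(1)[OF c(1) c(1) c(2), of 0 i0 j0] ray_d0[OF \<eta>, of i0] by simp
    then have "gp ?h g (\<eta> i0) \<ge> m" using gp_ray[OF \<eta>, of m i0] by (simp add: g_def)
    moreover have "m \<le> j0" using m0 gp_le(2)[OF c(1) c(1) c(2), of 0 i0 j0] ray_d0[OF \<eta>', of j0] base by simp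
    then have "gp ?h (\<eta>' j0) (\<eta>' j) \<ge> m" using gp_ray[OF \<eta>', of j0 j] base that by simp
    moreover have "min (gp ?h g (\<eta> i0)) (gp ?h (\<eta> i0) (\<eta>' j0)) - \<delta> \<le> gp ?h g (\<eta>' j0)" by (rule four_point) (simp_all add: c gc)
    moreover have "min (gp ?h g (\<eta>' j0)) (gp ?h (\<eta>' j0) (\<eta>' j)) - \<delta> \<le> gp ?h g (\<eta>' j)" by (rule four_point) (simp_all add: c gc)
    ultimately show ?thesis using m0 \<delta> by linarith
  qed
  have dg: "d ?h g = m" by (simp add: g_def ray_d0[OF \<eta>])
  \<comment> \<open>As \<open>g\<close> lies on \<eta>, moving the base point from the start to
    \<open>g\<close> lowers products with later points of \<eta> by exactly the product of
    \<open>g\<close> with \<open>y\<close>.\<close>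
  have change: "gp g (\<eta> (m + i)) y = gp ?h (\<eta> (m + i)) y - gp ?h g y" if "y \<in> carrier G" for i y
    using ray_d[OF \<eta>, of m "m + i"] ray_d0[OF \<eta>, of "m + i"] dg by (simp add: gromov_product_def g_def field_simps)
  define \<alpha>' where "\<alpha>' = (\<lambda>i. \<eta> (m + i))"
  have \<alpha>': "\<alpha>' \<in> rays" "req \<alpha>' \<eta>" "\<alpha>' 0 = g" using ray_shift[OF \<eta>] req_shift[OF \<eta>] by (auto simp: \<alpha>'_def g_def)
  obtain \<beta>' where \<beta>': "\<beta>' \<in> rays" "\<beta>' 0 = g" "req \<beta>' \<eta>'" using ray_from[OF \<eta>' gc] by blast
  obtain \<theta>' where \<theta>': "\<theta>' \<in> rays" "\<theta>' 0 = g" "req \<theta>' \<zeta>" using ray_from[OF \<zeta> gc] by blast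
  \<comment> \<open>The product with \<eta>' is at most \<open>m + 1\<close> from the start and
    drops by at least \<open>m - 2 * \<delta>\<close>; this gives the term
    \<open>2 * \<delta> + 1\<close>. A further \<open>2 * \<delta>\<close> comes from replacing
    \<eta>' by the equivalent ray that starts at \<open>g\<close>. The other two pairs are brought
    to the same constant.\<close>
  have ab: "sep ((k + 2 * \<delta> + 1) + 2 * \<delta>) \<alpha>' \<beta>'"
  proof (rule sep_transfer[OF \<alpha>'(1) \<beta>'(1) _ \<alpha>'(1) \<eta>' req_refl[OF \<alpha>'(1)] \<beta>'(3), of m])
    fix i j assume "m \<le> j"
    then show "gp (\<alpha>' 0) (\<alpha>' i) (\<eta>' j) \<le> k + 2 * \<delta> + 1"
      using change[OF c(2)[of j], of i] up[of "m + i" j] lo[of j] k0 by (simp add: \<alpha>'_def g_def)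
  qed (use \<alpha>' \<beta>' in simp)
  have at: "sep ((k + 2 * \<delta> + 1) + 2 * \<delta>) \<alpha>' \<theta>'"
  proof (rule sep_transfer[OF \<alpha>'(1) \<theta>'(1) _ \<alpha>'(1) \<zeta> req_refl[OF \<alpha>'(1)] \<theta>'(3), of 0])
    fix i j
    have "gp ?h (\<eta> (m + i)) (\<zeta> j) \<le> k" using k(1) by (simp add: sep_def)
    then show "gp (\<alpha>' 0) (\<alpha>' i) (\<zeta> j) \<le> k + 2 * \<delta> + 1"
      using change[OF c(3)[of j], of i] gp_nonneg[OF c(1) gc c(3), of 0 j] \<delta> by (simp add: \<alpha>'_def g_def)
  qed (use \<alpha>' \<theta>' in simp)
  have bt: "sep ((k + 2 * \<delta> + 1) + 2 * \<delta>) \<beta>' \<theta>'"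
  proof (rule sep_transfer[OF \<beta>'(1) \<theta>'(1) _ \<eta>' \<zeta> \<beta>'(3) \<theta>'(3), of m])
    fix i j assume i: "m \<le> i"
    have "gp ?h (\<eta>' i) (\<zeta> j) \<le> k" using k(2) base by (simp add: sep_def)
    moreover have "real (d g (\<eta>' i)) - d ?h (\<eta>' i) \<le> - real m + 4 * \<delta>"
      using lo[OF i] dg by (simp add: gromov_product_def)
    moreover have "d g (\<zeta> j) \<le> m + d ?h (\<zeta> j)"
      using d_triangle[OF gc c(1)[of 0] c(3)[of j]] d_commute[OF gc c(1)[of 0]] dg by simp
    ultimately show "gp (\<beta>' 0) (\<eta>' i) (\<zeta> j) \<le> k + 2 * \<delta> + 1"
      by (simp add: gromov_product_def \<beta>'(2))
  qed (use \<theta>' \<beta>' in simp)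
  have ig: "inv g \<in> carrier G" using gc by simp
  have can: "g \<otimes> (inv g \<otimes> x) = x" if "x \<in> carrier G" for x using gc that by (simp flip: m_assoc)
  have sep': "sep C (\<lambda>n. inv g \<otimes> a n) (\<lambda>n. inv g \<otimes> b n)" if "a \<in> rays" "b \<in> rays" "sep C a b" for a b C
    using that ig by (simp add: sep_def gp_left ray_carrier)
  have one: "inv g \<otimes> a 0 = \<one>" if "a 0 = g" for a :: "nat \<Rightarrow> 'a" using gc that by simp
  have eq: "(\<lambda>n. \<eta> m \<otimes> (inv g \<otimes> a n)) = a" if "a \<in> rays" for a
    using can ray_carrier[OF that] by (simp add: g_def)
  show ?thesis
    using sep'[OF \<alpha>'(1) \<beta>'(1) ab] sep'[OF \<alpha>'(1) \<theta>'(1) at] sep'[OF \<beta>'(1) \<theta>'(1) bt]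
      one[of \<alpha>', OF \<alpha>'(3)] one[of \<beta>', OF \<beta>'(2)] one[of \<theta>', OF \<theta>'(2)] eq[OF \<alpha>'(1)] eq[OF \<beta>'(1)] eq[OF \<theta>'(1)] \<alpha>'(2) \<beta>'(3) \<theta>'(3)
      ray_left[OF ig \<alpha>'(1)] ray_left[OF ig \<beta>'(1)] ray_left[OF ig \<theta>'(1)]
    by (intro exI[of _ m] bexI[of _ "\<lambda>n. inv g \<otimes> \<alpha>' n"] bexI[of _ "\<lambda>n. inv g \<otimes> \<beta>' n"] bexI[of _ "\<lambda>n. inv g \<otimes> \<theta>' n"])
      (simp_all add: algebra_simps)
qed

end

section \<open>Top minors of products\<close>

text \<open>Multilinearity in the rows, a form of Cauchy-Binet in which all index functions are kept
  instead of the increasing ones; those with a repetition contribute a vanishing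
  determinant.\<close>

lemma det_sum_rows:
  fixes f :: "nat \<Rightarrow> nat \<Rightarrow> 'a::comm_ring_1"
  shows "det (Matrix.mat r r (\<lambda>(i, j). \<Sum>t<d. c i t * f t j))
    = (\<Sum>t\<in>PiE {..<r} (\<lambda>_. {..<d}). (\<Prod>i<r. c i (t i)) * det (Matrix.mat r r (\<lambda>(i, j). f (t i) j)))"
proof -
  have ent: "(\<Prod>i<r. Matrix.mat r r (\<lambda>(i, j). g i j) $$ (i, p i)) = (\<Prod>i<r. g i (p i))"
    if "p permutes {0..<r}" for p and g :: "nat \<Rightarrow> nat \<Rightarrow> 'a"
    using permutes_in_image[OF that] by (intro prod.cong) auto
  have det: "det (Matrix.mat r r (\<lambda>(i, j). g i j)) = (\<Sum>p | p permutes {0..<r}. signof p * (\<Prod>i<r. g i (p i)))"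
    for g :: "nat \<Rightarrow> nat \<Rightarrow> 'a"
    unfolding det_def'[OF mat_carrier] atLeast0LessThan[of r, symmetric]
    by (intro sum.cong refl arg_cong2[of _ _ _ _ "(*)"]) (simp add: ent[unfolded atLeast0LessThan[symmetric]])
  have "det (Matrix.mat r r (\<lambda>(i, j). \<Sum>t<d. c i t * f t j))
      = (\<Sum>p | p permutes {0..<r}. signof p * (\<Prod>i<r. \<Sum>t<d. c i t * f t (p i)))"
    by (rule det)
  also have "\<dots> = (\<Sum>p | p permutes {0..<r}. signof p * (\<Sum>t\<in>PiE {..<r} (\<lambda>_. {..<d}). \<Prod>i<r. c i (t i) * f (t i) (p i)))"
    by (intro sum.cong refl arg_cong2[of _ _ _ _ "(*)"] prod_sum_PiE) auto
  also have "\<dots> = (\<Sum>p | p permutes {0..<r}. \<Sum>t\<in>PiE {..<r} (\<lambda>_. {..<d}).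
      (\<Prod>i<r. c i (t i)) * (signof p * (\<Prod>i<r. f (t i) (p i))))"
    by (simp only: sum_distrib_left prod.distrib mult.left_commute)
  also have "\<dots> = (\<Sum>t\<in>PiE {..<r} (\<lambda>_. {..<d}). \<Sum>p | p permutes {0..<r}. (\<Prod>i<r. c i (t i)) * (signof p * (\<Prod>i<r. f (t i) (p i))))"
    by (rule sum.swap)
  also have "\<dots> = (\<Sum>t\<in>PiE {..<r} (\<lambda>_. {..<d}). (\<Prod>i<r. c i (t i)) * det (Matrix.mat r r (\<lambda>(i, j). f (t i) j)))"
    by (simp only: sum_distrib_left[symmetric] det)
  finally show ?thesis .
qed

lemma det_sum_cols:
  fixes f :: "nat \<Rightarrow> nat \<Rightarrow> 'a::comm_ring_1"
  shows "det (Matrix.mat r r (\<lambda>(i, j). \<Sum>t<d. f i t * c j t))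
    = (\<Sum>t\<in>PiE {..<r} (\<lambda>_. {..<d}). (\<Prod>j<r. c j (t j)) * det (Matrix.mat r r (\<lambda>(i, j). f i (t j))))"
proof -
  have tr: "det (Matrix.mat r r (\<lambda>(i, j). g j i)) = det (Matrix.mat r r (\<lambda>(i, j). g i j))" for g :: "nat \<Rightarrow> nat \<Rightarrow> 'a"
  proof -
    have "Matrix.mat r r (\<lambda>(i, j). g j i) = transpose_mat (Matrix.mat r r (\<lambda>(i, j). g i j))" by (rule eq_matI) auto
    then show ?thesis using det_transpose[of "Matrix.mat r r (\<lambda>(i, j). g i j)" r] by simp
  qed
  have "det (Matrix.mat r r (\<lambda>(i, j). \<Sum>t<d. f i t * c j t)) = det (Matrix.mat r r (\<lambda>(j, i). \<Sum>t<d. c j t * f i t))"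
    using tr[of "\<lambda>j i. \<Sum>t<d. c j t * f i t"] by (simp only: mult.commute)
  also have "\<dots> = (\<Sum>t\<in>PiE {..<r} (\<lambda>_. {..<d}). (\<Prod>j<r. c j (t j)) * det (Matrix.mat r r (\<lambda>(j, i). f i (t j))))"
    by (rule det_sum_rows)
  also have "\<dots> = (\<Sum>t\<in>PiE {..<r} (\<lambda>_. {..<d}). (\<Prod>j<r. c j (t j)) * det (Matrix.mat r r (\<lambda>(i, j). f i (t j))))"
    by (intro sum.cong refl arg_cong2[of _ _ _ _ "(*)"] tr[symmetric])
  finally show ?thesis .
qed

text \<open>An index set of size \<open>r\<close> that misses \<open>q\<close> of the first
  \<open>r\<close> indices contains \<open>q\<close> later ones instead. Each exchange replaces a
  factor at least \<open>b\<close> by one at most \<open>\<tau> * b\<close>, so the product loses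
  \<tau> to the power \<open>q\<close>.\<close>

lemma prod_inj_le:
  fixes a :: "nat \<Rightarrow> real"
  assumes s: "inj_on s {..<r}" "s ` {..<r} \<subseteq> {..<n}"
    and a: "\<And>i. i < r \<Longrightarrow> b \<le> a i" "\<And>i. r \<le> i \<Longrightarrow> i < n \<Longrightarrow> 0 \<le> a i \<and> a i \<le> \<tau> * b" and b: "0 \<le> b" and t: "0 \<le> \<tau>" "\<tau> \<le> 1"
  shows "(\<Prod>i<r. a (s i)) \<le> (if s ` {..<r} \<subseteq> {..<r} then 1 else \<tau>) * (\<Prod>i<r. a i)"
proof -
  let ?I = "s ` {..<r}" and ?T = "{..<r}"
  define q where "q = card (?I - ?T)"
  have cI: "card ?I = card ?T" using card_image[OF s(1)] by simp
  have q': "q = card (?T - ?I)"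
    using card_Diff_subset_Int[of ?I ?T] card_Diff_subset_Int[of ?T ?I] cI by (simp add: q_def Int_commute)
  have "(\<Prod>i<r. a (s i)) = prod a ?I" using prod.reindex[OF s(1), of a] by (simp add: o_def)
  also have "\<dots> = prod a (?I \<inter> ?T) * prod a (?I - ?T)" using prod.Int_Diff[of ?I a ?T] by simp
  also have "\<dots> \<le> prod a (?I \<inter> ?T) * ((\<tau> * b) ^ q)"
  proof (rule mult_left_mono)
    have "prod a (?I - ?T) \<le> (\<Prod>i\<in>?I - ?T. \<tau> * b)" using a(2) s(2) by (intro prod_mono) auto
    then show "prod a (?I - ?T) \<le> (\<tau> * b) ^ q" by (simp add: q_def)
    show "0 \<le> prod a (?I \<inter> ?T)" using a(1) b by (intro prod_nonneg) (auto intro: order_trans)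
  qed
  also have "\<dots> = \<tau> ^ q * (prod a (?I \<inter> ?T) * b ^ q)" by (simp add: power_mult_distrib)
  also have "\<dots> \<le> \<tau> ^ q * (prod a (?T \<inter> ?I) * prod a (?T - ?I))"
  proof (intro mult_left_mono)
    have "(\<Prod>i\<in>?T - ?I. b) \<le> prod a (?T - ?I)" using a(1) b by (intro prod_mono) auto
    then show "prod a (?I \<inter> ?T) * b ^ q \<le> prod a (?T \<inter> ?I) * prod a (?T - ?I)"
      using a(1) b by (auto simp: q' Int_commute intro!: mult_left_mono prod_nonneg intro: order_trans)
  qed (use t in simp)
  also have "\<dots> = \<tau> ^ q * prod a ?T" using prod.Int_Diff[of ?T a ?I] by simp
  also have "\<dots> \<le> (if ?I \<subseteq> ?T then 1 else \<tau>) * prod a ?T"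
  proof (rule mult_right_mono)
    show "0 \<le> prod a ?T" using a(1) b by (intro prod_nonneg) (auto intro: order_trans)
    show "\<tau> ^ q \<le> (if ?I \<subseteq> ?T then 1 else \<tau>)"
    proof (cases "?I \<subseteq> ?T")
      case False
      then have "q \<noteq> 0" by (simp add: q_def)
      then have "\<tau> ^ q \<le> \<tau> ^ 1" using t by (intro power_decreasing) auto
      then show ?thesis using False by simp
    qed (use t in \<open>simp add: power_le_one\<close>)
  qed
  finally show ?thesis .
qed

text \<open>The upper left entry of the \<open>r\<close>-th exterior power of \<open>M\<close>. For
  a diagonal matrix it is the product of the first \<open>r\<close> entries, which for singular
  values is the norm of the exterior power.\<close>

definition top_minor :: "nat \<Rightarrow> 'k::field mat \<Rightarrow> 'k" where
  "top_minor r M = det (Matrix.mat r r (\<lambda>(i, j). M $$ (i, j)))"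

lemma top_minor_diag: "r \<le> n \<Longrightarrow> top_minor r (mat_diag n \<alpha>) = (\<Prod>i<r. \<alpha> i)"
proof -
  assume r: "r \<le> n"
  have "det (Matrix.mat r r (\<lambda>(i, j). mat_diag n \<alpha> $$ (i, j))) = prod_list (diag_mat (Matrix.mat r r (\<lambda>(i, j). mat_diag n \<alpha> $$ (i, j))))"
    by (rule det_upper_triangular) (use r in \<open>auto simp: mat_diag_def upper_triangular_def\<close>)
  also have "\<dots> = (\<Prod>i = 0..<r. \<alpha> i)"
    unfolding prod_list_diag_prod using r by (auto simp: mat_diag_def intro!: prod.cong)
  finally show ?thesis by (simp add: top_minor_def atLeast0LessThan)
qed

lemma det_submatrix_permute:
  fixes m :: "nat \<Rightarrow> nat \<Rightarrow> 'k::field"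
  assumes s: "inj_on s {..<r}" "s ` {..<r} \<subseteq> {..<r}"
  shows "\<exists>p. det (Matrix.mat r r (\<lambda>(i, j). m (s i) j)) = signof p * det (Matrix.mat r r (\<lambda>(i, j). m i j))"
proof -
  define p where "p i = (if i < r then s i else i)" for i
  have "bij_betw s {..<r} {..<r}" using s by (simp add: bij_betw_def endo_inj_surj)
  then have "bij_betw p {..<r} {..<r}" by (rule bij_betw_cong[THEN iffD1, rotated]) (simp add: p_def)
  then have p: "p permutes {0..<r}" unfolding atLeast0LessThan by (rule bij_imp_permutes) (simp add: p_def)
  have "Matrix.mat r r (\<lambda>(i, j). m (s i) j) = Matrix.mat r r (\<lambda>(i, j). Matrix.mat r r (\<lambda>(i, j). m i j) $$ (p i, j))"
    using s(2) by (intro eq_matI) (auto simp: p_def image_subset_iff)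
  then show ?thesis using det_permute_rows[OF _ p, of "Matrix.mat r r (\<lambda>(i, j). m i j)"] by auto
qed

context local_abs
begin

lemma av_det_le:
  assumes A: "A \<in> carrier_mat r r" and k: "k < r" and "0 \<le> \<epsilon>"
    and le: "\<And>i j. i < r \<Longrightarrow> j < r \<Longrightarrow> av (A $$ (i, j)) \<le> (if j = k then \<epsilon> else 1)"
  shows "av (det A) \<le> fact r * \<epsilon>"
proof -
  have "av (signof p * (\<Prod>j<r. A $$ (p j, j))) \<le> \<epsilon>" if p: "p permutes {0..<r}" for p
  proof -
    have "p j < r" if "j < r" for j using permutes_in_image[OF p, of j] that by simp
    then have "(\<Prod>j<r. av (A $$ (p j, j))) \<le> (\<Prod>j<r. if j = k then \<epsilon> else 1)"
      using le by (intro prod_mono) auto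
    then show ?thesis using k by (simp add: av_mult av_prod av_sign)
  qed
  then have "av (det A) \<le> (\<Sum>p | p permutes {0..<r}. \<epsilon>)"
    unfolding det_col[OF A] by (intro order_trans[OF av_sum] sum_mono) auto
  also have "\<dots> = fact r * \<epsilon>" using card_permutations[of "{0..<r}" r] by simp
  finally show ?thesis .
qed

lemma av_det_le_fact:
  assumes A: "A \<in> carrier_mat r r" and le: "\<And>i j. i < r \<Longrightarrow> j < r \<Longrightarrow> av (A $$ (i, j)) \<le> 1"
  shows "av (det A) \<le> fact r"
proof (cases "r = 0")
  case True
  then show ?thesis using A by simp
next
  case False
  then show ?thesis using av_det_le[OF A, of 0 1] le by simp
qed

text \<open>The minor is expanded over row selections \<open>s\<close> and column selections
  \<open>t\<close>. If both stay among the first \<open>r\<close> indices, the minor of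
  \<open>m\<close> that occurs is plus or minus \<open>top_minor r m\<close>, small by assumption.
  Otherwise the gap of \<alpha> or of \<beta> supplies the factor \<tau>. The power of
  \<open>n\<close> counts the pairs of selections.\<close>

lemma top_minor_product_le:
  assumes X: "X \<in> carrier_mat n n" and m: "m \<in> carrier_mat n n" and Y: "Y \<in> carrier_mat n n"
    and X1: "\<And>i j. i < n \<Longrightarrow> j < n \<Longrightarrow> av (X $$ (i, j)) \<le> 1"
    and m1: "\<And>i j. i < n \<Longrightarrow> j < n \<Longrightarrow> av (m $$ (i, j)) \<le> 1"
    and Y1: "\<And>i j. i < n \<Longrightarrow> j < n \<Longrightarrow> av (Y $$ (i, j)) \<le> 1"
    and r: "0 < r" "r \<le> n" and t: "0 \<le> \<tau>" "\<tau> \<le> 1"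
    and \<alpha>: "\<And>i j. i \<le> j \<Longrightarrow> j < n \<Longrightarrow> av (\<alpha> j) \<le> av (\<alpha> i)" "\<And>i. r \<le> i \<Longrightarrow> i < n \<Longrightarrow> av (\<alpha> i) \<le> \<tau> * av (\<alpha> (r - 1))"
    and \<beta>: "\<And>i j. i \<le> j \<Longrightarrow> j < n \<Longrightarrow> av (\<beta> j) \<le> av (\<beta> i)" "\<And>i. r \<le> i \<Longrightarrow> i < n \<Longrightarrow> av (\<beta> i) \<le> \<tau> * av (\<beta> (r - 1))"
    and top: "av (top_minor r m) \<le> fact r * \<tau>"
  shows "av (top_minor r (X * mat_diag n \<alpha> * m * mat_diag n \<beta> * Y))
    \<le> real (n ^ r * n ^ r) * fact r * \<tau> * (\<Prod>i<r. av (\<alpha> i)) * (\<Prod>i<r. av (\<beta> i))"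
proof -
  let ?P = "PiE {..<r} (\<lambda>_. {..<n}) :: (nat \<Rightarrow> nat) set"
  define D where "D s t = det (Matrix.mat r r (\<lambda>(i, j). m $$ (s i, t j)))" for s t
  define Q where "Q = (\<Prod>i<r. av (\<alpha> i)) * (\<Prod>i<r. av (\<beta> i))"
  have entry: "(X * mat_diag n \<alpha> * m * mat_diag n \<beta> * Y) $$ (i, j)
      = (\<Sum>s<n. (X $$ (i, s) * \<alpha> s) * (\<Sum>t<n. m $$ (s, t) * (\<beta> t * Y $$ (t, j))))" if "i < n" "j < n" for i j
  proof -
    have "X * mat_diag n \<alpha> * m * mat_diag n \<beta> * Y = (X * mat_diag n \<alpha>) * ((m * mat_diag n \<beta>) * Y)"
      using assoc_mult_mat[OF mult_carrier_mat[OF X mat_diag_dim] m mat_diag_dim, of \<alpha> \<beta>]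
        assoc_mult_mat[OF mult_carrier_mat[OF X mat_diag_dim] mult_carrier_mat[OF m mat_diag_dim] Y, of \<alpha> \<beta>]
      by metis
    then show ?thesis unfolding mat_diag_mult_right[OF X] mat_diag_mult_right[OF m] using that X m Y
      by (simp add: scalar_prod_def atLeast0LessThan mult.assoc)
  qed
  have "top_minor r (X * mat_diag n \<alpha> * m * mat_diag n \<beta> * Y)
      = det (Matrix.mat r r (\<lambda>(i, j). \<Sum>s<n. (X $$ (i, s) * \<alpha> s) * (\<Sum>t<n. m $$ (s, t) * (\<beta> t * Y $$ (t, j)))))"
    unfolding top_minor_def using entry r by (intro arg_cong[of _ _ det] eq_matI) auto
  also have "\<dots> = (\<Sum>s\<in>?P. (\<Prod>i<r. X $$ (i, s i) * \<alpha> (s i)) * (\<Sum>t\<in>?P. (\<Prod>j<r. \<beta> (t j) * Y $$ (t j, j)) * D s t))"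
    by (subst det_sum_rows)
      (simp only: D_def det_sum_cols[where f = "\<lambda>i t. m $$ (s i, t)" and c = "\<lambda>j t. \<beta> t * Y $$ (t, j)" for s])
  finally have eq: "top_minor r (X * mat_diag n \<alpha> * m * mat_diag n \<beta> * Y)
      = (\<Sum>s\<in>?P. \<Sum>t\<in>?P. (\<Prod>i<r. X $$ (i, s i) * \<alpha> (s i)) * ((\<Prod>j<r. \<beta> (t j) * Y $$ (t j, j)) * D s t))"
    by (simp add: sum_distrib_left)
  have pa: "0 \<le> (\<Prod>i<r. av (\<alpha> i))" "0 \<le> (\<Prod>i<r. av (\<beta> i))" by (auto intro: prod_nonneg)
  have summand: "av ((\<Prod>i<r. X $$ (i, s i) * \<alpha> (s i)) * ((\<Prod>j<r. \<beta> (t j) * Y $$ (t j, j)) * D s t)) \<le> fact r * \<tau> * Q"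
    if st: "s \<in> ?P" "t \<in> ?P" for s t
  proof (cases "inj_on s {..<r} \<and> inj_on t {..<r}")
    case False
    have "D s t = 0"
    proof (cases "inj_on s {..<r}")
      case True
      then obtain i j where ij: "i < r" "j < r" "i \<noteq> j" "t i = t j" using False by (auto simp: inj_on_def)
      show ?thesis unfolding D_def
        by (rule det_identical_columns[of _ r i j]) (use ij in \<open>auto intro!: eq_vecI\<close>)
    next
      case False
      then obtain i j where ij: "i < r" "j < r" "i \<noteq> j" "s i = s j" by (auto simp: inj_on_def)
      show ?thesis unfolding D_def
        by (rule det_identical_rows[of _ r i j]) (use ij in \<open>auto intro!: eq_vecI\<close>)
    qed
    then show ?thesis using t pa by (simp add: Q_def)
  next
    case True
    have sr: "s ` {..<r} \<subseteq> {..<n}" "t ` {..<r} \<subseteq> {..<n}" using st by auto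
    have mono: "av (\<gamma> (r - 1)) \<le> av (\<gamma> i)" if "\<And>i j. i \<le> j \<Longrightarrow> j < n \<Longrightarrow> av (\<gamma> j) \<le> av (\<gamma> i)" "i < r" for \<gamma> i
      using that r by auto
    define es where "es = (if s ` {..<r} \<subseteq> {..<r} then 1 else \<tau>)"
    define et where "et = (if t ` {..<r} \<subseteq> {..<r} then 1 else \<tau>)"
    have A: "(\<Prod>i<r. av (\<alpha> (s i))) \<le> es * (\<Prod>i<r. av (\<alpha> i))" unfolding es_def
      by (rule prod_inj_le[where a = "\<lambda>i. av (\<alpha> i)" and n = n and b = "av (\<alpha> (r - 1))"])
        (use True sr \<alpha> t mono[OF \<alpha>(1)] in auto)
    have B: "(\<Prod>i<r. av (\<beta> (t i))) \<le> et * (\<Prod>i<r. av (\<beta> i))" unfolding et_def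
      by (rule prod_inj_le[where a = "\<lambda>i. av (\<beta> i)" and n = n and b = "av (\<beta> (r - 1))"])
        (use True sr \<beta> t mono[OF \<beta>(1)] in auto)
    have "(\<Prod>i<r. av (X $$ (i, s i))) \<le> 1" "(\<Prod>i<r. av (Y $$ (t i, i))) \<le> 1"
      using sr r by (auto intro!: prod_le_1 X1 Y1)
    then have A': "av (\<Prod>i<r. X $$ (i, s i) * \<alpha> (s i)) \<le> es * (\<Prod>i<r. av (\<alpha> i))"
      and B': "av (\<Prod>j<r. \<beta> (t j) * Y $$ (t j, j)) \<le> et * (\<Prod>i<r. av (\<beta> i))"
      using A B by (auto simp: av_prod av_mult prod.distrib prod_nonneg
        intro: order_trans[OF mult_left_le_one_le] order_trans[OF mult_right_le_one_le])
    have et0: "0 \<le> es" "0 \<le> et" "es \<le> 1" "et \<le> 1" using t by (auto simp: es_def et_def)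
    have D: "es * et * av (D s t) \<le> fact r * \<tau>"
    proof (cases "s ` {..<r} \<subseteq> {..<r} \<and> t ` {..<r} \<subseteq> {..<r}")
      case sub: True
      obtain p where p: "D s t = signof p * det (Matrix.mat r r (\<lambda>(i, j). m $$ (i, t j)))"
        using det_submatrix_permute[of s r "\<lambda>i j. m $$ (i, t j)"] True sub by (auto simp: D_def)
      obtain q where "det (Matrix.mat r r (\<lambda>(i, j). m $$ (j, t i))) = signof q * det (Matrix.mat r r (\<lambda>(i, j). m $$ (j, i)))"
        using det_submatrix_permute[of t r "\<lambda>i j. m $$ (j, i)"] True sub by auto
      moreover have tr: "det (Matrix.mat r r (\<lambda>(i, j). g j i)) = det (Matrix.mat r r (\<lambda>(i, j). g i j))" for g :: "nat \<Rightarrow> nat \<Rightarrow> 'k"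
      proof -
        have "Matrix.mat r r (\<lambda>(i, j). g j i) = transpose_mat (Matrix.mat r r (\<lambda>(i, j). g i j))" by (rule eq_matI) auto
        then show ?thesis using det_transpose[of "Matrix.mat r r (\<lambda>(i, j). g i j)" r] by simp
      qed
      ultimately have "det (Matrix.mat r r (\<lambda>(i, j). m $$ (i, t j))) = signof q * top_minor r m"
        unfolding top_minor_def using tr[of "\<lambda>i j. m $$ (i, t j)"] tr[of "\<lambda>i j. m $$ (i, j)"] by simp
      then have "av (D s t) = av (top_minor r m)" by (simp add: p av_mult av_sign)
      then show ?thesis using sub top by (simp add: es_def et_def)
    next
      case False
      then have "es * et \<le> \<tau>" using et0 t by (auto simp: es_def et_def mult_left_le_one_le)
      moreover have "av (D s t) \<le> fact r" unfolding D_def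
        by (rule av_det_le_fact) (use sr m1 in \<open>auto simp: image_subset_iff\<close>)
      ultimately show ?thesis using mult_mono[of "es * et" \<tau> "av (D s t)" "fact r"] t by (simp add: mult.commute)
    qed
    have "av ((\<Prod>i<r. X $$ (i, s i) * \<alpha> (s i)) * ((\<Prod>j<r. \<beta> (t j) * Y $$ (t j, j)) * D s t))
        \<le> (es * (\<Prod>i<r. av (\<alpha> i))) * ((et * (\<Prod>i<r. av (\<beta> i))) * av (D s t))"
      unfolding av_mult using A' B' et0 pa by (intro mult_mono) (auto simp: av_mult)
    also have "\<dots> = (es * et * av (D s t)) * Q" by (simp add: Q_def)
    also have "\<dots> \<le> fact r * \<tau> * Q" using D pa by (intro mult_right_mono) (auto simp: Q_def)
    finally show ?thesis .
  qed
  have "av (top_minor r (X * mat_diag n \<alpha> * m * mat_diag n \<beta> * Y)) \<le> (\<Sum>s\<in>?P. \<Sum>t\<in>?P. fact r * \<tau> * Q)"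
    unfolding eq by (intro order_trans[OF av_sum] sum_mono summand) auto
  also have "\<dots> = real (n ^ r * n ^ r) * fact r * \<tau> * (\<Prod>i<r. av (\<alpha> i)) * (\<Prod>i<r. av (\<beta> i))"
    by (simp add: card_PiE Q_def)
  finally show ?thesis .
qed

text \<open>Cramer's rule: \<open>y $ k\<close> times the determinant is the determinant with column
  \<open>k\<close> replaced by the image of \<open>y\<close>, whose entries are at most \<epsilon>.
  A block that nearly annihilates a vector of definite size has a small determinant.\<close>

lemma top_minor_small:
  fixes y :: "'k vec"
  assumes m1: "\<And>i j. i < r \<Longrightarrow> j < r \<Longrightarrow> av (m $$ (i, j)) \<le> 1" and y: "y \<in> carrier_vec r" and k: "k < r" "av (y $ k) \<ge> c" "0 < c"
    and \<epsilon>: "0 \<le> \<epsilon>" "\<And>i. i < r \<Longrightarrow> av (\<Sum>j<r. m $$ (i, j) * y $ j) \<le> \<epsilon>"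
  shows "av (top_minor r m) \<le> fact r * (\<epsilon> / c)"
proof -
  let ?M = "Matrix.mat r r (\<lambda>(i, j). m $$ (i, j))"
  have My: "(?M *\<^sub>v y) $ i = (\<Sum>j<r. m $$ (i, j) * y $ j)" if "i < r" for i
    using that y by (simp add: scalar_prod_def atLeast0LessThan)
  have "det (replace_col ?M (?M *\<^sub>v y) k) = y $ k * det ?M"
    by (rule cramer_lemma_mat[OF _ y k(1)]) simp
  moreover have "av (det (replace_col ?M (?M *\<^sub>v y) k)) \<le> fact r * \<epsilon>"
    by (rule av_det_le[of _ r k]) (use m1 \<epsilon> k y My in \<open>auto simp: replace_col_def simp del: index_mult_mat_vec\<close>)
  ultimately have "av (y $ k) * av (det ?M) \<le> fact r * \<epsilon>" by (simp add: av_mult)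
  moreover have "c * av (det ?M) \<le> av (y $ k) * av (det ?M)" using k by (intro mult_right_mono) auto
  ultimately show ?thesis using k(3) by (simp add: top_minor_def field_simps)
qed

section \<open>Attracting subspaces of a Cartan decomposition\<close>

lemma nv_mono:
  assumes "dim_vec x = dim_vec y" "0 \<le> B" "\<And>i. i < dim_vec y \<Longrightarrow> av (x $ i) \<le> B * av (y $ i)"
  shows "nv x \<le> B * nv y"
proof (cases "ultrametric av")
  case True
  have "av (x $ i) \<le> B * nv y" if "i < dim_vec x" for i
  proof -
    have "av (x $ i) \<le> B * av (y $ i)" using assms(1,3) that by simp
    also have "\<dots> \<le> B * nv y" using nv_entry[of i y] that assms(1,2) by (intro mult_left_mono) auto
    finally show ?thesis .
  qed
  then show ?thesis using True assms(2) by (simp add: nv_ultra_le_iff)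
next
  case False
  have "(\<Sum>i<dim_vec y. (av (x $ i))\<^sup>2) \<le> (\<Sum>i<dim_vec y. (B * av (y $ i))\<^sup>2)"
    by (intro sum_mono power_mono assms(3)) auto
  also have "\<dots> = B\<^sup>2 * (\<Sum>i<dim_vec y. (av (y $ i))\<^sup>2)" by (simp add: power_mult_distrib sum_distrib_left)
  finally have "sqrt (\<Sum>i<dim_vec y. (av (x $ i))\<^sup>2) \<le> sqrt (B\<^sup>2 * (\<Sum>i<dim_vec y. (av (y $ i))\<^sup>2))" by simp
  then show ?thesis using False assms(1,2) by (simp add: nv_def onb_norm_def real_sqrt_mult)
qed

text \<open>The image of the first coordinate plane under an isometry. Describing the points of the
  Grassmannian in this way reduces its compactness to that of the group of isometries.\<close>

definition Sp :: "nat \<Rightarrow> 'k mat \<Rightarrow> nat \<Rightarrow> 'k vec set" where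
  "Sp n k p = {k *\<^sub>v y | y. y \<in> carrier_vec n \<and> (\<forall>i. p \<le> i \<and> i < n \<longrightarrow> y $ i = 0)}"

text \<open>One half of the gap between two subspaces. The error is measured relative to
  \<open>w\<close>, hence it is insensitive to scaling, and linear maps change it at most by their
  condition number.\<close>

definition near :: "real \<Rightarrow> 'k vec set \<Rightarrow> 'k vec set \<Rightarrow> bool" where
  "near e W V \<longleftrightarrow> (\<forall>w\<in>W. \<exists>v\<in>V. nv (w - v) \<le> e * nv w)"

lemma near_mono: "near e W V \<Longrightarrow> e \<le> e' \<Longrightarrow> near e' W V"
  unfolding near_def by (meson mult_right_mono nv_nonneg order_trans)

lemma near_refl: "W \<subseteq> carrier_vec n \<Longrightarrow> near 0 W W"
  unfolding near_def using minus_cancel_vec nv_zero by (metis mult_zero_left order_refl subsetD)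

text \<open>In the form \<open>1 + e\<close>, the closeness constants are multiplicative along chains.\<close>

lemma near_trans:
  assumes "near (a - 1) W V" "near (b - 1) V X" "1 \<le> b"
    and c: "W \<subseteq> carrier_vec n" "V \<subseteq> carrier_vec n" "X \<subseteq> carrier_vec n"
  shows "near (a * b - 1) W X"
  unfolding near_def
proof
  fix w assume w: "w \<in> W"
  obtain v where v: "v \<in> V" "nv (w - v) \<le> (a - 1) * nv w" using assms(1) w by (auto simp: near_def)
  obtain x where x: "x \<in> X" "nv (v - x) \<le> (b - 1) * nv v" using assms(2) v(1) by (auto simp: near_def)
  have "nv v \<le> nv w + nv (v - w)" by (rule nv_le_dist[of _ n]) (use w v c in auto)
  also have "nv (v - w) = nv (w - v)" by (rule nv_minus_commute[of _ n]) (use w v c in auto)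
  finally have "nv v \<le> a * nv w" using v(2) by (simp add: algebra_simps)
  then have "(b - 1) * nv v \<le> (b - 1) * (a * nv w)" using assms(3) by (intro mult_left_mono) auto
  moreover have "nv (w - x) \<le> nv (w - v) + nv (v - x)" by (rule nv_dist_triangle[of _ n]) (use w v x c in auto)
  ultimately have "nv (w - x) \<le> (a * b - 1) * nv w" using v(2) x(2) by (simp add: algebra_simps)
  then show "\<exists>x\<in>X. nv (w - x) \<le> (a * b - 1) * nv w" using x(1) by blast
qed

lemma near_image:
  assumes "near e W V" and g: "g \<in> carrier_mat n n" and c: "W \<subseteq> carrier_vec n" "V \<subseteq> carrier_vec n" and e: "0 \<le> e" "0 \<le> b"
    and b: "\<And>v. v \<in> carrier_vec n \<Longrightarrow> nv (g *\<^sub>v v) \<le> b * nv v" "\<And>v. v \<in> carrier_vec n \<Longrightarrow> nv v \<le> b' * nv (g *\<^sub>v v)"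
  shows "near (b * b' * e) ((*\<^sub>v) g ` W) ((*\<^sub>v) g ` V)"
  unfolding near_def
proof
  fix x assume "x \<in> (*\<^sub>v) g ` W"
  then obtain w where w: "w \<in> W" "x = g *\<^sub>v w" by blast
  obtain v where v: "v \<in> V" "nv (w - v) \<le> e * nv w" using assms(1) w by (auto simp: near_def)
  have wc: "w \<in> carrier_vec n" and vc: "v \<in> carrier_vec n" using w v c by auto
  have "x - g *\<^sub>v v = g *\<^sub>v (w - v)" unfolding w(2) by (rule mult_minus_distrib_mat_vec[symmetric, OF g wc vc])
  then have "nv (x - g *\<^sub>v v) \<le> b * nv (w - v)" using b(1)[of "w - v"] wc vc by simp
  also have "\<dots> \<le> b * (e * (b' * nv x))"
    using v(2) b(2)[OF wc] e unfolding w(2) by (meson mult_left_mono order_trans)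
  finally show "\<exists>y\<in>(*\<^sub>v) g ` V. nv (x - y) \<le> b * b' * e * nv x" using v(1) by (auto simp: mult_ac)
qed

lemma Sp_carrier: "k \<in> carrier_mat n n \<Longrightarrow> Sp n k p \<subseteq> carrier_vec n"
  by (auto simp: Sp_def)

lemma Sp_iff:
  assumes k: "k \<in> isom n" and v: "v \<in> carrier_vec n"
  shows "v \<in> Sp n k p \<longleftrightarrow> (\<forall>i. p \<le> i \<and> i < n \<longrightarrow> (minv k *\<^sub>v v) $ i = 0)"
proof
  note kc = isom_carrier[OF k] and kd = isom_det[OF k]
  assume "v \<in> Sp n k p"
  then show "\<forall>i. p \<le> i \<and> i < n \<longrightarrow> (minv k *\<^sub>v v) $ i = 0"
    using minv_mult_vec(1)[OF kc kd] by (auto simp: Sp_def)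
next
  note kc = isom_carrier[OF k] and kd = isom_det[OF k]
  assume "\<forall>i. p \<le> i \<and> i < n \<longrightarrow> (minv k *\<^sub>v v) $ i = 0"
  then show "v \<in> Sp n k p" unfolding Sp_def
    using minv_mult_vec(2)[OF kc kd v] mult_mat_vec_carrier[OF minv(1)[OF kc kd] v]
    by (intro CollectI exI[of _ "minv k *\<^sub>v v"]) simp
qed

lemma Sp_smult:
  assumes k: "k \<in> carrier_mat n n" and v: "v \<in> Sp n k p"
  shows "c \<cdot>\<^sub>v v \<in> Sp n k p"
proof -
  obtain y :: "'k vec" where y: "y \<in> carrier_vec n" "v = k *\<^sub>v y" "\<forall>i. p \<le> i \<and> i < n \<longrightarrow> y $ i = 0"
    using v by (auto simp: Sp_def)
  then show ?thesis unfolding Sp_def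
    using mult_mat_vec[OF k y(1), of c] by (intro CollectI exI[of _ "c \<cdot>\<^sub>v y"]) auto
qed

lemma Sp_mono: "p \<le> p' \<Longrightarrow> Sp n k p \<subseteq> Sp n k p'"
  unfolding Sp_def by auto

text \<open>Closedness for \<open>nv\<close>. Together with mutual approximation it identifies
  limits without any recourse to dimensions.\<close>

definition nclosed :: "nat \<Rightarrow> 'k vec set \<Rightarrow> bool" where
  "nclosed n V \<longleftrightarrow> V \<subseteq> carrier_vec n \<and> (\<forall>v\<in>carrier_vec n. (\<forall>e>0. \<exists>w\<in>V. nv (v - w) \<le> e) \<longrightarrow> v \<in> V)"

lemma nclosedD: "nclosed n V \<Longrightarrow> v \<in> carrier_vec n \<Longrightarrow> (\<And>e. e > 0 \<Longrightarrow> \<exists>w\<in>V. nv (v - w) \<le> e) \<Longrightarrow> v \<in> V"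
  by (auto simp: nclosed_def)

lemma Sp_closed:
  assumes k: "k \<in> isom n" shows "nclosed n (Sp n k p)"
  unfolding nclosed_def
proof (intro conjI ballI impI)
  show "Sp n k p \<subseteq> carrier_vec n" by (rule Sp_carrier[OF isom_carrier[OF k]])
  fix v assume v: "v \<in> carrier_vec n" and e: "\<forall>e>0. \<exists>w\<in>Sp n k p. nv (v - w) \<le> e"
  note mk = isom_minv[OF k] and mkc = isom_carrier[OF isom_minv[OF k]]
  have "(minv k *\<^sub>v v) $ i = 0" if i: "p \<le> i" "i < n" for i
  proof (rule ccontr)
    assume "(minv k *\<^sub>v v) $ i \<noteq> 0"
    then have "av ((minv k *\<^sub>v v) $ i) > 0" by (rule av_pos)
    then obtain w where w: "w \<in> Sp n k p" "nv (v - w) \<le> av ((minv k *\<^sub>v v) $ i) / 2" using e half_gt_zero by blast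
    have wc: "w \<in> carrier_vec n" using w Sp_carrier[OF isom_carrier[OF k]] by blast
    have "(minv k *\<^sub>v w) $ i = 0" using Sp_iff[OF k wc] w(1) i by blast
    then have "(minv k *\<^sub>v v) $ i = (minv k *\<^sub>v (v - w)) $ i"
      using mult_minus_distrib_mat_vec[OF mkc v wc] i mkc by simp
    then have "av ((minv k *\<^sub>v v) $ i) \<le> nv (minv k *\<^sub>v (v - w))"
      using nv_entry[of i "minv k *\<^sub>v (v - w)"] i mkc by simp
    also have "\<dots> = nv (v - w)" using isom_nv[OF mk] v wc by simp
    finally show False using w(2) \<open>av ((minv k *\<^sub>v v) $ i) > 0\<close> by linarith
  qed
  then show "v \<in> Sp n k p" using Sp_iff[OF k v] by blast
qed

definition tends :: "(nat \<Rightarrow> 'k vec set) \<Rightarrow> 'k vec set \<Rightarrow> bool" where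
  "tends W V \<longleftrightarrow> (\<forall>e>0. \<forall>\<^sub>F n in sequentially. near e (W n) V \<and> near e V (W n))"

text \<open>Every vector of \<open>V\<close> is approximated by \<open>V'\<close> through an
  intermediate set \<open>W\<close>, and closedness of \<open>V'\<close> concludes. \<open>W\<close>
  may change with the precision, which covers limits as well as inclusions between different
  limits.\<close>

lemma near_subset:
  assumes W: "\<And>a. 1 < a \<Longrightarrow> \<exists>W\<subseteq>carrier_vec n. near (a - 1) V W \<and> near (a - 1) W V'"
    and V: "V \<subseteq> carrier_vec n" and V': "nclosed n V'"
  shows "V \<subseteq> V'"
proof
  fix v assume v: "v \<in> V"
  then have vc: "v \<in> carrier_vec n" using V by blast
  show "v \<in> V'"
  proof (rule nclosedD[OF V' vc])
    fix e :: real assume e: "e > 0"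
    \<comment> \<open>Two steps of quality \<open>a\<close> amount to \<open>a * a - 1\<close>, at
      most three times \<open>a - 1\<close>; the choice makes this less than \<open>e\<close> after
      multiplication by \<open>nv v\<close>.\<close>
    define a where "a = 1 + min 1 (e / (4 * nv v + 4))"
    have nvp: "0 < 4 * nv v + 4" using nv_nonneg[of v] by linarith
    then have "e / (4 * nv v + 4) > 0" using e by simp
    then have a: "a - 1 > 0" "a \<le> 2" "a - 1 \<le> e / (4 * nv v + 4)" by (auto simp: a_def)
    obtain W where "W \<subseteq> carrier_vec n" "near (a - 1) V W" "near (a - 1) W V'" using W[of a] a(1) by auto
    then have "near (a * a - 1) V V'" using near_trans[of a V W a V' n] a V V' by (auto simp: nclosed_def)
    then obtain w where w: "w \<in> V'" "nv (v - w) \<le> (a * a - 1) * nv v" using v by (auto simp: near_def)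
    have "a * a - 1 = (a - 1) * (a + 1)" by (simp add: algebra_simps)
    also have "\<dots> \<le> e / (4 * nv v + 4) * 3" using a by (intro mult_mono) auto
    finally have "(a * a - 1) * nv v \<le> (e / (4 * nv v + 4) * 3) * nv v" by (intro mult_right_mono) auto
    also have "\<dots> = e * (3 * nv v / (4 * nv v + 4))" by simp
    also have "\<dots> \<le> e * 1"
    proof (rule mult_left_mono)
      have "0 < 4 * nv v + 4" using nvp by linarith
      moreover have "3 * nv v \<le> 4 * nv v + 4" using nv_nonneg[of v] by linarith
      ultimately show "3 * nv v / (4 * nv v + 4) \<le> 1" by (simp only: divide_le_eq_1_pos)
    qed (use e in simp)
    finally have "(a * a - 1) * nv v \<le> e" by simp
    then show "\<exists>w\<in>V'. nv (v - w) \<le> e" using w by (meson order_trans)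
  qed
qed

lemma tends_subset:
  assumes "tends W V" "tends W V'" and V: "V \<subseteq> carrier_vec n" and V': "nclosed n V'" and W: "\<And>m. W m \<subseteq> carrier_vec n"
  shows "V \<subseteq> V'"
proof (rule near_subset[OF _ V V'])
  fix a :: real assume "1 < a"
  then have "\<forall>\<^sub>F m in sequentially. near (a - 1) (W m) V \<and> near (a - 1) V (W m)"
    "\<forall>\<^sub>F m in sequentially. near (a - 1) (W m) V' \<and> near (a - 1) V' (W m)"
    using assms(1,2) unfolding tends_def by (metis diff_gt_0_iff_gt)+
  then have "\<forall>\<^sub>F m in sequentially. near (a - 1) V (W m) \<and> near (a - 1) (W m) V'"
    by eventually_elim blast
  then obtain m where "near (a - 1) V (W m)" "near (a - 1) (W m) V'" by (auto dest: eventually_happens)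
  then show "\<exists>W\<subseteq>carrier_vec n. near (a - 1) V W \<and> near (a - 1) W V'" using W by blast
qed

lemma tends_unique:
  assumes "tends W V" "tends W V'" "nclosed n V" "nclosed n V'" "\<And>m. W m \<subseteq> carrier_vec n"
  shows "V = V'"
  using tends_subset[OF assms(1,2) _ assms(4,5)] tends_subset[OF assms(2,1) _ assms(3,5)] assms(3,4)
  by (auto simp: nclosed_def)

lemma tends_offset: "tends (\<lambda>n. W (m + n)) V \<Longrightarrow> tends W V"
  unfolding tends_def
  using eventually_sequentially_seg[of "\<lambda>n. near e (W n) V \<and> near e V (W n)" m for e] by (simp add: add.commute)

lemma tends_trans:
  assumes VW: "tends W V" and e: "\<And>m. near (e m) (W' m) (W m)" "\<And>m. near (e m) (W m) (W' m)" "e \<longlonglongrightarrow> 0"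
    and c: "\<And>m. W m \<subseteq> carrier_vec n" "\<And>m. W' m \<subseteq> carrier_vec n" "V \<subseteq> carrier_vec n"
  shows "tends W' V"
  unfolding tends_def
proof (intro allI impI)
  fix x :: real assume x: "x > 0"
  define a where "a = 1 + min 1 (x / 3)"
  have a: "a - 1 > 0" "a \<le> 2" "a - 1 \<le> x / 3" using x by (auto simp: a_def)
  have "a * a - 1 = (a - 1) * (a + 1)" by (simp add: algebra_simps)
  also have "\<dots> \<le> x / 3 * 3" using a by (intro mult_mono) auto
  finally have aa: "a * a - 1 \<le> x" by simp
  have "\<forall>\<^sub>F m in sequentially. e m < a - 1" using e(3) a(1) order_tendstoD(2) by blast
  moreover have "\<forall>\<^sub>F m in sequentially. near (a - 1) (W m) V \<and> near (a - 1) V (W m)"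
    using VW a(1) unfolding tends_def by blast
  ultimately show "\<forall>\<^sub>F m in sequentially. near x (W' m) V \<and> near x V (W' m)"
  proof eventually_elim
    case (elim m)
    then have "near (a - 1) (W' m) (W m)" "near (a - 1) (W m) (W' m)" using near_mono[OF e(1)] near_mono[OF e(2)] by auto
    then have "near (a * a - 1) (W' m) V" "near (a * a - 1) V (W' m)"
      using near_trans[of a "W' m" "W m" a V n] near_trans[of a V "W m" a "W' m" n] elim a c by auto
    then show ?case using near_mono[OF _ aa] by blast
  qed
qed

text \<open>Sequential compactness of the Grassmannian: isometries have entries bounded by 1, so a
  subsequence converges entrywise. The limit is an isometry by continuity of the norm, and the
  planes converge because the error of a matrix controls the error of its images.\<close>

lemma isom_limit_subspace:
  assumes k: "\<And>m. k m \<in> isom n"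
  shows "\<exists>l\<in>isom n. \<exists>s. strict_mono (s :: nat \<Rightarrow> nat) \<and> tends (\<lambda>m. Sp n (k (s m)) p) (Sp n l p)"
proof -
  note kc = isom_carrier[OF k]
  obtain L s where s: "strict_mono (s :: nat \<Rightarrow> nat)"
    and L: "\<And>ij. ij \<in> {..<n} \<times> {..<n} \<Longrightarrow> (\<lambda>m. av (k (s m) $$ ij - L ij)) \<longlonglongrightarrow> 0"
    using family_convergent_subseq[of "{..<n} \<times> {..<n}" "\<lambda>m ij. k m $$ ij" 1] isom_entry[OF k] by fastforce
  define l where "l = Matrix.mat n n L"
  have lc: "l \<in> carrier_mat n n" by (simp add: l_def)
  define e where "e m = real n * (real n * (\<Sum>ij\<in>{..<n} \<times> {..<n}. av (k (s m) $$ ij - L ij)))" for m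
  have "(\<lambda>m. real n * (real n * (\<Sum>ij\<in>{..<n} \<times> {..<n}. av (k (s m) $$ ij - L ij)))) \<longlonglongrightarrow> real n * (real n * (\<Sum>ij\<in>{..<n} \<times> {..<n}. 0))"
    by (intro tendsto_mult_left tendsto_sum L)
  then have e0: "e \<longlonglongrightarrow> 0" by (simp add: e_def[abs_def])
  have diff: "nv (k (s m) *\<^sub>v y - l *\<^sub>v y) \<le> e m * nv y" if y: "y \<in> carrier_vec n" for m y
  proof -
    have "k (s m) *\<^sub>v y - l *\<^sub>v y = (k (s m) - l) *\<^sub>v y"
      by (rule minus_mult_distrib_mat_vec[symmetric, OF kc lc y])
    moreover have "av ((k (s m) - l) $$ (i, j)) \<le> (\<Sum>ij\<in>{..<n} \<times> {..<n}. av (k (s m) $$ ij - L ij))"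
      if "i < n" "j < n" for i j
      using member_le_sum[of "(i, j)" "{..<n} \<times> {..<n}" "\<lambda>ij. av (k (s m) $$ ij - L ij)"] that kc[of "s m"] lc
      by (auto simp: l_def)
    moreover have "0 \<le> (\<Sum>ij\<in>{..<n} \<times> {..<n}. av (k (s m) $$ ij - L ij))" by (intro sum_nonneg) simp
    moreover have "k (s m) - l \<in> carrier_mat n n" using lc by (rule minus_carrier_mat)
    ultimately show ?thesis unfolding e_def
      using mult_mat_vec_bounded_entries[OF _ y, of "k (s m) - l" n "\<Sum>ij\<in>{..<n} \<times> {..<n}. av (k (s m) $$ ij - L ij)"]
      by metis
  qed
  have "nv (l *\<^sub>v y) = nv y" if y: "y \<in> carrier_vec n" for y
  proof -
    have c: "k (s m) *\<^sub>v y \<in> carrier_vec n" "l *\<^sub>v y \<in> carrier_vec n" for m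
      using mult_mat_vec_carrier[OF kc y] mult_mat_vec_carrier[OF lc y] by auto
    have "\<bar>nv (l *\<^sub>v y) - nv y\<bar> \<le> e m * nv y" for m
      using nv_le_dist[OF c(1)[of m] c(2)] nv_le_dist[OF c(2) c(1)[of m]] diff[OF y, of m]
        isom_nv[OF k y, of "s m"] nv_minus_commute[OF c(2) c(1)[of m]] by auto
    moreover have "(\<lambda>m. e m * nv y) \<longlonglongrightarrow> 0" using tendsto_mult_right[OF e0, of "nv y"] by simp
    ultimately have "(\<lambda>m. \<bar>nv (l *\<^sub>v y) - nv y\<bar>) \<longlonglongrightarrow> 0" by (intro tendsto_0_le[of "\<lambda>_. \<bar>nv (l *\<^sub>v y) - nv y\<bar>"]) auto
    then show ?thesis by (simp add: LIMSEQ_const_iff)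
  qed
  then have l: "l \<in> isom n" using lc by (simp add: isom_def)
  have n1: "near (e m) (Sp n (k (s m)) p) (Sp n l p)" for m
    unfolding near_def
  proof
    fix w assume "w \<in> Sp n (k (s m)) p"
    then obtain y where y: "y \<in> carrier_vec n" "w = k (s m) *\<^sub>v y" "\<forall>i. p \<le> i \<and> i < n \<longrightarrow> y $ i = 0" by (auto simp: Sp_def)
    then show "\<exists>v\<in>Sp n l p. nv (w - v) \<le> e m * nv w"
      using diff[OF y(1), of m] isom_nv[OF k y(1), of "s m"] by (intro bexI[of _ "l *\<^sub>v y"]) (auto simp: Sp_def)
  qed
  have n2: "near (e m) (Sp n l p) (Sp n (k (s m)) p)" for m
    unfolding near_def
  proof
    fix w assume "w \<in> Sp n l p"
    then obtain y where y: "y \<in> carrier_vec n" "w = l *\<^sub>v y" "\<forall>i. p \<le> i \<and> i < n \<longrightarrow> y $ i = 0" by (auto simp: Sp_def)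
    have c: "k (s m) *\<^sub>v y \<in> carrier_vec n" "l *\<^sub>v y \<in> carrier_vec n"
      using mult_mat_vec_carrier[OF kc y(1)] mult_mat_vec_carrier[OF lc y(1)] by auto
    show "\<exists>v\<in>Sp n (k (s m)) p. nv (w - v) \<le> e m * nv w"
      using diff[OF y(1), of m] isom_nv[OF l y(1)] y nv_minus_commute[OF c]
      by (intro bexI[of _ "k (s m) *\<^sub>v y"]) (auto simp: Sp_def)
  qed
  have "tends (\<lambda>m. Sp n (k (s m)) p) (Sp n l p)" unfolding tends_def
  proof (intro allI impI)
    fix x :: real assume "x > 0"
    then have "\<forall>\<^sub>F m in sequentially. e m < x" using e0 order_tendstoD(2) by blast
    then show "\<forall>\<^sub>F m in sequentially. near x (Sp n (k (s m)) p) (Sp n l p) \<and> near x (Sp n l p) (Sp n (k (s m)) p)"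
      by eventually_elim (use near_mono[OF n1] near_mono[OF n2] in auto)
  qed
  then show ?thesis using l s by blast
qed

lemma mat_diag_mult_vec:
  "y \<in> carrier_vec n \<Longrightarrow> mat_diag n \<alpha> *\<^sub>v y = Matrix.vec n (\<lambda>i. \<alpha> i * y $ i)"
proof (rule eq_vecI)
  fix i assume y: "y \<in> carrier_vec n" and "i < dim_vec (Matrix.vec n (\<lambda>i. \<alpha> i * y $ i))"
  then have i: "i < n" by simp
  then have "(mat_diag n \<alpha> *\<^sub>v y) $ i = (\<Sum>j = 0..<n. (if i = j then \<alpha> j else 0) * y $ j)"
    using y by (auto simp: mat_diag_def scalar_prod_def intro!: sum.cong)
  also have "\<dots> = (\<Sum>j = 0..<n. if i = j then \<alpha> j * y $ j else 0)" by (rule sum.cong) auto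
  also have "\<dots> = \<alpha> i * y $ i" using i by simp
  finally show "(mat_diag n \<alpha> *\<^sub>v y) $ i = Matrix.vec n (\<lambda>i. \<alpha> i * y $ i) $ i" using i by simp
qed (simp add: mat_diag_def)

section \<open>Attraction, expansion and stability of singular directions\<close>

context
  fixes n A k \<alpha> l
  assumes svd: "svd n A k \<alpha> l"
begin

lemma svd_isom: "k \<in> isom n" "l \<in> isom n" and svd_eq: "A = k * mat_diag n \<alpha> * l"
  and svd_antimono: "i \<le> j \<Longrightarrow> j < n \<Longrightarrow> av (\<alpha> j) \<le> av (\<alpha> i)"
  using svd by (auto simp: svd_def)

lemma svd_carrier: "A \<in> carrier_mat n n"
  using svd_eq mult_carrier_mat[OF mult_carrier_mat[OF isom_carrier[OF svd_isom(1)] mat_diag_dim] isom_carrier[OF svd_isom(2)]] by simp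

lemma svd_vec:
  assumes v: "v \<in> carrier_vec n"
  shows "A *\<^sub>v v = k *\<^sub>v Matrix.vec n (\<lambda>i. \<alpha> i * (l *\<^sub>v v) $ i)"
proof -
  note kc = isom_carrier[OF svd_isom(1)] and lc = isom_carrier[OF svd_isom(2)]
  have "A *\<^sub>v v = (k * mat_diag n \<alpha>) *\<^sub>v (l *\<^sub>v v)"
    unfolding svd_eq by (rule assoc_mult_mat_vec[OF mult_carrier_mat[OF kc mat_diag_dim] lc v])
  also have "\<dots> = k *\<^sub>v (mat_diag n \<alpha> *\<^sub>v (l *\<^sub>v v))"
    by (rule assoc_mult_mat_vec[OF kc mat_diag_dim]) (use lc v in auto)
  finally show ?thesis using mat_diag_mult_vec[of "l *\<^sub>v v" n \<alpha>] lc v by simp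
qed

lemma svd_nv:
  assumes v: "v \<in> carrier_vec n"
  shows "nv (A *\<^sub>v v) = nv (Matrix.vec n (\<lambda>i. \<alpha> i * (l *\<^sub>v v) $ i))"
  unfolding svd_vec[OF v] by (rule isom_nv[OF svd_isom(1)]) simp

lemma svd_nonzero:
  assumes "det A \<noteq> 0" "i < n" shows "\<alpha> i \<noteq> 0"
proof
  assume a: "\<alpha> i = 0"
  note kc = isom_carrier[OF svd_isom(1)] and lc = isom_carrier[OF svd_isom(2)]
  let ?u = "minv l *\<^sub>v unit_vec n i"
  have u: "?u \<in> carrier_vec n" using isom_carrier[OF isom_minv[OF svd_isom(2)]] by simp
  have lu: "l *\<^sub>v ?u = unit_vec n i" by (rule minv_mult_vec(2)[OF lc isom_det[OF svd_isom(2)]]) simp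
  have "Matrix.vec n (\<lambda>j. \<alpha> j * (l *\<^sub>v ?u) $ j) = 0\<^sub>v n" unfolding lu using a by (intro eq_vecI) (auto simp: unit_vec_def)
  then have "nv (A *\<^sub>v ?u) = 0" using svd_nv[OF u] by simp
  then have "A *\<^sub>v ?u = 0\<^sub>v n" using nv_eq_0[of "A *\<^sub>v ?u" n] svd_carrier u by simp
  moreover have "?u \<noteq> 0\<^sub>v n"
    using isom_nv[OF isom_minv[OF svd_isom(2)], of "unit_vec n i"] nv_unit[OF assms(2)] by auto
  ultimately show False using det_0_iff_vec_prod_zero[OF svd_carrier] u assms(1) by blast
qed

text \<open>In the frame \<open>k\<close> the coordinates from \<open>p\<close> on are multiplied by
  at most \<open>av (\<alpha> p)\<close>; dropping them gives the point \<open>u\<close>. As indices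
  start at 0, this is the singular value number \<open>p + 1\<close>.\<close>

lemma svd_attract:
  assumes w: "w \<in> carrier_vec n" and p: "p < n"
  shows "\<exists>u\<in>Sp n k p. nv (A *\<^sub>v w - u) \<le> av (\<alpha> p) * nv w"
proof -
  note kc = isom_carrier[OF svd_isom(1)] and lc = isom_carrier[OF svd_isom(2)]
  define x where "x = Matrix.vec n (\<lambda>i. \<alpha> i * (l *\<^sub>v w) $ i)"
  define y where "y = Matrix.vec n (\<lambda>i. if i < p then x $ i else 0)"
  have xy: "x \<in> carrier_vec n" "y \<in> carrier_vec n" by (auto simp: x_def y_def)
  have "nv (A *\<^sub>v w - k *\<^sub>v y) = nv (k *\<^sub>v (x - y))"
    unfolding svd_vec[OF w] x_def[symmetric] using mult_minus_distrib_mat_vec[OF kc xy] by simp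
  also have "\<dots> = nv (x - y)" by (rule isom_nv[OF svd_isom(1)]) (use xy in simp)
  also have "\<dots> \<le> av (\<alpha> p) * nv (l *\<^sub>v w)"
    by (rule nv_mono) (use svd_antimono[of p] lc w in \<open>auto simp: x_def y_def av_mult intro!: mult_right_mono\<close>)
  also have "nv (l *\<^sub>v w) = nv w" by (rule isom_nv[OF svd_isom(2) w])
  finally show ?thesis by (intro bexI[of _ "k *\<^sub>v y"]) (auto simp: Sp_def y_def)
qed

text \<open>On the first \<open>p\<close> directions all factors are at least
  \<open>av (\<alpha> (p - 1))\<close>, so vectors of the attracting space have short preimages.
  This is the counterpart to attraction, and the quotient of the two constants is the gap.\<close>

lemma svd_expand:
  assumes u: "u \<in> Sp n k p" and p: "0 < p" "p \<le> n" and d: "det A \<noteq> 0"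
  shows "\<exists>w\<in>carrier_vec n. A *\<^sub>v w = u \<and> av (\<alpha> (p - 1)) * nv w \<le> nv u"
proof -
  note kc = isom_carrier[OF svd_isom(1)] and lc = isom_carrier[OF svd_isom(2)]
  obtain y where y: "y \<in> carrier_vec n" "u = k *\<^sub>v y" "\<forall>i. p \<le> i \<and> i < n \<longrightarrow> y $ i = 0" using u by (auto simp: Sp_def)
  define z where "z = Matrix.vec n (\<lambda>i. y $ i / \<alpha> i)"
  have z: "z \<in> carrier_vec n" by (simp add: z_def)
  define w where "w = minv l *\<^sub>v z"
  have w: "w \<in> carrier_vec n" using isom_carrier[OF isom_minv[OF svd_isom(2)]] z by (simp add: w_def)
  have lw: "l *\<^sub>v w = z" unfolding w_def by (rule minv_mult_vec(2)[OF lc isom_det[OF svd_isom(2)] z])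
  have yz: "Matrix.vec n (\<lambda>i. \<alpha> i * z $ i) = y" using y(1) svd_nonzero[OF d] by (intro eq_vecI) (auto simp: z_def)
  have "A *\<^sub>v w = u" unfolding svd_vec[OF w] lw yz y(2) ..
  moreover have "nv w = nv z" unfolding w_def by (rule isom_nv[OF isom_minv[OF svd_isom(2)] z])
  moreover have "nv z \<le> inverse (av (\<alpha> (p - 1))) * nv y"
  proof (rule nv_mono)
    fix i assume "i < dim_vec y"
    then have i: "i < n" using y(1) by simp
    show "av (z $ i) \<le> inverse (av (\<alpha> (p - 1))) * av (y $ i)"
    proof (cases "i < p")
      case True
      have "av (\<alpha> (p - 1)) \<le> av (\<alpha> i)" using True p by (intro svd_antimono) auto
      moreover have "0 < av (\<alpha> (p - 1))" using svd_nonzero[OF d, of "p - 1"] p by (intro av_pos) auto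
      ultimately have "inverse (av (\<alpha> i)) \<le> inverse (av (\<alpha> (p - 1)))" by (rule le_imp_inverse_le)
      then have "inverse (av (\<alpha> i)) * av (y $ i) \<le> inverse (av (\<alpha> (p - 1))) * av (y $ i)" by (rule mult_right_mono) simp
      then show ?thesis using i by (simp add: z_def av_divide field_simps)
    next
      case False
      then show ?thesis using i y(3) by (simp add: z_def)
    qed
  qed (use y z in auto)
  moreover have "nv y = nv u" unfolding y(2) by (rule isom_nv[OF svd_isom(1) y(1), symmetric])
  moreover have "0 < av (\<alpha> (p - 1))" using svd_nonzero[OF d, of "p - 1"] p by (intro av_pos) auto
  ultimately show ?thesis using w by (intro bexI[of _ w]) (auto simp: field_simps)
qed

end

text \<open>A dimension count: the span of the first \<open>i + 1\<close> directions of
  \<open>l'\<close> meets the kernel of \<open>i\<close> linear forms. The forms, completed by a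
  zero row, make a square matrix of size \<open>i + 1\<close> with determinant zero, and a kernel
  vector of it is extended by zeros.\<close>

lemma common_vector:
  assumes l: "l \<in> carrier_mat n n" and l': "l' \<in> isom n" and i: "i < n"
  shows "\<exists>x\<in>carrier_vec n. x \<noteq> 0\<^sub>v n \<and> (\<forall>j. i < j \<and> j < n \<longrightarrow> (l' *\<^sub>v x) $ j = 0) \<and> (\<forall>j<i. (l *\<^sub>v x) $ j = 0)"
proof -
  note lc = isom_carrier[OF l'] and ld = isom_det[OF l'] and ml = isom_minv[OF l']
  note mlc = isom_carrier[OF ml]
  define H where "H = l * minv l'"
  have Hc: "H \<in> carrier_mat n n" using l mlc by (simp add: H_def)
  define M where "M = Matrix.mat (Suc i) (Suc i) (\<lambda>(a, b). if a < i then H $$ (a, b) else 0)"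
  have M: "M \<in> carrier_mat (Suc i) (Suc i)" by (simp add: M_def)
  have "transpose_mat M *\<^sub>v unit_vec (Suc i) i = 0\<^sub>v (Suc i)"
    using mult_mat_vec_unit[of "transpose_mat M" "Suc i" "Suc i" i] M by (auto simp: M_def intro!: eq_vecI)
  moreover have "unit_vec (Suc i) i \<noteq> (0\<^sub>v (Suc i) :: 'k vec)"
    using nv_unit[of i "Suc i"] by auto
  ultimately have "det (transpose_mat M) = 0"
    using det_0_iff_vec_prod_zero[of "transpose_mat M" "Suc i"] M by (metis transpose_carrier_mat unit_vec_carrier)
  then have "det M = 0" using det_transpose[OF M] by simp
  then obtain y where y: "y \<in> carrier_vec (Suc i)" "y \<noteq> 0\<^sub>v (Suc i)" "M *\<^sub>v y = 0\<^sub>v (Suc i)"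
    using det_0_iff_vec_prod_zero[OF M] by blast
  define z where "z = Matrix.vec n (\<lambda>j. if j \<le> i then y $ j else 0)"
  have z: "z \<in> carrier_vec n" by (simp add: z_def)
  have z0: "z \<noteq> 0\<^sub>v n"
  proof
    assume a: "z = 0\<^sub>v n"
    have "y $ j = 0" if "j < Suc i" for j using arg_cong[OF a, of "\<lambda>v. v $ j"] that i by (simp add: z_def)
    then show False using y(1,2) by (metis carrier_vecD eq_vecI index_zero_vec)
  qed
  have Hz: "(H *\<^sub>v z) $ a = 0" if a: "a < i" for a
  proof -
    have "(H *\<^sub>v z) $ a = (\<Sum>b<n. H $$ (a, b) * (if b \<le> i then y $ b else 0))"
      using a i Hc by (auto simp: scalar_prod_def z_def atLeast0LessThan intro!: sum.cong)
    also have "\<dots> = (\<Sum>b<Suc i. H $$ (a, b) * y $ b)"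
      by (rule sum.mono_neutral_cong_right) (use i in auto)
    also have "\<dots> = (M *\<^sub>v y) $ a"
      using a y(1) by (auto simp: scalar_prod_def M_def atLeast0LessThan simp del: sum.lessThan_Suc intro!: sum.cong)
    finally show ?thesis using y(3) a by simp
  qed
  define x where "x = minv l' *\<^sub>v z"
  have x: "x \<in> carrier_vec n" using mlc z by (simp add: x_def)
  have lx: "l' *\<^sub>v x = z" unfolding x_def by (rule minv_mult_vec(2)[OF lc ld z])
  have "x \<noteq> 0\<^sub>v n"
  proof
    assume "x = 0\<^sub>v n"
    then have "nv z = 0" using isom_nv[OF ml z] by (simp add: x_def)
    then show False using z0 nv_eq_0[OF z] by blast
  qed
  moreover have "l *\<^sub>v x = H *\<^sub>v z" unfolding x_def H_def by (rule assoc_mult_mat_vec[symmetric, OF l mlc z])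
  ultimately show ?thesis using x lx Hz by (intro bexI[of _ x]) (auto simp: z_def)
qed

text \<open>Minimax: compare both singular values on a vector spanned by the first \<open>i + 1\<close> singular
  directions of \<open>B\<close> whose image under \<open>g\<^sub>2\<close> has no component along the first \<open>i\<close> ones of \<open>A\<close>.\<close>

lemma svd_minimax:
  assumes A: "svd n A k \<alpha> l" and B: "svd n B k' \<beta> l'" and i: "i < n"
    and g: "g1 \<in> carrier_mat n n" "g2 \<in> carrier_mat n n" and eq: "B = g1 * A * g2"
    and b1: "\<And>v. v \<in> carrier_vec n \<Longrightarrow> nv (g1 *\<^sub>v v) \<le> b1 * nv v" "0 \<le> b1"
    and b2: "\<And>v. v \<in> carrier_vec n \<Longrightarrow> nv (g2 *\<^sub>v v) \<le> b2 * nv v"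
  shows "av (\<beta> i) \<le> b1 * b2 * av (\<alpha> i)"
proof -
  note lc = isom_carrier[OF svd_isom(2)[OF A]] and lc' = isom_carrier[OF svd_isom(2)[OF B]] and Ac = svd_carrier[OF A]
  have lg: "l * g2 \<in> carrier_mat n n" using lc g by simp
  obtain x where x: "x \<in> carrier_vec n" "x \<noteq> 0\<^sub>v n" "\<forall>j. i < j \<and> j < n \<longrightarrow> (l' *\<^sub>v x) $ j = 0" "\<forall>j<i. ((l * g2) *\<^sub>v x) $ j = 0"
    using common_vector[OF lg svd_isom(2)[OF B] i] by blast
  have gx: "g2 *\<^sub>v x \<in> carrier_vec n" using g x by simp
  have x4: "(l *\<^sub>v (g2 *\<^sub>v x)) $ j = 0" if "j < i" for j
    using x(4) that assoc_mult_mat_vec[OF lc g(2) x(1)] by simp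
  have "av (\<beta> i) * nv x = av (\<beta> i) * nv (l' *\<^sub>v x)" using isom_nv[OF svd_isom(2)[OF B] x(1)] by simp
  also have "\<dots> = nv (\<beta> i \<cdot>\<^sub>v (l' *\<^sub>v x))" by simp
  also have "\<dots> \<le> 1 * nv (Matrix.vec n (\<lambda>j. \<beta> j * (l' *\<^sub>v x) $ j))"
  proof (rule nv_mono)
    fix j assume "j < dim_vec (Matrix.vec n (\<lambda>j. \<beta> j * (l' *\<^sub>v x) $ j))"
    then have j: "j < n" by simp
    show "av ((\<beta> i \<cdot>\<^sub>v (l' *\<^sub>v x)) $ j) \<le> 1 * av (Matrix.vec n (\<lambda>j. \<beta> j * (l' *\<^sub>v x) $ j) $ j)"
    proof (cases "i < j")
      case True then show ?thesis using x(3) j lc' x(1) by simp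
    next
      case False
      then have "av (\<beta> i) \<le> av (\<beta> j)" using svd_antimono[OF B, of j i] i by simp
      then show ?thesis using j lc' x(1) by (simp add: av_mult mult_right_mono del: index_mult_mat_vec)
    qed
  qed (use lc' in auto)
  also have "\<dots> = nv (B *\<^sub>v x)" using svd_nv[OF B x(1)] by simp
  also have "B *\<^sub>v x = g1 *\<^sub>v (A *\<^sub>v (g2 *\<^sub>v x))"
    unfolding eq using assoc_mult_mat_vec[OF mult_carrier_mat[OF g(1) Ac] g(2) x(1)] assoc_mult_mat_vec[OF g(1) Ac gx] by simp
  also have "nv \<dots> \<le> b1 * nv (A *\<^sub>v (g2 *\<^sub>v x))" by (rule b1(1)) (use Ac gx in simp)
  also have "nv (A *\<^sub>v (g2 *\<^sub>v x)) \<le> av (\<alpha> i) * nv (l *\<^sub>v (g2 *\<^sub>v x))"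
    unfolding svd_nv[OF A gx]
  proof (rule nv_mono)
    fix j assume "j < dim_vec (l *\<^sub>v (g2 *\<^sub>v x))"
    then have j: "j < n" using lc by simp
    show "av (Matrix.vec n (\<lambda>j. \<alpha> j * (l *\<^sub>v (g2 *\<^sub>v x)) $ j) $ j) \<le> av (\<alpha> i) * av ((l *\<^sub>v (g2 *\<^sub>v x)) $ j)"
    proof (cases "j < i")
      case True then show ?thesis using x4 j by simp
    next
      case False
      then have "av (\<alpha> j) \<le> av (\<alpha> i)" using svd_antimono[OF A, of i j] j by simp
      then show ?thesis using j by (simp add: av_mult mult_right_mono del: index_mult_mat_vec)
    qed
  qed (use lc in auto)
  also have "nv (l *\<^sub>v (g2 *\<^sub>v x)) = nv (g2 *\<^sub>v x)" by (rule isom_nv[OF svd_isom(2)[OF A] gx])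
  also have "\<dots> \<le> b2 * nv x" by (rule b2[OF x(1)])
  finally have "av (\<beta> i) * nv x \<le> b1 * (av (\<alpha> i) * (b2 * nv x))" using b1(2) by (simp add: mult_left_mono)
  then have "av (\<beta> i) * nv x \<le> (b1 * b2 * av (\<alpha> i)) * nv x" by (simp add: mult_ac)
  then show ?thesis using nv_pos[OF x(1,2)] by simp
qed

lemma svd_unique:
  assumes A: "svd n A k \<alpha> l" and B: "svd n A k' \<beta> l'" and i: "i < n"
  shows "av (\<alpha> i) = av (\<beta> i)"
proof -
  have "A = 1\<^sub>m n * A * 1\<^sub>m n" using svd_carrier[OF A] by simp
  then show ?thesis
    using svd_minimax[OF A B i one_carrier_mat one_carrier_mat, of 1 1] svd_minimax[OF B A i one_carrier_mat one_carrier_mat, of 1 1]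
    by (auto intro: order_antisym)
qed

end

lemma smult_mat_mult_vec:
  assumes "(A :: 'k::field mat) \<in> carrier_mat m n" "v \<in> carrier_vec n"
  shows "(c \<cdot>\<^sub>m A) *\<^sub>v v = c \<cdot>\<^sub>v (A *\<^sub>v v)"
  using assms by (intro eq_vecI) (auto simp: scalar_prod_def sum_distrib_left mult.assoc)

context local_abs
begin

lemma det_nonzero_of_lower_bound:
  assumes g: "g \<in> carrier_mat n n" and b: "\<And>v. v \<in> carrier_vec n \<Longrightarrow> nv v \<le> b * nv (g *\<^sub>v v)"
  shows "det g \<noteq> 0"
proof
  assume "det g = 0"
  then obtain v where v: "v \<in> carrier_vec n" "v \<noteq> 0\<^sub>v n" "g *\<^sub>v v = 0\<^sub>v n"
    using det_0_iff_vec_prod_zero[OF g] by blast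
  then show False using b[OF v(1)] nv_pos[OF v(1,2)] by simp
qed

text \<open>A vector of the attracting space of \<open>B\<close> is \<open>B *\<^sub>v w\<close>
  with \<open>w\<close> short, and \<open>A\<close> sends \<open>g2 *\<^sub>v w\<close> close to its
  own attracting space. The error is the gap of \<open>A\<close> times the condition numbers of
  \<open>g1\<close> and \<open>g2\<close>. One statement thus handles multiplication from the right,
  where the space hardly moves, and from the left, where it moves by \<open>g1\<close>.\<close>

lemma svd_perturb:
  assumes A: "svd n A k \<alpha> l" and B: "svd n B k' \<beta> l'" and p: "0 < p" "p < n" and dA: "det A \<noteq> 0"
    and g: "g1 \<in> carrier_mat n n" "g2 \<in> carrier_mat n n" and eq: "B = g1 * A * g2"
    and b1: "\<And>v. v \<in> carrier_vec n \<Longrightarrow> nv (g1 *\<^sub>v v) \<le> b1 * nv v" "\<And>v. v \<in> carrier_vec n \<Longrightarrow> nv v \<le> b1' * nv (g1 *\<^sub>v v)"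
    and b2: "\<And>v. v \<in> carrier_vec n \<Longrightarrow> nv (g2 *\<^sub>v v) \<le> b2 * nv v" "\<And>v. v \<in> carrier_vec n \<Longrightarrow> nv v \<le> b2' * nv (g2 *\<^sub>v v)"
    and pos: "0 < b1" "0 < b1'" "0 < b2" "0 < b2'"
  shows "near (b1 * b1' * b2 * b2' * (av (\<alpha> p) / av (\<alpha> (p - 1)))) (Sp n k' p) ((*\<^sub>v) g1 ` Sp n k p)" (is "near ?e _ _")
    and "near (b1 * b1' * b2 * b2' * (av (\<alpha> p) / av (\<alpha> (p - 1)))) ((*\<^sub>v) g1 ` Sp n k p) (Sp n k' p)"
proof -
  note Ac = svd_carrier[OF A] and Bc = svd_carrier[OF B]
  have dg1: "det g1 \<noteq> 0" by (rule det_nonzero_of_lower_bound[OF g(1) b1(2)])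
  have dg2: "det g2 \<noteq> 0" by (rule det_nonzero_of_lower_bound[OF g(2) b2(2)])
  have dB: "det B \<noteq> 0" unfolding eq
    using dg1 dg2 dA det_mult[OF mult_carrier_mat[OF g(1) Ac] g(2)] det_mult[OF g(1) Ac] by simp
  note m1 = minv[OF g(1) dg1] and m2 = minv[OF g(2) dg2]
  have kc: "k \<in> carrier_mat n n" "k' \<in> carrier_mat n n" using svd_isom[OF A] svd_isom[OF B] isom_carrier by auto
  have h1: "nv (minv g1 *\<^sub>v v) \<le> b1' * nv v" if "v \<in> carrier_vec n" for v
    using b1(2)[OF mult_mat_vec_carrier[OF m1(1) that]] minv_mult_vec(2)[OF g(1) dg1 that] by simp
  have h2: "nv (minv g2 *\<^sub>v v) \<le> b2' * nv v" if "v \<in> carrier_vec n" for v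
    using b2(2)[OF mult_mat_vec_carrier[OF m2(1) that]] minv_mult_vec(2)[OF g(2) dg2 that] by simp
  have Bv: "B *\<^sub>v v = g1 *\<^sub>v (A *\<^sub>v (g2 *\<^sub>v v))" if v: "v \<in> carrier_vec n" for v
    unfolding eq assoc_mult_mat_vec[OF mult_carrier_mat[OF g(1) Ac] g(2) v]
    by (rule assoc_mult_mat_vec[OF g(1) Ac]) (use g v in simp)
  have Aeq: "A = minv g1 * B * minv g2"
  proof (rule mat_eqI_vec[OF Ac])
    show "minv g1 * B * minv g2 \<in> carrier_mat n n" using m1 m2 Bc by auto
    fix v :: "'k vec" assume v: "v \<in> carrier_vec n"
    note mv = mult_mat_vec_carrier[OF m2(1) v]
    have "(minv g1 * B * minv g2) *\<^sub>v v = minv g1 *\<^sub>v (B *\<^sub>v (minv g2 *\<^sub>v v))"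
      unfolding assoc_mult_mat_vec[OF mult_carrier_mat[OF m1(1) Bc] m2(1) v]
      by (rule assoc_mult_mat_vec[OF m1(1) Bc mv])
    also have "\<dots> = A *\<^sub>v v"
      unfolding Bv[OF mv] minv_mult_vec(2)[OF g(2) dg2 v]
      by (rule minv_mult_vec(1)[OF g(1) dg1]) (use Ac v in simp)
    finally show "A *\<^sub>v v = (minv g1 * B * minv g2) *\<^sub>v v" by simp
  qed
  have a0: "0 < av (\<alpha> (p - 1))" "0 < av (\<alpha> p)" "0 < av (\<beta> (p - 1))"
    using svd_nonzero[OF A dA] svd_nonzero[OF B dB] p by (auto intro!: av_pos)
  \<comment> \<open>Minimax in both directions, for \<open>B\<close> in terms of \<open>A\<close>
    and for \<open>A\<close> in terms of \<open>B\<close>, lets the gap of \<open>A\<close> alone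
    appear in the bound.\<close>
  have up: "av (\<beta> p) \<le> b1 * b2 * av (\<alpha> p)"
    by (rule svd_minimax[OF A B p(2) g eq b1(1) _ b2(1)]) (use pos in auto)
  have "p - 1 < n" using p by simp
  then have lo: "av (\<alpha> (p - 1)) \<le> b1' * b2' * av (\<beta> (p - 1))"
    by (rule svd_minimax[OF B A _ m1(1) m2(1) Aeq h1 _ h2]) (use pos in auto)
  show "near ?e (Sp n k' p) ((*\<^sub>v) g1 ` Sp n k p)"
    unfolding near_def
  proof
    fix u assume u: "u \<in> Sp n k' p"
    obtain w where w: "w \<in> carrier_vec n" "B *\<^sub>v w = u" "av (\<beta> (p - 1)) * nv w \<le> nv u"
      using svd_expand[OF B u p(1) _ dB] p(2) by auto
    have gw: "g2 *\<^sub>v w \<in> carrier_vec n" using g w by simp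
    obtain v where v: "v \<in> Sp n k p" "nv (A *\<^sub>v (g2 *\<^sub>v w) - v) \<le> av (\<alpha> p) * nv (g2 *\<^sub>v w)"
      using svd_attract[OF A gw p(2)] by blast
    have vc: "v \<in> carrier_vec n" using v Sp_carrier[OF kc(1)] by blast
    have Agw: "A *\<^sub>v (g2 *\<^sub>v w) \<in> carrier_vec n" using Ac gw by simp
    have "nv (u - g1 *\<^sub>v v) = nv (g1 *\<^sub>v (A *\<^sub>v (g2 *\<^sub>v w) - v))"
      unfolding w(2)[symmetric] Bv[OF w(1)] using mult_minus_distrib_mat_vec[OF g(1) Agw vc] by simp
    also have "\<dots> \<le> b1 * nv (A *\<^sub>v (g2 *\<^sub>v w) - v)" by (rule b1(1)) (use Agw vc in simp)
    also have "\<dots> \<le> b1 * (av (\<alpha> p) * (b2 * nv w))"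
      using v(2) b2(1)[OF w(1)] pos by (meson av_nonneg less_imp_le mult_left_mono order_trans)
    finally have 1: "nv (u - g1 *\<^sub>v v) \<le> b1 * (av (\<alpha> p) * (b2 * nv w))" .
    have "av (\<alpha> (p - 1)) * nv w \<le> b1' * b2' * av (\<beta> (p - 1)) * nv w" using lo by (rule mult_right_mono) simp
    also have "\<dots> \<le> b1' * b2' * nv u" using w(3) pos by (simp add: mult.assoc)
    finally have "nv w \<le> b1' * b2' * nv u / av (\<alpha> (p - 1))" using a0 by (simp add: field_simps)
    then have "b1 * (av (\<alpha> p) * (b2 * nv w)) \<le> b1 * (av (\<alpha> p) * (b2 * (b1' * b2' * nv u / av (\<alpha> (p - 1)))))"
      using pos by (intro mult_left_mono) auto
    then show "\<exists>y\<in>(*\<^sub>v) g1 ` Sp n k p. nv (u - y) \<le> ?e * nv u"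
      using 1 v(1) by (intro bexI[of _ "g1 *\<^sub>v v"]) (auto simp: mult_ac)
  qed
  show "near ?e ((*\<^sub>v) g1 ` Sp n k p) (Sp n k' p)"
    unfolding near_def
  proof
    fix x assume "x \<in> (*\<^sub>v) g1 ` Sp n k p"
    then obtain v where v: "v \<in> Sp n k p" "x = g1 *\<^sub>v v" by blast
    have vc: "v \<in> carrier_vec n" using v Sp_carrier[OF kc(1)] by blast
    obtain w where w: "w \<in> carrier_vec n" "A *\<^sub>v w = v" "av (\<alpha> (p - 1)) * nv w \<le> nv v"
      using svd_expand[OF A v(1) p(1) _ dA] p(2) by auto
    note mw = mult_mat_vec_carrier[OF m2(1) w(1)]
    have Bx: "B *\<^sub>v (minv g2 *\<^sub>v w) = x"
      unfolding Bv[OF mw] minv_mult_vec(2)[OF g(2) dg2 w(1)] w(2) v(2) ..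
    obtain u where u: "u \<in> Sp n k' p" "nv (x - u) \<le> av (\<beta> p) * nv (minv g2 *\<^sub>v w)"
      using svd_attract[OF B mw p(2)] unfolding Bx by blast
    have "av (\<beta> p) * nv (minv g2 *\<^sub>v w) \<le> (b1 * b2 * av (\<alpha> p)) * (b2' * nv w)"
      using up h2[OF w(1)] pos by (intro mult_mono) auto
    moreover have "nv w \<le> b1' * nv x / av (\<alpha> (p - 1))"
      using w(3) b1(2)[OF vc] a0 unfolding v(2) by (simp add: field_simps)
    then have "(b1 * b2 * av (\<alpha> p)) * (b2' * nv w) \<le> (b1 * b2 * av (\<alpha> p)) * (b2' * (b1' * nv x / av (\<alpha> (p - 1))))"
      using pos by (intro mult_left_mono) auto
    ultimately show "\<exists>u\<in>Sp n k' p. nv (x - u) \<le> ?e * nv x" using u by (intro bexI[of _ u]) (auto simp: mult_ac)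
  qed
qed

definition rev_mat :: "nat \<Rightarrow> 'k mat" where
  "rev_mat n = Matrix.mat n n (\<lambda>(i, j). if j = n - 1 - i then 1 else 0)"

lemma rev_mat_carrier: "rev_mat n \<in> carrier_mat n n" by (simp add: rev_mat_def)

lemma rev_mat_vec: "y \<in> carrier_vec n \<Longrightarrow> rev_mat n *\<^sub>v y = Matrix.vec n (\<lambda>i. y $ (n - 1 - i))"
proof (rule eq_vecI)
  fix i assume y: "y \<in> carrier_vec n" and "i < dim_vec (Matrix.vec n (\<lambda>i. y $ (n - 1 - i)))"
  then have i: "i < n" by simp
  then have "(rev_mat n *\<^sub>v y) $ i = (\<Sum>j = 0..<n. (if j = n - 1 - i then 1 else 0) * y $ j)"
    using y by (auto simp: rev_mat_def scalar_prod_def intro!: sum.cong)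
  also have "\<dots> = (\<Sum>j = 0..<n. if j = n - 1 - i then y $ j else 0)" by (rule sum.cong) auto
  also have "\<dots> = y $ (n - 1 - i)" using i by simp
  finally show "(rev_mat n *\<^sub>v y) $ i = Matrix.vec n (\<lambda>i. y $ (n - 1 - i)) $ i" using i by simp
qed (simp add: rev_mat_def)

lemma rev_mat_isom: "rev_mat n \<in> isom n"
proof -
  have "nv (rev_mat n *\<^sub>v y) = nv y" if y: "y \<in> carrier_vec n" for y
  proof -
    have "nv (rev_mat n *\<^sub>v y) = onb_norm av {..<n} (\<lambda>i. y $ (n - 1 - i))"
      unfolding rev_mat_vec[OF y] nv_def dim_vec by (rule onb_norm_cong) simp
    also have "\<dots> = onb_norm av {..<n} (\<lambda>i. y $ i)"
    proof (cases "ultrametric av")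
      case True
      have "(\<lambda>i. av (y $ (n - 1 - i))) ` {..<n} = (\<lambda>i. av (y $ i)) ` {..<n}"
      proof (intro equalityI subsetI)
        fix x assume "x \<in> (\<lambda>i. av (y $ i)) ` {..<n}"
        then obtain i where "i < n" "x = av (y $ i)" by auto
        then show "x \<in> (\<lambda>i. av (y $ (n - 1 - i))) ` {..<n}" by (intro image_eqI[of _ _ "n - 1 - i"]) auto
      qed auto
      then show ?thesis using True by (simp add: onb_norm_def)
    next
      case False
      then show ?thesis using sum.nat_diff_reindex[of "\<lambda>i. (av (y $ i))\<^sup>2" n] by (simp add: onb_norm_def)
    qed
    also have "\<dots> = nv y" using y by (simp add: nv_def)
    finally show ?thesis .
  qed
  then show ?thesis using rev_mat_carrier by (simp add: isom_def)
qed

text \<open>Inverting \<open>k * mat_diag n \<alpha> * l\<close> inverts the diagonal and hence its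
  order. Inserting the order-reversing isometry \<open>rev_mat n\<close> on both sides makes it
  decreasing again, and uniqueness of singular values identifies the result with the decomposition
  of \<open>B\<close>.\<close>

lemma svd_inverse:
  assumes A: "svd n A k \<alpha> l" and B: "svd n B k' \<beta> l'" and dA: "det A \<noteq> 0"
    and eq: "A * B = c \<cdot>\<^sub>m 1\<^sub>m n" and i: "i < n"
  shows "av (\<beta> i) = av c / av (\<alpha> (n - 1 - i))"
proof -
  note Ac = svd_carrier[OF A] and Bc = svd_carrier[OF B] and kl = svd_isom[OF A]
  note mk = isom_minv[OF kl(1)] and ml = isom_minv[OF kl(2)] and kc = isom_carrier[OF kl(1)] and lc = isom_carrier[OF kl(2)]
  let ?J = "rev_mat n"
  define \<gamma> where "\<gamma> i = c / \<alpha> (n - 1 - i)" for i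
  define P where "P = minv l * ?J"
  define Q where "Q = ?J * minv k"
  have P: "P \<in> isom n" and Q: "Q \<in> isom n" unfolding P_def Q_def using mk ml rev_mat_isom isom_mult by auto
  note Pc = isom_carrier[OF P] and Qc = isom_carrier[OF Q]
  have PQ: "svd n (P * mat_diag n \<gamma> * Q) P \<gamma> Q"
    unfolding svd_def
  proof (intro conjI allI impI P Q refl)
    fix i j assume "i \<le> j \<and> j < n"
    then have "av (\<alpha> (n - 1 - i)) \<le> av (\<alpha> (n - 1 - j))" "0 < av (\<alpha> (n - 1 - i))" "0 < av (\<alpha> (n - 1 - j))"
      using svd_antimono[OF A, of "n - 1 - j" "n - 1 - i"] by (auto intro!: av_pos svd_nonzero[OF A dA])
    then show "av (\<gamma> j) \<le> av (\<gamma> i)" unfolding \<gamma>_def av_divide by (intro divide_left_mono mult_pos_pos) auto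
  qed
  have "B = P * mat_diag n \<gamma> * Q"
  proof (rule mat_eqI_vec[OF Bc])
    show "P * mat_diag n \<gamma> * Q \<in> carrier_mat n n" by (rule svd_carrier[OF PQ])
    fix v :: "'k vec" assume v: "v \<in> carrier_vec n"
    define y where "y = minv k *\<^sub>v v"
    have y: "y \<in> carrier_vec n" using isom_carrier[OF mk] v by (simp add: y_def)
    define z where "z = Matrix.vec n (\<lambda>i. c / \<alpha> i * y $ i)"
    have z: "z \<in> carrier_vec n" by (simp add: z_def)
    have Qv: "Q *\<^sub>v v = Matrix.vec n (\<lambda>i. y $ (n - 1 - i))"
      unfolding Q_def assoc_mult_mat_vec[OF rev_mat_carrier isom_carrier[OF mk] v] y_def[symmetric] by (rule rev_mat_vec[OF y])
    define x where "x = Matrix.vec n (\<lambda>i. \<gamma> i * (Q *\<^sub>v v) $ i)"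
    have x: "x \<in> carrier_vec n" by (simp add: x_def)
    have "(P * mat_diag n \<gamma> * Q) *\<^sub>v v = minv l *\<^sub>v (?J *\<^sub>v x)"
      unfolding svd_vec[OF PQ v] x_def[symmetric] unfolding P_def by (rule assoc_mult_mat_vec[OF isom_carrier[OF ml] rev_mat_carrier x])
    also have "?J *\<^sub>v x = z"
      unfolding rev_mat_vec[OF x] unfolding x_def Qv z_def \<gamma>_def by (rule eq_vecI) auto
    finally have 1: "(P * mat_diag n \<gamma> * Q) *\<^sub>v v = minv l *\<^sub>v z" .
    have lz: "l *\<^sub>v (minv l *\<^sub>v z) = z" by (rule minv_mult_vec(2)[OF lc isom_det[OF kl(2)] z])
    have mz: "minv l *\<^sub>v z \<in> carrier_vec n" using isom_carrier[OF ml] z by simp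
    have "Matrix.vec n (\<lambda>i. \<alpha> i * z $ i) = c \<cdot>\<^sub>v y"
      using y svd_nonzero[OF A dA] by (intro eq_vecI) (auto simp: z_def)
    then have "A *\<^sub>v (minv l *\<^sub>v z) = c \<cdot>\<^sub>v (k *\<^sub>v y)"
      unfolding svd_vec[OF A mz] lz using mult_mat_vec[OF kc y] by simp
    also have "k *\<^sub>v y = v" unfolding y_def by (rule minv_mult_vec(2)[OF kc isom_det[OF kl(1)] v])
    also have "c \<cdot>\<^sub>v v = A *\<^sub>v (B *\<^sub>v v)"
    proof -
      have "A *\<^sub>v (B *\<^sub>v v) = (c \<cdot>\<^sub>m 1\<^sub>m n) *\<^sub>v v" unfolding eq[symmetric] by (rule assoc_mult_mat_vec[symmetric, OF Ac Bc v])
      also have "\<dots> = c \<cdot>\<^sub>v v" using v smult_mat_mult_vec[of "1\<^sub>m n" n n v c] by simp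
      finally show ?thesis by simp
    qed
    finally have "minv A *\<^sub>v (A *\<^sub>v (minv l *\<^sub>v z)) = minv A *\<^sub>v (A *\<^sub>v (B *\<^sub>v v))" by simp
    then have "minv l *\<^sub>v z = B *\<^sub>v v" using minv_mult_vec(1)[OF Ac dA] mz Bc v by simp
    then show "B *\<^sub>v v = (P * mat_diag n \<gamma> * Q) *\<^sub>v v" using 1 by simp
  qed
  then have "av (\<beta> i) = av (\<gamma> i)" using svd_unique[OF B _ i] PQ by blast
  then show ?thesis by (simp add: \<gamma>_def av_divide)
qed

end

section \<open>Limit maps of Anosov representations\<close>

text \<open>A lift to matrices that is multiplicative up to scalars. Attracting spaces and ratios of
  singular values do not see the scalars. \<open>K\<close> is a parameter because the definition of
  the limit map fixes one Cartan decomposition per group element.\<close>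

locale projective_rep = local_abs av + hyp_group G S \<delta>
  for av :: "'k::field \<Rightarrow> real" and G :: "('g, 'm) monoid_scheme" (structure) and S \<delta> +
  fixes N :: nat and R :: "'g \<Rightarrow> 'k mat" and K :: "'g \<Rightarrow> 'k mat"
  assumes R_carrier: "\<gamma> \<in> carrier G \<Longrightarrow> R \<gamma> \<in> carrier_mat N N"
    and R_det: "\<gamma> \<in> carrier G \<Longrightarrow> det (R \<gamma>) \<noteq> 0"
    and R_mult: "\<gamma> \<in> carrier G \<Longrightarrow> \<gamma>' \<in> carrier G \<Longrightarrow> \<exists>c. c \<noteq> 0 \<and> R (\<gamma> \<otimes> \<gamma>') = c \<cdot>\<^sub>m (R \<gamma> * R \<gamma>')"
    and R_svd: "\<gamma> \<in> carrier G \<Longrightarrow> \<exists>\<alpha> l. svd N (R \<gamma>) (K \<gamma>) \<alpha> l"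
begin

lemma K_isom: "\<gamma> \<in> carrier G \<Longrightarrow> K \<gamma> \<in> isom N" using R_svd svd_isom by blast

definition U :: "nat \<Rightarrow> 'g \<Rightarrow> 'k vec set" where "U p \<gamma> = Sp N (K \<gamma>) p"

lemma U_carrier: "\<gamma> \<in> carrier G \<Longrightarrow> U p \<gamma> \<subseteq> carrier_vec N"
  unfolding U_def by (rule Sp_carrier[OF isom_carrier[OF K_isom]])

text \<open>The Anosov condition with the exponential written as a power of \<tau>, demanded of
  every decomposition, so that it may be applied to whichever one is at hand.\<close>

definition gapped :: "nat \<Rightarrow> bool" where
  "gapped p \<longleftrightarrow> (\<exists>c>0. \<exists>\<tau>. 0 < \<tau> \<and> \<tau> < 1 \<and> (\<forall>\<gamma>\<in>carrier G. \<forall>k \<alpha> l. svd N (R \<gamma>) k \<alpha> l \<longrightarrow>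
    av (\<alpha> p) / av (\<alpha> (p - 1)) \<le> c * \<tau> ^ len \<gamma>))"

lemma R_one: "\<exists>c. c \<noteq> 0 \<and> R \<one> = c \<cdot>\<^sub>m 1\<^sub>m N"
proof -
  note c1 = R_carrier[OF one_closed] and d1 = R_det[OF one_closed]
  obtain c where c: "c \<noteq> 0" "R \<one> = c \<cdot>\<^sub>m (R \<one> * R \<one>)" using R_mult[of \<one> \<one>] by auto
  have "1\<^sub>m N = minv (R \<one>) * R \<one>" using minv(2)[OF c1 d1] by simp
  also have "\<dots> = minv (R \<one>) * (c \<cdot>\<^sub>m (R \<one> * R \<one>))" using c by simp
  also have "\<dots> = c \<cdot>\<^sub>m ((minv (R \<one>) * R \<one>) * R \<one>)"
    using mult_smult_distrib[OF minv(1)[OF c1 d1] mult_carrier_mat[OF c1 c1], of c]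
      assoc_mult_mat[OF minv(1)[OF c1 d1] c1 c1] by simp
  also have "\<dots> = c \<cdot>\<^sub>m R \<one>" using minv(2)[OF c1 d1] c1 by simp
  finally have "inverse c \<cdot>\<^sub>m 1\<^sub>m N = inverse c \<cdot>\<^sub>m (c \<cdot>\<^sub>m R \<one>)" by simp
  also have "\<dots> = R \<one>" using c(1) c1 by (intro eq_matI) auto
  finally show ?thesis using c(1) by (intro exI[of _ "inverse c"]) simp
qed

lemma R_inv: "\<gamma> \<in> carrier G \<Longrightarrow> \<exists>c. c \<noteq> 0 \<and> R \<gamma> * R (inv \<gamma>) = c \<cdot>\<^sub>m 1\<^sub>m N"
proof -
  assume g: "\<gamma> \<in> carrier G"
  obtain c where c: "c \<noteq> 0" "R (\<gamma> \<otimes> inv \<gamma>) = c \<cdot>\<^sub>m (R \<gamma> * R (inv \<gamma>))" using R_mult[of \<gamma> "inv \<gamma>"] g by auto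
  obtain b where b: "b \<noteq> 0" "R \<one> = b \<cdot>\<^sub>m 1\<^sub>m N" using R_one by blast
  have eq: "c \<cdot>\<^sub>m (R \<gamma> * R (inv \<gamma>)) = b \<cdot>\<^sub>m 1\<^sub>m N" using c b g by simp
  have "inverse c \<cdot>\<^sub>m (c \<cdot>\<^sub>m (R \<gamma> * R (inv \<gamma>))) = R \<gamma> * R (inv \<gamma>)"
    using c(1) R_carrier[OF g] R_carrier[of "inv \<gamma>"] g by (intro eq_matI) auto
  then have "R \<gamma> * R (inv \<gamma>) = inverse c \<cdot>\<^sub>m (b \<cdot>\<^sub>m 1\<^sub>m N)" unfolding eq by simp
  also have "\<dots> = (inverse c * b) \<cdot>\<^sub>m 1\<^sub>m N" by (intro eq_matI) auto
  finally have "R \<gamma> * R (inv \<gamma>) = (inverse c * b) \<cdot>\<^sub>m 1\<^sub>m N" .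
  then show ?thesis using b c by (intro exI[of _ "inverse c * b"]) simp
qed

text \<open>Inversion reverses the singular values and preserves word length, so the gap at
  \<open>p\<close> for the inverse element is the gap at \<open>N - p\<close> for the element
  itself.\<close>

lemma gapped_dual:
  assumes p: "0 < p" "p < N" and g: "gapped p"
  shows "gapped (N - p)"
proof -
  obtain c \<tau> where c: "c > 0" "0 < \<tau>" "\<tau> < 1" and
    gap: "\<And>\<gamma> k \<alpha> l. \<gamma> \<in> carrier G \<Longrightarrow> svd N (R \<gamma>) k \<alpha> l \<Longrightarrow> av (\<alpha> p) / av (\<alpha> (p - 1)) \<le> c * \<tau> ^ len \<gamma>"
    using g unfolding gapped_def by blast
  have "av (\<beta> (N - p)) / av (\<beta> (N - p - 1)) \<le> c * \<tau> ^ len \<gamma>" if \<gamma>: "\<gamma> \<in> carrier G" and B: "svd N (R \<gamma>) k \<beta> l" for \<gamma> k \<beta> l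
  proof -
    have ig: "inv \<gamma> \<in> carrier G" using \<gamma> by simp
    obtain \<alpha> l' where A: "svd N (R (inv \<gamma>)) (K (inv \<gamma>)) \<alpha> l'" using R_svd[OF ig] by blast
    obtain b where b: "b \<noteq> 0" "R (inv \<gamma>) * R \<gamma> = b \<cdot>\<^sub>m 1\<^sub>m N" using R_inv[OF ig] \<gamma> by auto
    note s = svd_inverse[OF A B R_det[OF ig] b(2)]
    have "av (\<beta> (N - p)) = av b / av (\<alpha> (p - 1))" "av (\<beta> (N - p - 1)) = av b / av (\<alpha> p)"
      using s[of "N - p"] s[of "N - p - 1"] p by (auto simp: Suc_diff_Suc)
    then have "av (\<beta> (N - p)) / av (\<beta> (N - p - 1)) = av (\<alpha> p) / av (\<alpha> (p - 1))"
      using b(1) by simp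
    then show ?thesis using gap[OF ig A] len_inv[OF \<gamma>] by simp
  qed
  then show ?thesis unfolding gapped_def using c by blast
qed

lemma R_condition:
  assumes "\<gamma> \<in> carrier G"
  shows "\<exists>b b'. 0 < b \<and> 0 < b' \<and> (\<forall>v\<in>carrier_vec N. nv (R \<gamma> *\<^sub>v v) \<le> b * nv v \<and> nv v \<le> b' * nv (R \<gamma> *\<^sub>v v))"
proof -
  note c = R_carrier[OF assms] and d = R_det[OF assms]
  obtain b where b: "b > 0" "\<And>v. v \<in> carrier_vec N \<Longrightarrow> nv (R \<gamma> *\<^sub>v v) \<le> b * nv v" using mult_mat_vec_bounded[OF c] by blast
  obtain b' where b': "b' > 0" "\<And>v. v \<in> carrier_vec N \<Longrightarrow> nv (minv (R \<gamma>) *\<^sub>v v) \<le> b' * nv v"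
    using mult_mat_vec_bounded[OF minv(1)[OF c d]] by blast
  have "nv v \<le> b' * nv (R \<gamma> *\<^sub>v v)" if v: "v \<in> carrier_vec N" for v
    using b'(2)[OF mult_mat_vec_carrier[OF c v]] minv_mult_vec(1)[OF c d v] by simp
  then show ?thesis using b b' by blast
qed

text \<open>Balls of the word metric are finite. What is bounded is the product
  \<open>b * b'\<close>, a condition number; it does not depend on the lift, in contrast to the two
  factors.\<close>

lemma R_condition_uniform:
  "\<exists>\<kappa>\<ge>1. \<forall>\<gamma>\<in>carrier G. len \<gamma> \<le> m \<longrightarrow> (\<exists>b b'. 0 < b \<and> 0 < b' \<and> b * b' \<le> \<kappa> \<and>
    (\<forall>v\<in>carrier_vec N. nv (R \<gamma> *\<^sub>v v) \<le> b * nv v \<and> nv v \<le> b' * nv (R \<gamma> *\<^sub>v v)))"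
proof -
  obtain b b' where b: "\<And>\<gamma>. \<gamma> \<in> carrier G \<Longrightarrow> 0 < b \<gamma> \<and> 0 < b' \<gamma> \<and>
      (\<forall>v\<in>carrier_vec N. nv (R \<gamma> *\<^sub>v v) \<le> b \<gamma> * nv v \<and> nv v \<le> b' \<gamma> * nv (R \<gamma> *\<^sub>v v))"
    using R_condition by metis
  define \<kappa> where "\<kappa> = Max (insert 1 ((\<lambda>\<gamma>. b \<gamma> * b' \<gamma>) ` {\<gamma> \<in> carrier G. len \<gamma> \<le> m}))"
  have fin: "finite (insert 1 ((\<lambda>\<gamma>. b \<gamma> * b' \<gamma>) ` {\<gamma> \<in> carrier G. len \<gamma> \<le> m}))" using finite_ball by simp
  have "1 \<le> \<kappa>" unfolding \<kappa>_def by (rule Max_ge[OF fin]) simp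
  moreover have "b \<gamma> * b' \<gamma> \<le> \<kappa>" if "\<gamma> \<in> carrier G" "len \<gamma> \<le> m" for \<gamma>
    unfolding \<kappa>_def by (rule Max_ge[OF fin]) (use that in auto)
  ultimately show ?thesis using b by meson
qed

lemma scaled_bounds:
  assumes "g \<in> carrier_mat N N" "c \<noteq> 0" "v \<in> carrier_vec N"
    "nv (g *\<^sub>v v) \<le> b * nv v" "nv v \<le> b' * nv (g *\<^sub>v v)"
  shows "nv ((c \<cdot>\<^sub>m g) *\<^sub>v v) \<le> (av c * b) * nv v" "nv v \<le> (b' / av c) * nv ((c \<cdot>\<^sub>m g) *\<^sub>v v)"
  using assms av_pos[OF assms(2)] smult_mat_mult_vec[of g N N v c]
  by (auto simp: mult.assoc mult_left_mono)

text \<open>Right multiplication by a bounded element changes the decomposition only on the side of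
  the source, so the attracting space moves by the size of the gap: \<open>svd_perturb\<close> with
  \<open>g1\<close> the identity.\<close>

lemma U_right:
  assumes p: "0 < p" "p < N" and g: "gapped p"
  shows "\<exists>C>0. \<exists>\<tau>. 0 < \<tau> \<and> \<tau> < 1 \<and> (\<forall>\<gamma>\<in>carrier G. \<forall>s\<in>carrier G. len s \<le> m \<longrightarrow>
    near (C * \<tau> ^ len \<gamma>) (U p (\<gamma> \<otimes> s)) (U p \<gamma>) \<and> near (C * \<tau> ^ len \<gamma>) (U p \<gamma>) (U p (\<gamma> \<otimes> s)))"
proof -
  obtain c \<tau> where c: "c > 0" "0 < \<tau>" "\<tau> < 1" and
    gap: "\<And>\<gamma> k \<alpha> l. \<gamma> \<in> carrier G \<Longrightarrow> svd N (R \<gamma>) k \<alpha> l \<Longrightarrow> av (\<alpha> p) / av (\<alpha> (p - 1)) \<le> c * \<tau> ^ len \<gamma>"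
    using g unfolding gapped_def by blast
  obtain \<kappa> where \<kappa>: "1 \<le> \<kappa>" "\<And>s. s \<in> carrier G \<Longrightarrow> len s \<le> m \<Longrightarrow> \<exists>b b'. 0 < b \<and> 0 < b' \<and> b * b' \<le> \<kappa> \<and>
    (\<forall>v\<in>carrier_vec N. nv (R s *\<^sub>v v) \<le> b * nv v \<and> nv v \<le> b' * nv (R s *\<^sub>v v))"
    using R_condition_uniform[of m] by blast
  have "near (\<kappa> * c * \<tau> ^ len \<gamma>) (U p (\<gamma> \<otimes> s)) (U p \<gamma>) \<and> near (\<kappa> * c * \<tau> ^ len \<gamma>) (U p \<gamma>) (U p (\<gamma> \<otimes> s))"
    if \<gamma>: "\<gamma> \<in> carrier G" and s: "s \<in> carrier G" "len s \<le> m" for \<gamma> s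
  proof -
    note cc = R_carrier[OF \<gamma>] R_carrier[OF s(1)]
    obtain b b' where b: "0 < b" "0 < b'" "b * b' \<le> \<kappa>"
      and bb: "\<And>v. v \<in> carrier_vec N \<Longrightarrow> nv (R s *\<^sub>v v) \<le> b * nv v" "\<And>v. v \<in> carrier_vec N \<Longrightarrow> nv v \<le> b' * nv (R s *\<^sub>v v)"
      using \<kappa>(2)[OF s] by blast
    obtain a where a: "a \<noteq> 0" "R (\<gamma> \<otimes> s) = a \<cdot>\<^sub>m (R \<gamma> * R s)" using R_mult[OF \<gamma> s(1)] by blast
    obtain \<alpha> l where A: "svd N (R \<gamma>) (K \<gamma>) \<alpha> l" using R_svd[OF \<gamma>] by blast
    obtain \<beta> l' where B: "svd N (R (\<gamma> \<otimes> s)) (K (\<gamma> \<otimes> s)) \<beta> l'" using R_svd[of "\<gamma> \<otimes> s"] \<gamma> s by auto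
    have eq: "R (\<gamma> \<otimes> s) = 1\<^sub>m N * R \<gamma> * (a \<cdot>\<^sub>m R s)" using a(2) cc mult_smult_distrib[OF cc] by simp
    have im: "(*\<^sub>v) (1\<^sub>m N) ` Sp N (K \<gamma>) p = Sp N (K \<gamma>) p"
      using U_carrier[OF \<gamma>, of p] by (force simp: U_def image_iff)
    note sb = scaled_bounds[OF cc(2) a(1) _ bb]
    have one: "nv (1\<^sub>m N *\<^sub>v v) \<le> 1 * nv v" "nv v \<le> 1 * nv (1\<^sub>m N *\<^sub>v v)" if "v \<in> carrier_vec N" for v using that by auto
    have pos: "0 < av a * b" "0 < b' / av a" using a b av_pos by auto
    have "a \<cdot>\<^sub>m R s \<in> carrier_mat N N" using cc by simp
    note P = svd_perturb[OF A B p R_det[OF \<gamma>] one_carrier_mat this eq one sb _ _ pos, unfolded im]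
    have e: "1 * 1 * (av a * b) * (b' / av a) * (av (\<alpha> p) / av (\<alpha> (p - 1))) \<le> \<kappa> * c * \<tau> ^ len \<gamma>"
    proof -
      have "1 * 1 * (av a * b) * (b' / av a) = b * b'" using a(1) by simp
      moreover have "(b * b') * (av (\<alpha> p) / av (\<alpha> (p - 1))) \<le> \<kappa> * (c * \<tau> ^ len \<gamma>)"
        using b gap[OF \<gamma> A] \<kappa>(1) by (intro mult_mono) auto
      ultimately show ?thesis by (simp add: mult.assoc)
    qed
    show ?thesis unfolding U_def using near_mono[OF P(1) e] near_mono[OF P(2) e] by simp
  qed
  then show ?thesis using c \<kappa>(1) by (intro exI[of _ "\<kappa> * c"]) auto
qed

text \<open>Equivariance up to the gap: \<open>svd_perturb\<close> with \<open>g1 = R h\<close> and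
  \<open>g2\<close> a scalar matrix. The error tends to 0 along a ray, which makes the limit exactly
  equivariant.\<close>

lemma U_left:
  assumes p: "0 < p" "p < N" and g: "gapped p" and h: "h \<in> carrier G"
  shows "\<exists>C>0. \<exists>\<tau>. 0 < \<tau> \<and> \<tau> < 1 \<and> (\<forall>\<gamma>\<in>carrier G.
    near (C * \<tau> ^ len \<gamma>) (U p (h \<otimes> \<gamma>)) ((*\<^sub>v) (R h) ` U p \<gamma>) \<and> near (C * \<tau> ^ len \<gamma>) ((*\<^sub>v) (R h) ` U p \<gamma>) (U p (h \<otimes> \<gamma>)))"
proof -
  obtain c \<tau> where c: "c > 0" "0 < \<tau>" "\<tau> < 1" and
    gap: "\<And>\<gamma> k \<alpha> l. \<gamma> \<in> carrier G \<Longrightarrow> svd N (R \<gamma>) k \<alpha> l \<Longrightarrow> av (\<alpha> p) / av (\<alpha> (p - 1)) \<le> c * \<tau> ^ len \<gamma>"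
    using g unfolding gapped_def by blast
  obtain b b' where b: "0 < b" "0 < b'"
    and bb: "\<And>v. v \<in> carrier_vec N \<Longrightarrow> nv (R h *\<^sub>v v) \<le> b * nv v" "\<And>v. v \<in> carrier_vec N \<Longrightarrow> nv v \<le> b' * nv (R h *\<^sub>v v)"
    using R_condition[OF h] by blast
  have "near (b * b' * c * \<tau> ^ len \<gamma>) (U p (h \<otimes> \<gamma>)) ((*\<^sub>v) (R h) ` U p \<gamma>) \<and>
      near (b * b' * c * \<tau> ^ len \<gamma>) ((*\<^sub>v) (R h) ` U p \<gamma>) (U p (h \<otimes> \<gamma>))"
    if \<gamma>: "\<gamma> \<in> carrier G" for \<gamma>
  proof -
    note cc = R_carrier[OF h] R_carrier[OF \<gamma>]
    obtain a where a: "a \<noteq> 0" "R (h \<otimes> \<gamma>) = a \<cdot>\<^sub>m (R h * R \<gamma>)" using R_mult[OF h \<gamma>] by blast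
    obtain \<alpha> l where A: "svd N (R \<gamma>) (K \<gamma>) \<alpha> l" using R_svd[OF \<gamma>] by blast
    obtain \<beta> l' where B: "svd N (R (h \<otimes> \<gamma>)) (K (h \<otimes> \<gamma>)) \<beta> l'" using R_svd[of "h \<otimes> \<gamma>"] \<gamma> h by auto
    have eq: "R (h \<otimes> \<gamma>) = R h * R \<gamma> * (a \<cdot>\<^sub>m 1\<^sub>m N)"
      using a(2) cc mult_smult_distrib[OF mult_carrier_mat[OF cc] one_carrier_mat, of a] by simp
    have one: "nv (1\<^sub>m N *\<^sub>v v) \<le> 1 * nv v" "nv v \<le> 1 * nv (1\<^sub>m N *\<^sub>v v)" if "v \<in> carrier_vec N" for v using that by auto
    note sb = scaled_bounds[OF one_carrier_mat a(1) _ one]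
    have pos: "0 < av a * 1" "0 < 1 / av a" using a av_pos by auto
    have "a \<cdot>\<^sub>m 1\<^sub>m N \<in> carrier_mat N N" by simp
    note P = svd_perturb[OF A B p R_det[OF \<gamma>] cc(1) this eq bb sb b pos]
    have e: "b * b' * (av a * 1) * (1 / av a) * (av (\<alpha> p) / av (\<alpha> (p - 1))) \<le> b * b' * c * \<tau> ^ len \<gamma>"
    proof -
      have "b * b' * (av a * 1) * (1 / av a) = b * b'" using a(1) by simp
      moreover have "(b * b') * (av (\<alpha> p) / av (\<alpha> (p - 1))) \<le> (b * b') * (c * \<tau> ^ len \<gamma>)"
        using b gap[OF \<gamma> A] by (intro mult_left_mono) auto
      ultimately show ?thesis by (simp add: mult.assoc)
    qed
    show ?thesis unfolding U_def using near_mono[OF P(1) e] near_mono[OF P(2) e] by simp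
  qed
  then show ?thesis using c b by (intro exI[of _ "b * b' * c"]) auto
qed

text \<open>A weakening of a ray from the identity: steps of length at most 1, and word length
  growing linearly up to the defect \<open>D\<close>. The class contains translates of rays and
  broken geodesics, and the convergence rate will depend on \<open>D\<close> alone.\<close>

definition path :: "nat \<Rightarrow> (nat \<Rightarrow> 'g) \<Rightarrow> bool" where
  "path D q \<longleftrightarrow> (\<forall>n. q n \<in> carrier G) \<and> (\<forall>n. d (q n) (q (Suc n)) \<le> 1) \<and> (\<forall>n. n \<le> len (q n) + D)"

lemma ray_path: "\<eta> \<in> rays \<Longrightarrow> path (len (\<eta> 0)) \<eta>"
  unfolding path_def
proof (intro conjI allI)
  fix n assume r: "\<eta> \<in> rays"
  note c = ray_carrier[OF r]
  show "\<eta> n \<in> carrier G" by (rule c)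
  show "d (\<eta> n) (\<eta> (Suc n)) \<le> 1" using ray_d[OF r, of n "Suc n"] by simp
  show "n \<le> len (\<eta> n) + len (\<eta> 0)"
    using d_triangle[OF c one_closed c, of 0 n] ray_d0[OF r, of n] d_commute[OF c one_closed, of 0] d_one[OF c] by simp
qed

definition tail_bound :: "real \<Rightarrow> real \<Rightarrow> nat \<Rightarrow> (nat \<Rightarrow> 'g) \<Rightarrow> 'k vec set \<Rightarrow> bool" where
  "tail_bound C \<tau> p q V \<longleftrightarrow> (\<forall>n. near (C * \<tau> ^ n) (U p (q n)) V \<and> near (C * \<tau> ^ n) V (U p (q n)))"

lemma exp_minus_one_le: "0 \<le> x \<Longrightarrow> exp x - 1 \<le> x * exp (x :: real)"
proof -
  assume x: "0 \<le> x"
  have "1 - x \<le> exp (- x)" using exp_ge_add_one_self[of "- x"] by simp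
  then have "(1 - x) * exp x \<le> exp (- x) * exp x" by (intro mult_right_mono) auto
  then show ?thesis by (simp add: exp_minus algebra_simps)
qed

text \<open>The steps \<open>1 + C \<tau>\<^sup>i\<close> multiply up to a convergent product, so \<open>U p (q n)\<close> is Cauchy with a
  rate that depends on \<open>D\<close> only.\<close>

lemma path_limit:
  assumes p: "0 < p" "p < N" and g: "gapped p"
  shows "\<exists>C>0. \<exists>\<tau>. 0 < \<tau> \<and> \<tau> < 1 \<and> (\<forall>q. path D q \<longrightarrow> (\<exists>k\<in>isom N. tail_bound C \<tau> p q (Sp N k p)))"
proof -
  obtain C \<tau> where C: "C > 0" "0 < \<tau>" "\<tau> < 1" and
    step: "\<And>\<gamma> s. \<gamma> \<in> carrier G \<Longrightarrow> s \<in> carrier G \<Longrightarrow> len s \<le> 1 \<Longrightarrow>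
      near (C * \<tau> ^ len \<gamma>) (U p (\<gamma> \<otimes> s)) (U p \<gamma>) \<and> near (C * \<tau> ^ len \<gamma>) (U p \<gamma>) (U p (\<gamma> \<otimes> s))"
    using U_right[OF p g, of 1] by blast
  \<comment> \<open>The length at time \<open>n\<close> is at least \<open>n - D\<close>, so a step
    costs at most \<open>B * \<tau> ^ n\<close>. Below, \<open>X\<close> is the sum of all these
    costs, and \<open>C'\<close> turns the exponential of a tail into a multiple of
    \<open>\<tau> ^ n\<close>, by \<open>exp x - 1 \<le> x * exp x\<close>.\<close>
  define B where "B = C / \<tau> ^ D"
  have B: "B > 0" using C by (simp add: B_def)
  define X where "X = B / (1 - \<tau>)"
  have X: "X > 0" using B C by (simp add: X_def)
  define C' where "C' = X * exp X"
  have C': "C' > 0" using X by (simp add: C'_def)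
  have "\<exists>k\<in>isom N. tail_bound (2 * C' + 1) \<tau> p q (Sp N k p)" if q: "path D q" for q
  proof -
    have qc: "q n \<in> carrier G" for n using q by (simp add: path_def)
    note Uc = U_carrier[OF qc]
    have st: "near (B * \<tau> ^ n) (U p (q (Suc n))) (U p (q n)) \<and> near (B * \<tau> ^ n) (U p (q n)) (U p (q (Suc n)))" for n
    proof -
      let ?s = "inv (q n) \<otimes> q (Suc n)"
      have s: "?s \<in> carrier G" "len ?s \<le> 1" using q qc by (auto simp: path_def word_dist_def)
      have e: "q n \<otimes> ?s = q (Suc n)" using qc by (simp flip: m_assoc)
      have "C * \<tau> ^ len (q n) \<le> B * \<tau> ^ n"
      proof -
        have "\<tau> ^ (len (q n) + D) \<le> \<tau> ^ n" using q C by (intro power_decreasing) (auto simp: path_def)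
        then have "\<tau> ^ len (q n) \<le> \<tau> ^ n / \<tau> ^ D" using C by (simp add: power_add field_simps)
        then have "C * \<tau> ^ len (q n) \<le> C * (\<tau> ^ n / \<tau> ^ D)" using C by (intro mult_left_mono) auto
        then show ?thesis by (simp add: B_def)
      qed
      then show ?thesis using step[OF qc[of n] s] unfolding e using near_mono by blast
    qed
    have chain: "near (exp (\<Sum>i=n..<m. B * \<tau> ^ i) - 1) (U p (q n)) (U p (q m)) \<and>
        near (exp (\<Sum>i=n..<m. B * \<tau> ^ i) - 1) (U p (q m)) (U p (q n))" if "n \<le> m" for n m
      using that
    proof (induction m rule: dec_induct)
      case base
      then show ?case using near_refl[OF Uc] by simp
    next
      case (step m)
      define a where "a = exp (\<Sum>i=n..<m. B * \<tau> ^ i)"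
      define b where "b = exp (B * \<tau> ^ m)"
      have ab: "exp (\<Sum>i=n..<Suc m. B * \<tau> ^ i) = a * b" using step(1) by (simp add: a_def b_def exp_add)
      have b: "near (b - 1) (U p (q (Suc m))) (U p (q m))" "near (b - 1) (U p (q m)) (U p (q (Suc m)))"
        using st[of m] near_mono exp_ge_add_one_self[of "B * \<tau> ^ m"] unfolding b_def by (smt (verit))+
      have "1 \<le> a" "1 \<le> b" using B C by (auto simp: a_def b_def sum_nonneg)
      then have "near (a * b - 1) (U p (q n)) (U p (q (Suc m)))" "near (b * a - 1) (U p (q (Suc m))) (U p (q n))"
        using near_trans[of a "U p (q n)" "U p (q m)" b "U p (q (Suc m))" N] near_trans[of b "U p (q (Suc m))" "U p (q m)" a "U p (q n)" N]
          step.IH b Uc unfolding a_def by auto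
      then show ?case unfolding ab by (simp add: mult.commute)
    qed
    have sumle: "exp (\<Sum>i=n..<m. B * \<tau> ^ i) - 1 \<le> C' * \<tau> ^ n" if "n \<le> m" for n m
    proof -
      have "(\<Sum>i=n..<m. B * \<tau> ^ i) = B * (\<Sum>i=n..<m. \<tau> ^ i)" by (simp add: sum_distrib_left)
      also have "(\<Sum>i=n..<m. \<tau> ^ i) = (\<tau> ^ n - \<tau> ^ m) / (1 - \<tau>)"
      proof -
        have "(\<Sum>i=n..<m. \<tau> ^ i) * (1 - \<tau>) = \<tau> ^ n - \<tau> ^ m"
          using that
        proof (induction m rule: dec_induct)
          case (step m)
          have "(\<Sum>i=n..<Suc m. \<tau> ^ i) * (1 - \<tau>) = (\<Sum>i=n..<m. \<tau> ^ i) * (1 - \<tau>) + \<tau> ^ m * (1 - \<tau>)"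
            using step(1) by (simp add: distrib_right)
          then show ?case unfolding step.IH by (simp add: algebra_simps)
        qed simp
        then show ?thesis using C by (simp add: eq_divide_eq)
      qed
      also have "B * \<dots> \<le> B * (\<tau> ^ n / (1 - \<tau>))" using B C by (intro mult_left_mono divide_right_mono) auto
      also have "\<dots> = X * \<tau> ^ n" by (simp add: X_def)
      finally have le: "(\<Sum>i=n..<m. B * \<tau> ^ i) \<le> X * \<tau> ^ n" .
      have xt: "X * \<tau> ^ n \<le> X" using X C by (simp add: power_le_one mult_left_le)
      have "exp (\<Sum>i=n..<m. B * \<tau> ^ i) - 1 \<le> exp (X * \<tau> ^ n) - 1" using le by simp
      also have "\<dots> \<le> X * \<tau> ^ n * exp (X * \<tau> ^ n)" using X C by (intro exp_minus_one_le) simp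
      also have "\<dots> \<le> X * \<tau> ^ n * exp X" using xt X C by (intro mult_left_mono) auto
      finally show ?thesis by (simp add: C'_def mult_ac)
    qed
    \<comment> \<open>Compactness gives a limit along a subsequence; the Cauchy estimate
      \<open>chain\<close> then carries convergence to the whole path, with a rate.\<close>
    obtain k s where k: "k \<in> isom N" and s: "strict_mono (s :: nat \<Rightarrow> nat)"
      and lim: "tends (\<lambda>m. Sp N (K (q (s m))) p) (Sp N k p)"
      using isom_limit_subspace[of "\<lambda>m. K (q m)" N p] K_isom[OF qc] by blast
    have kc: "Sp N k p \<subseteq> carrier_vec N" by (rule Sp_carrier[OF isom_carrier[OF k]])
    have "near ((2 * C' + 1) * \<tau> ^ n) (U p (q n)) (Sp N k p) \<and> near ((2 * C' + 1) * \<tau> ^ n) (Sp N k p) (U p (q n))" for n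
    proof -
      \<comment> \<open>The subsequence is followed until its distance to the limit is itself of
        order \<open>\<tau> ^ n\<close>, so that it is absorbed into the rate.\<close>
      define b where "b = 1 + min 1 (\<tau> ^ n / (C' + 1))"
      have b: "b - 1 > 0" "b \<le> 2" "b - 1 \<le> \<tau> ^ n / (C' + 1)" "1 \<le> b" using C C' by (auto simp: b_def)
      define a where "a = 1 + C' * \<tau> ^ n"
      have a: "1 \<le> a" using C C' by (simp add: a_def)
      have "\<forall>\<^sub>F m in sequentially. near (b - 1) (Sp N (K (q (s m))) p) (Sp N k p) \<and> near (b - 1) (Sp N k p) (Sp N (K (q (s m))) p)"
        using lim b(1) unfolding tends_def by blast
      then obtain m0 where m0: "\<And>m. m \<ge> m0 \<Longrightarrow> near (b - 1) (U p (q (s m))) (Sp N k p) \<and> near (b - 1) (Sp N k p) (U p (q (s m)))"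
        unfolding eventually_sequentially U_def by blast
      define m where "m = m0 + n"
      have m: "n \<le> s m" "m \<ge> m0" using seq_suble[OF s, of m] by (auto simp: m_def)
      have "near (a - 1) (U p (q n)) (U p (q (s m)))" "near (a - 1) (U p (q (s m))) (U p (q n))"
        using chain[OF m(1)] near_mono[OF _ sumle[OF m(1)]] by (auto simp: a_def)
      then have "near (a * b - 1) (U p (q n)) (Sp N k p)" "near (b * a - 1) (Sp N k p) (U p (q n))"
        using near_trans[of a "U p (q n)" "U p (q (s m))" b "Sp N k p" N] near_trans[of b "Sp N k p" "U p (q (s m))" a "U p (q n)" N]
          m0[OF m(2)] a b Uc kc by auto
      moreover have "a * b - 1 \<le> (2 * C' + 1) * \<tau> ^ n"
      proof -
        have "a * b - 1 = (b - 1) + C' * \<tau> ^ n * b" by (simp add: a_def algebra_simps)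
        also have "\<dots> \<le> \<tau> ^ n + C' * \<tau> ^ n * 2"
        proof (intro add_mono mult_left_mono)
          have "\<tau> ^ n / (C' + 1) \<le> \<tau> ^ n / 1" using C C' by (intro divide_left_mono) auto
          then show "b - 1 \<le> \<tau> ^ n" using b(3) by simp
        qed (use b C C' in auto)
        finally show ?thesis by (simp add: algebra_simps)
      qed
      ultimately show ?thesis using near_mono by (metis mult.commute)
    qed
    then show ?thesis using k unfolding tail_bound_def by blast
  qed
  moreover have "2 * C' + 1 > 0" using C' by simp
  ultimately show ?thesis using C by blast
qed

end

section \<open>The limit map along paths\<close>

context projective_rep
begin

text \<open>Attached to a path rather than to a boundary point; that equivalent rays give the same
  space is a consequence of stability under right multiplication. Requiring the form
  \<open>Sp N k p\<close> guarantees closedness and with it uniqueness.\<close>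

definition xi :: "nat \<Rightarrow> (nat \<Rightarrow> 'g) \<Rightarrow> 'k vec set" where
  "xi p q = (SOME V. (\<exists>k\<in>isom N. V = Sp N k p) \<and> tends (\<lambda>n. U p (q n)) V)"

lemma xi_eq:
  assumes q: "\<And>n. q n \<in> carrier G" and k: "k \<in> isom N" and lim: "tends (\<lambda>n. U p (q n)) (Sp N k p)"
  shows "xi p q = Sp N k p"
proof -
  have "(\<exists>k\<in>isom N. xi p q = Sp N k p) \<and> tends (\<lambda>n. U p (q n)) (xi p q)"
    unfolding xi_def by (rule someI[where x = "Sp N k p"]) (use k lim in blast)
  then show ?thesis using tends_unique[OF _ lim _ Sp_closed[OF k]] Sp_closed U_carrier[OF q] by metis
qed

lemma tail_bound_tends:
  assumes "0 < \<tau>" "\<tau> < 1" "tail_bound C \<tau> p q V"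
  shows "tends (\<lambda>n. U p (q n)) V"
  unfolding tends_def
proof (intro allI impI)
  fix e :: real assume e: "e > 0"
  have "(\<lambda>n. C * \<tau> ^ n) \<longlonglongrightarrow> C * 0" using assms by (intro tendsto_mult_left LIMSEQ_power_zero) auto
  then have "\<forall>\<^sub>F n in sequentially. C * \<tau> ^ n < e" using e order_tendstoD(2) by (metis mult_zero_right)
  then show "\<forall>\<^sub>F n in sequentially. near e (U p (q n)) V \<and> near e V (U p (q n))"
    by eventually_elim (use assms(3) near_mono in \<open>unfold tail_bound_def, meson less_imp_le\<close>)
qed

lemma path_carrier: "path D q \<Longrightarrow> q n \<in> carrier G" by (simp add: path_def)

lemma path_offset: "path D q \<Longrightarrow> path D (\<lambda>n. q (m + n))"
  unfolding path_def by (metis add_Suc_right le_add2 order_trans)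

lemma path_left: "path D q \<Longrightarrow> h \<in> carrier G \<Longrightarrow> path (D + len h) (\<lambda>n. h \<otimes> q n)"
  unfolding path_def
proof (intro conjI allI; elim conjE)
  fix n assume h: "h \<in> carrier G" and q: "\<forall>n. q n \<in> carrier G" "\<forall>n. d (q n) (q (Suc n)) \<le> 1" "\<forall>n. n \<le> len (q n) + D"
  show "h \<otimes> q n \<in> carrier G" using h q by simp
  show "d (h \<otimes> q n) (h \<otimes> q (Suc n)) \<le> 1" using h q by (simp add: d_left)
  have "q n = inv h \<otimes> (h \<otimes> q n)" using h q by (simp flip: m_assoc)
  then have "len (q n) \<le> len (inv h) + len (h \<otimes> q n)" using len_mult[of "inv h" "h \<otimes> q n"] h q by simp
  then show "n \<le> len (h \<otimes> q n) + (D + len h)" using q(3)[rule_format, of n] len_inv[OF h] by simp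
qed

lemma tends_image:
  assumes W: "tends W V" and h: "h \<in> carrier G" and c: "\<And>n. W n \<subseteq> carrier_vec N" "V \<subseteq> carrier_vec N"
  shows "tends (\<lambda>n. (*\<^sub>v) (R h) ` W n) ((*\<^sub>v) (R h) ` V)"
  unfolding tends_def
proof (intro allI impI)
  obtain b b' where b: "0 < b" "0 < b'"
    and bb: "\<And>v. v \<in> carrier_vec N \<Longrightarrow> nv (R h *\<^sub>v v) \<le> b * nv v" "\<And>v. v \<in> carrier_vec N \<Longrightarrow> nv v \<le> b' * nv (R h *\<^sub>v v)"
    using R_condition[OF h] by blast
  fix e :: real assume e: "e > 0"
  define x where "x = e / (b * b')"
  have x: "x > 0" "b * b' * x = e" using e b by (auto simp: x_def)
  have "\<forall>\<^sub>F n in sequentially. near x (W n) V \<and> near x V (W n)" using W x(1) unfolding tends_def by blast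
  then show "\<forall>\<^sub>F n in sequentially. near e ((*\<^sub>v) (R h) ` W n) ((*\<^sub>v) (R h) ` V) \<and> near e ((*\<^sub>v) (R h) ` V) ((*\<^sub>v) (R h) ` W n)"
  proof eventually_elim
    case (elim n)
    then show ?case
      using near_image[of x "W n" V "R h" N b b'] near_image[of x V "W n" "R h" N b b'] R_carrier[OF h] c x b bb by auto
  qed
qed

lemma nclosed_image:
  assumes V: "nclosed N V" and h: "h \<in> carrier G"
  shows "nclosed N ((*\<^sub>v) (R h) ` V)"
  unfolding nclosed_def
proof (intro conjI ballI impI)
  note c = R_carrier[OF h] and dd = R_det[OF h]
  have Vc: "V \<subseteq> carrier_vec N" using V by (simp add: nclosed_def)
  then show "(*\<^sub>v) (R h) ` V \<subseteq> carrier_vec N" using c by auto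
  fix v assume v: "v \<in> carrier_vec N" and lim: "\<forall>e>0. \<exists>w\<in>(*\<^sub>v) (R h) ` V. nv (v - w) \<le> e"
  obtain b b' where b: "0 < b" "0 < b'"
    and bb': "\<forall>v\<in>carrier_vec N. nv (R h *\<^sub>v v) \<le> b * nv v \<and> nv v \<le> b' * nv (R h *\<^sub>v v)"
    using R_condition[OF h] by blast
  have bb: "nv v \<le> b' * nv (R h *\<^sub>v v)" if "v \<in> carrier_vec N" for v using bb' that by blast
  let ?x = "minv (R h) *\<^sub>v v"
  have x: "?x \<in> carrier_vec N" using minv(1)[OF c dd] v by simp
  have hx: "R h *\<^sub>v ?x = v" by (rule minv_mult_vec(2)[OF c dd v])
  have "?x \<in> V"
  proof (rule nclosedD[OF V x])
    fix e :: real assume "e > 0"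
    then have "e / b' > 0" using b by simp
    then obtain w where w: "w \<in> V" "nv (v - R h *\<^sub>v w) \<le> e / b'" using lim by blast
    have wc: "w \<in> carrier_vec N" using w Vc by blast
    have "nv (?x - w) \<le> b' * nv (R h *\<^sub>v (?x - w))" by (rule bb) (use x wc in simp)
    also have "R h *\<^sub>v (?x - w) = v - R h *\<^sub>v w" using mult_minus_distrib_mat_vec[OF c x wc] hx by simp
    finally show "\<exists>w\<in>V. nv (?x - w) \<le> e" using w b by (intro bexI[of _ w]) (auto simp: field_simps)
  qed
  then show "v \<in> (*\<^sub>v) (R h) ` V" using hx by (metis image_eqI)
qed

context
  fixes p
  assumes p: "0 < p" "p < N" and gap: "gapped p"
begin

lemma xi_tail_bound:
  "\<exists>C>0. \<exists>\<tau>. 0 < \<tau> \<and> \<tau> < 1 \<and> (\<forall>q. path D q \<longrightarrow> tail_bound C \<tau> p q (xi p q))"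
proof -
  obtain C \<tau> where C: "C > 0" "0 < \<tau>" "\<tau> < 1" "\<And>q. path D q \<Longrightarrow> \<exists>k\<in>isom N. tail_bound C \<tau> p q (Sp N k p)"
    using path_limit[OF p gap, of D] by blast
  have "tail_bound C \<tau> p q (xi p q)" if q: "path D q" for q
  proof -
    obtain k where k: "k \<in> isom N" "tail_bound C \<tau> p q (Sp N k p)" using C(4)[OF q] by blast
    then show ?thesis using xi_eq[OF path_carrier[OF q] k(1) tail_bound_tends[OF C(2,3) k(2)]] by simp
  qed
  then show ?thesis using C by blast
qed

lemma xi_tends: "path D q \<Longrightarrow> tends (\<lambda>n. U p (q n)) (xi p q)"
  using xi_tail_bound[of D] tail_bound_tends by blast

lemma xi_Sp: "path D q \<Longrightarrow> \<exists>k\<in>isom N. xi p q = Sp N k p"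
proof -
  assume q: "path D q"
  obtain C \<tau> k where C: "0 < \<tau>" "\<tau> < 1" "k \<in> isom N" "tail_bound C \<tau> p q (Sp N k p)"
    using path_limit[OF p gap, of D] q by blast
  then show ?thesis using xi_eq[OF path_carrier[OF q] C(3) tail_bound_tends[OF C(1,2,4)]] by blast
qed

lemma xi_closed: "path D q \<Longrightarrow> nclosed N (xi p q)"
  using xi_Sp Sp_closed by metis

lemma xi_carrier: "path D q \<Longrightarrow> xi p q \<subseteq> carrier_vec N"
  using xi_closed by (auto simp: nclosed_def)

lemma xi_smult: "path D q \<Longrightarrow> v \<in> xi p q \<Longrightarrow> c \<cdot>\<^sub>v v \<in> xi p q"
  using xi_Sp Sp_smult isom_carrier by metis

lemma xi_offset: "path D q \<Longrightarrow> xi p (\<lambda>n. q (m + n)) = xi p q"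
proof -
  assume q: "path D q"
  have "tends (\<lambda>n. U p (q n)) (xi p (\<lambda>n. q (m + n)))"
    by (rule tends_offset[OF xi_tends[OF path_offset[OF q]]])
  then show ?thesis
    using tends_unique[OF _ xi_tends[OF q] xi_closed[OF path_offset[OF q]] xi_closed[OF q]] U_carrier[OF path_carrier[OF q]] by blast
qed

lemma xi_fellow:
  assumes q: "path D q" "path D' q'" and b: "\<And>n. d (q n) (q' n) \<le> m"
  shows "xi p q' = xi p q"
proof -
  obtain C \<tau> where C: "C > 0" "0 < \<tau>" "\<tau> < 1" and
    step: "\<And>\<gamma> s. \<gamma> \<in> carrier G \<Longrightarrow> s \<in> carrier G \<Longrightarrow> len s \<le> m \<Longrightarrow>
      near (C * \<tau> ^ len \<gamma>) (U p (\<gamma> \<otimes> s)) (U p \<gamma>) \<and> near (C * \<tau> ^ len \<gamma>) (U p \<gamma>) (U p (\<gamma> \<otimes> s))"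
    using U_right[OF p gap, of m] by blast
  note c = path_carrier[OF q(1)] path_carrier[OF q(2)]
  have near: "near (C * \<tau> ^ len (q n)) (U p (q' n)) (U p (q n)) \<and> near (C * \<tau> ^ len (q n)) (U p (q n)) (U p (q' n))" for n
  proof -
    have e: "q n \<otimes> (inv (q n) \<otimes> q' n) = q' n" using c[of n] by (simp flip: m_assoc)
    show ?thesis using step[of "q n" "inv (q n) \<otimes> q' n"] b[of n] c[of n] unfolding e by (simp add: word_dist_def)
  qed
  have "(\<lambda>n. C * \<tau> ^ len (q n)) \<longlonglongrightarrow> 0"
  proof (rule tendsto_0_le)
    show "C * \<tau> ^ len (q n) \<le> C * (\<tau> ^ n / \<tau> ^ D)" for n
    proof -
      have "\<tau> ^ (len (q n) + D) \<le> \<tau> ^ n" using q(1) C by (intro power_decreasing) (auto simp: path_def)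
      then have "\<tau> ^ len (q n) \<le> \<tau> ^ n / \<tau> ^ D" using C by (simp add: power_add field_simps)
      then show ?thesis using C by (intro mult_left_mono) auto
    qed
    have "(\<lambda>n. C * (\<tau> ^ n / \<tau> ^ D)) \<longlonglongrightarrow> C * (0 / \<tau> ^ D)" using C by (intro tendsto_intros LIMSEQ_power_zero) auto
    then show "(\<lambda>n. C * (\<tau> ^ n / \<tau> ^ D)) \<longlonglongrightarrow> 0" by simp
  qed (use C in simp)
  then have "tends (\<lambda>n. U p (q' n)) (xi p q)"
    using near U_carrier[OF c(1)] U_carrier[OF c(2)] xi_carrier[OF q(1)]
    by (intro tends_trans[OF xi_tends[OF q(1)], where e = "\<lambda>n. C * \<tau> ^ len (q n)" and n = N]) auto
  then show ?thesis
    using tends_unique[OF _ xi_tends[OF q(2)] xi_closed[OF q(1)] xi_closed[OF q(2)]] U_carrier[OF c(2)] by blast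
qed

lemma xi_left:
  assumes q: "path D q" and h: "h \<in> carrier G"
  shows "xi p (\<lambda>n. h \<otimes> q n) = (*\<^sub>v) (R h) ` xi p q"
proof -
  obtain C \<tau> where C: "C > 0" "0 < \<tau>" "\<tau> < 1" and
    step: "\<And>\<gamma>. \<gamma> \<in> carrier G \<Longrightarrow> near (C * \<tau> ^ len \<gamma>) (U p (h \<otimes> \<gamma>)) ((*\<^sub>v) (R h) ` U p \<gamma>) \<and>
      near (C * \<tau> ^ len \<gamma>) ((*\<^sub>v) (R h) ` U p \<gamma>) (U p (h \<otimes> \<gamma>))"
    using U_left[OF p gap h] by blast
  note c = path_carrier[OF q] and pl = path_left[OF q h]
  have Uc: "U p (q n) \<subseteq> carrier_vec N" "(*\<^sub>v) (R h) ` U p (q n) \<subseteq> carrier_vec N" for n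
    using U_carrier[OF c] mult_mat_vec_carrier[OF R_carrier[OF h]] by blast+
  have "(\<lambda>n. C * \<tau> ^ len (q n)) \<longlonglongrightarrow> 0"
  proof (rule tendsto_0_le)
    show "C * \<tau> ^ len (q n) \<le> C * (\<tau> ^ n / \<tau> ^ D)" for n
    proof -
      have "\<tau> ^ (len (q n) + D) \<le> \<tau> ^ n" using q C by (intro power_decreasing) (auto simp: path_def)
      then have "\<tau> ^ len (q n) \<le> \<tau> ^ n / \<tau> ^ D" using C by (simp add: power_add field_simps)
      then show ?thesis using C by (intro mult_left_mono) auto
    qed
    have "(\<lambda>n. C * (\<tau> ^ n / \<tau> ^ D)) \<longlonglongrightarrow> C * (0 / \<tau> ^ D)" using C by (intro tendsto_intros LIMSEQ_power_zero) auto
    then show "(\<lambda>n. C * (\<tau> ^ n / \<tau> ^ D)) \<longlonglongrightarrow> 0" by simp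
  qed (use C in simp)
  then have "tends (\<lambda>n. U p (h \<otimes> q n)) ((*\<^sub>v) (R h) ` xi p q)"
    using step[OF c] Uc U_carrier[OF path_carrier[OF pl]] xi_carrier[OF q] R_carrier[OF h]
    by (intro tends_trans[OF tends_image[OF xi_tends[OF q] h Uc(1) xi_carrier[OF q]], where e = "\<lambda>n. C * \<tau> ^ len (q n)" and n = N])
      auto
  then show ?thesis
    using tends_unique[OF xi_tends[OF pl] _ xi_closed[OF pl] nclosed_image[OF xi_closed[OF q] h]] U_carrier[OF path_carrier[OF pl]]
    by blast
qed

text \<open>The rate of convergence is common to all paths with defect \<open>D\<close>. Hence paths
  that agree at a single late index \<open>i\<close> have limit spaces that are both close to the
  same \<open>U p (q' i)\<close>.\<close>

lemma xi_continuous: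
  assumes q: "\<And>j. path D (q j)" "path D q'" and ev: "\<And>i. \<exists>j0. \<forall>j\<ge>j0. q j i = q' i"
    and v: "\<And>j. v j \<in> xi p (q j)" "(\<lambda>j. nv (v j - w)) \<longlonglongrightarrow> 0" "w \<in> carrier_vec N"
  shows "w \<in> xi p q'"
proof (rule nclosedD[OF xi_closed[OF q(2)] v(3)])
  fix e :: real assume e: "e > 0"
  obtain C \<tau> where C: "C > 0" "0 < \<tau>" "\<tau> < 1" "\<And>q. path D q \<Longrightarrow> tail_bound C \<tau> p q (xi p q)"
    using xi_tail_bound[of D] by blast
  have "(\<lambda>i. ((1 + C * \<tau> ^ i) * (1 + C * \<tau> ^ i) - 1) * (nv w + 1)) \<longlonglongrightarrow> ((1 + C * 0) * (1 + C * 0) - 1) * (nv w + 1)"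
    using C by (intro tendsto_intros LIMSEQ_power_zero) auto
  then have "(\<lambda>i. ((1 + C * \<tau> ^ i) * (1 + C * \<tau> ^ i) - 1) * (nv w + 1)) \<longlonglongrightarrow> 0" by simp
  then have "\<forall>\<^sub>F i in sequentially. ((1 + C * \<tau> ^ i) * (1 + C * \<tau> ^ i) - 1) * (nv w + 1) < e / 2"
    by (rule order_tendstoD(2)) (use e in simp)
  then obtain i where i: "((1 + C * \<tau> ^ i) * (1 + C * \<tau> ^ i) - 1) * (nv w + 1) < e / 2"
    by (auto dest: eventually_happens)
  define a where "a = 1 + C * \<tau> ^ i"
  have a: "1 \<le> a" "1 \<le> a * a" using C mult_mono[of 1 a 1 a] by (auto simp: a_def)
  have "\<forall>\<^sub>F j in sequentially. nv (v j - w) < min 1 (e / 2)" using v(2) e by (intro order_tendstoD(2)[of _ 0]) auto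
  then obtain j1 where j1: "\<And>j. j \<ge> j1 \<Longrightarrow> nv (v j - w) < min 1 (e / 2)" unfolding eventually_sequentially by blast
  obtain j0 where j0: "\<And>j. j \<ge> j0 \<Longrightarrow> q j i = q' i" using ev by blast
  define j where "j = max j0 j1"
  have j: "nv (v j - w) < min 1 (e / 2)" "q j i = q' i" using j0[of j] j1[of j] by (auto simp: j_def)
  have "near (a - 1) (xi p (q j)) (U p (q' i))" "near (a - 1) (U p (q' i)) (xi p q')"
    using C(4)[OF q(1), of j] C(4)[OF q(2)] j(2) unfolding tail_bound_def a_def by (metis add_diff_cancel_left')+
  then have "near (a * a - 1) (xi p (q j)) (xi p q')"
    using near_trans[of a "xi p (q j)" "U p (q' i)" a "xi p q'" N] a xi_carrier[OF q(1)] xi_carrier[OF q(2)] U_carrier[OF path_carrier[OF q(2)]]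
    by blast
  then obtain x where x: "x \<in> xi p q'" "nv (v j - x) \<le> (a * a - 1) * nv (v j)" using v(1)[of j] by (auto simp: near_def)
  have vc: "v j \<in> carrier_vec N" "x \<in> carrier_vec N" using v(1)[of j] x xi_carrier[OF q(1)] xi_carrier[OF q(2)] by auto
  have "nv (v j) \<le> nv w + 1" using nv_le_dist[OF vc(1) v(3)] j(1) by simp
  then have "(a * a - 1) * nv (v j) \<le> (a * a - 1) * (nv w + 1)" using a by (intro mult_left_mono) auto
  then have "nv (v j - x) \<le> e / 2" using x(2) i by (simp add: a_def)
  moreover have "nv (w - v j) \<le> e / 2" using j(1) nv_minus_commute[OF v(3) vc(1)] by simp
  ultimately show "\<exists>x\<in>xi p q'. nv (w - x) \<le> e" using nv_dist_triangle[OF v(3) vc] x(1) by (intro bexI[of _ x]) auto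
qed

end

lemma xi_mono:
  assumes p: "0 < p" "p < N" "gapped p" and p': "0 < p'" "p' < N" "gapped p'" and le: "p \<le> p'" and q: "path D q"
  shows "xi p q \<subseteq> xi p' q"
proof (rule near_subset[OF _ xi_carrier[OF p q] xi_closed[OF p' q]])
  fix a :: real assume "1 < a"
  then have "a - 1 > 0" by simp
  then have "\<forall>\<^sub>F m in sequentially. near (a - 1) (U p (q m)) (xi p q) \<and> near (a - 1) (xi p q) (U p (q m))"
    "\<forall>\<^sub>F m in sequentially. near (a - 1) (U p' (q m)) (xi p' q) \<and> near (a - 1) (xi p' q) (U p' (q m))"
    using xi_tends[OF p q] xi_tends[OF p' q] unfolding tends_def by blast+
  then have "\<forall>\<^sub>F m in sequentially. near (a - 1) (xi p q) (U p (q m)) \<and> near (a - 1) (U p' (q m)) (xi p' q)"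
    by eventually_elim blast
  then obtain m where m: "near (a - 1) (xi p q) (U p (q m))" "near (a - 1) (U p' (q m)) (xi p' q)" by (auto dest: eventually_happens)
  have "U p (q m) \<subseteq> U p' (q m)" unfolding U_def by (rule Sp_mono[OF le])
  then have "near (a - 1) (xi p q) (U p' (q m))" using m(1) unfolding near_def by blast
  then show "\<exists>W\<subseteq>carrier_vec N. near (a - 1) (xi p q) W \<and> near (a - 1) W (xi p' q)"
    using m(2) U_carrier[OF path_carrier[OF q]] by blast
qed

end

section \<open>Transversality\<close>

text \<open>\<open>f i n\<close> measures a window of length \<open>n\<close> that starts at
  \<open>i\<close>. Once \<open>n\<close> is so large that half of \<open>\<mu> * n\<close>
  outweighs \<open>a\<close>, each doubling of the window loses a fixed amount per unit of length.
  After \<open>k\<close> doublings the value is at most \<open>2 ^ k * (B - k * c)\<close>, which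
  falls below any lower bound.\<close>

lemma doubling_contradiction:
  fixes f :: "int \<Rightarrow> nat \<Rightarrow> real"
  assumes step: "\<And>i n. n \<ge> M \<Longrightarrow> f i (2 * n) \<le> f i n + f (i + int n) n + a - \<mu> * real n" and \<mu>: "0 < \<mu>"
    and lower: "\<And>i n. b \<le> f i n" and upper: "\<And>n. \<exists>B. \<forall>i. f i n \<le> B"
  shows False
proof -
  obtain n2 :: nat where n2: "2 * a / \<mu> < n2" using reals_Archimedean2 by blast
  define m where "m = M + n2 + 1"
  have "a * 2 < \<mu> * real n2" using n2 \<mu> by (simp add: field_simps)
  also have "\<dots> \<le> \<mu> * real m" using \<mu> by (intro mult_left_mono) (auto simp: m_def)
  finally have a: "a \<le> \<mu> * real m / 2" by simp
  obtain B where B: "\<And>i. f i m \<le> B" using upper by blast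
  define c where "c = \<mu> * real m / 4"
  have c: "c > 0" using \<mu> by (simp add: c_def m_def)
  have "f i (2 ^ k * m) \<le> 2 ^ k * (B - real k * c)" for i k
  proof (induction k arbitrary: i)
    case 0 then show ?case using B by simp
  next
    case (Suc k)
    let ?n = "2 ^ k * m"
    have "1 * m \<le> 2 ^ k * m" by (intro mult_right_mono) auto
    then have n: "M \<le> ?n" by (simp add: m_def)
    have "f i (2 ^ Suc k * m) = f i (2 * ?n)" by (simp add: mult.assoc)
    also have "\<dots> \<le> f i ?n + f (i + int ?n) ?n + a - \<mu> * real ?n" by (rule step[OF n])
    also have "\<dots> \<le> 2 ^ k * (B - real k * c) + 2 ^ k * (B - real k * c) + a - \<mu> * real ?n"
      using Suc[of i] Suc[of "i + int ?n"] by linarith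
    also have "\<dots> \<le> 2 ^ k * (B - real k * c) + 2 ^ k * (B - real k * c) + 2 ^ k * (\<mu> * real m / 2) - 2 ^ k * (\<mu> * real m)"
    proof -
      have "1 * (\<mu> * real m / 2) \<le> 2 ^ k * (\<mu> * real m / 2)" using \<mu> by (intro mult_right_mono) auto
      then show ?thesis using a by (simp add: mult_ac)
    qed
    also have "\<dots> = 2 ^ Suc k * (B - real (Suc k) * c)" by (simp add: c_def algebra_simps)
    finally show ?case .
  qed
  then have up: "b \<le> 2 ^ k * (B - real k * c)" for k using lower[of 0 "2 ^ k * m"] by (meson order_trans)
  obtain k1 :: nat where k1: "(B + 1) / c < k1" using reals_Archimedean2 by blast
  obtain k2 :: nat where k2: "- b < k2" using reals_Archimedean2 by blast
  define k where "k = k1 + k2"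
  have "B + 1 < real k1 * c" using k1 c by (simp add: field_simps)
  also have "\<dots> \<le> real k * c" using c by (intro mult_right_mono) (auto simp: k_def)
  finally have "B - real k * c \<le> - 1" by simp
  then have "2 ^ k * (B - real k * c) \<le> 2 ^ k * (- 1)" by (intro mult_left_mono) auto
  moreover have "real k < 2 ^ k" by (rule of_nat_less_two_power)
  moreover have "- b < real k" using k2 by (simp add: k_def)
  ultimately show False using up[of k] by linarith
qed

lemma mult_mat_vec_index:
  "(A :: 'k::field mat) \<in> carrier_mat m n \<Longrightarrow> v \<in> carrier_vec n \<Longrightarrow> i < m \<Longrightarrow> (A *\<^sub>v v) $ i = (\<Sum>j<n. A $$ (i, j) * v $ j)"
  by (auto simp: scalar_prod_def atLeast0LessThan)

lemma top_minor_smult: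
  assumes "A \<in> carrier_mat n n" "p \<le> n"
  shows "top_minor p (c \<cdot>\<^sub>m A) = c ^ p * top_minor p A"
proof -
  have "Matrix.mat p p (\<lambda>(i, j). (c \<cdot>\<^sub>m A) $$ (i, j)) = c \<cdot>\<^sub>m Matrix.mat p p (\<lambda>(i, j). A $$ (i, j))"
    using assms by (intro eq_matI) auto
  then show ?thesis by (simp add: top_minor_def)
qed

section \<open>Products of singular values and transversality\<close>

context projective_rep
begin

definition sv :: "'g \<Rightarrow> nat \<Rightarrow> 'k" where "sv \<gamma> = (SOME \<alpha>. \<exists>l. svd N (R \<gamma>) (K \<gamma>) \<alpha> l)"

definition K' :: "'g \<Rightarrow> 'k mat" where "K' \<gamma> = (SOME l. svd N (R \<gamma>) (K \<gamma>) (sv \<gamma>) l)"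

lemma svd_sv: "\<gamma> \<in> carrier G \<Longrightarrow> svd N (R \<gamma>) (K \<gamma>) (sv \<gamma>) (K' \<gamma>)"
  unfolding K'_def sv_def using R_svd by (metis (mono_tags, lifting) someI_ex)

lemma sv_pos: "\<gamma> \<in> carrier G \<Longrightarrow> i < N \<Longrightarrow> 0 < av (sv \<gamma> i)"
  using svd_nonzero[OF svd_sv R_det] by (intro av_pos) auto

text \<open>The attracting space of the inverse is spanned by the directions that
  \<open>R \<gamma>\<close> contracts most. Its vectors have short preimages under
  \<open>R (inv \<gamma>)\<close>, and applying \<open>R \<gamma>\<close> returns these preimages up
  to a scalar.\<close>

lemma dual_contract:
  assumes p: "0 < p" "p < N" and \<gamma>: "\<gamma> \<in> carrier G" and u: "u \<in> U (N - p) (inv \<gamma>)"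
  shows "nv (R \<gamma> *\<^sub>v u) \<le> av (sv \<gamma> p) * nv u"
proof -
  have ig: "inv \<gamma> \<in> carrier G" using \<gamma> by simp
  obtain b where b: "b \<noteq> 0" "R \<gamma> * R (inv \<gamma>) = b \<cdot>\<^sub>m 1\<^sub>m N" using R_inv[OF \<gamma>] by blast
  have "0 < N - p" "N - p \<le> N" using p by auto
  then obtain w where w: "w \<in> carrier_vec N" "R (inv \<gamma>) *\<^sub>v w = u" "av (sv (inv \<gamma>) (N - p - 1)) * nv w \<le> nv u"
    using svd_expand[OF svd_sv[OF ig] _ _ _ R_det[OF ig], of u "N - p"] u unfolding U_def by blast
  have "av (sv (inv \<gamma>) (N - p - 1)) = av b / av (sv \<gamma> p)"
    using svd_inverse[OF svd_sv[OF \<gamma>] svd_sv[OF ig] R_det[OF \<gamma>] b(2), of "N - p - 1"] p by simp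
  then have "av b * nv w \<le> av (sv \<gamma> p) * nv u" using w(3) sv_pos[OF \<gamma> p(2)] by (simp add: field_simps)
  moreover have "R \<gamma> *\<^sub>v u = b \<cdot>\<^sub>v w"
    using assoc_mult_mat_vec[OF R_carrier[OF \<gamma>] R_carrier[OF ig] w(1)] smult_mat_mult_vec[of "1\<^sub>m N" N N w b] w(1,2)
    unfolding b(2) by simp
  ultimately show ?thesis by simp
qed

text \<open>A vector at definite distance from the contracted space is stretched at least by the
  \<open>p\<close>-th singular value: \<open>R (inv \<gamma>)\<close> brings
  \<open>R \<gamma> *\<^sub>v x\<close>, a lift of \<open>x\<close> up to scalar, close to its
  attracting space.\<close>

lemma dual_expand:
  assumes p: "0 < p" "p < N" and \<gamma>: "\<gamma> \<in> carrier G" and x: "x \<in> carrier_vec N"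
  shows "\<exists>u\<in>U (N - p) (inv \<gamma>). av (sv \<gamma> (p - 1)) * nv (x - u) \<le> nv (R \<gamma> *\<^sub>v x)"
proof -
  have ig: "inv \<gamma> \<in> carrier G" using \<gamma> by simp
  obtain b where b: "b \<noteq> 0" "R (inv \<gamma>) * R \<gamma> = b \<cdot>\<^sub>m 1\<^sub>m N" using R_inv[OF ig] \<gamma> by auto
  have Rx: "R \<gamma> *\<^sub>v x \<in> carrier_vec N" by (rule mult_mat_vec_carrier[OF R_carrier[OF \<gamma>] x])
  have "N - p < N" using p by simp
  then obtain u where u: "u \<in> U (N - p) (inv \<gamma>)"
    "nv (R (inv \<gamma>) *\<^sub>v (R \<gamma> *\<^sub>v x) - u) \<le> av (sv (inv \<gamma>) (N - p)) * nv (R \<gamma> *\<^sub>v x)"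
    using svd_attract[OF svd_sv[OF ig] Rx] unfolding U_def by blast
  have uc: "u \<in> carrier_vec N" using u(1) U_carrier[OF ig] by blast
  have bx: "R (inv \<gamma>) *\<^sub>v (R \<gamma> *\<^sub>v x) = b \<cdot>\<^sub>v x"
    using assoc_mult_mat_vec[OF R_carrier[OF ig] R_carrier[OF \<gamma>] x] smult_mat_mult_vec[of "1\<^sub>m N" N N x b] x
    unfolding b(2) by simp
  obtain a where a: "a \<noteq> 0" "R \<gamma> * R (inv \<gamma>) = a \<cdot>\<^sub>m 1\<^sub>m N" using R_inv[OF \<gamma>] by blast
  have "av (sv (inv \<gamma>) (N - p)) = av a / av (sv \<gamma> (p - 1))"
    using svd_inverse[OF svd_sv[OF \<gamma>] svd_sv[OF ig] R_det[OF \<gamma>] a(2), of "N - p"] p by simp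
  \<comment> \<open>The scalars of the two products of \<open>R \<gamma>\<close> and
    \<open>R (inv \<gamma>)\<close> agree, as the triple product evaluated on one nonzero vector
    shows.\<close>
  moreover have "a = b"
  proof -
    have "b \<cdot>\<^sub>v (R (inv \<gamma>) *\<^sub>v e) = a \<cdot>\<^sub>v (R (inv \<gamma>) *\<^sub>v e)" if e: "e \<in> carrier_vec N" for e
    proof -
      have y: "R (inv \<gamma>) *\<^sub>v e \<in> carrier_vec N" by (rule mult_mat_vec_carrier[OF R_carrier[OF ig] e])
      have "R (inv \<gamma>) *\<^sub>v (R \<gamma> *\<^sub>v (R (inv \<gamma>) *\<^sub>v e)) = b \<cdot>\<^sub>v (R (inv \<gamma>) *\<^sub>v e)"
        using assoc_mult_mat_vec[OF R_carrier[OF ig] R_carrier[OF \<gamma>] y] smult_mat_mult_vec[of "1\<^sub>m N" N N _ b] y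
        unfolding b(2) by simp
      moreover have "R \<gamma> *\<^sub>v (R (inv \<gamma>) *\<^sub>v e) = a \<cdot>\<^sub>v e"
        using assoc_mult_mat_vec[OF R_carrier[OF \<gamma>] R_carrier[OF ig] e] smult_mat_mult_vec[of "1\<^sub>m N" N N e a] e
        unfolding a(2) by simp
      ultimately show ?thesis using mult_mat_vec[OF R_carrier[OF ig] e, of a] by simp
    qed
    from this[of "unit_vec N 0"] have eq: "b \<cdot>\<^sub>v (R (inv \<gamma>) *\<^sub>v unit_vec N 0) = a \<cdot>\<^sub>v (R (inv \<gamma>) *\<^sub>v unit_vec N 0)" by simp
    define y where "y = R (inv \<gamma>) *\<^sub>v unit_vec N 0"
    have y: "y \<in> carrier_vec N" using R_carrier[OF ig] by (simp add: y_def)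
    have "(b - a) \<cdot>\<^sub>v y = b \<cdot>\<^sub>v y - a \<cdot>\<^sub>v y" using y by (intro eq_vecI) (auto simp: left_diff_distrib)
    also have "\<dots> = 0\<^sub>v N" using eq y unfolding y_def[symmetric] by (intro eq_vecI) auto
    finally have "av (b - a) * nv y = 0" by (metis nv_smult nv_zero)
    moreover have "nv y \<noteq> 0"
    proof
      assume "nv y = 0"
      then have "R (inv \<gamma>) *\<^sub>v unit_vec N 0 = 0\<^sub>v N" using nv_eq_0[OF y] by (simp add: y_def)
      moreover have "unit_vec N 0 \<noteq> (0\<^sub>v N :: 'k vec)" using nv_unit[of 0 N] p by auto
      ultimately show False using det_0_iff_vec_prod_zero[OF R_carrier[OF ig]] R_det[OF ig] by (metis unit_vec_carrier)
    qed
    ultimately show ?thesis by simp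
  qed
  ultimately have le: "nv (b \<cdot>\<^sub>v x - u) \<le> av b / av (sv \<gamma> (p - 1)) * nv (R \<gamma> *\<^sub>v x)" using u(2) bx by simp
  define w where "w = inverse b \<cdot>\<^sub>v u"
  have "w \<in> U (N - p) (inv \<gamma>)" unfolding w_def U_def
    by (rule Sp_smult[OF isom_carrier[OF K_isom[OF ig]]]) (use u(1) in \<open>simp add: U_def\<close>)
  moreover have "b \<cdot>\<^sub>v (x - w) = b \<cdot>\<^sub>v x - u" using b(1) x uc by (intro eq_vecI) (auto simp: w_def algebra_simps)
  then have "av b * nv (x - w) \<le> av b / av (sv \<gamma> (p - 1)) * nv (R \<gamma> *\<^sub>v x)" using le by (metis nv_smult)
  then have "av (sv \<gamma> (p - 1)) * nv (x - w) \<le> nv (R \<gamma> *\<^sub>v x)"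
    using av_pos[OF b(1)] sv_pos[OF \<gamma>, of "p - 1"] p by (simp add: field_simps)
  ultimately show ?thesis by blast
qed

text \<open>The logarithm of the product of the first \<open>p\<close> singular values, normalised by the determinant
  so that it does not depend on the lift.\<close>

definition F :: "nat \<Rightarrow> 'g \<Rightarrow> real" where
  "F p \<gamma> = real N * ln (\<Prod>i<p. av (sv \<gamma> i)) - real p * ln (av (det (R \<gamma>)))"

lemma prod_sv_pos: "\<gamma> \<in> carrier G \<Longrightarrow> p \<le> N \<Longrightarrow> 0 < (\<Prod>i<p. av (sv \<gamma> i))"
  using sv_pos by (intro prod_pos) auto

text \<open>For a decreasing sequence the average of the first \<open>p\<close> logarithms is at
  least the average of all of them, and the sum of all is the logarithm of the determinant. The term
  \<open>ln (fact N)\<close> appears twice because determinants of the two isometries are only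
  bounded by the Leibniz formula.\<close>

lemma F_lower:
  assumes p: "0 < p" "p < N"
  shows "\<exists>b. \<forall>\<gamma>\<in>carrier G. b \<le> F p \<gamma>"
proof (intro exI ballI)
  fix \<gamma> assume \<gamma>: "\<gamma> \<in> carrier G"
  note s = svd_sv[OF \<gamma>] and pos = sv_pos[OF \<gamma>]
  note kc = isom_carrier[OF svd_isom(1)[OF s]] and lc = isom_carrier[OF svd_isom(2)[OF s]]
  define x where "x i = ln (av (sv \<gamma> i))" for i
  have "det (R \<gamma>) = det (K \<gamma>) * det (mat_diag N (sv \<gamma>)) * det (K' \<gamma>)"
    using arg_cong[OF svd_eq[OF s], of det] det_mult[OF mult_carrier_mat[OF kc mat_diag_dim] lc] det_mult[OF kc mat_diag_dim] by simp
  moreover have "det (mat_diag N (sv \<gamma>)) = (\<Prod>i<N. sv \<gamma> i)"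
  proof -
    have "Matrix.mat N N (\<lambda>(i, j). mat_diag N (sv \<gamma>) $$ (i, j)) = mat_diag N (sv \<gamma>)" by (rule eq_matI) (auto simp: mat_diag_def)
    then show ?thesis using top_minor_diag[of N N "sv \<gamma>"] by (simp add: top_minor_def)
  qed
  ultimately have "av (det (R \<gamma>)) = av (det (K \<gamma>)) * (\<Prod>i<N. av (sv \<gamma> i)) * av (det (K' \<gamma>))" by (simp add: av_mult av_prod)
  also have "\<dots> \<le> fact N * (\<Prod>i<N. av (sv \<gamma> i)) * fact N"
    using av_det_le_fact[OF kc isom_entry[OF svd_isom(1)[OF s]]] av_det_le_fact[OF lc isom_entry[OF svd_isom(2)[OF s]]]
    by (intro mult_mono prod_nonneg mult_nonneg_nonneg) auto
  finally have "ln (av (det (R \<gamma>))) \<le> ln (fact N * (\<Prod>i<N. av (sv \<gamma> i)) * fact N)"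
    using av_pos[OF R_det[OF \<gamma>]] by (subst ln_le_cancel_iff) (auto intro: less_le_trans)
  also have "\<dots> = 2 * ln (fact N) + (\<Sum>i<N. x i)"
  proof -
    have "ln (\<Prod>i<N. av (sv \<gamma> i)) = (\<Sum>i<N. x i)"
      unfolding x_def by (intro ln_prod finite_lessThan) (metis lessThan_iff less_irrefl pos)
    moreover have "ln (fact N * y * fact N) = 2 * ln (fact N) + ln y" if "0 < y" for y :: real
      using that by (simp add: ln_mult)
    ultimately show ?thesis using prod_sv_pos[OF \<gamma>, of N] by simp
  qed
  finally have d: "ln (av (det (R \<gamma>))) \<le> 2 * ln (fact N) + (\<Sum>i<N. x i)" .
  have mono: "x j \<le> x i" if "i \<le> j" "j < N" for i j
    using svd_antimono[OF s that] pos[of i] pos[of j] that by (simp add: x_def)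
  define A where "A = (\<Sum>i<p. x i)"
  have lnp: "ln (\<Prod>i<p. av (sv \<gamma> i)) = A" 
    unfolding A_def x_def by (intro ln_prod finite_lessThan) (metis lessThan_iff less_irrefl pos p(2) less_trans)
  have "(\<Sum>i<N. x i) = A + (\<Sum>i<N - p. x (p + i))" using sum_lessThan_plus[of x p "N - p"] p by (simp add: A_def)
  also have "(\<Sum>i<N - p. x (p + i)) \<le> (\<Sum>i<N - p. x (p - 1))" using p by (intro sum_mono mono) auto
  finally have "(\<Sum>i<N. x i) \<le> A + real (N - p) * x (p - 1)" by simp
  then have "real p * (\<Sum>i<N. x i) \<le> real p * (A + real (N - p) * x (p - 1))" by (intro mult_left_mono) auto
  also have "\<dots> = real p * A + real (N - p) * (\<Sum>i<p. x (p - 1))" by (simp add: algebra_simps)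
  also have "\<dots> \<le> real p * A + real (N - p) * A"
  proof -
    have "(\<Sum>i<p. x (p - 1)) \<le> A" unfolding A_def using p by (intro sum_mono mono) auto
    then show ?thesis by (intro add_left_mono mult_left_mono) auto
  qed
  also have "\<dots> = real N * A" using p by (simp add: of_nat_diff algebra_simps)
  finally have "real p * (\<Sum>i<N. x i) \<le> real N * A" .
  moreover have "real p * ln (av (det (R \<gamma>))) \<le> real p * (2 * ln (fact N) + (\<Sum>i<N. x i))" using d by (intro mult_left_mono) auto
  ultimately show "- (real p * (2 * ln (fact N))) \<le> F p \<gamma>" unfolding F_def lnp by (simp add: distrib_left)
qed

text \<open>Up to the scalar \<open>c\<close>, the singular values of the product are those of two
  diagonal matrices separated by the isometry \<open>K' \<gamma>1 * K \<gamma>2\<close>. If the top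
  minor of this isometry is small, the exterior power of the product is smaller than the product of
  the exterior powers. The scalar cancels between the minor and the determinant, which is what the
  normalisation of \<open>F\<close> is made for.\<close>

lemma F_submult:
  assumes p: "0 < p" "p < N" and \<gamma>: "\<gamma>1 \<in> carrier G" "\<gamma>2 \<in> carrier G" and t: "0 < t" "t \<le> 1"
    and gap1: "av (sv \<gamma>1 p) \<le> t * av (sv \<gamma>1 (p - 1))" and gap2: "av (sv \<gamma>2 p) \<le> t * av (sv \<gamma>2 (p - 1))"
    and top: "av (top_minor p (K' \<gamma>1 * K \<gamma>2)) \<le> fact p * t"
  shows "F p (\<gamma>1 \<otimes> \<gamma>2) \<le> F p \<gamma>1 + F p \<gamma>2 + real N * ln (real (N ^ p * N ^ p) * fact p * t)"
proof -
  have g: "\<gamma>1 \<otimes> \<gamma>2 \<in> carrier G" using \<gamma> by simp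
  note s1 = svd_sv[OF \<gamma>(1)] and s2 = svd_sv[OF \<gamma>(2)] and s = svd_sv[OF g]
  note k = isom_carrier[OF svd_isom(1)[OF s]] and k1 = isom_carrier[OF svd_isom(1)[OF s1]] and k2 = isom_carrier[OF svd_isom(1)[OF s2]]
  note l = isom_carrier[OF svd_isom(2)[OF s]] and l1 = isom_carrier[OF svd_isom(2)[OF s1]] and l2 = isom_carrier[OF svd_isom(2)[OF s2]]
  note dk = isom_det[OF svd_isom(1)[OF s]] and dl = isom_det[OF svd_isom(2)[OF s]]
  define X where "X = minv (K (\<gamma>1 \<otimes> \<gamma>2)) * K \<gamma>1"
  define m where "m = K' \<gamma>1 * K \<gamma>2"
  define Y where "Y = K' \<gamma>2 * minv (K' (\<gamma>1 \<otimes> \<gamma>2))"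
  have X: "X \<in> isom N" and m: "m \<in> isom N" and Y: "Y \<in> isom N"
    unfolding X_def m_def Y_def using svd_isom[OF s] svd_isom[OF s1] svd_isom[OF s2] isom_minv isom_mult by auto
  note XC = isom_carrier[OF X] and mC = isom_carrier[OF m] and YC = isom_carrier[OF Y]
  obtain c where c: "c \<noteq> 0" "R (\<gamma>1 \<otimes> \<gamma>2) = c \<cdot>\<^sub>m (R \<gamma>1 * R \<gamma>2)" using R_mult[OF \<gamma>] by blast
  let ?D = "mat_diag N" and ?P = "X * mat_diag N (sv \<gamma>1) * m * mat_diag N (sv \<gamma>2) * Y"
  have PC: "?P \<in> carrier_mat N N" using XC mC YC by (meson mat_diag_dim mult_carrier_mat)
  have diag: "?D (sv (\<gamma>1 \<otimes> \<gamma>2)) = c \<cdot>\<^sub>m ?P"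
  proof (rule mat_eqI_vec[OF mat_diag_dim smult_carrier_mat[OF PC]])
    fix v :: "'k vec" assume v: "v \<in> carrier_vec N"
    note mlv = mult_mat_vec_carrier[OF minv(1)[OF l dl] v]
    have c4: "A \<in> carrier_mat N N \<Longrightarrow> B \<in> carrier_mat N N \<Longrightarrow> x \<in> carrier_vec N \<Longrightarrow> (A * B) *\<^sub>v x = A *\<^sub>v (B *\<^sub>v x)" for A B :: "'k mat" and x
      by (rule assoc_mult_mat_vec)
    have "R (\<gamma>1 \<otimes> \<gamma>2) *\<^sub>v (minv (K' (\<gamma>1 \<otimes> \<gamma>2)) *\<^sub>v v) = K (\<gamma>1 \<otimes> \<gamma>2) *\<^sub>v (?D (sv (\<gamma>1 \<otimes> \<gamma>2)) *\<^sub>v v)"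
      unfolding svd_vec[OF s mlv] minv_mult_vec(2)[OF l dl v] using mat_diag_mult_vec[OF v] by simp
    then have 1: "?D (sv (\<gamma>1 \<otimes> \<gamma>2)) *\<^sub>v v = minv (K (\<gamma>1 \<otimes> \<gamma>2)) *\<^sub>v (R (\<gamma>1 \<otimes> \<gamma>2) *\<^sub>v (minv (K' (\<gamma>1 \<otimes> \<gamma>2)) *\<^sub>v v))"
      using minv_mult_vec(1)[OF k dk, of "?D (sv (\<gamma>1 \<otimes> \<gamma>2)) *\<^sub>v v"] mult_mat_vec_carrier[OF mat_diag_dim v] by simp
    let ?z = "minv (K' (\<gamma>1 \<otimes> \<gamma>2)) *\<^sub>v v"
    have R2: "R \<gamma>2 *\<^sub>v ?z = K \<gamma>2 *\<^sub>v (?D (sv \<gamma>2) *\<^sub>v (Y *\<^sub>v v))"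
      unfolding svd_vec[OF s2 mlv] Y_def c4[OF l2 minv(1)[OF l dl] v] 
      using mat_diag_mult_vec[OF mult_mat_vec_carrier[OF l2 mlv]] by simp
    define y where "y = ?D (sv \<gamma>2) *\<^sub>v (Y *\<^sub>v v)"
    have y: "y \<in> carrier_vec N" unfolding y_def by (rule mult_mat_vec_carrier[OF mat_diag_dim mult_mat_vec_carrier[OF YC v]])
    have R1: "R \<gamma>1 *\<^sub>v (K \<gamma>2 *\<^sub>v y) = K \<gamma>1 *\<^sub>v (?D (sv \<gamma>1) *\<^sub>v (m *\<^sub>v y))"
      unfolding svd_vec[OF s1 mult_mat_vec_carrier[OF k2 y]] m_def c4[OF l1 k2 y]
      using mat_diag_mult_vec[OF mult_mat_vec_carrier[OF l1 mult_mat_vec_carrier[OF k2 y]]] by simp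
    define w where "w = ?D (sv \<gamma>1) *\<^sub>v (m *\<^sub>v y)"
    have w: "w \<in> carrier_vec N" unfolding w_def by (rule mult_mat_vec_carrier[OF mat_diag_dim mult_mat_vec_carrier[OF mC y]])
    have "R (\<gamma>1 \<otimes> \<gamma>2) *\<^sub>v ?z = c \<cdot>\<^sub>v (K \<gamma>1 *\<^sub>v w)"
      unfolding c(2) smult_mat_mult_vec[OF mult_carrier_mat[OF R_carrier[OF \<gamma>(1)] R_carrier[OF \<gamma>(2)]] mlv]
        c4[OF R_carrier[OF \<gamma>(1)] R_carrier[OF \<gamma>(2)] mlv] R2 y_def[symmetric] R1 w_def[symmetric] ..
    then have "?D (sv (\<gamma>1 \<otimes> \<gamma>2)) *\<^sub>v v = c \<cdot>\<^sub>v (X *\<^sub>v w)"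
      unfolding 1 X_def c4[OF minv(1)[OF k dk] k1 w]
      using mult_mat_vec[OF minv(1)[OF k dk] mult_mat_vec_carrier[OF k1 w], of c] by simp
    moreover have "?P *\<^sub>v v = X *\<^sub>v w"
    proof -
      note a1 = mult_carrier_mat[OF XC mat_diag_dim, of "sv \<gamma>1"]
      note a2 = mult_carrier_mat[OF a1 mC]
      note a3 = mult_carrier_mat[OF a2 mat_diag_dim, of "sv \<gamma>2"]
      show ?thesis
        unfolding c4[OF a3 YC v] c4[OF a2 mat_diag_dim mult_mat_vec_carrier[OF YC v]] y_def[symmetric]
          c4[OF a1 mC y] c4[OF XC mat_diag_dim mult_mat_vec_carrier[OF mC y]] w_def ..
    qed
    ultimately show "?D (sv (\<gamma>1 \<otimes> \<gamma>2)) *\<^sub>v v = (c \<cdot>\<^sub>m ?P) *\<^sub>v v" using smult_mat_mult_vec[OF PC v] by simp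
  qed
  have "(\<Prod>i<p. av (sv (\<gamma>1 \<otimes> \<gamma>2) i)) = av (top_minor p (c \<cdot>\<^sub>m ?P))"
    unfolding diag[symmetric] using top_minor_diag[of p N "sv (\<gamma>1 \<otimes> \<gamma>2)"] p by (simp add: av_prod)
  also have "top_minor p (c \<cdot>\<^sub>m ?P) = c ^ p * top_minor p ?P"
    using top_minor_smult[OF PC] p by simp
  also have "av (c ^ p * top_minor p ?P) = av c ^ p * av (top_minor p ?P)" by (simp add: av_mult av_power)
  also have "\<dots> \<le> av c ^ p * (real (N ^ p * N ^ p) * fact p * t * (\<Prod>i<p. av (sv \<gamma>1 i)) * (\<Prod>i<p. av (sv \<gamma>2 i)))"
  proof (intro mult_left_mono top_minor_product_le[OF XC mC YC isom_entry[OF X] isom_entry[OF m] isom_entry[OF Y]])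
    show "av (sv \<gamma>1 i) \<le> t * av (sv \<gamma>1 (p - 1))" if "p \<le> i" "i < N" for i using svd_antimono[OF s1 that] gap1 by linarith
    show "av (sv \<gamma>2 i) \<le> t * av (sv \<gamma>2 (p - 1))" if "p \<le> i" "i < N" for i using svd_antimono[OF s2 that] gap2 by linarith
  qed (use p t top svd_antimono[OF s1] svd_antimono[OF s2] in \<open>auto simp: m_def\<close>)
  finally have le: "(\<Prod>i<p. av (sv (\<gamma>1 \<otimes> \<gamma>2) i)) \<le> av c ^ p * (real (N ^ p * N ^ p) * fact p * t * (\<Prod>i<p. av (sv \<gamma>1 i)) * (\<Prod>i<p. av (sv \<gamma>2 i)))" .
  have pp: "0 < (\<Prod>i<p. av (sv \<gamma>1 i))" "0 < (\<Prod>i<p. av (sv \<gamma>2 i))" "0 < (\<Prod>i<p. av (sv (\<gamma>1 \<otimes> \<gamma>2) i))"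
    using prod_sv_pos \<gamma> g p by auto
  have cp: "0 < av c" using c(1) by (rule av_pos)
  define Q where "Q = real (N ^ p * N ^ p) * fact p * t"
  have Q: "0 < Q" using t p by (simp add: Q_def)
  have "ln (\<Prod>i<p. av (sv (\<gamma>1 \<otimes> \<gamma>2) i)) \<le> ln (av c ^ p * (Q * (\<Prod>i<p. av (sv \<gamma>1 i)) * (\<Prod>i<p. av (sv \<gamma>2 i))))"
    using le pp unfolding Q_def by (subst ln_le_cancel_iff) (auto intro: less_le_trans)
  also have "\<dots> = real p * ln (av c) + (ln Q + ln (\<Prod>i<p. av (sv \<gamma>1 i)) + ln (\<Prod>i<p. av (sv \<gamma>2 i)))"
  proof -
    have "ln (x ^ p * (Q * y * z)) = real p * ln x + (ln Q + ln y + ln z)" if "0 < x" "0 < y" "0 < z" for x y z :: real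
      using that Q by (simp add: ln_mult ln_realpow)
    then show ?thesis using pp cp by blast
  qed
  finally have "real N * ln (\<Prod>i<p. av (sv (\<gamma>1 \<otimes> \<gamma>2) i))
      \<le> real N * (real p * ln (av c) + (ln Q + ln (\<Prod>i<p. av (sv \<gamma>1 i)) + ln (\<Prod>i<p. av (sv \<gamma>2 i))))"
    by (intro mult_left_mono) auto
  moreover have "ln (av (det (R (\<gamma>1 \<otimes> \<gamma>2)))) = real N * ln (av c) + ln (av (det (R \<gamma>1))) + ln (av (det (R \<gamma>2)))"
  proof -
    have "det (R (\<gamma>1 \<otimes> \<gamma>2)) = c ^ N * (det (R \<gamma>1) * det (R \<gamma>2))"
      unfolding c(2) using R_carrier[OF \<gamma>(1)] R_carrier[OF \<gamma>(2)] by (simp add: det_mult[OF R_carrier[OF \<gamma>(1)] R_carrier[OF \<gamma>(2)]])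
    moreover have "ln (x ^ N * (y * z)) = real N * ln x + ln y + ln z" if "0 < x" "0 < y" "0 < z" for x y z :: real
      using that by (simp add: ln_mult ln_realpow)
    ultimately show ?thesis using cp av_pos[OF R_det[OF \<gamma>(1)]] av_pos[OF R_det[OF \<gamma>(2)]]
      by (metis av_mult av_power)
  qed
  ultimately show ?thesis unfolding F_def Q_def[symmetric] by (simp add: algebra_simps)
qed

text \<open>A vector near both the attracting space of \<gamma>2 and the space contracted by
  \<gamma>1 has coordinates \<open>y\<close> in the frame \<open>K \<gamma>2\<close> that the top
  block of \<open>K' \<gamma>1 * K \<gamma>2\<close> nearly kills. Some \<open>y $ k\<close> has
  size at least \<open>nv v / (4 * N)\<close> and the images have size at most
  \<open>4 * e * nv v\<close>; Cramer's rule turns the quotient into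
  \<open>16 * N * e\<close>.\<close>

lemma top_minor_common_vector:
  assumes p: "0 < p" "p < N" and \<gamma>: "\<gamma>1 \<in> carrier G" "\<gamma>2 \<in> carrier G"
    and v: "v \<in> carrier_vec N" "v \<noteq> 0\<^sub>v N" and e: "0 \<le> e" "e \<le> 1 / 2"
    and u: "u \<in> U p \<gamma>2" "nv (v - u) \<le> e * nv v" and w: "w \<in> U (N - p) (inv \<gamma>1)" "nv (v - w) \<le> e * nv v"
    and gap1: "av (sv \<gamma>1 p) \<le> e * av (sv \<gamma>1 (p - 1))"
  shows "av (top_minor p (K' \<gamma>1 * K \<gamma>2)) \<le> fact p * (16 * real N * e)"
proof -
  note s1 = svd_sv[OF \<gamma>(1)] and s2 = svd_sv[OF \<gamma>(2)]
  note k2 = svd_isom(1)[OF s2] and l1 = svd_isom(2)[OF s1]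
  note k2c = isom_carrier[OF k2] and l1c = isom_carrier[OF l1]
  have nvv: "0 < nv v" by (rule nv_pos[OF v])
  have uc: "u \<in> carrier_vec N" and wc: "w \<in> carrier_vec N" using u(1) w(1) U_carrier[OF \<gamma>(2)] U_carrier[of "inv \<gamma>1"] \<gamma>(1) by auto
  obtain y where y: "y \<in> carrier_vec N" "u = K \<gamma>2 *\<^sub>v y" "\<forall>i. p \<le> i \<and> i < N \<longrightarrow> y $ i = 0"
    using u(1) by (auto simp: U_def Sp_def)
  have nu: "nv u \<ge> nv v / 2"
  proof -
    have "nv v \<le> nv u + e * nv v" using nv_le_dist[OF v(1) uc] u(2) by linarith
    moreover have "e * nv v \<le> 1 / 2 * nv v" using e by (intro mult_right_mono) auto
    ultimately show ?thesis by simp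
  qed
  have nw: "nv w \<le> 2 * nv v"
  proof -
    have "nv w \<le> nv v + e * nv v" using nv_le_dist[OF wc v(1)] w(2) nv_minus_commute[OF wc v(1)] by linarith
    moreover have "e * nv v \<le> 1 * nv v" using e by (intro mult_right_mono) auto
    ultimately show ?thesis by simp
  qed
  have "\<exists>k<p. nv v / (4 * real N) \<le> av (y $ k)"
  proof (rule ccontr)
    assume neg: "\<not> (\<exists>k<p. nv v / (4 * real N) \<le> av (y $ k))"
    have "av (y $ i) \<le> nv v / (4 * real N)" if "i < dim_vec y" for i
      using neg y that nvv by (cases "i < p") (auto simp: not_le intro: less_imp_le)
    then have "nv y \<le> real (dim_vec y) * (nv v / (4 * real N))" using nvv by (intro nv_le) auto
    then have "nv y \<le> nv v / 4" using y(1) p by simp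
    moreover have "nv y = nv u" unfolding y(2) using isom_nv[OF k2 y(1)] by simp
    ultimately show False using nu nvv by linarith
  qed
  then obtain k where k: "k < p" "nv v / (4 * real N) \<le> av (y $ k)" by blast
  let ?m = "K' \<gamma>1 * K \<gamma>2"
  have mis: "?m \<in> isom N" by (rule isom_mult[OF l1 k2])
  let ?y = "Matrix.vec p (\<lambda>i. y $ i)"
  have my: "(\<Sum>j<p. ?m $$ (i, j) * ?y $ j) = (K' \<gamma>1 *\<^sub>v u) $ i" if i: "i < p" for i
  proof -
    have "(K' \<gamma>1 *\<^sub>v u) $ i = (?m *\<^sub>v y) $ i" unfolding y(2) using assoc_mult_mat_vec[OF l1c k2c y(1)] by simp
    also have "\<dots> = (\<Sum>j<N. ?m $$ (i, j) * y $ j)"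
      using mult_mat_vec_index[OF isom_carrier[OF mis] y(1), of i] i p by simp
    also have "\<dots> = (\<Sum>j<p. ?m $$ (i, j) * y $ j)" by (rule sum.mono_neutral_right) (use p y(3) in auto)
    finally show ?thesis by simp
  qed
  have bound: "av ((K' \<gamma>1 *\<^sub>v u) $ i) \<le> 4 * e * nv v" if i: "i < p" for i
  proof -
    have iN: "i < N" using i p by simp
    have "K' \<gamma>1 *\<^sub>v u = K' \<gamma>1 *\<^sub>v w + K' \<gamma>1 *\<^sub>v (u - w)"
      using mult_minus_distrib_mat_vec[OF l1c uc wc] l1c uc wc by (intro eq_vecI) auto
    then have "av ((K' \<gamma>1 *\<^sub>v u) $ i) \<le> av ((K' \<gamma>1 *\<^sub>v w) $ i) + av ((K' \<gamma>1 *\<^sub>v (u - w)) $ i)"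
      using iN l1c av_triangle by (simp del: index_mult_mat_vec)
    moreover have "av ((K' \<gamma>1 *\<^sub>v (u - w)) $ i) \<le> 2 * e * nv v"
    proof -
      have "av ((K' \<gamma>1 *\<^sub>v (u - w)) $ i) \<le> nv (K' \<gamma>1 *\<^sub>v (u - w))" using iN l1c by (intro nv_entry) simp
      also have "\<dots> = nv (u - w)" using uc wc by (intro isom_nv[OF l1]) simp
      also have "\<dots> \<le> nv (u - v) + nv (v - w)" by (rule nv_dist_triangle[OF uc v(1) wc])
      finally show ?thesis using u(2) w(2) nv_minus_commute[OF uc v(1)] by simp
    qed
    moreover have "av ((K' \<gamma>1 *\<^sub>v w) $ i) \<le> 2 * e * nv v"
    proof -
      have "av (sv \<gamma>1 i) * av ((K' \<gamma>1 *\<^sub>v w) $ i) \<le> nv (Matrix.vec N (\<lambda>i. sv \<gamma>1 i * (K' \<gamma>1 *\<^sub>v w) $ i))"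
        using nv_entry[of i "Matrix.vec N (\<lambda>i. sv \<gamma>1 i * (K' \<gamma>1 *\<^sub>v w) $ i)"] iN by (simp add: av_mult del: index_mult_mat_vec)
      also have "\<dots> = nv (R \<gamma>1 *\<^sub>v w)" by (rule svd_nv[OF s1 wc, symmetric])
      also have "\<dots> \<le> av (sv \<gamma>1 p) * nv w" by (rule dual_contract[OF p \<gamma>(1) w(1)])
      also have "\<dots> \<le> (e * av (sv \<gamma>1 (p - 1))) * (2 * nv v)" using gap1 nw e by (intro mult_mono) auto
      finally have "av (sv \<gamma>1 i) * av ((K' \<gamma>1 *\<^sub>v w) $ i) \<le> av (sv \<gamma>1 (p - 1)) * (2 * e * nv v)" by (simp add: mult_ac)
      also have "\<dots> \<le> av (sv \<gamma>1 i) * (2 * e * nv v)"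
        using svd_antimono[OF s1, of i "p - 1"] i p e by (intro mult_right_mono) auto
      finally show ?thesis using sv_pos[OF \<gamma>(1) iN] by simp
    qed
    ultimately show ?thesis by linarith
  qed
  have "av (top_minor p ?m) \<le> fact p * ((4 * e * nv v) / (nv v / (4 * real N)))"
  proof (rule top_minor_small[where y = ?y and k = k])
    show "av (\<Sum>j<p. ?m $$ (i, j) * ?y $ j) \<le> 4 * e * nv v" if "i < p" for i using bound[OF that] my[OF that] by simp
  qed (use k nvv p e isom_entry[OF mis] in auto)
  also have "(4 * e * nv v) / (nv v / (4 * real N)) = 16 * real N * e" using nvv by simp
  finally show ?thesis .
qed

lemma biinfinite_path:
  fixes P :: "int \<Rightarrow> 'g"
  assumes P: "\<And>i. P i \<in> carrier G" "\<And>i j. real (d (P i) (P j)) \<le> \<bar>real_of_int (i - j)\<bar>"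
      "\<And>i j. \<bar>real_of_int (i - j)\<bar> \<le> d (P i) (P j) + real D"
  shows "path D (\<lambda>n. inv (P i) \<otimes> P (i + int n))"
  unfolding path_def
proof (intro conjI allI)
  fix n
  show "inv (P i) \<otimes> P (i + int n) \<in> carrier G" using P(1) by simp
  show "d (inv (P i) \<otimes> P (i + int n)) (inv (P i) \<otimes> P (i + int (Suc n))) \<le> 1"
    using P(2)[of "i + int n" "i + int (Suc n)"] P(1) by (simp add: d_left)
  show "n \<le> len (inv (P i) \<otimes> P (i + int n)) + D"
    using P(3)[of i "i + int n"] by (simp add: word_dist_def)
qed

lemma biinfinite_path_rev:
  fixes P :: "int \<Rightarrow> 'g"
  assumes P: "\<And>i. P i \<in> carrier G" "\<And>i j. real (d (P i) (P j)) \<le> \<bar>real_of_int (i - j)\<bar>"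
      "\<And>i j. \<bar>real_of_int (i - j)\<bar> \<le> d (P i) (P j) + real D"
  shows "path D (\<lambda>n. inv (P i) \<otimes> P (i - int n))"
proof -
  have eq: "\<bar>real_of_int (- i - - j)\<bar> = \<bar>real_of_int (i - j)\<bar>" for i j by simp
  have "path D (\<lambda>n. inv (P (- (- i))) \<otimes> P (- (- i + int n)))"
    by (rule biinfinite_path[where P = "\<lambda>i. P (- i)"]) (use P eq in \<open>metis+\<close>)
  then show ?thesis by simp
qed

text \<open>At each \<open>i\<close> the vector \<open>v i\<close> lies in the limit spaces of both
  directions, so windows of length \<open>n\<close> on the two sides of \<open>i\<close> nearly
  share it, up to \<open>B * \<tau> ^ n\<close>. Thus \<open>F\<close> of the joined window loses a
  term linear in \<open>n\<close>. Lower bounds for \<open>F\<close> are general; upper bounds hold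
  because windows of length \<open>n\<close> range over a finite ball.\<close>

lemma transversal_path:
  fixes P :: "int \<Rightarrow> 'g"
  assumes p: "0 < p" "p < N" and gap: "gapped p"
    and P: "\<And>i. P i \<in> carrier G" "\<And>i j. real (d (P i) (P j)) \<le> \<bar>real_of_int (i - j)\<bar>"
      "\<And>i j. \<bar>real_of_int (i - j)\<bar> \<le> d (P i) (P j) + real D"
    and v: "\<And>i. v i \<in> carrier_vec N" "\<And>i. v i \<noteq> 0\<^sub>v N"
      "\<And>i. v i \<in> xi p (\<lambda>n. inv (P i) \<otimes> P (i + int n))" "\<And>i. v i \<in> xi (N - p) (\<lambda>n. inv (P i) \<otimes> P (i - int n))"
  shows False
proof -
  have p': "0 < N - p" "N - p < N" using p by auto
  have gap': "gapped (N - p)" by (rule gapped_dual[OF p gap])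
  obtain C1 \<tau>1 where C1: "C1 > 0" "0 < \<tau>1" "\<tau>1 < 1" "\<And>q. path D q \<Longrightarrow> tail_bound C1 \<tau>1 p q (xi p q)"
    using xi_tail_bound[OF p gap, of D] by blast
  obtain C2 \<tau>2 where C2: "C2 > 0" "0 < \<tau>2" "\<tau>2 < 1" "\<And>q. path D q \<Longrightarrow> tail_bound C2 \<tau>2 (N - p) q (xi (N - p) q)"
    using xi_tail_bound[OF p' gap', of D] by blast
  obtain c \<tau>3 where c: "c > 0" "0 < \<tau>3" "\<tau>3 < 1" and
    gp: "\<And>\<gamma> k \<alpha> l. \<gamma> \<in> carrier G \<Longrightarrow> svd N (R \<gamma>) k \<alpha> l \<Longrightarrow> av (\<alpha> p) / av (\<alpha> (p - 1)) \<le> c * \<tau>3 ^ len \<gamma>"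
    using gap unfolding gapped_def by blast
  define \<tau> where "\<tau> = max \<tau>1 (max \<tau>2 \<tau>3)"
  have \<tau>: "0 < \<tau>" "\<tau> < 1" "\<tau>1 \<le> \<tau>" "\<tau>2 \<le> \<tau>" "\<tau>3 \<le> \<tau>" using C1 C2 c by (auto simp: \<tau>_def)
  define B where "B = C1 + C2 + c / \<tau>3 ^ D"
  have B: "B > 0" "C1 \<le> B" "C2 \<le> B" "c / \<tau>3 ^ D \<le> B" using C1 C2 c by (auto simp: B_def add_pos_pos)
  have le: "x * y ^ n \<le> B * \<tau> ^ n" if "0 \<le> x" "x \<le> B" "0 < y" "y \<le> \<tau>" for x y n
    using that by (intro mult_mono power_mono) auto
  have dist: "len (inv (P i) \<otimes> P j) = d (P i) (P j)" for i j by (simp add: word_dist_def)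
  note pathf = biinfinite_path[OF P] and pathb = biinfinite_path_rev[OF P]
  define f where "f i n = F p (inv (P i) \<otimes> P (i + int n))" for i n
  define Q where "Q = real (N ^ p * N ^ p) * fact p * (16 * real N * B)"
  have Q: "Q > 0" using p B by (simp add: Q_def)
  have "(\<lambda>n. 16 * real N * B * \<tau> ^ n) \<longlonglongrightarrow> 16 * real N * B * 0" using \<tau> by (intro tendsto_intros LIMSEQ_power_zero) auto
  then have "\<forall>\<^sub>F n in sequentially. 16 * real N * B * \<tau> ^ n < 1 / 2" by (intro order_tendstoD(2)) auto
  then obtain n1 where n1: "\<And>n. n \<ge> n1 \<Longrightarrow> 16 * real N * B * \<tau> ^ n < 1 / 2" unfolding eventually_sequentially by blast
  \<comment> \<open>Centred at \<open>i\<close>, where the common vector lives; the window of length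
    \<open>2 * n\<close> therefore starts at \<open>i - int n\<close>.\<close>
  have step: "f (i - int n) (2 * n) \<le> f (i - int n) n + f i n + real N * ln Q - (- (real N * ln \<tau>)) * real n" if n: "n \<ge> n1" for i n
  proof -
    define \<gamma>1 where "\<gamma>1 = inv (P (i - int n)) \<otimes> P i"
    define \<gamma>2 where "\<gamma>2 = inv (P i) \<otimes> P (i + int n)"
    have \<gamma>: "\<gamma>1 \<in> carrier G" "\<gamma>2 \<in> carrier G" using P(1) by (auto simp: \<gamma>1_def \<gamma>2_def)
    have i1: "inv \<gamma>1 = inv (P i) \<otimes> P (i - int n)" using P(1) by (simp add: \<gamma>1_def inv_mult_group)
    have "\<gamma>1 \<otimes> \<gamma>2 = inv (P (i - int n)) \<otimes> (P i \<otimes> (inv (P i) \<otimes> P (i + int n)))" using P(1) by (simp add: \<gamma>1_def \<gamma>2_def m_assoc)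
    also have "P i \<otimes> (inv (P i) \<otimes> P (i + int n)) = P (i + int n)" using P(1) by (simp flip: m_assoc)
    finally have g12: "\<gamma>1 \<otimes> \<gamma>2 = inv (P (i - int n)) \<otimes> P (i + int n)" .
    define e where "e = B * \<tau> ^ n"
    have e: "0 < e" using B \<tau> by (simp add: e_def)
    have Ne: "16 * real N * e < 1 / 2" using n1[OF n] by (simp add: e_def mult.assoc)
    have "1 * e \<le> 16 * real N * e" using p e by (intro mult_right_mono) auto
    then have e2: "e \<le> 1 / 2" "e \<le> 16 * real N * e" using Ne by linarith+
    have gape: "av (sv \<gamma> p) \<le> e * av (sv \<gamma> (p - 1))" if g: "\<gamma> \<in> carrier G" and l: "n \<le> len \<gamma> + D" for \<gamma>
    proof -
      have "\<tau>3 ^ (len \<gamma> + D) \<le> \<tau>3 ^ n" using l c by (intro power_decreasing) auto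
      then have "c * \<tau>3 ^ len \<gamma> \<le> c / \<tau>3 ^ D * \<tau>3 ^ n" using c by (simp add: power_add field_simps)
      also have "\<dots> \<le> e" unfolding e_def using B c \<tau> by (intro le) auto
      finally have "av (sv \<gamma> p) / av (sv \<gamma> (p - 1)) \<le> e" using gp[OF g svd_sv[OF g]] by linarith
      then show ?thesis using sv_pos[OF g, of "p - 1"] p by (simp add: field_simps)
    qed
    have "real n \<le> len \<gamma>1 + real D" using P(3)[of "i - int n" i] unfolding \<gamma>1_def dist by simp
    then have gap1: "av (sv \<gamma>1 p) \<le> e * av (sv \<gamma>1 (p - 1))" by (intro gape[OF \<gamma>(1)]) linarith
    have "real n \<le> len \<gamma>2 + real D" using P(3)[of i "i + int n"] unfolding \<gamma>2_def dist by simp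
    then have gap2: "av (sv \<gamma>2 p) \<le> e * av (sv \<gamma>2 (p - 1))" by (intro gape[OF \<gamma>(2)]) linarith
    have "near e (xi p (\<lambda>n. inv (P i) \<otimes> P (i + int n))) (U p \<gamma>2)"
      using C1(4)[OF pathf[of i]] near_mono[OF _ le[of C1 \<tau>1 n]] C1 B \<tau> unfolding tail_bound_def \<gamma>2_def e_def by auto
    then obtain u where u: "u \<in> U p \<gamma>2" "nv (v i - u) \<le> e * nv (v i)" using v(3)[of i] by (auto simp: near_def)
    have "near e (xi (N - p) (\<lambda>n. inv (P i) \<otimes> P (i - int n))) (U (N - p) (inv \<gamma>1))"
      using C2(4)[OF pathb[of i]] near_mono[OF _ le[of C2 \<tau>2 n]] C2 B \<tau> unfolding tail_bound_def i1 e_def by auto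
    then obtain w where w: "w \<in> U (N - p) (inv \<gamma>1)" "nv (v i - w) \<le> e * nv (v i)" using v(4)[of i] by (auto simp: near_def)
    have top: "av (top_minor p (K' \<gamma>1 * K \<gamma>2)) \<le> fact p * (16 * real N * e)"
      by (rule top_minor_common_vector[OF p \<gamma> v(1,2) _ e2(1) u w gap1]) (use e in simp)
    define t where "t = 16 * real N * e"
    have t: "0 < t" "t \<le> 1" using e p Ne by (auto simp: t_def)
    have up: "e * av x \<le> t * av x" for x using e2(2) unfolding t_def by (intro mult_right_mono) auto
    have "F p (\<gamma>1 \<otimes> \<gamma>2) \<le> F p \<gamma>1 + F p \<gamma>2 + real N * ln (real (N ^ p * N ^ p) * fact p * t)"
      by (rule F_submult[OF p \<gamma> t order_trans[OF gap1 up] order_trans[OF gap2 up]]) (use top in \<open>simp add: t_def\<close>)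
    also have "real (N ^ p * N ^ p) * fact p * t = Q * \<tau> ^ n" by (simp add: Q_def t_def e_def)
    also have "ln (Q * \<tau> ^ n) = ln Q + real n * ln \<tau>" using Q \<tau> by (simp add: ln_mult ln_realpow)
    finally show ?thesis
      unfolding f_def g12 unfolding \<gamma>1_def \<gamma>2_def by (simp add: algebra_simps)
  qed
  obtain b where b: "\<And>\<gamma>. \<gamma> \<in> carrier G \<Longrightarrow> b \<le> F p \<gamma>" using F_lower[OF p] by blast
  show False
  proof (rule doubling_contradiction[where f = f and a = "real N * ln Q" and \<mu> = "- (real N * ln \<tau>)" and M = n1])
    show "f i (2 * n) \<le> f i n + f (i + int n) n + real N * ln Q - - (real N * ln \<tau>) * real n" if "n1 \<le> n" for i n
      using step[OF that, of "i + int n"] by simp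
    show "0 < - (real N * ln \<tau>)" using \<tau> p by (simp add: mult_pos_neg)
    show "b \<le> f i n" for i n unfolding f_def using b P(1) by simp
    show "\<exists>B. \<forall>i. f i n \<le> B" for n
    proof -
      have fin: "finite (F p ` {\<gamma> \<in> carrier G. len \<gamma> \<le> n})" using finite_ball by simp
      have "f i n \<le> Max (F p ` {\<gamma> \<in> carrier G. len \<gamma> \<le> n})" for i
        unfolding f_def
      proof (rule Max_ge[OF fin imageI])
        show "inv (P i) \<otimes> P (i + int n) \<in> {\<gamma> \<in> carrier G. len \<gamma> \<le> n}"
          using P(1) P(2)[of i "i + int n"] dist[of i "i + int n"] by simp
      qed
      then show ?thesis by blast
    qed
  qed
qed

end

context projective_rep
begin

text \<open>The rays are joined at the identity to a bi-infinite path, whose defect is at most twice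
  the Gromov product bound. By equivariance a common vector at the identity yields one at every
  point of this path.\<close>

lemma transversal_rays:
  assumes p: "0 < p" "p < N" and gap: "gapped p"
    and r: "\<eta> \<in> rays" "\<zeta> \<in> rays" "\<eta> 0 = \<one>" "\<zeta> 0 = \<one>" and sep: "sep C \<eta> \<zeta>"
    and v: "v \<in> xi p \<eta>" "v \<in> xi (N - p) \<zeta>"
  shows "v = 0\<^sub>v N"
proof (rule ccontr)
  assume v0: "v \<noteq> 0\<^sub>v N"
  have p': "0 < N - p" "N - p < N" using p by auto
  have gap': "gapped (N - p)" by (rule gapped_dual[OF p gap])
  note c = ray_carrier[OF r(1)] ray_carrier[OF r(2)]
  define D where "D = nat \<lceil>2 * C\<rceil>"
  define P where "P i = (if 0 \<le> i then \<eta> (nat i) else \<zeta> (nat (- i)))" for i :: int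
  have Pc: "P i \<in> carrier G" for i using c by (simp add: P_def)
  have Pm: "P (- int n) = \<zeta> n" for n using r by (cases "n = 0") (auto simp: P_def)
  have Pp: "P (int n) = \<eta> n" for n by (simp add: P_def)
  have same: "d (\<eta> a) (\<eta> b) = nat \<bar>int a - int b\<bar>" "d (\<zeta> a) (\<zeta> b) = nat \<bar>int a - int b\<bar>" for a b
    using ray_d[OF r(1), of a b] ray_d[OF r(1), of b a] ray_d[OF r(2), of a b] ray_d[OF r(2), of b a]
      d_commute[OF c(1)[of a] c(1)[of b]] d_commute[OF c(2)[of a] c(2)[of b]] by (cases "a \<le> b"; simp)+
  have opp: "real (d (\<eta> a) (\<zeta> b)) \<le> real a + real b" "real a + real b \<le> real (d (\<eta> a) (\<zeta> b)) + real D" for a b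
  proof -
    have l: "d \<one> (\<eta> a) = a" "d \<one> (\<zeta> b) = b" using ray_d0[OF r(1), of a] ray_d0[OF r(2), of b] r by auto
    have "d (\<eta> a) (\<zeta> b) \<le> d (\<eta> a) \<one> + d \<one> (\<zeta> b)" using d_triangle[OF c(1) one_closed c(2)] by simp
    then show "real (d (\<eta> a) (\<zeta> b)) \<le> real a + real b" using l d_commute[OF c(1) one_closed] by simp
    have "gp \<one> (\<eta> a) (\<zeta> b) \<le> C" using sep r unfolding sep_def by simp
    then have "real a + b - d (\<eta> a) (\<zeta> b) \<le> 2 * C" using l by (simp add: gromov_product_def field_simps)
    moreover have "2 * C \<le> real D" unfolding D_def by (rule real_nat_ceiling_ge)
    ultimately show "real a + real b \<le> real (d (\<eta> a) (\<zeta> b)) + real D" by linarith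
  qed
  have cases: "\<exists>n. i = int n \<or> i = - int n" for i :: int by (cases i rule: int_cases2) auto
  have P2: "real (d (P i) (P j)) \<le> \<bar>real_of_int (i - j)\<bar> \<and> \<bar>real_of_int (i - j)\<bar> \<le> d (P i) (P j) + real D" for i j
  proof -
    obtain a b where a: "i = int a \<or> i = - int a" and b: "j = int b \<or> j = - int b" using cases by meson
    consider "i = int a" "j = int b" | "i = int a" "j = - int b" | "i = - int a" "j = int b" | "i = - int a" "j = - int b"
      using a b by blast
    then show ?thesis
    proof cases
      case 2
      then show ?thesis using opp[of a b] by (simp add: Pp Pm)
    next
      case 3
      then show ?thesis using opp[of b a] d_commute[OF c(1)[of b] c(2)[of a]] by (simp add: Pp Pm)
    qed (auto simp: Pp Pm same)
  qed
  have P: "\<And>i. P i \<in> carrier G" "\<And>i j. real (d (P i) (P j)) \<le> \<bar>real_of_int (i - j)\<bar>"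
      "\<And>i j. \<bar>real_of_int (i - j)\<bar> \<le> d (P i) (P j) + real D" using Pc P2 by auto
  \<comment> \<open>For negative \<open>i\<close> the forward path first runs back along \<zeta>.
    Dropping the first \<open>m\<close> terms leaves a translated tail of \<eta>, and the limit does
    not notice.\<close>
  have fwd: "xi p (\<lambda>n. inv (P i) \<otimes> P (i + int n)) = (*\<^sub>v) (R (inv (P i))) ` xi p \<eta>" for i
  proof -
    define m where "m = nat \<bar>i\<bar>"
    define m' where "m' = nat (i + int m)"
    have "P (i + int (m + n)) = \<eta> (m' + n)" for n
      by (simp add: P_def m_def m'_def nat_add_distrib add.assoc[symmetric])
    then have "xi p (\<lambda>n. inv (P i) \<otimes> P (i + int n)) = xi p (\<lambda>n. inv (P i) \<otimes> \<eta> (m' + n))"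
      using xi_offset[OF p gap biinfinite_path[OF P, of i], of m] by simp
    also have "\<dots> = (*\<^sub>v) (R (inv (P i))) ` xi p (\<lambda>n. \<eta> (m' + n))"
      by (rule xi_left[OF p gap path_offset[OF ray_path[OF r(1)]]]) (use Pc in simp)
    also have "xi p (\<lambda>n. \<eta> (m' + n)) = xi p \<eta>" by (rule xi_offset[OF p gap ray_path[OF r(1)]])
    finally show ?thesis .
  qed
  have bwd: "xi (N - p) (\<lambda>n. inv (P i) \<otimes> P (i - int n)) = (*\<^sub>v) (R (inv (P i))) ` xi (N - p) \<zeta>" for i
  proof -
    define m where "m = nat \<bar>i\<bar>"
    define m' where "m' = nat (int m - i)"
    have "P (i - int (m + n)) = \<zeta> (m' + n)" for n
    proof -
      have "i - int (m + n) = - int (m' + n)" by (simp add: m_def m'_def)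
      then show ?thesis using Pm by metis
    qed
    then have "xi (N - p) (\<lambda>n. inv (P i) \<otimes> P (i - int n)) = xi (N - p) (\<lambda>n. inv (P i) \<otimes> \<zeta> (m' + n))"
      using xi_offset[OF p' gap' biinfinite_path_rev[OF P, of i], of m] by simp
    also have "\<dots> = (*\<^sub>v) (R (inv (P i))) ` xi (N - p) (\<lambda>n. \<zeta> (m' + n))"
      by (rule xi_left[OF p' gap' path_offset[OF ray_path[OF r(2)]]]) (use Pc in simp)
    also have "xi (N - p) (\<lambda>n. \<zeta> (m' + n)) = xi (N - p) \<zeta>" by (rule xi_offset[OF p' gap' ray_path[OF r(2)]])
    finally show ?thesis .
  qed
  have vc: "v \<in> carrier_vec N" using v(1) xi_carrier[OF p gap ray_path[OF r(1)]] by blast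
  define w where "w i = R (inv (P i)) *\<^sub>v v" for i
  have iP: "inv (P i) \<in> carrier G" for i using Pc by simp
  have w1: "w i \<in> carrier_vec N" for i unfolding w_def by (rule mult_mat_vec_carrier[OF R_carrier[OF iP] vc])
  have w2: "w i \<noteq> 0\<^sub>v N" for i
    using det_0_iff_vec_prod_zero[OF R_carrier[OF iP]] R_det[OF iP] vc v0 unfolding w_def by blast
  have w3: "w i \<in> xi p (\<lambda>n. inv (P i) \<otimes> P (i + int n))" for i unfolding fwd w_def using v(1) by (rule imageI)
  have w4: "w i \<in> xi (N - p) (\<lambda>n. inv (P i) \<otimes> P (i - int n))" for i unfolding bwd w_def using v(2) by (rule imageI)
  show False by (rule transversal_path[OF p gap P w1 w2 w3 w4])
qed

lemma rays_compact:
  assumes a: "\<And>j. a j \<in> rays" "\<And>j. a j 0 = \<one>" and b: "\<And>j. b j \<in> rays" "\<And>j. b j 0 = \<one>" and c: "\<And>j. c j \<in> rays" "\<And>j. c j 0 = \<one>"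
  obtains s a' b' c' where "strict_mono (s :: nat \<Rightarrow> nat)" "a' \<in> rays" "a' 0 = \<one>" "b' \<in> rays" "b' 0 = \<one>" "c' \<in> rays" "c' 0 = \<one>"
    "\<And>i. \<exists>j0. \<forall>j\<ge>j0. a (s j) i = a' i" "\<And>i. \<exists>j0. \<forall>j\<ge>j0. b (s j) i = b' i" "\<And>i. \<exists>j0. \<forall>j\<ge>j0. c (s j) i = c' i"
proof -
  have ball: "x i \<in> {g \<in> carrier G. len g \<le> i}" if "x \<in> rays" "x 0 = \<one>" for x i
    using ray_carrier[OF that(1)] ray_d0[OF that(1), of i] that(2) d_one[OF ray_carrier[OF that(1)]] by simp
  define X where "X j i = (a j i, b j i, c j i)" for j i
  have "finite (range (\<lambda>j. X j i))" for i
  proof (rule finite_subset)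
    let ?B = "{g \<in> carrier G. len g \<le> i}"
    show "range (\<lambda>j. X j i) \<subseteq> ?B \<times> ?B \<times> ?B" using ball a b c by (auto simp: X_def)
    show "finite (?B \<times> ?B \<times> ?B)" using finite_ball by (intro finite_cartesian_product)
  qed
  then obtain l s where s: "strict_mono (s :: nat \<Rightarrow> nat)" and l: "\<And>i. \<exists>n0. \<forall>n\<ge>n0. X (s n) i = l i"
    using pointwise_convergent_subseq by blast
  define a' where "a' i = fst (l i)" for i
  define b' where "b' i = fst (snd (l i))" for i
  define c' where "c' i = snd (snd (l i))" for i
  have ev: "\<exists>j0. \<forall>j\<ge>j0. a (s j) i = a' i" "\<exists>j0. \<forall>j\<ge>j0. b (s j) i = b' i" "\<exists>j0. \<forall>j\<ge>j0. c (s j) i = c' i" for i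
    using l[of i] unfolding X_def a'_def b'_def c'_def by (metis fst_conv snd_conv)+
  have ray: "x' \<in> rays \<and> x' 0 = \<one>" if ev: "\<And>i. \<exists>j0. \<forall>j\<ge>j0. x (s j) i = x' i" and x: "\<And>j. x j \<in> rays" "\<And>j. x j 0 = \<one>"
    for x :: "nat \<Rightarrow> nat \<Rightarrow> 'g" and x'
  proof -
    have "\<exists>j. x (s j) m = x' m \<and> x (s j) n = x' n" for m n
    proof -
      obtain j0 j1 where "\<forall>j\<ge>j0. x (s j) m = x' m" "\<forall>j\<ge>j1. x (s j) n = x' n" using ev by meson
      then show ?thesis by (intro exI[of _ "max j0 j1"]) simp
    qed
    note ag = this
    have "x' m \<in> carrier G" for m using ag[of m m] ray_carrier[OF x(1)] by metis
    moreover have "d (x' m) (x' n) = n - m" if "m \<le> n" for m n using ag[of m n] ray_d[OF x(1) that] by metis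
    moreover have "x' 0 = \<one>" using ag[of 0 0] x(2) by metis
    ultimately show ?thesis unfolding geodesic_rays_def by blast
  qed
  show ?thesis using that[OF s] ray[OF ev(1) a] ray[OF ev(2) b] ray[OF ev(3) c] ev by blast
qed

lemma sep_limit:
  fixes a b :: "nat \<Rightarrow> nat \<Rightarrow> 'g" and s :: "nat \<Rightarrow> nat"
  assumes "\<And>j. sep C (a j) (b j)" "\<And>j. a j 0 = \<one>" "a' 0 = \<one>"
    "\<And>i. \<exists>j0. \<forall>j\<ge>j0. a (s j) i = a' i" "\<And>i. \<exists>j0. \<forall>j\<ge>j0. b (s j) i = b' i"
  shows "sep C a' b'"
  unfolding sep_def
proof (intro allI)
  fix m n
  obtain j0 j1 where "\<forall>j\<ge>j0. a (s j) m = a' m" "\<forall>j\<ge>j1. b (s j) n = b' n" using assms(4,5) by meson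
  then have "a (s (max j0 j1)) m = a' m \<and> b (s (max j0 j1)) n = b' n" by simp
  then show "gp (a' 0) (a' m) (b' n) \<le> C" using assms(1)[of "s (max j0 j1)"] assms(2,3) unfolding sep_def by metis
qed

lemma ray_path_one: "\<eta> \<in> rays \<Longrightarrow> \<eta> 0 = \<one> \<Longrightarrow> path 0 \<eta>"
  using ray_path[of \<eta>] by simp

lemma inverse_Suc_tendsto: "strict_mono (s :: nat \<Rightarrow> nat) \<Longrightarrow> (\<lambda>j. inverse (real (Suc (s j)))) \<longlonglongrightarrow> 0"
  using LIMSEQ_subseq_LIMSEQ[OF LIMSEQ_inverse_real_of_nat] by (simp add: o_def)

text \<open>By contradiction: normalised counterexamples subconverge, continuity places the limit
  vector in both limit spaces, and \<open>sep C\<close> holds for the limit rays, against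
  \<open>transversal_rays\<close>.\<close>

lemma uniform_transversality:
  assumes p: "0 < p" "p < N" and gap: "gapped p"
  shows "\<exists>\<epsilon>>0. \<forall>\<eta> \<zeta>. \<eta> \<in> rays \<and> \<zeta> \<in> rays \<and> \<eta> 0 = \<one> \<and> \<zeta> 0 = \<one> \<and> sep C \<eta> \<zeta> \<longrightarrow>
    (\<forall>v\<in>xi p \<eta>. \<forall>w\<in>xi (N - p) \<zeta>. \<epsilon> * nv v \<le> nv (v - w))"
proof (rule ccontr)
  assume neg: "\<not> ?thesis"
  have p': "0 < N - p" "N - p < N" using p by auto
  have gap': "gapped (N - p)" by (rule gapped_dual[OF p gap])
  define bad where "bad j \<eta> \<zeta> v w \<longleftrightarrow> \<eta> \<in> rays \<and> \<zeta> \<in> rays \<and> \<eta> 0 = \<one> \<and> \<zeta> 0 = \<one> \<and> sep C \<eta> \<zeta> \<and>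
      v \<in> xi p \<eta> \<and> w \<in> xi (N - p) \<zeta> \<and> nv v = 1 \<and> nv (v - w) \<le> inverse (real (Suc j))" for j \<eta> \<zeta> v w
  have "\<exists>\<eta> \<zeta> v w. bad j \<eta> \<zeta> v w" for j
  proof -
    have "\<not> (\<forall>\<eta> \<zeta>. \<eta> \<in> rays \<and> \<zeta> \<in> rays \<and> \<eta> 0 = \<one> \<and> \<zeta> 0 = \<one> \<and> sep C \<eta> \<zeta> \<longrightarrow>
        (\<forall>v\<in>xi p \<eta>. \<forall>w\<in>xi (N - p) \<zeta>. inverse (real (Suc j)) * nv v \<le> nv (v - w)))"
      using neg by (metis inverse_positive_iff_positive of_nat_0_less_iff zero_less_Suc)
    then obtain \<eta> \<zeta> v w where r: "\<eta> \<in> rays" "\<zeta> \<in> rays" "\<eta> 0 = \<one>" "\<zeta> 0 = \<one>" "sep C \<eta> \<zeta>" and v: "v \<in> xi p \<eta>" and w: "w \<in> xi (N - p) \<zeta>"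
      and lt: "nv (v - w) < inverse (real (Suc j)) * nv v" by (auto simp: not_le)
    have c: "v \<in> carrier_vec N" "w \<in> carrier_vec N"
      using v w xi_carrier[OF p gap ray_path[OF r(1)]] xi_carrier[OF p' gap' ray_path[OF r(2)]] by auto
    have "v \<noteq> 0\<^sub>v N"
    proof
      assume "v = 0\<^sub>v N"
      then have "nv (v - w) < 0" using lt by simp
      then show False using nv_nonneg[of "v - w"] by linarith
    qed
    then obtain b where b: "b \<noteq> 0" "nv (b \<cdot>\<^sub>v v) = 1" using nv_normalise[OF c(1)] by blast
    have "b \<cdot>\<^sub>v v - b \<cdot>\<^sub>v w = b \<cdot>\<^sub>v (v - w)" using c by (intro eq_vecI) (auto simp: right_diff_distrib)
    then have "nv (b \<cdot>\<^sub>v v - b \<cdot>\<^sub>v w) = av b * nv (v - w)" by simp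
    also have "\<dots> \<le> av b * (inverse (real (Suc j)) * nv v)" using lt by (intro mult_left_mono) auto
    also have "\<dots> = inverse (real (Suc j)) * nv (b \<cdot>\<^sub>v v)" by simp
    finally have "bad j \<eta> \<zeta> (b \<cdot>\<^sub>v v) (b \<cdot>\<^sub>v w)"
      unfolding bad_def using r b(2) xi_smult[OF p gap ray_path[OF r(1)] v] xi_smult[OF p' gap' ray_path[OF r(2)] w] by simp
    then show ?thesis by blast
  qed
  then obtain \<eta> \<zeta> v w where bad: "\<And>j. bad j (\<eta> j) (\<zeta> j) (v j) (w j)" by metis
  then have r: "\<And>j. \<eta> j \<in> rays" "\<And>j. \<eta> j 0 = \<one>" "\<And>j. \<zeta> j \<in> rays" "\<And>j. \<zeta> j 0 = \<one>" "\<And>j. sep C (\<eta> j) (\<zeta> j)"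
    and vw: "\<And>j. v j \<in> xi p (\<eta> j)" "\<And>j. w j \<in> xi (N - p) (\<zeta> j)" "\<And>j. nv (v j) = 1" "\<And>j. nv (v j - w j) \<le> inverse (real (Suc j))"
    unfolding bad_def by auto
  \<comment> \<open>Compactness is available for triples of rays; \<zeta> simply fills two
    places.\<close>
  obtain s \<eta>' \<zeta>' x where s: "strict_mono (s :: nat \<Rightarrow> nat)" and r': "\<eta>' \<in> rays" "\<eta>' 0 = \<one>" "\<zeta>' \<in> rays" "\<zeta>' 0 = \<one>" "x \<in> rays" "x 0 = \<one>"
    and ev: "\<And>i. \<exists>j0. \<forall>j\<ge>j0. \<eta> (s j) i = \<eta>' i" "\<And>i. \<exists>j0. \<forall>j\<ge>j0. \<zeta> (s j) i = \<zeta>' i" "\<And>i. \<exists>j0. \<forall>j\<ge>j0. \<zeta> (s j) i = x i"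
    by (rule rays_compact[where a = \<eta> and b = \<zeta> and c = \<zeta>, OF r(1,2,3,4) r(3,4)]) (rule that, assumption+)
  have vc: "v j \<in> carrier_vec N" "w j \<in> carrier_vec N" for j
    using subsetD[OF xi_carrier[OF p gap ray_path[OF r(1)]] vw(1)] subsetD[OF xi_carrier[OF p' gap' ray_path[OF r(3)]] vw(2)] by blast+
  obtain L t where t: "strict_mono (t :: nat \<Rightarrow> nat)" and L: "L \<in> carrier_vec N" and lim: "(\<lambda>j. nv (v (s (t j)) - L)) \<longlonglongrightarrow> 0"
    using vec_convergent_subseq[of "\<lambda>j. v (s j)" N 1] vc vw(3) by auto
  have st: "strict_mono (\<lambda>j. s (t j))" using strict_mono_o[OF s t] by (simp add: o_def)
  have evt: "\<exists>j0. \<forall>j\<ge>j0. y (s (t j)) i = y' i" if "\<exists>j0. \<forall>j\<ge>j0. y (s j) i = y' i" for y :: "nat \<Rightarrow> nat \<Rightarrow> 'g" and y' i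
    using that seq_suble[OF t] by (meson order_trans)
  have "L \<in> xi p \<eta>'"
    by (rule xi_continuous[OF p gap, where D = 0 and q = "\<lambda>j. \<eta> (s (t j))" and v = "\<lambda>j. v (s (t j))"])
      (use r r' ray_path_one evt[where y = \<eta> and y' = \<eta>', OF ev(1)] vw lim L in auto)
  moreover have "L \<in> xi (N - p) \<zeta>'"
  proof (rule xi_continuous[OF p' gap', where D = 0 and q = "\<lambda>j. \<zeta> (s (t j))" and v = "\<lambda>j. w (s (t j))"])
    have "nv (w (s (t j)) - L) \<le> inverse (real (Suc (s (t j)))) + nv (v (s (t j)) - L)" for j
      using nv_dist_triangle[OF vc(2) vc(1) L, of "s (t j)" "s (t j)"] nv_minus_commute[OF vc(2) vc(1), of "s (t j)" "s (t j)"] vw(4)[of "s (t j)"]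
      by linarith
    moreover have "(\<lambda>j. inverse (real (Suc (s (t j)))) + nv (v (s (t j)) - L)) \<longlonglongrightarrow> 0 + 0"
      by (intro tendsto_add inverse_Suc_tendsto[OF st] lim)
    ultimately show "(\<lambda>j. nv (w (s (t j)) - L)) \<longlonglongrightarrow> 0" using tendsto_0_le by (metis (no_types, lifting) add_0 nv_nonneg)
  qed (use r r' ray_path_one evt[where y = \<zeta> and y' = \<zeta>', OF ev(2)] vw L in auto)
  moreover have "sep C \<eta>' \<zeta>'" by (rule sep_limit[where a = \<eta> and b = \<zeta> and s = s, OF r(5,2) r'(2) ev(1,2)])
  ultimately have "L = 0\<^sub>v N" using transversal_rays[OF p gap r'(1,3,2,4)] by blast
  then have "nv (v (s (t j)) - L) = 1" for j using vw(3)[of "s (t j)"] vc(1)[of "s (t j)"] by simp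
  then show False using lim by (simp add: LIMSEQ_const_iff)
qed

lemma xi_req:
  assumes p: "0 < p" "p < N" "gapped p" and ray: "\<eta> \<in> rays" "\<zeta> \<in> rays" "req \<eta> \<zeta>"
  shows "xi p \<zeta> = xi p \<eta>"
proof -
  obtain k where "\<And>n. d (\<eta> n) (\<zeta> n) \<le> k" using ray(3) by (auto simp: req_def)
  then show ?thesis by (rule xi_fellow[OF p ray_path[OF ray(1)] ray_path[OF ray(2)]])
qed

section \<open>Consequences of hyperconvexity\<close>

context
  fixes r
  assumes r: "0 < r" "r < N" and N1: "1 < N" and gap1: "gapped 1" and gapr: "gapped r"
    and hyper: "\<And>a b c u v. a \<in> rays \<Longrightarrow> b \<in> rays \<Longrightarrow> c \<in> rays \<Longrightarrow> \<not> req a b \<Longrightarrow> \<not> req b c \<Longrightarrow> \<not> req a c \<Longrightarrow>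
      u \<in> xi 1 a \<Longrightarrow> v \<in> xi 1 b \<Longrightarrow> u + v \<in> xi (N - r) c \<Longrightarrow> u + v = 0\<^sub>v N"
begin

text \<open>Again a compactness argument, with one complication: only the sum \<open>u + v\<close>
  is normalised, and its summands might escape to infinity. They stay bounded because
  \<open>xi 1 a\<close> is uniformly transverse to \<open>xi (N - 1) b\<close>, which contains
  \<open>xi 1 b\<close>.\<close>

lemma uniform_hyperconvexity:
  "\<exists>\<epsilon>>0. \<forall>a b c. a \<in> rays \<and> b \<in> rays \<and> c \<in> rays \<and> a 0 = \<one> \<and> b 0 = \<one> \<and> c 0 = \<one> \<and> sep C a b \<and> sep C a c \<and> sep C b c \<longrightarrow>
    (\<forall>u\<in>xi 1 a. \<forall>v\<in>xi 1 b. \<forall>w\<in>xi (N - r) c. \<epsilon> * nv (u + v) \<le> nv (u + v - w))"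
proof (rule ccontr)
  assume neg: "\<not> ?thesis"
  have r': "0 < N - r" "N - r < N" using r by auto
  have gapr': "gapped (N - r)" by (rule gapped_dual[OF r gapr])
  have one: "0 < (1::nat)" by simp
  have n1: "0 < N - 1" "N - 1 < N" using N1 by auto
  have gapn1: "gapped (N - 1)" by (rule gapped_dual[OF one N1 gap1])
  from uniform_transversality[OF one N1 gap1, of C]
  obtain \<epsilon> where \<epsilon>: "\<epsilon> > 0" and
    ut': "\<forall>\<eta> \<zeta>. \<eta> \<in> rays \<and> \<zeta> \<in> rays \<and> \<eta> 0 = \<one> \<and> \<zeta> 0 = \<one> \<and> sep C \<eta> \<zeta> \<longrightarrow>
    (\<forall>v\<in>xi 1 \<eta>. \<forall>w\<in>xi (N - 1) \<zeta>. \<epsilon> * nv v \<le> nv (v - w))"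
    by (elim exE conjE)
  have ut: "\<epsilon> * nv v \<le> nv (v - w)"
    if "\<eta> \<in> rays" "\<zeta> \<in> rays" "\<eta> 0 = \<one>" "\<zeta> 0 = \<one>" "sep C \<eta> \<zeta>" "v \<in> xi 1 \<eta>" "w \<in> xi (N - 1) \<zeta>" for \<eta> \<zeta> v w
    by (rule ut'[rule_format, of \<eta> \<zeta> v w]) (intro conjI that, rule that, rule that)
  define bad where "bad j a b c u v w \<longleftrightarrow> a \<in> rays \<and> b \<in> rays \<and> c \<in> rays \<and> a 0 = \<one> \<and> b 0 = \<one> \<and> c 0 = \<one> \<and> sep C a b \<and> sep C a c \<and> sep C b c \<and>
      u \<in> xi 1 a \<and> v \<in> xi 1 b \<and> w \<in> xi (N - r) c \<and> nv (u + v) = 1 \<and> nv (u + v - w) \<le> inverse (real (Suc j))" for j a b c u v w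
  have "\<exists>a b c u v w. bad j a b c u v w" for j
  proof -
    have "\<not> (\<forall>a b c. a \<in> rays \<and> b \<in> rays \<and> c \<in> rays \<and> a 0 = \<one> \<and> b 0 = \<one> \<and> c 0 = \<one> \<and> sep C a b \<and> sep C a c \<and> sep C b c \<longrightarrow>
        (\<forall>u\<in>xi 1 a. \<forall>v\<in>xi 1 b. \<forall>w\<in>xi (N - r) c. inverse (real (Suc j)) * nv (u + v) \<le> nv (u + v - w)))"
      using neg by (metis inverse_positive_iff_positive of_nat_0_less_iff zero_less_Suc)
    then obtain a b c u v w where abc: "a \<in> rays" "b \<in> rays" "c \<in> rays" "a 0 = \<one>" "b 0 = \<one>" "c 0 = \<one>" "sep C a b" "sep C a c" "sep C b c"
      and u: "u \<in> xi 1 a" and v: "v \<in> xi 1 b" and w: "w \<in> xi (N - r) c"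
      and lt: "nv (u + v - w) < inverse (real (Suc j)) * nv (u + v)" by (auto simp: not_le)
    have c: "u \<in> carrier_vec N" "v \<in> carrier_vec N" "w \<in> carrier_vec N"
      using u v w xi_carrier[OF one N1 gap1 ray_path] abc(1,2) xi_carrier[OF r' gapr' ray_path[OF abc(3)]] by auto
    have "u + v \<noteq> 0\<^sub>v N"
    proof
      assume "u + v = 0\<^sub>v N"
      then have "nv (u + v - w) < 0" using lt by simp
      then show False using nv_nonneg[of "u + v - w"] by linarith
    qed
    then obtain x where x: "x \<noteq> 0" "nv (x \<cdot>\<^sub>v (u + v)) = 1" using nv_normalise[of "u + v" N] c by auto
    have e1: "x \<cdot>\<^sub>v u + x \<cdot>\<^sub>v v = x \<cdot>\<^sub>v (u + v)" using c by (intro eq_vecI) (auto simp: distrib_left)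
    have "x \<cdot>\<^sub>v (u + v) - x \<cdot>\<^sub>v w = x \<cdot>\<^sub>v (u + v - w)" using c by (intro eq_vecI) (auto simp: right_diff_distrib)
    then have "nv (x \<cdot>\<^sub>v (u + v) - x \<cdot>\<^sub>v w) = av x * nv (u + v - w)" by simp
    also have "\<dots> \<le> av x * (inverse (real (Suc j)) * nv (u + v))" using lt by (intro mult_left_mono) auto
    also have "\<dots> = inverse (real (Suc j)) * nv (x \<cdot>\<^sub>v (u + v))" by simp
    finally have "bad j a b c (x \<cdot>\<^sub>v u) (x \<cdot>\<^sub>v v) (x \<cdot>\<^sub>v w)"
      unfolding bad_def e1 using abc x(2) xi_smult[OF one N1 gap1 ray_path[OF abc(1)] u] xi_smult[OF one N1 gap1 ray_path[OF abc(2)] v]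
        xi_smult[OF r' gapr' ray_path[OF abc(3)] w] by simp
    then show ?thesis by blast
  qed
  then obtain a b c u v w where bad: "\<And>j. bad j (a j) (b j) (c j) (u j) (v j) (w j)" by metis
  then have abc: "\<And>j. a j \<in> rays" "\<And>j. a j 0 = \<one>" "\<And>j. b j \<in> rays" "\<And>j. b j 0 = \<one>" "\<And>j. c j \<in> rays" "\<And>j. c j 0 = \<one>"
      "\<And>j. sep C (a j) (b j)" "\<And>j. sep C (a j) (c j)" "\<And>j. sep C (b j) (c j)"
    and uvw: "\<And>j. u j \<in> xi 1 (a j)" "\<And>j. v j \<in> xi 1 (b j)" "\<And>j. w j \<in> xi (N - r) (c j)" "\<And>j. nv (u j + v j) = 1"
      "\<And>j. nv (u j + v j - w j) \<le> inverse (real (Suc j))"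
    unfolding bad_def by auto
  obtain s a' b' c' where s: "strict_mono (s :: nat \<Rightarrow> nat)" and abc': "a' \<in> rays" "a' 0 = \<one>" "b' \<in> rays" "b' 0 = \<one>" "c' \<in> rays" "c' 0 = \<one>"
    and ev: "\<And>i. \<exists>j0. \<forall>j\<ge>j0. a (s j) i = a' i" "\<And>i. \<exists>j0. \<forall>j\<ge>j0. b (s j) i = b' i" "\<And>i. \<exists>j0. \<forall>j\<ge>j0. c (s j) i = c' i"
    by (rule rays_compact[where a = a and b = b and c = c, OF abc(1,2,3,4,5,6)]) (rule that, assumption+)
  have cc: "u j \<in> carrier_vec N" "v j \<in> carrier_vec N" "w j \<in> carrier_vec N" for j
    using subsetD[OF xi_carrier[OF one N1 gap1 ray_path[OF abc(1)]] uvw(1)] subsetD[OF xi_carrier[OF one N1 gap1 ray_path[OF abc(3)]] uvw(2)]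
      subsetD[OF xi_carrier[OF r' gapr' ray_path[OF abc(5)]] uvw(3)] by blast+
  have ub: "nv (u j) \<le> 1 / \<epsilon>" for j
  proof -
    have "(- 1) \<cdot>\<^sub>v v j \<in> xi 1 (b j)" by (rule xi_smult[OF one N1 gap1 ray_path[OF abc(3)] uvw(2)])
    moreover have "1 \<le> N - 1" using N1 by linarith
    ultimately have "(- 1) \<cdot>\<^sub>v v j \<in> xi (N - 1) (b j)"
      using xi_mono[OF one N1 gap1 n1 gapn1 _ ray_path[OF abc(3)]] by blast
    then have "\<epsilon> * nv (u j) \<le> nv (u j - (- 1) \<cdot>\<^sub>v v j)" by (intro ut[OF abc(1,3,2,4,7) uvw(1)])
    also have "u j - (- 1) \<cdot>\<^sub>v v j = u j + v j" using cc[of j] by (intro eq_vecI) auto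
    finally show ?thesis using \<epsilon> uvw(4)[of j] by (simp add: field_simps)
  qed
  have vb: "nv (v j) \<le> 1 + 1 / \<epsilon>" for j
  proof -
    have "v j = (u j + v j) - u j" using cc[of j] by (intro eq_vecI) auto
    then have "nv (v j) \<le> nv (u j + v j) + nv (u j)" using nv_triangle_minus[of "u j + v j" N "u j"] cc by simp
    then show ?thesis using ub[of j] uvw(4)[of j] by simp
  qed
  obtain L t where t: "strict_mono (t :: nat \<Rightarrow> nat)" and L: "L \<in> carrier_vec N" and limu: "(\<lambda>j. nv (u (s (t j)) - L)) \<longlonglongrightarrow> 0"
    using vec_convergent_subseq[of "\<lambda>j. u (s j)" N "1 / \<epsilon>"] cc ub by auto
  obtain M t' where t': "strict_mono (t' :: nat \<Rightarrow> nat)" and M: "M \<in> carrier_vec N" and limv: "(\<lambda>j. nv (v (s (t (t' j))) - M)) \<longlonglongrightarrow> 0"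
    using vec_convergent_subseq[of "\<lambda>j. v (s (t j))" N "1 + 1 / \<epsilon>"] cc vb by auto
  define z where "z j = t (t' j)" for j
  have z: "strict_mono z" using strict_mono_o[OF t t'] by (simp add: o_def z_def[abs_def])
  have limu': "(\<lambda>j. nv (u (s (z j)) - L)) \<longlonglongrightarrow> 0" using LIMSEQ_subseq_LIMSEQ[OF limu t'] by (simp add: o_def z_def)
  have limv': "(\<lambda>j. nv (v (s (z j)) - M)) \<longlonglongrightarrow> 0" using limv by (simp add: z_def)
  have sz: "strict_mono (\<lambda>j. s (z j))" using strict_mono_o[OF s z] by (simp add: o_def)
  have evz: "\<exists>j0. \<forall>j\<ge>j0. y (s (z j)) i = y' i" if "\<exists>j0. \<forall>j\<ge>j0. y (s j) i = y' i" for y :: "nat \<Rightarrow> nat \<Rightarrow> 'g" and y' i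
    using that seq_suble[OF z] by (meson order_trans)
  have limuv: "(\<lambda>j. nv (u (s (z j)) + v (s (z j)) - (L + M))) \<longlonglongrightarrow> 0"
  proof (rule tendsto_0_le)
    show "nv (u (s (z j)) + v (s (z j)) - (L + M)) \<le> nv (u (s (z j)) - L) + nv (v (s (z j)) - M)" for j
    proof -
      have "u (s (z j)) + v (s (z j)) - (L + M) = (u (s (z j)) - L) + (v (s (z j)) - M)" using cc[of "s (z j)"] L M by (intro eq_vecI) auto
      then show ?thesis using nv_triangle[of "u (s (z j)) - L" N "v (s (z j)) - M"] cc L M by simp
    qed
    show "(\<lambda>j. nv (u (s (z j)) - L) + nv (v (s (z j)) - M)) \<longlonglongrightarrow> 0" using tendsto_add[OF limu' limv'] by simp
  qed simp
  have "L \<in> xi 1 a'"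
    by (rule xi_continuous[OF one N1 gap1, where D = 0 and q = "\<lambda>j. a (s (z j))" and v = "\<lambda>j. u (s (z j))"])
      (use abc abc' ray_path_one evz[where y = a and y' = a', OF ev(1)] uvw limu' L in auto)
  moreover have "M \<in> xi 1 b'"
    by (rule xi_continuous[OF one N1 gap1, where D = 0 and q = "\<lambda>j. b (s (z j))" and v = "\<lambda>j. v (s (z j))"])
      (use abc abc' ray_path_one evz[where y = b and y' = b', OF ev(2)] uvw limv' M in auto)
  moreover have "L + M \<in> xi (N - r) c'"
  proof (rule xi_continuous[OF r' gapr', where D = 0 and q = "\<lambda>j. c (s (z j))" and v = "\<lambda>j. w (s (z j))"])
    have uvc: "u j + v j \<in> carrier_vec N" "L + M \<in> carrier_vec N" for j using cc L M by auto
    have le: "nv (w (s (z j)) - (L + M)) \<le> inverse (real (Suc (s (z j)))) + nv (u (s (z j)) + v (s (z j)) - (L + M))" for j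
      using nv_dist_triangle[OF cc(3) uvc, of "s (z j)" "s (z j)"] nv_minus_commute[OF cc(3) uvc(1), of "s (z j)" "s (z j)"] uvw(5)[of "s (z j)"]
      by linarith
    have "(\<lambda>j. inverse (real (Suc (s (z j)))) + nv (u (s (z j)) + v (s (z j)) - (L + M))) \<longlonglongrightarrow> 0 + 0"
      by (intro tendsto_add inverse_Suc_tendsto[OF sz] limuv)
    then show "(\<lambda>j. nv (w (s (z j)) - (L + M))) \<longlonglongrightarrow> 0" by (intro tendsto_0_le[OF _ le]) auto
  qed (use abc abc' ray_path_one evz[where y = c and y' = c', OF ev(3)] uvw L M in auto)
  moreover have "sep C a' b'" "sep C b' c'" "sep C a' c'"
    by (rule sep_limit[where a = a and b = b and s = s, OF abc(7,2) abc'(2) ev(1,2)],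
      rule sep_limit[where a = b and b = c and s = s, OF abc(9,4) abc'(4) ev(2,3)],
      rule sep_limit[where a = a and b = c and s = s, OF abc(8,2) abc'(2) ev(1,3)])
  ultimately have "L + M = 0\<^sub>v N" using hyper[OF abc'(1,3,5)] sep_not_req abc' by blast
  then have "nv (u (s (z j)) + v (s (z j)) - (L + M)) = 1" for j
    using uvw(4)[of "s (z j)"] cc(1,2)[of "s (z j)"] by simp
  then show False using limuv by (simp add: LIMSEQ_const_iff)
qed

text \<open>The heart of the argument. At the quasi-centre \<open>g\<close> of the triangle \<open>\<eta>, \<eta>', \<zeta>\<close> hyperconvexity gives a definite
  angle. Going back by \<open>R g\<close>, vectors transverse to the contracted subspace are pushed towards \<open>U r g\<close>, which is close
  to \<open>xi r \<eta>\<close>, hence transverse to \<open>xi (N - r) \<zeta>\<close>.\<close>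

lemma tangent_transversality:
  assumes \<zeta>: "\<zeta> \<in> rays" "\<zeta> 0 = \<one>"
  shows "\<exists>\<epsilon>>0. \<forall>\<eta> \<eta>'. \<eta> \<in> rays \<and> \<eta>' \<in> rays \<and> \<eta> 0 = \<one> \<and> \<eta>' 0 = \<one> \<and> sep k \<eta> \<zeta> \<and> sep k \<eta>' \<zeta> \<and> \<not> req \<eta> \<eta>' \<longrightarrow>
    (\<forall>u\<in>xi 1 \<eta>. \<forall>u'\<in>xi 1 \<eta>'. \<forall>w\<in>xi (N - r) \<zeta>. \<epsilon> * nv (u + u') \<le> nv (u + u' - w))"
proof -
  have r': "0 < N - r" "N - r < N" using r by auto
  have gapr': "gapped (N - r)" by (rule gapped_dual[OF r gapr])
  have one: "0 < (1::nat)" by simp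
  define C where "C = k + 4 * \<delta> + 1"
  from uniform_hyperconvexity[of C]
  obtain \<epsilon>0 where \<epsilon>0: "\<epsilon>0 > 0" and
    uh': "\<forall>a b c. a \<in> rays \<and> b \<in> rays \<and> c \<in> rays \<and> a 0 = \<one> \<and> b 0 = \<one> \<and> c 0 = \<one> \<and> sep C a b \<and> sep C a c \<and> sep C b c \<longrightarrow>
    (\<forall>u\<in>xi 1 a. \<forall>v\<in>xi 1 b. \<forall>w\<in>xi (N - r) c. \<epsilon>0 * nv (u + v) \<le> nv (u + v - w))"
    by (elim exE conjE)
  have uh0: "\<epsilon>0 * nv (u + v) \<le> nv (u + v - w)"
    if "a \<in> rays" "b \<in> rays" "c \<in> rays" "a 0 = \<one>" "b 0 = \<one>" "c 0 = \<one>" "sep C a b" "sep C a c" "sep C b c"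
      "u \<in> xi 1 a" "v \<in> xi 1 b" "w \<in> xi (N - r) c" for a b c u v w
    by (rule uh'[rule_format, of a b c u v w]) (intro conjI that, rule that, rule that, rule that)
  from uniform_transversality[OF r gapr, of k]
  obtain \<epsilon>2 where \<epsilon>2: "\<epsilon>2 > 0" and
    ut': "\<forall>\<eta> \<zeta>. \<eta> \<in> rays \<and> \<zeta> \<in> rays \<and> \<eta> 0 = \<one> \<and> \<zeta> 0 = \<one> \<and> sep k \<eta> \<zeta> \<longrightarrow>
    (\<forall>v\<in>xi r \<eta>. \<forall>w\<in>xi (N - r) \<zeta>. \<epsilon>2 * nv v \<le> nv (v - w))"
    by (elim exE conjE)
  have ut: "\<epsilon>2 * nv v \<le> nv (v - w)"
    if "\<eta> \<in> rays" "\<eta> 0 = \<one>" "sep k \<eta> \<zeta>" "v \<in> xi r \<eta>" "w \<in> xi (N - r) \<zeta>" for \<eta> v w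
    by (rule ut'[rule_format, of \<eta> \<zeta> v w]) (intro conjI that \<zeta>, rule that, rule that)
  \<comment> \<open>Twice the Gromov product bound is the defect of the broken geodesic that runs
    back along \<eta> to the identity and then out along \<zeta>.\<close>
  define D where "D = nat \<lceil>2 * k\<rceil>"
  obtain C2 \<tau>2 where C2: "C2 > 0" "0 < \<tau>2" "\<tau>2 < 1" "\<And>q. path D q \<Longrightarrow> tail_bound C2 \<tau>2 (N - r) q (xi (N - r) q)"
    using xi_tail_bound[OF r' gapr', of D] by blast
  obtain C3 \<tau>3 where C3: "C3 > 0" "0 < \<tau>3" "\<tau>3 < 1" "\<And>q. path 0 q \<Longrightarrow> tail_bound C3 \<tau>3 r q (xi r q)"
    using xi_tail_bound[OF r gapr, of 0] by blast
  obtain c \<tau>4 where c: "c > 0" "0 < \<tau>4" "\<tau>4 < 1" and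
    gp: "\<And>\<gamma> k \<alpha> l. \<gamma> \<in> carrier G \<Longrightarrow> svd N (R \<gamma>) k \<alpha> l \<Longrightarrow> av (\<alpha> r) / av (\<alpha> (r - 1)) \<le> c * \<tau>4 ^ len \<gamma>"
    using gapr unfolding gapped_def by blast
  have pw: "(\<lambda>n. x * t ^ n) \<longlonglongrightarrow> 0" if "0 < t" "t < 1" for x t :: real
    using tendsto_mult_left[OF LIMSEQ_power_zero[of t], of x] that by simp
  have "(\<lambda>m. 4 / \<epsilon>0 * c * \<tau>4 ^ m + 2 * C3 * \<tau>3 ^ m) \<longlonglongrightarrow> 0 + 0"
    by (intro tendsto_add pw c C3)
  then have "(\<lambda>m. 4 / \<epsilon>0 * c * \<tau>4 ^ m + 2 * C3 * \<tau>3 ^ m) \<longlonglongrightarrow> 0" by simp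
  moreover have "(\<lambda>m. 2 * C2 * \<tau>2 ^ m) \<longlonglongrightarrow> 0" by (intro pw C2)
  ultimately have "\<forall>\<^sub>F m in sequentially. 4 / \<epsilon>0 * c * \<tau>4 ^ m + 2 * C3 * \<tau>3 ^ m < min (1 / 2) (\<epsilon>2 / 4) \<and> 2 * C2 * \<tau>2 ^ m < min (\<epsilon>0 / 4) (1 / 2)"
    using \<epsilon>0 \<epsilon>2 by (intro eventually_conj order_tendstoD(2)) auto
  then obtain M where M: "\<And>m. m \<ge> M \<Longrightarrow> 4 / \<epsilon>0 * c * \<tau>4 ^ m + 2 * C3 * \<tau>3 ^ m < min (1 / 2) (\<epsilon>2 / 4) \<and> 2 * C2 * \<tau>2 ^ m < min (\<epsilon>0 / 4) (1 / 2)"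
    unfolding eventually_sequentially by blast
  obtain \<kappa> where \<kappa>: "1 \<le> \<kappa>" "\<And>\<gamma>. \<gamma> \<in> carrier G \<Longrightarrow> len \<gamma> \<le> M \<Longrightarrow> \<exists>b b'. 0 < b \<and> 0 < b' \<and> b * b' \<le> \<kappa> \<and>
    (\<forall>v\<in>carrier_vec N. nv (R \<gamma> *\<^sub>v v) \<le> b * nv v \<and> nv v \<le> b' * nv (R \<gamma> *\<^sub>v v))"
    using R_condition_uniform[of M] by blast
  \<comment> \<open>The first term covers the finitely many quasi-centres of length at most
    \<open>M\<close>, where the condition number costs \<kappa>. The second covers distant ones,
    where attraction takes over and no condition number enters.\<close>
  define \<epsilon> where "\<epsilon> = min (\<epsilon>0 / \<kappa>) (\<epsilon>2 / 4)"
  have "\<epsilon> * nv (u + u') \<le> nv (u + u' - w)"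
    if ray: "\<eta> \<in> rays" "\<eta>' \<in> rays" "\<eta> 0 = \<one>" "\<eta>' 0 = \<one>" "sep k \<eta> \<zeta>" "sep k \<eta>' \<zeta>" "\<not> req \<eta> \<eta>'"
      and u: "u \<in> xi 1 \<eta>" and u': "u' \<in> xi 1 \<eta>'" and w: "w \<in> xi (N - r) \<zeta>" for \<eta> \<eta>' u u' w
  proof -
    have base: "\<eta>' 0 = \<eta> 0" "\<zeta> 0 = \<eta> 0" using ray \<zeta> by auto
    obtain m \<alpha> \<beta> \<theta> where abt: "\<alpha> \<in> rays" "\<beta> \<in> rays" "\<theta> \<in> rays" "\<alpha> 0 = \<one>" "\<beta> 0 = \<one>" "\<theta> 0 = \<one>"
      and rq: "req (\<lambda>n. \<eta> m \<otimes> \<alpha> n) \<eta>" "req (\<lambda>n. \<eta> m \<otimes> \<beta> n) \<eta>'" "req (\<lambda>n. \<eta> m \<otimes> \<theta> n) \<zeta>"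
      and sp: "sep C \<alpha> \<beta>" "sep C \<alpha> \<theta>" "sep C \<beta> \<theta>"
      using centre[OF ray(1,2) \<zeta>(1) base ray(5-7)] unfolding C_def by blast
    define g where "g = \<eta> m"
    have g: "g \<in> carrier G" unfolding g_def by (rule ray_carrier[OF ray(1)])
    have ig: "inv g \<in> carrier G" using g by simp
    have leng: "len g = m" using ray_d0[OF ray(1), of m] ray(3) d_one[OF g] by (simp add: g_def)
    have tr: "xi p \<theta>' = (*\<^sub>v) (R g) ` xi p \<alpha>'"
      if "0 < p" "p < N" "gapped p" "\<alpha>' \<in> rays" "\<theta>' \<in> rays" "req (\<lambda>n. \<eta> m \<otimes> \<alpha>' n) \<theta>'" for p \<alpha>' \<theta>'
      using xi_req[OF that(1-3) ray_left[OF g that(4)] that(5)] xi_left[OF that(1-3) ray_path[OF that(4)] g] that(6)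
      by (simp add: g_def)
    obtain x where x: "x \<in> xi 1 \<alpha>" "u = R g *\<^sub>v x" using u tr[OF one N1 gap1 abt(1) ray(1) rq(1)] by blast
    obtain x' where x': "x' \<in> xi 1 \<beta>" "u' = R g *\<^sub>v x'" using u' tr[OF one N1 gap1 abt(2) ray(2) rq(2)] by blast
    obtain y where y: "y \<in> xi (N - r) \<theta>" "w = R g *\<^sub>v y" using w tr[OF r' gapr' abt(3) \<zeta>(1) rq(3)] by blast
    have cx: "x \<in> carrier_vec N" "x' \<in> carrier_vec N" "y \<in> carrier_vec N"
      using x x' y xi_carrier[OF one N1 gap1 ray_path[OF abt(1)]] xi_carrier[OF one N1 gap1 ray_path[OF abt(2)]]
        xi_carrier[OF r' gapr' ray_path[OF abt(3)]] by auto
    define z where "z = x + x'"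
    have z: "z \<in> carrier_vec N" using cx by (simp add: z_def)
    have uz: "u + u' = R g *\<^sub>v z" unfolding x(2) x'(2) z_def by (rule mult_add_distrib_mat_vec[symmetric, OF R_carrier[OF g] cx(1,2)])
    have uh: "\<epsilon>0 * nv z \<le> nv (z - y')" if "y' \<in> xi (N - r) \<theta>" for y'
      unfolding z_def by (rule uh0[OF abt sp x(1) x'(1) that])
    have zc: "R g *\<^sub>v z \<in> carrier_vec N" by (rule mult_mat_vec_carrier[OF R_carrier[OF g] z])
    show ?thesis
    proof (cases "M \<le> m")
      case False
      then have "len g \<le> M" using leng by simp
      then obtain b b' where b: "0 < b" "0 < b'" "b * b' \<le> \<kappa>"
        and bb: "\<forall>v\<in>carrier_vec N. nv (R g *\<^sub>v v) \<le> b * nv v \<and> nv v \<le> b' * nv (R g *\<^sub>v v)" using \<kappa>(2)[OF g] by blast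
      have zy: "z - y \<in> carrier_vec N" using z cx by simp
      have "u + u' - w = R g *\<^sub>v (z - y)" unfolding uz y(2) by (rule mult_minus_distrib_mat_vec[symmetric, OF R_carrier[OF g] z cx(3)])
      then have "nv (z - y) \<le> b' * nv (u + u' - w)" using bb zy by simp
      then have 1: "\<epsilon>0 * nv z \<le> b' * nv (u + u' - w)" using uh[OF y(1)] by linarith
      have "\<epsilon>0 * nv (u + u') \<le> \<epsilon>0 * (b * nv z)" unfolding uz using bb z \<epsilon>0 by (intro mult_left_mono) auto
      also have "\<dots> = b * (\<epsilon>0 * nv z)" by simp
      also have "\<dots> \<le> b * (b' * nv (u + u' - w))" using 1 b by (intro mult_left_mono) auto
      also have "\<dots> \<le> \<kappa> * nv (u + u' - w)" using b(3) by (simp add: mult.assoc[symmetric] mult_right_mono)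
      finally have "\<epsilon>0 / \<kappa> * nv (u + u') \<le> nv (u + u' - w)" using \<kappa>(1) by (simp add: field_simps)
      moreover have "\<epsilon> \<le> \<epsilon>0 / \<kappa>" unfolding \<epsilon>_def by (rule min.cobounded1)
      then have "\<epsilon> * nv (u + u') \<le> \<epsilon>0 / \<kappa> * nv (u + u')" by (rule mult_right_mono) simp
      ultimately show ?thesis by linarith
    next
      case True
      note Mm = M[OF True]
      \<comment> \<open>Seen from \<open>g\<close>, the path leads from the identity through
        \<open>inv g\<close>, at time \<open>m\<close>, to the endpoint of \<theta>. As its defect
        is \<open>D\<close>, its limit space \<open>xi (N - r) \<theta>\<close> is close to
        \<open>U (N - r) (inv g)\<close>.\<close>
      define q where "q n = inv g \<otimes> (if n \<le> m then \<eta> (m - n) else \<zeta> (n - m))" for n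
      have qc: "q n \<in> carrier G" for n using ig ray_carrier[OF ray(1)] ray_carrier[OF \<zeta>(1)] by (simp add: q_def)
      have qm: "q (m + n) = inv g \<otimes> \<zeta> n" for n using base by (cases "n = 0") (auto simp: q_def)
      have pq: "path D q"
        unfolding path_def
      proof (intro conjI allI)
        fix n
        show "q n \<in> carrier G" by (rule qc)
        show "d (q n) (q (Suc n)) \<le> 1"
        proof (cases "n < m")
          case True
          then show ?thesis using ray_d[OF ray(1), of "m - Suc n" "m - n"] ig ray_carrier[OF ray(1)]
            by (simp add: q_def d_left d_commute[of "\<eta> (m - n)"])
        next
          case False
          then obtain j where j: "n = m + j" using le_Suc_ex not_less by blast
          show ?thesis using qm[of j] qm[of "Suc j"] ray_d[OF \<zeta>(1), of j "Suc j"] ig ray_carrier[OF \<zeta>(1)] by (simp add: j d_left)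
        qed
        show "n \<le> len (q n) + D"
        proof (cases "n \<le> m")
          case True
          have "len (q n) = d g (\<eta> (m - n))" using True by (simp add: q_def word_dist_def)
          also have "\<dots> = n" using ray_d[OF ray(1), of "m - n" m] True d_commute[OF g ray_carrier[OF ray(1)]] by (simp add: g_def)
          finally show ?thesis by simp
        next
          case False
          define j where "j = n - m"
          have l: "len (q n) = d g (\<zeta> j)" using False by (simp add: q_def word_dist_def j_def)
          have "gp \<one> g (\<zeta> j) \<le> k" using ray(5) ray(3) unfolding sep_def g_def by simp
          moreover have "d \<one> g = m" "d \<one> (\<zeta> j) = j" using leng d_one[OF g] ray_d0[OF \<zeta>(1), of j] \<zeta>(2) by auto
          ultimately have "real m + real j - d g (\<zeta> j) \<le> 2 * k" by (simp add: gromov_product_def field_simps)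
          moreover have "2 * k \<le> real D" unfolding D_def by (rule real_nat_ceiling_ge)
          ultimately have "real n \<le> real (len (q n)) + real D" unfolding l using False by (simp add: j_def of_nat_diff)
          then show ?thesis by linarith
        qed
      qed
      have "xi (N - r) q = xi (N - r) (\<lambda>n. inv g \<otimes> \<zeta> n)" using xi_offset[OF r' gapr' pq, of m] by (simp add: qm)
      also have "\<dots> = xi (N - r) \<theta>"
      proof (rule xi_req[OF r' gapr' abt(3) ray_left[OF ig \<zeta>(1)]])
        have "(\<lambda>n. inv g \<otimes> (g \<otimes> \<theta> n)) = \<theta>" using g ray_carrier[OF abt(3)] by (simp flip: m_assoc)
        then show "req \<theta> (\<lambda>n. inv g \<otimes> \<zeta> n)"
          using req_left[OF ig ray_left[OF g abt(3)] \<zeta>(1)] rq(3) by (simp add: g_def)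
      qed
      finally have xq: "xi (N - r) q = xi (N - r) \<theta>" .
      have q1: "q m = inv g" using qm[of 0] \<zeta>(2) ig by simp
      have nearq: "near (C2 * \<tau>2 ^ m) (U (N - r) (inv g)) (xi (N - r) \<theta>)"
        using C2(4)[OF pq] unfolding tail_bound_def xq using q1 by metis
      obtain y' where y': "y' \<in> U (N - r) (inv g)" "av (sv g (r - 1)) * nv (z - y') \<le> nv (R g *\<^sub>v z)"
        using dual_expand[OF r g z] by blast
      have yc': "y' \<in> carrier_vec N" using y'(1) U_carrier[OF ig] by blast
      \<comment> \<open>Hyperconvexity keeps \<open>z\<close> away from
        \<open>xi (N - r) \<theta>\<close>, and so also from the space contracted by
        \<open>R g\<close>, which is nearly the same for large \<open>m\<close>.\<close>
      have far: "\<epsilon>0 / 4 * nv z \<le> nv (z - y')"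
      proof (rule ccontr)
        assume neg: "\<not> \<epsilon>0 / 4 * nv z \<le> nv (z - y')"
        obtain t where t: "t \<in> xi (N - r) \<theta>" "nv (y' - t) \<le> C2 * \<tau>2 ^ m * nv y'" using nearq y'(1) by (auto simp: near_def)
        have tc: "t \<in> carrier_vec N" using t xi_carrier[OF r' gapr' ray_path[OF abt(3)]] by blast
        have ny: "nv y' \<le> nv z + nv (z - y')" using nv_le_dist[OF yc' z] nv_minus_commute[OF yc' z] by simp
        have "\<epsilon>0 * nv z \<le> nv (z - y') + nv (y' - t)" using uh[OF t(1)] nv_dist_triangle[OF z yc' tc] by linarith
        also have "nv (y' - t) \<le> C2 * \<tau>2 ^ m * (nv z + nv (z - y'))"
          using t(2) ny C2 by (meson mult_left_mono order_trans mult_nonneg_nonneg less_imp_le zero_le_power)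
        finally have a1: "\<epsilon>0 * nv z \<le> nv (z - y') + (C2 * \<tau>2 ^ m * nv z + C2 * \<tau>2 ^ m * nv (z - y'))" by (simp add: distrib_left)
        have "C2 * \<tau>2 ^ m * nv z \<le> \<epsilon>0 / 4 * nv z" using Mm \<epsilon>0 by (intro mult_right_mono) auto
        moreover have "C2 * \<tau>2 ^ m * nv (z - y') \<le> 1 * nv (z - y')" using Mm by (intro mult_right_mono) auto
        ultimately have "\<epsilon>0 * nv z \<le> 2 * nv (z - y') + \<epsilon>0 / 4 * nv z" using a1 by linarith
        moreover have "nv (z - y') < \<epsilon>0 / 4 * nv z" using neg by simp
        ultimately have "\<epsilon>0 * nv z < 3 * (\<epsilon>0 / 4 * nv z)" by linarith
        moreover have "0 \<le> \<epsilon>0 * nv z" using \<epsilon>0 by simp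
        ultimately show False by simp
      qed
      have sp: "0 < av (sv g (r - 1))" "0 < av (sv g r)" using sv_pos[OF g] r by auto
      have "av (sv g (r - 1)) * (\<epsilon>0 / 4 * nv z) \<le> nv (R g *\<^sub>v z)" using far y'(2) sp by (meson mult_left_mono less_imp_le order_trans)
      then have nz: "nv z \<le> 4 / \<epsilon>0 * nv (R g *\<^sub>v z) / av (sv g (r - 1))" using \<epsilon>0 sp by (simp add: field_simps)
      \<comment> \<open>The image of \<open>z\<close> has norm at least a multiple of the
        \<open>r\<close>-th singular value, while its part off \<open>U r g\<close> is at most the
        next one; so the relative error is the gap.\<close>
      obtain t where t: "t \<in> U r g" "nv (R g *\<^sub>v z - t) \<le> av (sv g r) * nv z"
        using svd_attract[OF svd_sv[OF g] z r(2)] unfolding U_def by blast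
      have tc: "t \<in> carrier_vec N" using t(1) U_carrier[OF g] by blast
      define Z where "Z = nv (R g *\<^sub>v z)"
      have Z: "0 \<le> Z" by (simp add: Z_def)
      define e1 where "e1 = 4 / \<epsilon>0 * c * \<tau>4 ^ m"
      define e2 where "e2 = C3 * \<tau>3 ^ m"
      have e: "0 \<le> e1" "0 \<le> e2" "e1 + 2 * e2 \<le> 1 / 2" "e1 + 2 * e2 \<le> \<epsilon>2 / 4" using Mm \<epsilon>0 c C3 by (auto simp: e1_def e2_def)
      have d1: "nv (R g *\<^sub>v z - t) \<le> e1 * Z"
      proof -
        have "av (sv g r) * nv z \<le> av (sv g r) * (4 / \<epsilon>0 * Z / av (sv g (r - 1)))" using nz sp by (intro mult_left_mono) (auto simp: Z_def)
        also have "\<dots> = 4 / \<epsilon>0 * Z * (av (sv g r) / av (sv g (r - 1)))" by simp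
        also have "\<dots> \<le> 4 / \<epsilon>0 * Z * (c * \<tau>4 ^ m)"
          using gp[OF g svd_sv[OF g]] leng \<epsilon>0 Z by (intro mult_left_mono) auto
        finally show ?thesis using t(2) by (simp add: e1_def mult_ac)
      qed
      \<comment> \<open>Since \<open>g\<close> is on \<eta>, the space \<open>U r g\<close> is close
        to \<open>xi r \<eta>\<close>, and uniform transversality to
        \<open>xi (N - r) \<zeta>\<close> applies to \<open>v\<close>.\<close>
      obtain v where v: "v \<in> xi r \<eta>" "nv (t - v) \<le> e2 * nv t"
        using C3(4)[OF ray_path_one[OF ray(1,3)]] t(1) unfolding tail_bound_def near_def g_def e2_def by blast
      have vc: "v \<in> carrier_vec N" using v(1) xi_carrier[OF r gapr ray_path[OF ray(1)]] by blast
      have wc: "w \<in> carrier_vec N" using w xi_carrier[OF r' gapr' ray_path[OF \<zeta>(1)]] by blast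
      have nt: "nv t \<le> 2 * Z"
      proof -
        have "nv t \<le> Z + e1 * Z" using nv_le_dist[OF tc zc] nv_minus_commute[OF tc zc] d1 by (simp add: Z_def)
        moreover have "e1 * Z \<le> 1 * Z" using e Z by (intro mult_right_mono) auto
        ultimately show ?thesis by simp
      qed
      have d2: "nv (R g *\<^sub>v z - v) \<le> (e1 + 2 * e2) * Z"
      proof -
        have "e2 * nv t \<le> e2 * (2 * Z)" using nt e by (intro mult_left_mono) auto
        then show ?thesis using nv_dist_triangle[OF zc tc vc] d1 v(2) by (simp add: distrib_right)
      qed
      have "(e1 + 2 * e2) * Z \<le> 1 / 2 * Z" using e Z by (intro mult_right_mono) auto
      then have "Z / 2 \<le> nv v" using nv_le_dist[OF zc vc] d2 by (simp add: Z_def)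
      then have "\<epsilon>2 * (Z / 2) \<le> nv (v - w)" using ut[OF ray(1,3,5) v(1) w] \<epsilon>2 by (meson mult_left_mono less_imp_le order_trans)
      moreover have "nv (v - w) \<le> nv (R g *\<^sub>v z - v) + nv (R g *\<^sub>v z - w)"
        using nv_dist_triangle[OF vc zc wc] nv_minus_commute[OF vc zc] by simp
      moreover have "(e1 + 2 * e2) * Z \<le> \<epsilon>2 / 4 * Z" using e Z by (intro mult_right_mono) auto
      ultimately have "\<epsilon>2 / 4 * Z \<le> nv (R g *\<^sub>v z - w)" using d2 by simp
      moreover have "\<epsilon> \<le> \<epsilon>2 / 4" unfolding \<epsilon>_def by (rule min.cobounded2)
      then have "\<epsilon> * Z \<le> \<epsilon>2 / 4 * Z" using Z by (rule mult_right_mono)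
      ultimately show ?thesis unfolding uz Z_def by linarith
    qed
  qed
  moreover have "\<epsilon> > 0" using \<epsilon>0 \<epsilon>2 \<kappa>(1) by (simp add: \<epsilon>_def)
  ultimately show ?thesis by blast
qed

end

end

section \<open>Hausdorff measure zero\<close>

text \<open>The dimension is an infimum of exponents at which the measure vanishes. Only null sets
  have to be compared, and those are described by covers of arbitrarily small mesh and
  total.\<close>

lemma hausdorff_measure_0_iff:
  fixes dst :: "'a \<Rightarrow> 'a \<Rightarrow> real"
  shows "hausdorff_measure dst s A = 0 \<longleftrightarrow> (\<forall>\<delta>>0. \<forall>e>0. \<exists>C :: nat \<Rightarrow> 'a set.
    (\<Union>i. C i) = A \<and> (\<forall>i. diam dst (C i) \<le> ennreal \<delta>) \<and>
    (\<Sum>i. ennreal (enn2real (diam dst (C i)) powr s)) \<le> ennreal e)" (is "_ \<longleftrightarrow> ?R")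
proof -
  define F where "F \<delta> = {C :: nat \<Rightarrow> 'a set. (\<Union>i. C i) = A \<and> (\<forall>i. diam dst (C i) \<le> ennreal \<delta>)}" for \<delta> :: real
  define T where "T C = (\<Sum>i. ennreal (enn2real (diam dst (C i)) powr s))" for C :: "nat \<Rightarrow> 'a set"
  have "(INF C\<in>F \<delta>. T C) = 0 \<longleftrightarrow> (\<forall>e>0. \<exists>C\<in>F \<delta>. T C \<le> ennreal e)" for \<delta>
  proof
    assume 0: "(INF C\<in>F \<delta>. T C) = 0"
    show "\<forall>e>0. \<exists>C\<in>F \<delta>. T C \<le> ennreal e"
    proof (intro allI impI)
      fix e :: real assume "e > 0"
      then have "(INF C\<in>F \<delta>. T C) < ennreal e" using 0 by simp
      then show "\<exists>C\<in>F \<delta>. T C \<le> ennreal e" unfolding INF_less_iff using less_imp_le by blast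
    qed
  next
    assume r: "\<forall>e>0. \<exists>C\<in>F \<delta>. T C \<le> ennreal e"
    have "(INF C\<in>F \<delta>. T C) \<le> 0"
    proof (rule ennreal_le_epsilon)
      fix e :: real assume "e > 0"
      then obtain C where "C \<in> F \<delta>" "T C \<le> ennreal e" using r by blast
      then show "(INF C\<in>F \<delta>. T C) \<le> 0 + ennreal e" using INF_lower[of C "F \<delta>" T] by (simp add: order_trans)
    qed
    then show "(INF C\<in>F \<delta>. T C) = 0" by simp
  qed
  then have "(\<forall>\<delta>>0. (INF C\<in>F \<delta>. T C) = 0) \<longleftrightarrow> ?R" unfolding F_def T_def by auto
  moreover have "hausdorff_measure dst s A = 0 \<longleftrightarrow> (\<forall>\<delta>>0. (INF C\<in>F \<delta>. T C) = 0)"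
  proof -
    have "hausdorff_measure dst s A = (SUP \<delta>\<in>{0<..}. INF C\<in>F \<delta>. T C)"
      unfolding hausdorff_measure_def F_def T_def ..
    then have "hausdorff_measure dst s A = bot \<longleftrightarrow> (\<forall>\<delta>\<in>{0<..}. (INF C\<in>F \<delta>. T C) = bot)"
      by (simp only: SUP_bot_conv)
    then show ?thesis by (simp add: bot_ennreal Ball_def)
  qed
  ultimately show ?thesis by simp
qed

text \<open>A map \<open>f\<close> that shrinks distances by at most a constant factor is injective
  up to distance zero with a Lipschitz inverse; covers of \<open>B\<close> are pulled back along it,
  and diameters grow at most by the factor \<open>L\<close>.\<close>

lemma hausdorff_measure_0_lipschitz:
  fixes f :: "'a \<Rightarrow> 'b"
  assumes lip: "\<And>x y. x \<in> A \<Longrightarrow> y \<in> A \<Longrightarrow> dst x y \<le> L * dst' (f x) (f y)" and L: "0 < L"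
    and f: "f ` A \<subseteq> B" and B: "hausdorff_measure dst' s B = 0" and s: "0 < s"
  shows "hausdorff_measure dst s A = 0"
  unfolding hausdorff_measure_0_iff
proof (intro allI impI)
  fix \<delta> e :: real assume \<delta>: "\<delta> > 0" and e: "e > 0"
  have "\<delta> / L > 0" "e / L powr s > 0" using \<delta> e L by auto
  then obtain D :: "nat \<Rightarrow> 'b set" where D: "(\<Union>i. D i) = B" "\<And>i. diam dst' (D i) \<le> ennreal (\<delta> / L)"
    "(\<Sum>i. ennreal (enn2real (diam dst' (D i)) powr s)) \<le> ennreal (e / L powr s)"
    using B unfolding hausdorff_measure_0_iff by blast
  define C where "C i = {x \<in> A. f x \<in> D i}" for i
  have diam: "diam dst (C i) \<le> ennreal L * diam dst' (D i)" for i
    unfolding diam_def[of dst]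
  proof (intro SUP_least)
    fix x y assume xy: "x \<in> C i" "y \<in> C i"
    have "ennreal (dst x y) \<le> ennreal L * ennreal (dst' (f x) (f y))"
      using lip[of x y] xy L by (simp add: C_def ennreal_mult'[symmetric] ennreal_leI)
    also have "ennreal (dst' (f x) (f y)) \<le> diam dst' (D i)"
      unfolding diam_def using xy
      by (intro SUP_upper2[of "f x"] SUP_upper[of "f y" _ "\<lambda>y. ennreal (dst' (f x) y)"]) (auto simp: C_def)
    finally show "ennreal (dst x y) \<le> ennreal L * diam dst' (D i)" by (simp add: mult_left_mono)
  qed
  have fin: "diam dst' (D i) < \<infinity>" for i using D(2)[of i] by (simp add: le_less_trans)
  have real: "enn2real (diam dst (C i)) \<le> L * enn2real (diam dst' (D i))" for i
  proof -
    have "enn2real (diam dst (C i)) \<le> enn2real (ennreal L * diam dst' (D i))"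
      using diam[of i] fin[of i] by (intro enn2real_mono) (auto simp: ennreal_mult_less_top)
    then show ?thesis using L by (simp add: enn2real_mult)
  qed
  have "x \<in> (\<Union>i. C i)" if "x \<in> A" for x
  proof -
    have "f x \<in> (\<Union>i. D i)" using f D(1) that by auto
    then show ?thesis using that by (auto simp: C_def)
  qed
  then have "(\<Union>i. C i) = A" by (auto simp: C_def)
  moreover have "diam dst (C i) \<le> ennreal \<delta>" for i
  proof -
    have "diam dst (C i) \<le> ennreal L * ennreal (\<delta> / L)" 
      by (rule order_trans[OF diam mult_left_mono[OF D(2)]]) simp
    then show ?thesis using L \<delta> by (simp add: ennreal_mult'[symmetric])
  qed
  moreover have "(\<Sum>i. ennreal (enn2real (diam dst (C i)) powr s)) \<le> ennreal e"
  proof -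
    have "ennreal (enn2real (diam dst (C i)) powr s) \<le> ennreal (L powr s) * ennreal (enn2real (diam dst' (D i)) powr s)" for i
    proof -
      have "enn2real (diam dst (C i)) powr s \<le> (L * enn2real (diam dst' (D i))) powr s"
        using real[of i] s by (intro powr_mono2) auto
      then show ?thesis using L by (simp add: powr_mult ennreal_mult'[symmetric] ennreal_leI)
    qed
    then have "(\<Sum>i. ennreal (enn2real (diam dst (C i)) powr s)) \<le> (\<Sum>i. ennreal (L powr s) * ennreal (enn2real (diam dst' (D i)) powr s))"
      by (intro suminf_le) auto
    also have "\<dots> = ennreal (L powr s) * (\<Sum>i. ennreal (enn2real (diam dst' (D i)) powr s))" by simp
    also have "\<dots> \<le> ennreal (L powr s) * ennreal (e / L powr s)" using D(3) by (intro mult_left_mono) auto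
    also have "\<dots> = ennreal e" using L e by (simp add: ennreal_mult'[symmetric])
    finally show ?thesis .
  qed
  ultimately show "\<exists>C. (\<Union>i. C i) = A \<and> (\<forall>i. diam dst (C i) \<le> ennreal \<delta>) \<and>
    (\<Sum>i. ennreal (enn2real (diam dst (C i)) powr s)) \<le> ennreal e" by blast
qed

text \<open>The \<open>n\<close>-th set is covered with total at most
  \<open>e / 2 ^ (n + 1)\<close>, and the double sequence of covers is enumerated by
  \<open>prod_decode\<close>.\<close>

lemma hausdorff_measure_0_UN:
  assumes B: "\<And>n :: nat. hausdorff_measure dst s (B n) = 0"
  shows "hausdorff_measure dst s (\<Union>n. B n) = 0"
  unfolding hausdorff_measure_0_iff
proof (intro allI impI)
  fix \<delta> e :: real assume \<delta>: "\<delta> > 0" and e: "e > 0"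
  have "\<exists>C. (\<Union>i. C i) = B n \<and> (\<forall>i. diam dst (C i) \<le> ennreal \<delta>) \<and>
    (\<Sum>i. ennreal (enn2real (diam dst (C i)) powr s)) \<le> ennreal (e * (1 / 2) ^ Suc n)" for n
  proof -
    have "e * (1 / 2) ^ Suc n > 0" using e by simp
    then show ?thesis using B[of n] \<delta> unfolding hausdorff_measure_0_iff by blast
  qed
  then obtain C where C: "\<And>n. (\<Union>i :: nat. C n i) = B n" "\<And>n i. diam dst (C n i) \<le> ennreal \<delta>"
    "\<And>n. (\<Sum>i. ennreal (enn2real (diam dst (C n i)) powr s)) \<le> ennreal (e * (1 / 2) ^ Suc n)" by metis
  define C' where "C' i = (case prod_decode i of (m, n) \<Rightarrow> C m n)" for i
  have C'e: "C' (prod_encode (m, n)) = C m n" for m n by (simp add: C'_def)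
  have "(\<Union>i. C' i) = (\<Union>n. B n)"
  proof (intro equalityI subsetI)
    fix x assume "x \<in> (\<Union>i. C' i)"
    then show "x \<in> (\<Union>n. B n)" using C(1) by (fastforce simp: C'_def split: prod.splits)
  next
    fix x assume "x \<in> (\<Union>n. B n)"
    then obtain m n where "x \<in> C m n" using C(1) by blast
    then show "x \<in> (\<Union>i. C' i)" using C'e by blast
  qed
  moreover have "diam dst (C' i) \<le> ennreal \<delta>" for i using C(2) by (simp add: C'_def split: prod.splits)
  moreover have "(\<Sum>i. ennreal (enn2real (diam dst (C' i)) powr s)) \<le> ennreal e"
  proof -
    have "(\<Sum>i. (\<lambda>(m, n). ennreal (enn2real (diam dst (C m n)) powr s)) (prod_decode i))
        = (\<Sum>m. \<Sum>n. ennreal (enn2real (diam dst (C m n)) powr s))"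
      by (rule suminf_ennreal_2dimen) simp
    moreover have "(\<lambda>(m, n). ennreal (enn2real (diam dst (C m n)) powr s)) (prod_decode i)
        = ennreal (enn2real (diam dst (C' i)) powr s)" for i by (simp add: C'_def split: prod.splits)
    ultimately have "(\<Sum>i. ennreal (enn2real (diam dst (C' i)) powr s))
        = (\<Sum>m. \<Sum>n. ennreal (enn2real (diam dst (C m n)) powr s))" by simp
    also have "\<dots> \<le> (\<Sum>m. ennreal (e * (1 / 2) ^ Suc m))" using C(3) by (intro suminf_le) auto
    also have "\<dots> = ennreal e"
    proof (rule suminf_ennreal_eq)
      show "(\<lambda>m. e * (1 / 2) ^ Suc m) sums e" using sums_mult[OF power_half_series, of e] by simp
    qed (use e in auto)
    finally show ?thesis .
  qed
  ultimately show "\<exists>C. (\<Union>i. C i) = (\<Union>n. B n) \<and> (\<forall>i. diam dst (C i) \<le> ennreal \<delta>) \<and>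
    (\<Sum>i. ennreal (enn2real (diam dst (C i)) powr s)) \<le> ennreal e" by blast
qed

lemma hausdorff_measure_0_singleton:
  assumes "dst x x = 0" shows "hausdorff_measure dst s {x} = 0"
  unfolding hausdorff_measure_0_iff
proof (intro allI impI)
  fix \<delta> e :: real assume "\<delta> > 0" and "e > 0"
  then show "\<exists>C. (\<Union>i :: nat. C i) = {x} \<and> (\<forall>i. diam dst (C i) \<le> ennreal \<delta>) \<and>
    (\<Sum>i. ennreal (enn2real (diam dst (C i)) powr s)) \<le> ennreal e"
    using assms by (intro exI[of _ "\<lambda>_. {x}"]) (simp add: diam_def)
qed

section \<open>The norm on the exterior square\<close>

context local_abs
begin

definition wn :: "nat \<Rightarrow> 'k vec \<Rightarrow> 'k vec \<Rightarrow> real" where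
  "wn n v w = onb_norm av {(i, j). i < j \<and> j < n} (\<lambda>(i, j). v $ i * w $ j - v $ j * w $ i)"

lemma finite_index_pairs: "finite {(i, j). i < j \<and> j < (n :: nat)}"
  by (rule finite_subset[of _ "{..<n} \<times> {..<n}"]) auto

lemma card_index_pairs: "card {(i, j). i < j \<and> j < (n :: nat)} \<le> n * n"
proof -
  have "{(i, j). i < j \<and> j < n} \<subseteq> {..<n} \<times> {..<n}" by auto
  from card_mono[OF _ this] show ?thesis by (simp add: card_cartesian_product)
qed

lemma wn_nonneg [simp]: "0 \<le> wn n v w" by (simp add: wn_def finite_index_pairs)

lemma wn_entry:
  assumes "i < n" "j < n" shows "av (v $ i * w $ j - v $ j * w $ i) \<le> wn n v w"
proof -
  have *: "av (v $ i * w $ j - v $ j * w $ i) \<le> wn n v w" if "i < j" "j < n" for i j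
    using onb_norm_entry[OF finite_index_pairs[of n], of "(i, j)" "\<lambda>(i, j). v $ i * w $ j - v $ j * w $ i"] that
    by (simp add: wn_def)
  show ?thesis
  proof (cases i j rule: linorder_cases)
    case greater
    then show ?thesis using *[of j i] assms av_minus_commute[of "v $ i * w $ j"] by simp
  qed (use * assms in auto)
qed

lemma wn_le:
  assumes "v \<in> carrier_vec n" "w \<in> carrier_vec n"
  shows "wn n v w \<le> 2 * (real n)\<^sup>2 * (nv v * nv w)"
proof -
  have "wn n v w \<le> real (card {(i, j). i < j \<and> j < n}) * (2 * (nv v * nv w))"
    unfolding wn_def
  proof (rule onb_norm_le[OF finite_index_pairs])
    fix p assume "p \<in> {(i, j). i < j \<and> j < n}"
    then obtain i j where p: "p = (i, j)" and ij: "i < n" "j < n" by auto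
    have e: "av (v $ i) \<le> nv v" "av (v $ j) \<le> nv v" "av (w $ i) \<le> nv w" "av (w $ j) \<le> nv w"
      using ij assms by (auto intro!: nv_entry)
    have "av (v $ i * w $ j - v $ j * w $ i) \<le> av (v $ i * w $ j) + av (v $ j * w $ i)"
      using av_triangle2 by blast
    also have "\<dots> \<le> nv v * nv w + nv v * nv w"
      unfolding av_mult using e by (intro add_mono mult_mono) auto
    finally show "av (case p of (i, j) \<Rightarrow> v $ i * w $ j - v $ j * w $ i) \<le> 2 * (nv v * nv w)" by (simp add: p)
  qed simp
  also have "\<dots> \<le> real (n * n) * (2 * (nv v * nv w))"
    using card_index_pairs[of n] by (intro mult_right_mono) (simp_all flip: of_nat_mult)
  finally show ?thesis by (simp add: power2_eq_square)
qed

lemma wn_shear: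
  assumes "v \<in> carrier_vec n" "w \<in> carrier_vec n"
  shows "wn n v (w - c \<cdot>\<^sub>v v) = wn n v w"
  unfolding wn_def by (rule onb_norm_cong) (use assms in \<open>auto simp: algebra_simps\<close>)

lemma wn_smult: "v \<in> carrier_vec n \<Longrightarrow> w \<in> carrier_vec n \<Longrightarrow> wn n (a \<cdot>\<^sub>v v) (b \<cdot>\<^sub>v w) = av a * av b * wn n v w"
proof -
  assume c: "v \<in> carrier_vec n" "w \<in> carrier_vec n"
  have "wn n (a \<cdot>\<^sub>v v) (b \<cdot>\<^sub>v w) = onb_norm av {(i, j). i < j \<and> j < n} (\<lambda>p. (a * b) * (case p of (i, j) \<Rightarrow> v $ i * w $ j - v $ j * w $ i))"
    unfolding wn_def by (rule onb_norm_cong) (use c in \<open>auto simp: algebra_simps\<close>)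
  then show ?thesis by (simp add: onb_norm_smult[OF finite_index_pairs] wn_def av_mult)
qed

text \<open>Subtracting a multiple of \<open>v\<close> from \<open>w\<close> leaves the wedge
  unchanged. The multiple \<open>c\<close> is chosen to cancel \<open>w'\<close> at the largest
  coordinate of \<open>v'\<close>; the remaining coordinates of \<open>w' - c v'\<close>, multiplied
  by that largest one, are minors of the pair. This bounds \<open>w' - c v'\<close>, hence
  \<open>w - c v\<close> through \<epsilon>, hence the wedge of \<open>v\<close> and
  \<open>w\<close>. Lastly \<open>nv w' \<le> nv w\<close> adjusts the denominator.\<close>

lemma wedge_ratio_le:
  assumes v: "v \<in> carrier_vec n" "w \<in> carrier_vec n" "0 < nv v" "0 < nv w"
    and v': "v' \<in> carrier_vec r" "w' \<in> carrier_vec r" "0 < nv v'" "0 < nv w'" "nv w' \<le> nv w"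
    and \<epsilon>: "0 < \<epsilon>" "\<And>c. \<epsilon> * nv (w - c \<cdot>\<^sub>v v) \<le> nv (w' - c \<cdot>\<^sub>v v')"
  shows "wn n v w / (nv v * nv w) \<le> 2 * (real n)\<^sup>2 * (real r)\<^sup>2 / \<epsilon> * (wn r v' w' / (nv v' * nv w'))"
proof -
  have r: "0 < r" using v'(1,3) nv_le[of 0 v'] by (cases r) auto
  obtain i where i: "i < r" "\<And>j. j < r \<Longrightarrow> av (v' $ j) \<le> av (v' $ i)"
  proof -
    have "Max ((\<lambda>j. av (v' $ j)) ` {..<r}) \<in> (\<lambda>j. av (v' $ j)) ` {..<r}" using r by (intro Max_in) auto
    then obtain i where "i < r" "Max ((\<lambda>j. av (v' $ j)) ` {..<r}) = av (v' $ i)" by auto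
    then show ?thesis using that[of i] by (metis Max_ge finite_imageI finite_lessThan imageI lessThan_iff)
  qed
  have le: "nv v' \<le> real r * av (v' $ i)" using nv_le[of "av (v' $ i)" v'] i(2) v'(1) by simp
  then have pos: "0 < av (v' $ i)" using v'(3) by (metis av_nonneg less_eq_real_def mult_zero_right not_le)
  then have ne: "v' $ i \<noteq> 0" by auto
  define c where "c = w' $ i / v' $ i"
  have "nv (w' - c \<cdot>\<^sub>v v') \<le> real (dim_vec (w' - c \<cdot>\<^sub>v v')) * (wn r v' w' / av (v' $ i))"
  proof (rule nv_le)
    fix j assume "j < dim_vec (w' - c \<cdot>\<^sub>v v')"
    then have j: "j < r" using v' by simp
    have "v' $ i * (w' - c \<cdot>\<^sub>v v') $ j = v' $ i * w' $ j - v' $ j * w' $ i"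
      using v' j ne by (simp add: c_def algebra_simps)
    then have "av (v' $ i) * av ((w' - c \<cdot>\<^sub>v v') $ j) \<le> wn r v' w'"
      using wn_entry[OF i(1) j, of v' w'] by (simp flip: av_mult)
    then show "av ((w' - c \<cdot>\<^sub>v v') $ j) \<le> wn r v' w' / av (v' $ i)" using pos by (simp add: field_simps)
  qed simp
  also have "\<dots> = real r * (wn r v' w' / av (v' $ i))" using v' by simp
  also have "\<dots> \<le> real r * (real r * wn r v' w' / nv v')"
  proof (intro mult_left_mono)
    show "wn r v' w' / av (v' $ i) \<le> real r * wn r v' w' / nv v'"
      using mult_right_mono[OF le wn_nonneg[of r v' w']] pos v'(3) by (simp add: field_simps)
  qed simp
  finally have 1: "nv (w' - c \<cdot>\<^sub>v v') \<le> (real r)\<^sup>2 * wn r v' w' / nv v'" by (simp add: power2_eq_square)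
  have 2: "nv (w - c \<cdot>\<^sub>v v) \<le> (real r)\<^sup>2 * wn r v' w' / nv v' / \<epsilon>"
    by (subst pos_le_divide_eq[OF \<epsilon>(1)]) (use order_trans[OF \<epsilon>(2)[of c] 1] in \<open>simp only: mult.commute\<close>)
  have "wn n v w \<le> 2 * (real n)\<^sup>2 * (nv v * nv (w - c \<cdot>\<^sub>v v))"
    using wn_le[of v n "w - c \<cdot>\<^sub>v v"] v wn_shear[of v n w c] by simp
  also have "\<dots> \<le> 2 * (real n)\<^sup>2 * (nv v * ((real r)\<^sup>2 * wn r v' w' / nv v' / \<epsilon>))"
    using 2 by (intro mult_left_mono) auto
  finally have "wn n v w / (nv v * nv w) \<le> 2 * (real n)\<^sup>2 * (nv v * ((real r)\<^sup>2 * wn r v' w' / nv v' / \<epsilon>)) / (nv v * nv w)"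
    using v(3,4) by (intro divide_right_mono) auto
  also have "\<dots> = 2 * (real n)\<^sup>2 * (real r)\<^sup>2 / \<epsilon> * (wn r v' w' / (nv v' * nv w))"
    using v(3) by (simp add: field_simps)
  also have "\<dots> \<le> 2 * (real n)\<^sup>2 * (real r)\<^sup>2 / \<epsilon> * (wn r v' w' / (nv v' * nv w'))"
    using v' v(4) \<epsilon>(1) by (intro mult_left_mono divide_left_mono) auto
  finally show ?thesis .
qed

text \<open>The norm of \<open>S x\<close> is the distance of \<open>x\<close> to \<open>Sp n k m\<close>.\<close>

lemma complement_projection:
  assumes k: "k \<in> isom n" and m: "m \<le> n"
  defines "S x \<equiv> Matrix.vec (n - m) (\<lambda>i. (minv k *\<^sub>v x) $ (m + i))"
  shows "x \<in> carrier_vec n \<Longrightarrow> nv (S x) \<le> nv x"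
    and "x \<in> carrier_vec n \<Longrightarrow> \<exists>w\<in>Sp n k m. nv (x - w) = nv (S x)"
proof -
  note kc = isom_carrier[OF k] and kd = isom_det[OF k]
  assume x: "x \<in> carrier_vec n"
  define y where "y = minv k *\<^sub>v x"
  have y: "y \<in> carrier_vec n" "k *\<^sub>v y = x" using minv_mult_vec[OF kc kd x] minv(1)[OF kc kd] x by (auto simp: y_def)
  have ny: "nv y = nv x" using isom_nv[OF k y(1)] y(2) by simp
  have split: "z = Matrix.vec m (\<lambda>i. z $ i) @\<^sub>v Matrix.vec (n - m) (\<lambda>i. z $ (m + i))" if "z \<in> carrier_vec n" for z :: "'k vec"
    using that m by (intro eq_vecI) (auto simp: append_vec_def)
  have Sx: "S x = Matrix.vec (n - m) (\<lambda>i. y $ (m + i))" by (simp add: S_def y_def)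
  have "nv y = nv (Matrix.vec m (\<lambda>i. y $ i) @\<^sub>v S x)" using split[OF y(1)] Sx by simp
  also have "\<dots> \<ge> nv (S x)" unfolding nv_append
    by (simp add: real_le_rsqrt)
  finally show "nv (S x) \<le> nv x" using ny by simp
  define t where "t = Matrix.vec n (\<lambda>i. if i < m then y $ i else 0)"
  have t: "t \<in> carrier_vec n" by (simp add: t_def)
  have "k *\<^sub>v t \<in> Sp n k m" unfolding Sp_def using t by (auto simp: t_def)
  moreover have "nv (x - k *\<^sub>v t) = nv (S x)"
  proof -
    have "x - k *\<^sub>v t = k *\<^sub>v (y - t)" using y t kc by (simp add: mult_minus_distrib_mat_vec[of _ n n])
    then have "nv (x - k *\<^sub>v t) = nv (y - t)" using isom_nv[OF k, of "y - t"] y t by simp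
    also have "y - t = 0\<^sub>v m @\<^sub>v S x" using y(1) m Sx by (intro eq_vecI) (auto simp: t_def)
    also have "nv (0\<^sub>v m @\<^sub>v S x) = nv (S x)" unfolding nv_append by simp
    finally show ?thesis .
  qed
  ultimately show "\<exists>w\<in>Sp n k m. nv (x - w) = nv (S x)" by blast
qed

end

section \<open>Grassmannians\<close>

context vec_space
begin

lemma span_cols:
  assumes M: "M \<in> carrier_mat n n" and p: "p \<le> n"
  shows "span (col M ` {..<p}) = {M *\<^sub>v y | y. y \<in> carrier_vec n \<and> (\<forall>i. p \<le> i \<and> i < n \<longrightarrow> y $ i = 0)}"
proof -
  define A where "A = mat_of_cols n (map (col M) [0..<p])"
  have A: "A \<in> carrier_mat n p" using mat_of_cols_carrier(1)[of n "map (col M) [0..<p]"] by (simp add: A_def)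
  have "set (map (col M) [0..<p]) \<subseteq> carrier_vec n" using M by auto
  then have "cols A = map (col M) [0..<p]" unfolding A_def by (rule cols_mat_of_cols)
  then have cs: "set (cols A) = col M ` {..<p}" by (simp add: atLeast0LessThan)
  have idx: "A $$ (i, j) = M $$ (i, j)" if "i < n" "j < p" for i j
    using that M p by (simp add: A_def mat_of_cols_index)
  have eq: "A *\<^sub>v x = M *\<^sub>v y"
    if x: "x \<in> carrier_vec p" and y: "y \<in> carrier_vec n" and xy: "\<And>i. i < p \<Longrightarrow> y $ i = x $ i" "\<And>i. p \<le> i \<Longrightarrow> i < n \<Longrightarrow> y $ i = 0"
    for x y :: "'a vec"
  proof (rule eq_vecI)
    fix i assume "i < dim_vec (M *\<^sub>v y)"
    then have i: "i < n" using M by simp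
    have "(M *\<^sub>v y) $ i = (\<Sum>j<n. M $$ (i, j) * y $ j)" by (rule mult_mat_vec_index[OF M y i])
    also have "\<dots> = (\<Sum>j<p. M $$ (i, j) * y $ j)"
      by (rule sum.mono_neutral_right) (use p xy(2) in auto)
    also have "\<dots> = (\<Sum>j<p. A $$ (i, j) * x $ j)"
      by (rule sum.cong) (use idx i xy(1) in auto)
    also have "\<dots> = (A *\<^sub>v x) $ i" by (rule mult_mat_vec_index[OF A x i, symmetric])
    finally show "(A *\<^sub>v x) $ i = (M *\<^sub>v y) $ i" by simp
  qed (use A M in simp)
  have "span (col M ` {..<p}) = {y \<in> carrier_vec n. \<exists>x\<in>carrier_vec p. A *\<^sub>v x = y}"
    using col_space_eq[OF A] A unfolding col_space_def cs by simp
  also have "\<dots> = {M *\<^sub>v y | y. y \<in> carrier_vec n \<and> (\<forall>i. p \<le> i \<and> i < n \<longrightarrow> y $ i = 0)}"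
  proof (intro equalityI subsetI)
    fix z assume "z \<in> {y \<in> carrier_vec n. \<exists>x\<in>carrier_vec p. A *\<^sub>v x = y}"
    then obtain x where x: "x \<in> carrier_vec p" "z = A *\<^sub>v x" by auto
    let ?y = "Matrix.vec n (\<lambda>i. if i < p then x $ i else 0)"
    have "A *\<^sub>v x = M *\<^sub>v ?y" by (rule eq[OF x(1)]) (use p in auto)
    then show "z \<in> {M *\<^sub>v y | y. y \<in> carrier_vec n \<and> (\<forall>i. p \<le> i \<and> i < n \<longrightarrow> y $ i = 0)}"
      unfolding x(2) by (intro CollectI exI[of _ ?y]) auto
  next
    fix z assume "z \<in> {M *\<^sub>v y | y. y \<in> carrier_vec n \<and> (\<forall>i. p \<le> i \<and> i < n \<longrightarrow> y $ i = 0)}"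
    then obtain y :: "'a vec" where y: "y \<in> carrier_vec n" "z = M *\<^sub>v y" "\<forall>i. p \<le> i \<and> i < n \<longrightarrow> y $ i = 0" by auto
    let ?x = "Matrix.vec p (\<lambda>i. y $ i)"
    have "A *\<^sub>v ?x = M *\<^sub>v y" by (rule eq) (use y in auto)
    then show "z \<in> {y \<in> carrier_vec n. \<exists>x\<in>carrier_vec p. A *\<^sub>v x = y}"
      using y(2) M y(1) by (intro CollectI conjI bexI[of _ ?x]) auto
  qed
  finally show ?thesis .
qed

lemma span_cols_grassmannian:
  assumes M: "M \<in> carrier_mat n n" "det M \<noteq> 0" and p: "p \<le> n"
  shows "span (col M ` {..<p}) \<in> grassmannian p n"
proof -
  let ?B = "col M ` {..<p}"
  have Bc: "?B \<subseteq> carrier_vec n" using M(1) by auto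
  have inj: "inj_on (col M) {..<n}"
  proof (rule inj_onI)
    fix i j assume ij: "i \<in> {..<n}" "j \<in> {..<n}" and "col M i = col M j"
    then have "M *\<^sub>v unit_vec n i = M *\<^sub>v unit_vec n j" using mult_mat_vec_unit[OF M(1)] by simp
    then have "unit_vec n i = (unit_vec n j :: 'a vec)"
      using minv_mult_vec(1)[OF M] unit_vec_carrier by metis
    then have "unit_vec n i $ i = (unit_vec n j :: 'a vec) $ i" by simp
    then show "i = j" using ij by (simp split: if_splits)
  qed
  have card: "card ?B = p" using card_image[of "col M" "{..<p}"] inj_on_subset[OF inj, of "{..<p}"] p by auto
  have "lin_indpt (set (cols M))" using lin_dep_cols_imp_det_0[OF M(1)] M(2) by blast
  moreover have "?B \<subseteq> set (cols M)" using M(1) p by (auto simp: cols_def)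
  ultimately have li: "lin_indpt ?B" using subset_li_is_li by blast
  have sub: "submodule class_ring (span ?B) V" by (rule span_is_submodule[OF Bc])
  have ss: "VectorSpace.subspace class_ring (span ?B) V" using span_is_subspace Bc by simp
  interpret W: vectorspace class_ring "vs (span ?B)" by (rule subspace_is_vs[OF ss])
  have own: "?B \<subseteq> span ?B" by (rule in_own_span[OF Bc])
  have "W.basis ?B" unfolding W.basis_def
    using own li span_li_not_depend[OF own sub] by simp
  then have "W.dim = p" using W.dim_basis[of ?B] card by simp
  then show ?thesis unfolding grassmannian_def using ss by simp
qed

text \<open>An independent subset of \<open>V'\<close> of largest cardinality is a basis of
  \<open>V'\<close>. It has \<open>p\<close> elements and is independent in \<open>W\<close>, whose
  dimension is also \<open>p\<close>, so it spans \<open>W\<close> as well.\<close>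

lemma grassmannian_subset_eq:
  assumes V': "V' \<in> grassmannian p n" and W: "W \<in> grassmannian p n" "W = span B" "finite B" "B \<subseteq> carrier_vec n" and sub: "V' \<subseteq> W"
  shows "V' = W"
proof -
  have ss: "VectorSpace.subspace class_ring V' V" "vectorspace.dim class_ring (vs V') = p"
    "VectorSpace.subspace class_ring W V" "vectorspace.dim class_ring (vs W) = p" 
    using V' W(1) by (auto simp: grassmannian_def)
  have sm: "submodule class_ring V' V" "submodule class_ring W V" using ss by (auto simp: VectorSpace.subspace_def)
  interpret X: vectorspace class_ring "vs V'" by (rule subspace_is_vs[OF ss(1)])
  interpret Y: vectorspace class_ring "vs W" by (rule subspace_is_vs[OF ss(3)])
  have V'c: "V' \<subseteq> carrier_vec n" using sm(1) by (auto simp: submodule_def)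
  have fin: "finite A \<and> card A \<le> n" if "A \<subseteq> V'" "lin_indpt A" for A
    using li_le_dim[of A] that V'c dim_is_n by auto
  define P where "P A \<longleftrightarrow> A \<subseteq> V' \<and> lin_indpt A" for A
  have "P {}" by (auto simp: P_def lin_dep_def)
  then obtain A where A: "P A" "\<And>A'. P A' \<Longrightarrow> card A' \<le> card A"
  proof -
    have "\<forall>A. P A \<longrightarrow> card A < Suc n" using fin unfolding P_def by (simp add: less_Suc_eq_le)
    then show ?thesis using ex_has_greatest_nat[of P "{}" card "Suc n"] \<open>P {}\<close> that by blast
  qed
  have A': "A \<subseteq> V'" "lin_indpt A" "finite A" using A(1) fin by (auto simp: P_def)
  have "maximal A (\<lambda>S. S \<subseteq> V' \<and> X.lin_indpt S)"
    unfolding maximal_def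
  proof (intro conjI allI impI)
    show "A \<subseteq> V'" "X.lin_indpt A" using A' span_li_not_depend(2)[OF A'(1) sm(1)] by auto
    fix S assume S: "A \<subseteq> S \<and> S \<subseteq> V' \<and> X.lin_indpt S"
    then have "lin_indpt S" using span_li_not_depend(2)[of S V'] sm(1) by auto
    then have "P S" using S by (simp add: P_def)
    then have "card S \<le> card A" "finite S" using A(2) fin by (auto simp: P_def)
    then show "S = A" using S by (metis card_seteq)
  qed
  then have bX: "X.basis A" using X.max_li_is_basis[of A] by simp
  then have cA: "card A = p" using X.dim_basis[of A] A'(3) ss(2) by simp
  have AW: "A \<subseteq> W" using A'(1) sub by blast
  have "Y.fin_dim" using fin_dim_span[of B] W by simp
  moreover have "Y.lin_indpt A" using A'(2) span_li_not_depend(2)[OF AW sm(2)] by simp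
  ultimately have "Y.basis A" using Y.dim_li_is_basis[of A] A'(3) AW cA ss(4) by simp
  then have "W = span A" unfolding Y.basis_def using span_li_not_depend(1)[OF AW sm(2)] by simp
  moreover have "V' = span A" using bX unfolding X.basis_def using span_li_not_depend(1)[OF A'(1) sm(1)] by simp
  ultimately show ?thesis by simp
qed

end

section \<open>Change of basis\<close>

lemma GL_iff: "g \<in> carrier (GL d) \<longleftrightarrow> (g :: 'k::field mat) \<in> carrier_mat d d \<and> det g \<noteq> 0"
proof -
  have "g \<in> Units (ring_mat TYPE('k) d ()) \<Longrightarrow> g \<in> carrier_mat d d"
    by (simp add: Units_def ring_mat_simps)
  then show ?thesis
    unfolding GL_def units_of_carrier
    using unit_imp_det_non_zero[of g d "()"] det_non_zero_imp_unit[of g d "()"] by blast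
qed

lemma mult_GL: "mult (GL d) = (*)" by (simp add: GL_def units_of_def ring_mat_simps)

locale good_basis = local_abs av for av :: "'k::field \<Rightarrow> real" +
  fixes E :: "'k mat" and d :: nat
  assumes E: "E \<in> carrier_mat d d" and dE: "det E \<noteq> 0"
begin

lemma Ei: "minv E \<in> carrier_mat d d" by (rule minv(1)[OF E dE])

lemma coords_eq: "v \<in> carrier_vec d \<Longrightarrow> coords E v = minv E *\<^sub>v v"
  unfolding coords_def
proof (rule the_equality)
  assume v: "v \<in> carrier_vec d"
  show "minv E *\<^sub>v v \<in> carrier_vec (dim_col E) \<and> E *\<^sub>v (minv E *\<^sub>v v) = v"
    using minv_mult_vec[OF E dE v] E Ei v by auto
  fix c assume "c \<in> carrier_vec (dim_col E) \<and> E *\<^sub>v c = v"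
  then show "c = minv E *\<^sub>v v" using minv_mult_vec(1)[OF E dE, of c] E by auto
qed

lemma good_norm_eq: "v \<in> carrier_vec d \<Longrightarrow> good_norm av E v = nv (minv E *\<^sub>v v)"
  unfolding good_norm_def nv_def using coords_eq[of v] E Ei by auto

lemma good_norm_mult: "y \<in> carrier_vec d \<Longrightarrow> good_norm av E (E *\<^sub>v y) = nv y"
  using good_norm_eq[of "E *\<^sub>v y"] minv_mult_vec(1)[OF E dE, of y] mult_mat_vec_carrier[OF E, of y] by simp

lemma wedge_norm_eq: "v \<in> carrier_vec d \<Longrightarrow> w \<in> carrier_vec d \<Longrightarrow>
    wedge_norm av E v w = wn d (minv E *\<^sub>v v) (minv E *\<^sub>v w)"
  unfolding wedge_norm_def wn_def using coords_eq E by auto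

text \<open>The matrix of the operator \<open>g\<close> in the basis given by the columns of
  \<open>E\<close>. It carries isometries of the good norm to \<open>isom\<close> and Cartan
  decompositions to \<open>svd\<close>.\<close>

definition cj :: "'k mat \<Rightarrow> 'k mat" where "cj g = minv E * g * E"

definition uncj :: "'k mat \<Rightarrow> 'k mat" where "uncj g = E * g * minv E"

lemma cj_carrier: "g \<in> carrier_mat d d \<Longrightarrow> cj g \<in> carrier_mat d d"
  unfolding cj_def using E Ei by simp

lemma uncj_carrier: "g \<in> carrier_mat d d \<Longrightarrow> uncj g \<in> carrier_mat d d"
  unfolding uncj_def using E Ei by simp

lemma cj_vec: "g \<in> carrier_mat d d \<Longrightarrow> v \<in> carrier_vec d \<Longrightarrow> cj g *\<^sub>v v = minv E *\<^sub>v (g *\<^sub>v (E *\<^sub>v v))"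
  unfolding cj_def using E Ei by (simp add: assoc_mult_mat_vec[of _ d d _ d])

lemma uncj_vec: "g \<in> carrier_mat d d \<Longrightarrow> v \<in> carrier_vec d \<Longrightarrow> uncj g *\<^sub>v v = E *\<^sub>v (g *\<^sub>v (minv E *\<^sub>v v))"
  unfolding uncj_def using E Ei by (simp add: assoc_mult_mat_vec[of _ d d _ d])

lemma cj_uncj: "g \<in> carrier_mat d d \<Longrightarrow> cj (uncj g) = g"
  by (rule mat_eqI_vec[of _ d d])
    (use E Ei in \<open>auto simp: cj_carrier uncj_carrier cj_vec uncj_vec minv_mult_vec[OF E dE]\<close>)

lemma uncj_cj: "g \<in> carrier_mat d d \<Longrightarrow> uncj (cj g) = g"
  by (rule mat_eqI_vec[of _ d d])
    (use E Ei in \<open>auto simp: cj_carrier uncj_carrier cj_vec uncj_vec minv_mult_vec[OF E dE]\<close>)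

lemma cj_mult: "g \<in> carrier_mat d d \<Longrightarrow> h \<in> carrier_mat d d \<Longrightarrow> cj (g * h) = cj g * cj h"
proof (rule mat_eqI_vec[of _ d d])
  assume g: "g \<in> carrier_mat d d" "h \<in> carrier_mat d d"
  show "cj (g * h) *\<^sub>v v = (cj g * cj h) *\<^sub>v v" if v: "v \<in> carrier_vec d" for v
    using g v E Ei assoc_mult_mat_vec[OF cj_carrier[OF g(1)] cj_carrier[OF g(2)] v]
    by (simp add: cj_vec cj_carrier minv_mult_vec[OF E dE] assoc_mult_mat_vec[OF g])
qed (use cj_carrier mult_carrier_mat in blast)+

lemma det_cj: "g \<in> carrier_mat d d \<Longrightarrow> det (cj g) = det g"
proof -
  assume g: "g \<in> carrier_mat d d"
  have "det (minv E) * det E = 1" using det_mult[OF Ei E] minv(2)[OF E dE] by simp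
  then show ?thesis unfolding cj_def using det_mult[OF mult_carrier_mat[OF Ei g] E] det_mult[OF Ei g]
    by (simp add: algebra_simps)
qed

lemma det_uncj: "g \<in> carrier_mat d d \<Longrightarrow> det (uncj g) = det g"
  using det_cj[OF uncj_carrier, of g] by (simp add: cj_uncj)

lemma cj_smult: "g \<in> carrier_mat d d \<Longrightarrow> cj (c \<cdot>\<^sub>m g) = c \<cdot>\<^sub>m cj g"
  unfolding cj_def using E Ei by (simp add: mult_smult_distrib[of _ d d _ d] mult_smult_assoc_mat[of _ d d _ d])

lemma isometries_iff: "g \<in> isometries av E \<longleftrightarrow> g \<in> carrier_mat d d \<and> cj g \<in> isom d"
proof
  assume g: "g \<in> isometries av E"
  then have gc: "g \<in> carrier_mat d d" using E by (auto simp: isometries_def GL_iff)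
  have "nv (cj g *\<^sub>v v) = nv v" if v: "v \<in> carrier_vec d" for v
  proof -
    have Ev: "E *\<^sub>v v \<in> carrier_vec d" using E v by simp
    have "nv (cj g *\<^sub>v v) = good_norm av E (g *\<^sub>v (E *\<^sub>v v))"
      using good_norm_eq[of "g *\<^sub>v (E *\<^sub>v v)"] cj_vec[OF gc v] Ev gc by simp
    also have "\<dots> = good_norm av E (E *\<^sub>v v)" using g Ev E by (auto simp: isometries_def)
    finally show ?thesis using good_norm_mult[OF v] by simp
  qed
  then show "g \<in> carrier_mat d d \<and> cj g \<in> isom d" using gc cj_carrier by (auto simp: isom_def)
next
  assume g: "g \<in> carrier_mat d d \<and> cj g \<in> isom d"
  then have "det g \<noteq> 0" using isom_det[of "cj g" d] det_cj by auto
  moreover have "good_norm av E (g *\<^sub>v v) = good_norm av E v" if v: "v \<in> carrier_vec d" for v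
  proof -
    have y: "minv E *\<^sub>v v \<in> carrier_vec d" using Ei v by simp
    have "good_norm av E (g *\<^sub>v v) = nv (cj g *\<^sub>v (minv E *\<^sub>v v))"
      using good_norm_eq[of "g *\<^sub>v v"] cj_vec[of g, OF _ y] g v minv_mult_vec[OF E dE v] mult_mat_vec_carrier[of g d d v] by simp
    then show ?thesis using isom_nv[of "cj g" d, OF _ y] g good_norm_eq[OF v] by simp
  qed
  ultimately show "g \<in> isometries av E" using g E by (auto simp: isometries_def GL_iff)
qed

lemma cartan_imp_svd:
  assumes c: "cartan av E g k \<alpha> l"
  shows "k \<in> carrier_mat d d" "svd d (cj g) (cj k) \<alpha> (cj l)"
proof -
  have dr: "dim_row E = d" using E by simp
  have kl: "k \<in> carrier_mat d d" "cj k \<in> isom d" "l \<in> carrier_mat d d" "cj l \<in> isom d"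
    and mono: "\<forall>i j. i \<le> j \<and> j < d \<longrightarrow> av (\<alpha> j) \<le> av (\<alpha> i)"
    and ex: "\<exists>a\<in>carrier (GL d). a * E = E * mat_diag d \<alpha> \<and> g = k * a * l"
    using c[unfolded cartan_def isometries_iff dr] by simp_all
  from ex obtain a where "a \<in> carrier (GL d)" and a: "a * E = E * mat_diag d \<alpha>" "g = k * a * l" by blast
  then have a: "a \<in> carrier_mat d d" "a * E = E * mat_diag d \<alpha>" "g = k * a * l" by (auto simp: GL_iff)
  show "k \<in> carrier_mat d d" by fact
  have "cj a = minv E * (E * mat_diag d \<alpha>)" unfolding cj_def using a E Ei by simp
  also have "\<dots> = mat_diag d \<alpha>" using assoc_mult_mat[OF Ei E, of "mat_diag d \<alpha>" d] minv(2)[OF E dE] left_mult_one_mat[of "mat_diag d \<alpha>" d d] by simp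
  finally have "cj g = cj k * mat_diag d \<alpha> * cj l"
    unfolding a(3) cj_mult[OF mult_carrier_mat[OF kl(1) a(1)] kl(3)] cj_mult[OF kl(1) a(1)] by simp
  then show "svd d (cj g) (cj k) \<alpha> (cj l)" using kl mono by (simp add: svd_def)
qed

lemma svd_imp_cartan:
  assumes g: "g \<in> carrier_mat d d" "det g \<noteq> 0" and s: "svd d (cj g) k \<alpha> l"
  shows "cartan av E g (uncj k) \<alpha> (uncj l)"
proof -
  have dr: "dim_row E = d" using E by simp
  have kl: "k \<in> isom d" "l \<in> isom d" and eq: "cj g = k * mat_diag d \<alpha> * l"
    and mono: "\<forall>i j. i \<le> j \<and> j < d \<longrightarrow> av (\<alpha> j) \<le> av (\<alpha> i)" using s by (auto simp: svd_def)
  note kc = isom_carrier[OF kl(1)] and lc = isom_carrier[OF kl(2)]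
  define a where "a = uncj (mat_diag d \<alpha>)"
  have m: "mat_diag d \<alpha> \<in> carrier_mat d d" by simp
  have ac: "a \<in> carrier_mat d d" unfolding a_def by (rule uncj_carrier[OF m])
  have "det (cj g) = det k * det (mat_diag d \<alpha>) * det l"
    unfolding eq using det_mult[OF mult_carrier_mat[OF kc m] lc] det_mult[OF kc m] by simp
  then have "det (mat_diag d \<alpha>) \<noteq> 0" using det_cj[OF g(1)] g(2) by auto
  then have "det a \<noteq> 0" unfolding a_def using det_uncj[OF m] by simp
  moreover have "a * E = E * mat_diag d \<alpha>"
  proof -
    have "a * E = E * mat_diag d \<alpha> * (minv E * E)"
      unfolding a_def uncj_def by (rule assoc_mult_mat[of _ d d _ d _ d]) (use E Ei in auto)
    then show ?thesis using minv(2)[OF E dE] right_mult_one_mat[OF mult_carrier_mat[OF E m]] by simp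
  qed
  moreover have "g = uncj k * a * uncj l"
  proof -
    have c: "uncj k * a * uncj l \<in> carrier_mat d d" using uncj_carrier[OF kc] uncj_carrier[OF lc] ac by simp
    note u = uncj_carrier[OF kc] uncj_carrier[OF m] uncj_carrier[OF lc]
    have "cj (uncj k * a * uncj l) = cj g" unfolding eq a_def
      cj_mult[OF mult_carrier_mat[OF u(1,2)] u(3)] cj_mult[OF u(1,2)] cj_uncj[OF kc] cj_uncj[OF lc] cj_uncj[OF m] ..
    from arg_cong[OF this, of uncj] show ?thesis unfolding uncj_cj[OF c] uncj_cj[OF g(1)] by (rule sym)
  qed
  moreover have "uncj k \<in> isometries av E" "uncj l \<in> isometries av E"
    unfolding isometries_iff using kc lc kl by (auto simp: uncj_carrier cj_uncj)
  ultimately have "a \<in> carrier (GL d)" "a * E = E * mat_diag d \<alpha> \<and> g = uncj k * a * uncj l"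
    "uncj k \<in> isometries av E" "uncj l \<in> isometries av E" using ac unfolding GL_iff by - (assumption | rule conjI)+
  then show ?thesis unfolding cartan_def dr using mono by - (assumption | rule conjI bexI)+
qed

text \<open>The definite description in \<open>singular_value\<close> is legitimate because minimax
  determines the absolute values of the diagonal entries.\<close>

lemma singular_value_eq:
  assumes g: "g \<in> carrier_mat d d" "det g \<noteq> 0" and s: "svd d (cj g) k \<alpha> l" and i: "0 < i" "i \<le> d"
  shows "singular_value av E i g = av (\<alpha> (i - 1))"
  unfolding singular_value_def
proof (rule the_equality)
  show "\<exists>k \<alpha>' l. cartan av E g k \<alpha>' l \<and> av (\<alpha> (i - 1)) = av (\<alpha>' (i - 1))"
    using svd_imp_cartan[OF g s] by blast
  fix x assume "\<exists>k \<alpha> l. cartan av E g k \<alpha> l \<and> x = av (\<alpha> (i - 1))"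
  then obtain k' \<alpha>' l' where c: "cartan av E g k' \<alpha>' l'" "x = av (\<alpha>' (i - 1))" by blast
  show "x = av (\<alpha> (i - 1))"
    unfolding c(2) by (rule svd_unique[OF cartan_imp_svd(2)[OF c(1)] s]) (use i in simp)
qed

lemma span_cols_E:
  assumes k: "k \<in> carrier_mat d d" and p: "p \<le> d"
  shows "(*\<^sub>v) k ` LinearCombinations.module.span class_ring (module_vec TYPE('k) d) (col E ` {..<p}) = (*\<^sub>v) E ` Sp d (cj k) p"
proof -
  interpret vec_space "TYPE('k)" d .
  have "k *\<^sub>v (E *\<^sub>v y) = E *\<^sub>v (cj k *\<^sub>v y)" if "y \<in> carrier_vec d" for y
    using that cj_vec[OF k that] minv_mult_vec(2)[OF E dE, of "k *\<^sub>v (E *\<^sub>v y)"] k E by simp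
  then show ?thesis unfolding span_cols[OF E p] Sp_def by (auto simp: image_iff) metis+
qed

lemma Sp_grassmannian:
  assumes k: "k \<in> isom d" and p: "p \<le> d"
  shows "(*\<^sub>v) E ` Sp d k p \<in> grassmannian p d"
    and "V \<in> grassmannian p d \<Longrightarrow> V \<subseteq> (*\<^sub>v) E ` Sp d k p \<Longrightarrow> V = (*\<^sub>v) E ` Sp d k p"
proof -
  interpret vec_space "TYPE('k)" d .
  note kc = isom_carrier[OF k]
  have Ek: "E * k \<in> carrier_mat d d" using E kc by simp
  have dd: "det (E * k) \<noteq> 0" using det_mult[OF E kc] dE isom_det[OF k] by simp
  have "(E * k) *\<^sub>v y = E *\<^sub>v (k *\<^sub>v y)" if "y \<in> carrier_vec d" for y
    using that E kc by (simp add: assoc_mult_mat_vec[of _ d d _ d])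
  then have eq: "(*\<^sub>v) E ` Sp d k p = span (col (E * k) ` {..<p})"
    unfolding span_cols[OF Ek p] Sp_def by (auto simp: image_iff) metis+
  show g: "(*\<^sub>v) E ` Sp d k p \<in> grassmannian p d" unfolding eq by (rule span_cols_grassmannian[OF Ek dd p])
  assume "V \<in> grassmannian p d" "V \<subseteq> (*\<^sub>v) E ` Sp d k p"
  moreover have "col (E * k) ` {..<p} \<subseteq> carrier_vec d" using col_carrier_vec[OF _ Ek] p by auto
  ultimately show "V = (*\<^sub>v) E ` Sp d k p"
    using grassmannian_subset_eq[of V p "(*\<^sub>v) E ` Sp d k p" "col (E * k) ` {..<p}"] g eq by simp
qed

lemma grass_tendsto_iff:
  assumes c: "\<And>n. W n \<subseteq> carrier_vec d" "V \<subseteq> carrier_vec d"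
  shows "grass_tendsto av E (\<lambda>n. (*\<^sub>v) E ` W n) ((*\<^sub>v) E ` V) \<longleftrightarrow> tends W V"
proof -
  have gn: "good_norm av E (E *\<^sub>v w - E *\<^sub>v v) = nv (w - v)" if "w \<in> carrier_vec d" "v \<in> carrier_vec d" for v w
    using good_norm_mult[of "w - v"] that E by (simp add: mult_minus_distrib_mat_vec[of _ d d])
  have "(\<forall>w\<in>(*\<^sub>v) E ` W n. \<exists>v\<in>(*\<^sub>v) E ` V. good_norm av E (w - v) \<le> e * good_norm av E w) \<longleftrightarrow> near e (W n) V"
    "(\<forall>v\<in>(*\<^sub>v) E ` V. \<exists>w\<in>(*\<^sub>v) E ` W n. good_norm av E (w - v) \<le> e * good_norm av E v) \<longleftrightarrow> near e V (W n)" for e n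
  proof -
    have "good_norm av E (E *\<^sub>v w - E *\<^sub>v v) = nv (w - v)" "good_norm av E (E *\<^sub>v w) = nv w"
      "good_norm av E (E *\<^sub>v v) = nv v" "nv (w - v) = nv (v - w)" if "w \<in> W n" "v \<in> V" for v w
      using that c gn good_norm_mult nv_minus_commute by (meson subsetD)+
    then show "(\<forall>w\<in>(*\<^sub>v) E ` W n. \<exists>v\<in>(*\<^sub>v) E ` V. good_norm av E (w - v) \<le> e * good_norm av E w) \<longleftrightarrow> near e (W n) V"
      "(\<forall>v\<in>(*\<^sub>v) E ` V. \<exists>w\<in>(*\<^sub>v) E ` W n. good_norm av E (w - v) \<le> e * good_norm av E v) \<longleftrightarrow> near e V (W n)"
      unfolding near_def by simp_all
  qed
  then show ?thesis unfolding grass_tendsto_def tends_def by simp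
qed

definition line :: "'k vec \<Rightarrow> 'k vec set" where "line u = range (\<lambda>c. E *\<^sub>v (c \<cdot>\<^sub>v u))"

lemma Sp_1:
  assumes k: "k \<in> isom d" and d: "0 < d"
  shows "\<exists>u\<in>carrier_vec d. u \<noteq> 0\<^sub>v d \<and> Sp d k 1 = range (\<lambda>c. c \<cdot>\<^sub>v u)"
proof (intro bexI conjI)
  note kc = isom_carrier[OF k]
  let ?u = "k *\<^sub>v unit_vec d 0"
  show u: "?u \<in> carrier_vec d" using kc by simp
  have "nv ?u = 1" using isom_nv[OF k] nv_unit[OF d] by simp
  then show "?u \<noteq> 0\<^sub>v d" by (metis nv_zero zero_neq_one)
  have "y = (y $ 0) \<cdot>\<^sub>v unit_vec d 0" if "y \<in> carrier_vec d" "\<forall>i. 1 \<le> i \<and> i < d \<longrightarrow> y $ i = 0" for y :: "'k vec"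
  proof (rule eq_vecI)
    fix i assume "i < dim_vec ((y $ 0) \<cdot>\<^sub>v unit_vec d 0)"
    then show "y $ i = ((y $ 0) \<cdot>\<^sub>v unit_vec d 0) $ i" using that d by (cases i) auto
  qed (use that in auto)
  then have "k *\<^sub>v y \<in> range (\<lambda>c. c \<cdot>\<^sub>v ?u)" if "y \<in> carrier_vec d" "\<forall>i. 1 \<le> i \<and> i < d \<longrightarrow> y $ i = 0" for y :: "'k vec"
    using that mult_mat_vec[OF kc unit_vec_carrier[of d 0], of "y $ 0"] by (metis rangeI)
  moreover have "c \<cdot>\<^sub>v ?u \<in> Sp d k 1" for c
    unfolding Sp_def using mult_mat_vec[OF kc unit_vec_carrier[of d 0], of c]
    by (intro CollectI exI[of _ "c \<cdot>\<^sub>v unit_vec d 0"]) auto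
  ultimately show "Sp d k 1 = range (\<lambda>c. c \<cdot>\<^sub>v ?u)" unfolding Sp_def[of d k 1] by auto
qed

text \<open>Isometries act transitively on unit vectors, up to unit scalars, so every line is the
  image of the first axis and thereby falls under \<open>Sp_grassmannian\<close>.\<close>

lemma line_grassmannian:
  assumes u: "u \<in> carrier_vec d" "u \<noteq> 0\<^sub>v d"
  shows "line u \<in> projective_space d"
proof -
  have d: "0 < d" using u by (cases d) auto
  obtain b where b: "b \<noteq> 0" "nv (b \<cdot>\<^sub>v u) = 1" using nv_normalise[OF u] by blast
  obtain Q c where Q: "Q \<in> isom d" "av c = 1" "Q *\<^sub>v unit_vec d 0 = c \<cdot>\<^sub>v (b \<cdot>\<^sub>v u)"
    using isom_transitive[OF _ d b(2)] u(1) by auto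
  obtain v where v: "v \<in> carrier_vec d" "Sp d Q 1 = range (\<lambda>c. c \<cdot>\<^sub>v v)" using Sp_1[OF Q(1) d] by blast
  have "Q *\<^sub>v unit_vec d 0 \<in> Sp d Q 1" unfolding Sp_def by auto
  then obtain a where a: "c \<cdot>\<^sub>v (b \<cdot>\<^sub>v u) = a \<cdot>\<^sub>v v" using v(2) Q(3) by auto
  have c0: "c \<noteq> 0" using Q(2) by auto
  have "a \<noteq> 0"
  proof
    assume "a = 0"
    then have "av c * (av b * nv u) = 0" using arg_cong[OF a, of nv] by simp
    then show False using c0 b(1) nv_pos[OF u] by simp
  qed
  have uv: "u = (a / (c * b)) \<cdot>\<^sub>v v" "v = ((c * b) / a) \<cdot>\<^sub>v u"
  proof -
    have i: "c * (b * u $ i) = a * v $ i" if "i < d" for i using arg_cong[OF a, of "\<lambda>x. x $ i"] that u v by simp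
    show "u = (a / (c * b)) \<cdot>\<^sub>v v" using u v i c0 b(1) by (intro eq_vecI) (auto simp: field_simps)
    show "v = ((c * b) / a) \<cdot>\<^sub>v u" using u v i \<open>a \<noteq> 0\<close> by (intro eq_vecI) (auto simp: field_simps)
  qed
  have "range (\<lambda>c. c \<cdot>\<^sub>v u) = range (\<lambda>c. c \<cdot>\<^sub>v v)"
  proof (intro equalityI subsetI)
    fix x assume "x \<in> range (\<lambda>c. c \<cdot>\<^sub>v u)"
    then obtain e where "x = e \<cdot>\<^sub>v u" by blast
    then have "x = (e * (a / (c * b))) \<cdot>\<^sub>v v" using uv(1) smult_smult_assoc by metis
    then show "x \<in> range (\<lambda>c. c \<cdot>\<^sub>v v)" by blast
  next
    fix x assume "x \<in> range (\<lambda>c. c \<cdot>\<^sub>v v)"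
    then obtain e where "x = e \<cdot>\<^sub>v v" by blast
    then have "x = (e * ((c * b) / a)) \<cdot>\<^sub>v u" using uv(2) smult_smult_assoc by metis
    then show "x \<in> range (\<lambda>c. c \<cdot>\<^sub>v u)" by blast
  qed
  moreover have "line u = (*\<^sub>v) E ` range (\<lambda>c. c \<cdot>\<^sub>v u)" unfolding line_def image_image ..
  ultimately have "line u = (*\<^sub>v) E ` Sp d Q 1" unfolding v(2) by simp
  then show ?thesis using Sp_grassmannian(1)[OF Q(1), of 1] d by simp
qed

text \<open>The vector chosen inside \<open>proj_dist\<close> is unknown, but it is a nonzero
  multiple of the given one, and the quotient of norms does not depend on the multiple.\<close>

lemma line_some:
  assumes u: "u \<in> carrier_vec d" "u \<noteq> 0\<^sub>v d"
  shows "\<exists>a. a \<noteq> 0 \<and> (SOME v. v \<in> line u \<and> v \<noteq> 0\<^sub>v (dim_row E)) = E *\<^sub>v (a \<cdot>\<^sub>v u)"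
proof -
  have dr: "dim_row E = d" using E by simp
  have inj: "E *\<^sub>v x \<noteq> 0\<^sub>v d" if "x \<in> carrier_vec d" "x \<noteq> 0\<^sub>v d" for x
  proof
    assume "E *\<^sub>v x = 0\<^sub>v d"
    then have "x = minv E *\<^sub>v 0\<^sub>v d" using minv_mult_vec(1)[OF E dE that(1)] by simp
    then show False using that(2) Ei by auto
  qed
  have "E *\<^sub>v (1 \<cdot>\<^sub>v u) \<in> line u" unfolding line_def by blast
  then have "E *\<^sub>v (1 \<cdot>\<^sub>v u) \<in> line u \<and> E *\<^sub>v (1 \<cdot>\<^sub>v u) \<noteq> 0\<^sub>v (dim_row E)" using inj[OF u] dr by simp
  from someI[where P = "\<lambda>v. v \<in> line u \<and> v \<noteq> 0\<^sub>v (dim_row E)", OF this]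
  obtain a where a: "(SOME v. v \<in> line u \<and> v \<noteq> 0\<^sub>v (dim_row E)) = E *\<^sub>v (a \<cdot>\<^sub>v u)" "E *\<^sub>v (a \<cdot>\<^sub>v u) \<noteq> 0\<^sub>v d"
    unfolding dr line_def by auto
  have "a \<noteq> 0"
  proof
    assume "a = 0"
    then have "a \<cdot>\<^sub>v u = 0\<^sub>v d" using u(1) by auto
    then show False using a(2) E by auto
  qed
  then show ?thesis using a(1) by blast
qed

lemma proj_dist_line:
  assumes u: "u \<in> carrier_vec d" "u \<noteq> 0\<^sub>v d" and w: "w \<in> carrier_vec d" "w \<noteq> 0\<^sub>v d"
  shows "proj_dist av E (line u) (line w) = wn d u w / (nv u * nv w)"
proof -
  obtain a where a: "a \<noteq> 0" "(SOME v. v \<in> line u \<and> v \<noteq> 0\<^sub>v (dim_row E)) = E *\<^sub>v (a \<cdot>\<^sub>v u)" using line_some[OF u] by blast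
  obtain b where b: "b \<noteq> 0" "(SOME v. v \<in> line w \<and> v \<noteq> 0\<^sub>v (dim_row E)) = E *\<^sub>v (b \<cdot>\<^sub>v w)" using line_some[OF w] by blast
  have c: "a \<cdot>\<^sub>v u \<in> carrier_vec d" "b \<cdot>\<^sub>v w \<in> carrier_vec d" using u w by auto
  have "wedge_norm av E (E *\<^sub>v (a \<cdot>\<^sub>v u)) (E *\<^sub>v (b \<cdot>\<^sub>v w)) = av a * av b * wn d u w"
    using wedge_norm_eq[OF mult_mat_vec_carrier[OF E c(1)] mult_mat_vec_carrier[OF E c(2)]]
      minv_mult_vec(1)[OF E dE c(1)] minv_mult_vec(1)[OF E dE c(2)] wn_smult[OF u(1) w(1)] by simp
  moreover have "good_norm av E (E *\<^sub>v (a \<cdot>\<^sub>v u)) = av a * nv u" "good_norm av E (E *\<^sub>v (b \<cdot>\<^sub>v w)) = av b * nv w"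
    using good_norm_mult[OF c(1)] good_norm_mult[OF c(2)] by simp_all
  moreover have "av a \<noteq> 0" "av b \<noteq> 0" using a b by auto
  ultimately show ?thesis unfolding proj_dist_def a(2) b(2) Let_def by simp
qed

end

section \<open>Representations into the projective linear group\<close>

lemma PGL_coset:
  assumes "C \<in> carrier (PGL d)"
  shows "\<exists>g \<in> carrier (GL d). C = {c \<cdot>\<^sub>m (g :: 'k::field mat) | c. c \<noteq> 0}"
proof -
  obtain g where g: "g \<in> carrier (GL d)" "C = scalars d #>\<^bsub>GL d\<^esub> g"
    using assms unfolding PGL_def FactGroup_def RCOSETS_def by auto
  have "(c \<cdot>\<^sub>m 1\<^sub>m d) * g = c \<cdot>\<^sub>m g" for c
    using g(1) mult_smult_assoc_mat[OF one_carrier_mat, of g d d c] left_mult_one_mat[of g d d] by (simp add: GL_iff)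
  then have "C = {c \<cdot>\<^sub>m g | c. c \<noteq> 0}"
    unfolding g(2) r_coset_def scalars_def mult_GL by auto
  then show ?thesis using g(1) by blast
qed

lemma mult_PGL: "g \<in> C \<Longrightarrow> g' \<in> C' \<Longrightarrow> (g :: 'k::field mat) * g' \<in> mult (PGL d) C C'"
  unfolding PGL_def FactGroup_def set_mult_def by (auto simp: mult_GL)

locale linear_rep = good_basis av E D + hyp_group G S \<delta>
  for av :: "'k::field \<Rightarrow> real" and E :: "'k mat" and D :: nat
    and G :: "('g, 'm) monoid_scheme" (structure) and S \<delta> +
  fixes \<rho> :: "'g \<Rightarrow> 'k mat set"
  assumes hom: "\<rho> \<in> hom G (PGL D)"
begin

lemma rho_coset: "\<gamma> \<in> carrier G \<Longrightarrow> \<exists>g\<in>carrier_mat D D. det g \<noteq> 0 \<and> \<rho> \<gamma> = {c \<cdot>\<^sub>m g | c. c \<noteq> 0}"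
  using PGL_coset[of "\<rho> \<gamma>" D] hom by (auto simp: hom_def GL_iff Pi_iff)

lemma rho_lift: "\<gamma> \<in> carrier G \<Longrightarrow> g \<in> \<rho> \<gamma> \<Longrightarrow> g \<in> carrier_mat D D \<and> det g \<noteq> 0"
  using rho_coset[of \<gamma>] by (auto simp: det_smult)

lemma rho_proportional: 
  assumes "\<gamma> \<in> carrier G" "g \<in> \<rho> \<gamma>" "h \<in> \<rho> \<gamma>"
  shows "\<exists>c. c \<noteq> 0 \<and> h = c \<cdot>\<^sub>m g"
proof -
  obtain g0 a b where g: "g0 \<in> carrier_mat D D" "a \<noteq> 0" "g = a \<cdot>\<^sub>m g0" "b \<noteq> 0" "h = b \<cdot>\<^sub>m g0"
    using rho_coset[OF assms(1)] assms(2,3) by auto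
  then have "h = (b / a) \<cdot>\<^sub>m g" by (intro eq_matI) auto
  then show ?thesis using g by (intro exI[of _ "b / a"]) simp
qed

lemma cartan_lift_exists:
  assumes \<gamma>: "\<gamma> \<in> carrier G"
  shows "\<exists>g. g \<in> \<rho> \<gamma> \<and> (\<exists>\<alpha> l. cartan av E g (cartan_K av E (\<rho> \<gamma>)) \<alpha> l)"
proof -
  obtain g0 where g0: "g0 \<in> carrier_mat D D" "\<rho> \<gamma> = {c \<cdot>\<^sub>m g0 | c. c \<noteq> 0}" using rho_coset[OF \<gamma>] by blast
  have "1 \<cdot>\<^sub>m g0 \<in> \<rho> \<gamma>" unfolding g0(2) by (rule CollectI, rule exI[of _ 1]) simp
  then obtain g where g: "g \<in> \<rho> \<gamma>" by blast
  have gc: "g \<in> carrier_mat D D" "det g \<noteq> 0" using rho_lift[OF \<gamma> g] by auto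
  obtain k \<alpha> l where "svd D (cj g) k \<alpha> l" using svd_exists[OF cj_carrier[OF gc(1)]] by blast
  from svd_imp_cartan[OF gc this] have "\<exists>k. \<exists>g\<in>\<rho> \<gamma>. \<exists>\<alpha> l. cartan av E g k \<alpha> l" using g by blast
  from someI_ex[OF this] show ?thesis unfolding cartan_K_def by blast
qed

text \<open>The lift is taken to be one that admits a Cartan decomposition with the left factor
  already fixed by \<open>cartan_K\<close>, so that \<open>U p \<gamma>\<close> corresponds exactly
  to \<open>cartan_space\<close>.\<close>

definition lift :: "'g \<Rightarrow> 'k mat" where
  "lift \<gamma> = (SOME g. g \<in> \<rho> \<gamma> \<and> (\<exists>\<alpha> l. cartan av E g (cartan_K av E (\<rho> \<gamma>)) \<alpha> l))"

lemma lift: "\<gamma> \<in> carrier G \<Longrightarrow> lift \<gamma> \<in> \<rho> \<gamma>" "\<gamma> \<in> carrier G \<Longrightarrow> \<exists>\<alpha> l. cartan av E (lift \<gamma>) (cartan_K av E (\<rho> \<gamma>)) \<alpha> l"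
  using someI_ex[OF cartan_lift_exists] unfolding lift_def by blast+

lemma lift_carrier: "\<gamma> \<in> carrier G \<Longrightarrow> lift \<gamma> \<in> carrier_mat D D" "\<gamma> \<in> carrier G \<Longrightarrow> det (lift \<gamma>) \<noteq> 0"
  using rho_lift[OF _ lift(1)] by blast+

definition R :: "'g \<Rightarrow> 'k mat" where "R \<gamma> = cj (lift \<gamma>)"

definition K :: "'g \<Rightarrow> 'k mat" where "K \<gamma> = cj (cartan_K av E (\<rho> \<gamma>))"

sublocale projective_rep av G S \<delta> D R K
proof
  fix \<gamma> assume \<gamma>: "\<gamma> \<in> carrier G"
  show "R \<gamma> \<in> carrier_mat D D" "det (R \<gamma>) \<noteq> 0"
    unfolding R_def using lift_carrier[OF \<gamma>] cj_carrier det_cj by auto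
  show "\<exists>\<alpha> l. svd D (R \<gamma>) (K \<gamma>) \<alpha> l"
    using lift(2)[OF \<gamma>] cartan_imp_svd(2) unfolding R_def K_def by blast
  fix \<gamma>' assume \<gamma>': "\<gamma>' \<in> carrier G"
  have "\<rho> (\<gamma> \<otimes> \<gamma>') = \<rho> \<gamma> \<otimes>\<^bsub>PGL D\<^esub> \<rho> \<gamma>'" using hom \<gamma> \<gamma>' by (auto simp: hom_def)
  then have "lift \<gamma> * lift \<gamma>' \<in> \<rho> (\<gamma> \<otimes> \<gamma>')" using mult_PGL[OF lift(1)[OF \<gamma>] lift(1)[OF \<gamma>']] by simp
  then obtain c where c: "c \<noteq> 0" "lift (\<gamma> \<otimes> \<gamma>') = c \<cdot>\<^sub>m (lift \<gamma> * lift \<gamma>')"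
    using rho_proportional[OF _ _ lift(1)] \<gamma> \<gamma>' by (meson m_closed)
  note l = lift_carrier(1)[OF \<gamma>] lift_carrier(1)[OF \<gamma>']
  have "R (\<gamma> \<otimes> \<gamma>') = c \<cdot>\<^sub>m (R \<gamma> * R \<gamma>')"
    unfolding R_def c(2) cj_smult[OF mult_carrier_mat[OF l]] cj_mult[OF l] ..
  then show "\<exists>c. c \<noteq> 0 \<and> R (\<gamma> \<otimes> \<gamma>') = c \<cdot>\<^sub>m (R \<gamma> * R \<gamma>')" using c(1) by blast
qed

lemma dim_row_E: "dim_row E = D" using E by simp

lemma cartan_space_eq: "\<gamma> \<in> carrier G \<Longrightarrow> p \<le> D \<Longrightarrow> cartan_space av E p (\<rho> \<gamma>) = (*\<^sub>v) E ` U p \<gamma>"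
proof -
  assume \<gamma>: "\<gamma> \<in> carrier G" and p: "p \<le> D"
  have "cartan_K av E (\<rho> \<gamma>) \<in> carrier_mat D D" using lift(2)[OF \<gamma>] cartan_imp_svd(1) by blast
  then show ?thesis unfolding cartan_space_def dim_row_E U_def K_def by (rule span_cols_E[OF _ p])
qed

lemma anosov_gapped:
  assumes p: "0 < p" "p < D" and an: "anosov av E G S \<rho> p"
  shows "gapped p"
proof -
  obtain c \<mu> where c: "c > 0" "\<mu> > 0" and
    b: "\<And>\<gamma> g. \<gamma> \<in> carrier G \<Longrightarrow> g \<in> \<rho> \<gamma> \<Longrightarrow>
      singular_value av E (p + 1) g / singular_value av E p g \<le> c * exp (- \<mu> * real (len \<gamma>))"
    using an unfolding anosov_def by blast
  have "av (\<alpha> p) / av (\<alpha> (p - 1)) \<le> c * exp (- \<mu>) ^ len \<gamma>"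
    if \<gamma>: "\<gamma> \<in> carrier G" and s: "svd D (R \<gamma>) k \<alpha> l" for \<gamma> k \<alpha> l
  proof -
    note e = singular_value_eq[OF lift_carrier[OF \<gamma>] s[unfolded R_def]]
    show ?thesis
      using b[OF \<gamma> lift(1)[OF \<gamma>]] e[of p] e[of "p + 1"] p exp_of_nat_mult[of "len \<gamma>" "- \<mu>"] by (simp add: mult.commute)
  qed
  then show ?thesis unfolding gapped_def using c by (intro exI[of _ c] conjI exI[of _ "exp (- \<mu>)"]) auto
qed

definition cls :: "(nat \<Rightarrow> 'g) \<Rightarrow> (nat \<Rightarrow> 'g) set" where "cls \<eta> = {\<zeta> \<in> rays. req \<eta> \<zeta>}"

lemma cls_eq_iff: "\<eta> \<in> rays \<Longrightarrow> \<zeta> \<in> rays \<Longrightarrow> cls \<eta> = cls \<zeta> \<longleftrightarrow> req \<eta> \<zeta>"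
proof
  assume r: "\<eta> \<in> rays" "\<zeta> \<in> rays"
  show "cls \<eta> = cls \<zeta> \<Longrightarrow> req \<eta> \<zeta>" using req_refl[OF r(2)] r unfolding cls_def by blast
  show "req \<eta> \<zeta> \<Longrightarrow> cls \<eta> = cls \<zeta>"
    unfolding cls_def using r req_trans[OF r(1,2)] req_trans[OF r(2,1)] req_sym[OF r] by blast
qed

lemma boundary_cls: "gromov_boundary G S = cls ` {\<eta> \<in> rays. \<eta> 0 = \<one>}"
proof (intro equalityI subsetI)
  fix x assume "x \<in> gromov_boundary G S"
  then obtain \<eta> where \<eta>: "\<eta> \<in> rays" "x = cls \<eta>" unfolding boundary_iff cls_def by blast
  obtain \<eta>' where "\<eta>' \<in> rays" "\<eta>' 0 = \<one>" "req \<eta>' \<eta>" using ray_from[OF \<eta>(1) one_closed] by blast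
  then show "x \<in> cls ` {\<eta> \<in> rays. \<eta> 0 = \<one>}" using cls_eq_iff[of \<eta>' \<eta>] \<eta> by blast
qed (auto simp: boundary_iff cls_def)

text \<open>The limit exists and is the same for all rays of the class because equivalent rays
  fellow-travel. For uniqueness, another limit \<open>V\<close> in the Grassmannian is only known to
  be contained in the closed set coming from \<open>xi p \<eta>\<close>; equality follows from equal
  dimension.\<close>

lemma limit_map_eq:
  assumes p: "0 < p" "p < D" "gapped p" and \<eta>: "\<eta> \<in> rays"
  shows "limit_map av E \<rho> p (cls \<eta>) = (*\<^sub>v) E ` xi p \<eta>"
proof -
  note path = ray_path[OF \<eta>]
  obtain k where k: "k \<in> isom D" "xi p \<eta> = Sp D k p" using xi_Sp[OF p path] by blast
  have pD: "p \<le> D" using p by simp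
  note gr = Sp_grassmannian[OF k(1) pD, folded k(2)]
  have Uc: "U p (\<gamma> n) \<subseteq> carrier_vec D" if "\<gamma> \<in> rays" for \<gamma> n using U_carrier ray_carrier[OF that] by blast
  have cs: "(\<lambda>n. cartan_space av E p (\<rho> (\<gamma> n))) = (\<lambda>n. (*\<^sub>v) E ` U p (\<gamma> n))" if "\<gamma> \<in> rays" for \<gamma>
    using cartan_space_eq[OF ray_carrier[OF that] pD] by simp
  have xc: "xi p \<eta> \<subseteq> carrier_vec D" by (rule xi_carrier[OF p path])
  have lim: "grass_tendsto av E (\<lambda>n. cartan_space av E p (\<rho> (\<gamma> n))) ((*\<^sub>v) E ` xi p \<eta>)" if "\<gamma> \<in> cls \<eta>" for \<gamma>
  proof -
    have g: "\<gamma> \<in> rays" "req \<eta> \<gamma>" using that by (auto simp: cls_def)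
    have "tends (\<lambda>n. U p (\<gamma> n)) (xi p \<eta>)"
      using xi_tends[OF p ray_path[OF g(1)]] xi_req[OF p \<eta> g] by simp
    then show ?thesis unfolding cs[OF g(1)] using grass_tendsto_iff[of "\<lambda>n. U p (\<gamma> n)" "xi p \<eta>"] Uc[OF g(1)] xc by simp
  qed
  show ?thesis unfolding limit_map_def dim_row_E
  proof (rule the_equality)
    show "(*\<^sub>v) E ` xi p \<eta> \<in> grassmannian p D \<and>
      (\<forall>\<gamma>\<in>cls \<eta>. grass_tendsto av E (\<lambda>n. cartan_space av E p (\<rho> (\<gamma> n))) ((*\<^sub>v) E ` xi p \<eta>))"
      using gr(1) lim by blast
    fix V assume V: "V \<in> grassmannian p D \<and> (\<forall>\<gamma>\<in>cls \<eta>. grass_tendsto av E (\<lambda>n. cartan_space av E p (\<rho> (\<gamma> n))) V)"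
    have Vc: "V \<subseteq> carrier_vec D"
      using V unfolding grassmannian_def by (auto simp: VectorSpace.subspace_def submodule_def module_vec_simps)
    define W where "W = (*\<^sub>v) (minv E) ` V"
    have VW: "V = (*\<^sub>v) E ` W"
    proof -
      have "E *\<^sub>v (minv E *\<^sub>v v) = v" if "v \<in> V" for v using minv_mult_vec(2)[OF E dE] Vc that by blast
      then show ?thesis unfolding W_def image_image by simp
    qed
    have Wc: "W \<subseteq> carrier_vec D" unfolding W_def using Vc Ei by auto
    have "\<eta> \<in> cls \<eta>" using \<eta> req_refl by (simp add: cls_def)
    then have "grass_tendsto av E (\<lambda>n. (*\<^sub>v) E ` U p (\<eta> n)) ((*\<^sub>v) E ` W)" using V cs[OF \<eta>] VW by auto
    then have "tends (\<lambda>n. U p (\<eta> n)) W" using grass_tendsto_iff[of "\<lambda>n. U p (\<eta> n)" W] Uc[OF \<eta>] Wc by simp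
    then have "W \<subseteq> xi p \<eta>"
      using tends_subset[OF _ xi_tends[OF p path] Wc xi_closed[OF p path] Uc[OF \<eta>]] by simp
    then have "V \<subseteq> (*\<^sub>v) E ` xi p \<eta>" unfolding VW by blast
    then show "V = (*\<^sub>v) E ` xi p \<eta>" using gr(2)[of V] V by blast
  qed
qed

lemma hyperconvex_xi:
  assumes r: "0 < r" "r < D" and D1: "1 < D" and gap: "gapped 1" "gapped r" and hc: "hyperconvex av E G S \<rho> r"
    and ray: "a \<in> rays" "b \<in> rays" "c \<in> rays" and ne: "\<not> req a b" "\<not> req b c" "\<not> req a c"
    and uv: "u \<in> xi 1 a" "v \<in> xi 1 b" "u + v \<in> xi (D - r) c"
  shows "u + v = 0\<^sub>v D"
proof -
  have p: "0 < (1 :: nat)" "1 < D" "gapped 1" and q: "0 < D - r" "D - r < D" "gapped (D - r)"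
    using r D1 gap gapped_dual[OF r gap(2)] by auto
  have bd: "cls \<eta> \<in> gromov_boundary G S" if "\<eta> \<in> rays" for \<eta> using that by (auto simp: boundary_iff cls_def)
  have "{x + y | x y. x \<in> limit_map av E \<rho> 1 (cls a) \<and> y \<in> limit_map av E \<rho> 1 (cls b)}
      \<inter> limit_map av E \<rho> (D - r) (cls c) = {0\<^sub>v D}"
    using hc[unfolded hyperconvex_def dim_row_E] bd[OF ray(1)] bd[OF ray(2)] bd[OF ray(3)] ne
      cls_eq_iff[OF ray(1,2)] cls_eq_iff[OF ray(2,3)] cls_eq_iff[OF ray(1,3)] by simp
  note int = this[unfolded limit_map_eq[OF p ray(1)] limit_map_eq[OF p ray(2)] limit_map_eq[OF q ray(3)]]
  have c: "u \<in> carrier_vec D" "v \<in> carrier_vec D"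
    using uv(1,2) xi_carrier[OF p ray_path[OF ray(1)]] xi_carrier[OF p ray_path[OF ray(2)]] by auto
  have "E *\<^sub>v (u + v) = E *\<^sub>v u + E *\<^sub>v v" using mult_add_distrib_mat_vec[OF E c] .
  then have "E *\<^sub>v (u + v) \<in> {0\<^sub>v D}" unfolding int[symmetric] using uv by blast
  then have "E *\<^sub>v (u + v) = 0\<^sub>v D" by simp
  then have "u + v = minv E *\<^sub>v 0\<^sub>v D" using minv_mult_vec(1)[OF E dE, of "u + v"] c by simp
  then show ?thesis using Ei by auto
qed

lemma xi_line:
  assumes gap: "gapped 1" and D1: "1 < D" and \<eta>: "\<eta> \<in> rays"
  shows "\<exists>u\<in>xi 1 \<eta>. u \<in> carrier_vec D \<and> u \<noteq> 0\<^sub>v D \<and> (*\<^sub>v) E ` xi 1 \<eta> = line u"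
proof -
  have p: "0 < (1 :: nat)" "1 < D" "gapped 1" using gap D1 by auto
  obtain k where k: "k \<in> isom D" "xi 1 \<eta> = Sp D k 1" using xi_Sp[OF p ray_path[OF \<eta>]] by blast
  obtain u where u: "u \<in> carrier_vec D" "u \<noteq> 0\<^sub>v D" "xi 1 \<eta> = range (\<lambda>c. c \<cdot>\<^sub>v u)" using Sp_1[OF k(1)] D1 k(2) by auto
  have "1 \<cdot>\<^sub>v u \<in> xi 1 \<eta>" unfolding u(3) by blast
  then have "u \<in> xi 1 \<eta>" by simp
  moreover have "(*\<^sub>v) E ` xi 1 \<eta> = line u" unfolding u(3) line_def image_image ..
  ultimately show ?thesis using u(1,2) by blast
qed

text \<open>The projection of \<open>K\<^sup>D\<close> along \<open>xi (D - r) \<zeta>\<close> maps the part of the limit set at bounded distance from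
  the point of \<open>\<zeta>\<close> to \<open>P(K\<^sup>r)\<close>, and it shrinks distances by at most a constant factor.\<close>

lemma limit_set_piece:
  assumes r: "0 < r" "r < D" and D1: "1 < D" and gap: "gapped 1" "gapped r" and hc: "hyperconvex av E G S \<rho> r"
    and E': "E' \<in> carrier_mat r r" "det E' \<noteq> 0" and \<zeta>: "\<zeta> \<in> rays" "\<zeta> 0 = \<one>"
    and s: "0 < s" "hausdorff_measure (proj_dist av E') s (projective_space r) = 0"
  shows "hausdorff_measure (proj_dist av E) s ((\<lambda>\<eta>. (*\<^sub>v) E ` xi 1 \<eta>) ` {\<eta> \<in> rays. \<eta> 0 = \<one> \<and> sep C \<eta> \<zeta>}) = 0"
    (is "hausdorff_measure _ s ?A = 0")
proof -
  interpret F: good_basis av E' r by unfold_locales (fact E')+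
  have p: "0 < (1 :: nat)" "1 < D" "gapped 1" and q: "0 < D - r" "D - r < D" "gapped (D - r)"
    and q': "0 < D - 1" "D - 1 < D" "gapped (D - 1)"
    using r D1 gap gapped_dual[OF r gap(2)] gapped_dual[of 1] by auto
  have hyp: "u + v = 0\<^sub>v D"
    if "a \<in> rays" "b \<in> rays" "c \<in> rays" "\<not> req a b" "\<not> req b c" "\<not> req a c"
      "u \<in> xi 1 a" "v \<in> xi 1 b" "u + v \<in> xi (D - r) c" for a b c u v
    by (rule hyperconvex_xi[OF r D1 gap hc that])
  have tang: "\<exists>\<epsilon>>0. \<forall>\<eta> \<eta>'. \<eta> \<in> rays \<and> \<eta>' \<in> rays \<and> \<eta> 0 = \<one> \<and> \<eta>' 0 = \<one> \<and> sep C \<eta> \<zeta> \<and> sep C \<eta>' \<zeta> \<and> \<not> req \<eta> \<eta>' \<longrightarrow>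
    (\<forall>u\<in>xi 1 \<eta>. \<forall>u'\<in>xi 1 \<eta>'. \<forall>w\<in>xi (D - r) \<zeta>. \<epsilon> * nv (u + u') \<le> nv (u + u' - w))"
    by (rule tangent_transversality[OF r D1 gap _ \<zeta>]) (rule hyp; assumption)
  obtain \<epsilon> where \<epsilon>: "\<epsilon> > 0" and tang: "\<And>\<eta> \<eta>' u u' w. \<eta> \<in> rays \<Longrightarrow> \<eta>' \<in> rays \<Longrightarrow> \<eta> 0 = \<one> \<Longrightarrow> \<eta>' 0 = \<one> \<Longrightarrow>
      sep C \<eta> \<zeta> \<Longrightarrow> sep C \<eta>' \<zeta> \<Longrightarrow> \<not> req \<eta> \<eta>' \<Longrightarrow> u \<in> xi 1 \<eta> \<Longrightarrow> u' \<in> xi 1 \<eta>' \<Longrightarrow> w \<in> xi (D - r) \<zeta> \<Longrightarrow>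
      \<epsilon> * nv (u + u') \<le> nv (u + u' - w)"
    using tang by blast
  obtain k where k: "k \<in> isom D" "xi (D - r) \<zeta> = Sp D k (D - r)" using xi_Sp[OF q ray_path[OF \<zeta>(1)]] by blast
  \<comment> \<open>The last \<open>r\<close> coordinates in the frame \<open>k\<close> of
    \<open>xi (D - r) \<zeta>\<close>: a linear map onto the coordinates of the quotient, whose norm
    is the distance to that space.\<close>
  define P where "P x = Matrix.vec r (\<lambda>i. (minv k *\<^sub>v x) $ (D - r + i))" for x
  have Pc: "P x \<in> carrier_vec r" for x by (simp add: P_def)
  have P: "nv (P x) \<le> nv x" "\<exists>w\<in>xi (D - r) \<zeta>. nv (x - w) = nv (P x)" if "x \<in> carrier_vec D" for x
    using complement_projection[OF k(1), of "D - r" x] that r unfolding k(2) P_def by auto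
  have mk: "minv k \<in> carrier_mat D D" using minv(1)[OF isom_carrier isom_det] k(1) by blast
  have Plin: "P (x - c \<cdot>\<^sub>v y) = P x - c \<cdot>\<^sub>v P y" if "x \<in> carrier_vec D" "y \<in> carrier_vec D" for x y c
  proof -
    have "minv k *\<^sub>v (x - c \<cdot>\<^sub>v y) = minv k *\<^sub>v x - c \<cdot>\<^sub>v (minv k *\<^sub>v y)"
      using that mk by (simp add: mult_minus_distrib_mat_vec[of _ D D] mult_mat_vec[of _ D D])
    then show ?thesis using mk r by (intro eq_vecI) (auto simp: P_def)
  qed
  \<comment> \<open>A line of the limit set inside \<open>xi (D - r) \<zeta>\<close> would lie in
    \<open>xi (D - 1) \<zeta>\<close>, against transversality at the index 1; so the projection is
    defined on the whole piece.\<close>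
  have Pne: "0 < nv (P u)" if ray: "\<eta> \<in> rays" "\<eta> 0 = \<one>" "sep C \<eta> \<zeta>" and u: "u \<in> xi 1 \<eta>" "u \<in> carrier_vec D" "u \<noteq> 0\<^sub>v D" for \<eta> u
  proof (rule ccontr)
    assume "\<not> 0 < nv (P u)"
    then have "nv (P u) = 0" using nv_nonneg[of "P u"] by linarith
    then obtain w where w: "w \<in> xi (D - r) \<zeta>" "nv (u - w) = 0" using P(2)[OF u(2)] by auto
    have wc: "w \<in> carrier_vec D" using w(1) xi_carrier[OF q ray_path[OF \<zeta>(1)]] by blast
    have "u - w = 0\<^sub>v D" using w(2) nv_eq_0[of "u - w" D] u(2) wc by simp
    have "u $ i = w $ i" if i: "i < D" for i
    proof -
      have "(u - w) $ i = 0" unfolding \<open>u - w = 0\<^sub>v D\<close> using i by simp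
      then show ?thesis using i wc by simp
    qed
    then have "u = w" using u(2) wc by (intro eq_vecI) auto
    moreover have "D - r \<le> D - 1" using r(1) by simp
    ultimately have "u \<in> xi (D - 1) \<zeta>" using w(1) xi_mono[OF q q' _ ray_path[OF \<zeta>(1)]] by blast
    then show False using transversal_rays[OF p ray(1) \<zeta>(1) ray(2) \<zeta>(2) ray(3) u(1)] u(3) by simp
  qed
  \<comment> \<open>A ray and a spanning vector are fixed for each point of the piece, because the
    metric and the projection refer to lines while the estimate refers to rays.\<close>
  define good where "good L \<eta> u \<longleftrightarrow> \<eta> \<in> rays \<and> \<eta> 0 = \<one> \<and> sep C \<eta> \<zeta> \<and> L = (*\<^sub>v) E ` xi 1 \<eta> \<and>
    u \<in> xi 1 \<eta> \<and> u \<in> carrier_vec D \<and> u \<noteq> 0\<^sub>v D \<and> L = line u" for L \<eta> u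
  have "\<forall>L. \<exists>\<eta> u. L \<in> ?A \<longrightarrow> good L \<eta> u"
  proof
    fix L
    show "\<exists>\<eta> u. L \<in> ?A \<longrightarrow> good L \<eta> u"
    proof (cases "L \<in> ?A")
      case True
      then obtain \<eta> where \<eta>: "\<eta> \<in> rays" "\<eta> 0 = \<one>" "sep C \<eta> \<zeta>" "L = (*\<^sub>v) E ` xi 1 \<eta>" by auto
      then show ?thesis using xi_line[OF gap(1) D1 \<eta>(1)] unfolding good_def by auto
    qed simp
  qed
  from choice[OF this] obtain \<eta> where "\<forall>L. \<exists>u. L \<in> ?A \<longrightarrow> good L (\<eta> L) u" by blast
  from choice[OF this] obtain u where "\<forall>L. L \<in> ?A \<longrightarrow> good L (\<eta> L) (u L)" by blast
  then have g: "\<And>L. L \<in> ?A \<Longrightarrow> good L (\<eta> L) (u L)" by blast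
  have gray: "\<eta> L \<in> rays" "\<eta> L 0 = \<one>" "sep C (\<eta> L) \<zeta>" "L = (*\<^sub>v) E ` xi 1 (\<eta> L)"
    and gu: "u L \<in> xi 1 (\<eta> L)" "u L \<in> carrier_vec D" "u L \<noteq> 0\<^sub>v D" "L = line (u L)" if "L \<in> ?A" for L
    using g[OF that] unfolding good_def by auto
  have pos: "0 < nv (u L)" "0 < nv (P (u L))" "P (u L) \<noteq> 0\<^sub>v r" if "L \<in> ?A" for L
  proof -
    show "0 < nv (u L)" by (rule nv_pos[OF gu(2,3)[OF that]])
    show "0 < nv (P (u L))" by (rule Pne[OF gray(1-3)[OF that] gu(1-3)[OF that]])
    then show "P (u L) \<noteq> 0\<^sub>v r" by auto
  qed
  define f where "f L = F.line (P (u L))" for L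
  define B where "B = 2 * (real D)\<^sup>2 * (real r)\<^sup>2 / \<epsilon>"
  have B: "0 < B" unfolding B_def using r \<epsilon> by simp
  show ?thesis
  proof (rule hausdorff_measure_0_lipschitz[where f = f and L = B])
    show "f ` ?A \<subseteq> projective_space r"
      unfolding f_def using F.line_grassmannian[OF Pc] pos(3) by blast
    fix L M assume L: "L \<in> ?A" and M: "M \<in> ?A"
    have dE: "proj_dist av E L M = wn D (u L) (u M) / (nv (u L) * nv (u M))"
      using proj_dist_line[OF gu(2,3)[OF L] gu(2,3)[OF M]] gu(4)[OF L] gu(4)[OF M] by simp
    have dF: "proj_dist av E' (f L) (f M) = wn r (P (u L)) (P (u M)) / (nv (P (u L)) * nv (P (u M)))"
      unfolding f_def by (rule F.proj_dist_line[OF Pc pos(3)[OF L] Pc pos(3)[OF M]])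
    show "proj_dist av E L M \<le> B * proj_dist av E' (f L) (f M)"
    proof (cases "req (\<eta> L) (\<eta> M)")
      case True
      then have "L = M" using xi_req[OF p gray(1)[OF L] gray(1)[OF M]] gray(4)[OF L] gray(4)[OF M] by simp
      moreover have "wn D v v = 0" for v unfolding wn_def onb_norm_eq_0[OF finite_index_pairs] by (auto simp: mult.commute)
      ultimately show ?thesis unfolding dE dF using B by simp
    next
      case False
      \<comment> \<open>Every combination of the two spanning vectors lies in the sum of two limit
        lines; the tangent estimate bounds its distance to \<open>xi (D - r) \<zeta>\<close> from
        below, with an \<epsilon> that is the same for all pairs in the piece.\<close>
      have "\<epsilon> * nv (u M - c \<cdot>\<^sub>v u L) \<le> nv (P (u M) - c \<cdot>\<^sub>v P (u L))" for c
      proof -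
        let ?v = "(- c) \<cdot>\<^sub>v u L"
        have v: "?v \<in> xi 1 (\<eta> L)" by (rule xi_smult[OF p ray_path[OF gray(1)[OF L]] gu(1)[OF L]])
        have eq: "u M - c \<cdot>\<^sub>v u L = ?v + u M" using gu(2)[OF L] gu(2)[OF M] by (intro eq_vecI) auto
        have "u M - c \<cdot>\<^sub>v u L \<in> carrier_vec D" using gu(2)[OF L] gu(2)[OF M] by simp
        then obtain w where w: "w \<in> xi (D - r) \<zeta>" "nv (u M - c \<cdot>\<^sub>v u L - w) = nv (P (u M - c \<cdot>\<^sub>v u L))" using P(2) by blast
        then show ?thesis
          using tang[OF gray(1)[OF L] gray(1)[OF M] gray(2)[OF L] gray(2)[OF M] gray(3)[OF L] gray(3)[OF M] False v gu(1)[OF M] w(1)]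
          unfolding Plin[OF gu(2)[OF M] gu(2)[OF L], symmetric] eq by simp
      qed
      then show ?thesis unfolding dE dF B_def
        using wedge_ratio_le[OF gu(2)[OF L] gu(2)[OF M] pos(1)[OF L] pos(1)[OF M] Pc Pc pos(2)[OF L] pos(2)[OF M] P(1)[OF gu(2)[OF M]] \<epsilon>]
        by blast
    qed
  qed (use s B in auto)
qed

lemma limit_set_null:
  assumes r: "0 < r" "r < D" and D1: "1 < D" and hc: "hyperconvex av E G S \<rho> r"
    and E': "E' \<in> carrier_mat r r" "det E' \<noteq> 0"
    and s: "0 < s" "hausdorff_measure (proj_dist av E') s (projective_space r) = 0"
  shows "hausdorff_measure (proj_dist av E) s (limit_map av E \<rho> 1 ` gromov_boundary G S) = 0"
proof (cases "gromov_boundary G S = {}")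
  case True
  \<comment> \<open>With empty boundary, as for a finite group, there is no \<zeta> to project from.
    The empty set is null by the Lipschitz lemma with any map.\<close>
  then show ?thesis using hausdorff_measure_0_lipschitz[of "{}" "proj_dist av E" 1 "proj_dist av E'" undefined, OF _ _ _ s(2,1)] by simp
next
  case False
  have gap: "gapped 1" "gapped r" using anosov_gapped[of 1] anosov_gapped[OF r] D1 hc by (auto simp: hyperconvex_def)
  have p: "0 < (1 :: nat)" "1 < D" "gapped 1" using D1 gap by auto
  obtain \<zeta> where \<zeta>: "\<zeta> \<in> rays" "\<zeta> 0 = \<one>" using False unfolding boundary_cls by auto
  define X where "X = (\<lambda>\<eta>. (*\<^sub>v) E ` xi 1 \<eta>)"
  \<comment> \<open>Index 0 is reserved for the point of \<zeta> itself; the others exhaust the rays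
    inequivalent to \<zeta> by integral bounds on the Gromov product.\<close>
  define B where "B n = (case n of 0 \<Rightarrow> {X \<zeta>} | Suc m \<Rightarrow> X ` {\<eta> \<in> rays. \<eta> 0 = \<one> \<and> sep (real m) \<eta> \<zeta>})" for n
  have "limit_map av E \<rho> 1 ` gromov_boundary G S = X ` {\<eta> \<in> rays. \<eta> 0 = \<one>}"
    unfolding boundary_cls image_image X_def by (rule image_cong) (use limit_map_eq[OF p] in auto)
  also have "\<dots> = (\<Union>n. B n)"
  proof (intro equalityI subsetI)
    fix L assume "L \<in> X ` {\<eta> \<in> rays. \<eta> 0 = \<one>}"
    then obtain \<eta> where \<eta>: "\<eta> \<in> rays" "\<eta> 0 = \<one>" "L = X \<eta>" by auto
    show "L \<in> (\<Union>n. B n)"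
    proof (cases "req \<eta> \<zeta>")
      case True
      then have "L \<in> B 0" using xi_req[OF p \<eta>(1) \<zeta>(1)] \<eta>(3) by (simp add: B_def X_def)
      then show ?thesis by blast
    next
      case False
      then obtain m :: nat where "sep m \<eta> \<zeta>" using sep_of_not_req[OF \<eta>(1) \<zeta>(1)] by blast
      then have "L \<in> B (Suc m)" using \<eta> by (auto simp: B_def)
      then show ?thesis by blast
    qed
  next
    fix L assume "L \<in> (\<Union>n. B n)"
    then obtain n where n: "L \<in> B n" by blast
    show "L \<in> X ` {\<eta> \<in> rays. \<eta> 0 = \<one>}" using n \<zeta> by (cases n) (auto simp: B_def)
  qed
  finally have eq: "limit_map av E \<rho> 1 ` gromov_boundary G S = (\<Union>n. B n)" .
  have "hausdorff_measure (proj_dist av E) s (B n) = 0" for n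
  proof (cases n)
    case 0
    obtain u where u: "u \<in> carrier_vec D" "u \<noteq> 0\<^sub>v D" "X \<zeta> = line u"
      using xi_line[OF gap(1) D1 \<zeta>(1)] unfolding X_def by blast
    have "wn D u u = 0" unfolding wn_def onb_norm_eq_0[OF finite_index_pairs] by (auto simp: mult.commute)
    then have "proj_dist av E (X \<zeta>) (X \<zeta>) = 0" unfolding u(3) proj_dist_line[OF u(1,2) u(1,2)] by simp
    then show ?thesis unfolding B_def 0 by (simp add: hausdorff_measure_0_singleton)
  next
    case (Suc m)
    then show ?thesis unfolding B_def X_def using limit_set_piece[OF r D1 gap hc E' \<zeta> s, of "real m"] by simp
  qed
  then show ?thesis unfolding eq by (rule hausdorff_measure_0_UN)
qed

end

theorem proposition7p3:
  fixes av :: "'k::field \<Rightarrow> real"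
    and d r :: nat
    and E F :: "'k mat"
    and \<Gamma> :: "('g, 'm) monoid_scheme"
    and S :: "'g set"
    and \<rho> :: "'g \<Rightarrow> 'k mat set"
  assumes "local_field av"
    and "E \<in> carrier (GL d)" and "F \<in> carrier (GL r)"
    and "group \<Gamma>" and "sym_generating \<Gamma> S" and "word_hyperbolic \<Gamma> S"
    and "\<rho> \<in> hom \<Gamma> (PGL d)"
    and "2 \<le> r" and "r \<le> d - 1"
    and "hyperconvex av E \<Gamma> S \<rho> r"
  shows "hausdorff_dim (proj_dist av E) (limit_map av E \<rho> 1 ` gromov_boundary \<Gamma> S)
       \<le> hausdorff_dim (proj_dist av F) (projective_space r)"
proof -
  obtain \<delta> where \<delta>: "\<And>w x y z. w \<in> carrier \<Gamma> \<Longrightarrow> x \<in> carrier \<Gamma> \<Longrightarrow> y \<in> carrier \<Gamma> \<Longrightarrow> z \<in> carrier \<Gamma> \<Longrightarrow>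
      min (gromov_product \<Gamma> S w x y) (gromov_product \<Gamma> S w y z) - \<delta> \<le> gromov_product \<Gamma> S w x z"
    using assms(6) unfolding word_hyperbolic_def by blast
  interpret local_abs av by (rule local_field_local_abs[OF assms(1)])
  interpret group \<Gamma> by fact
  \<comment> \<open>The four-point condition persists when \<delta> grows, so the constant may be
    taken nonnegative.\<close>
  interpret rep: linear_rep av E d \<Gamma> S "max \<delta> 0" \<rho>
  proof unfold_locales
    show "E \<in> carrier_mat d d" "det E \<noteq> 0" using assms(2) by (auto simp: GL_iff)
    fix w x y z assume "w \<in> carrier \<Gamma>" "x \<in> carrier \<Gamma>" "y \<in> carrier \<Gamma>" "z \<in> carrier \<Gamma>"
    from \<delta>[OF this] show "min (gromov_product \<Gamma> S w x y) (gromov_product \<Gamma> S w y z) - max \<delta> 0 \<le> gromov_product \<Gamma> S w x z"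
      by linarith
  qed (use assms in auto)
  have F: "F \<in> carrier_mat r r" "det F \<noteq> 0" using assms(3) by (auto simp: GL_iff)
  \<comment> \<open>Every exponent at which the projective space is null is one at which the limit
    set is null, so the second infimum runs over the larger set.\<close>
  show ?thesis
    unfolding hausdorff_dim_def
    using rep.limit_set_null[OF _ _ _ assms(10) F] assms(8,9) by (intro INF_superset_mono) auto
qed

end
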